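(* Let $n\ge1$, $\ell\ge3$, and let $\rho:\Gamma_\ell\to U(n)$ be an irreducible Lagrangian representation with $\pi(\rho)=\mathfrak{a}\in\mathcal{L}_{I,\ell}(n,\mathfrak{m},z)$. Then near $\rho$, $\mathcal{L}\mathrm{Rep}^{irr.}_{\mathfrak a}(\Gamma_\ell,U(n))$ is a smooth manifold of dimension $$\dim\left(\mathcal{L}\mathrm{Rep}^{irr.}_{\mathfrak a}(\Gamma_\ell,U(n))\right)=\frac{(\ell-2)}{2}n^2+1-\frac12\sum_{s=1}^{\ell}\sum_{j=1}^{l_s}(\mu^s_j)^2 .$$ Moreover, the spectral projection $$\pi:\mathcal{L}\mathrm{Rep}^{irr.}(\Gamma_\ell,U(n))\cap\pi^{-1}\left(\mathcal{L}_{I,\ell}(n,\mathfrak{m},z)\right)\longrightarrow\mathcal{P}_{I,\ell}(n,\mathfrak{m},z)$$ is locally surjective and is a fibration near $\rho$.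
   Context: $\Gamma_\ell=\langle \gamma_1,\dots,\gamma_\ell : \gamma_1\cdots\gamma_\ell=1\rangle$. Lagrangian representations. A Lagrangian subspace $L\subset\mathbb{C}^n$ has the form $L=g\mathbb{R}^n$ with $g\in U(n)$; $\sigma_L=g\sigma_0g^{-1}$, $\sigma_0(z)=\bar z$, is the anti-linear involution fixing $L$. A representation $\rho:\Gamma_\ell\to U(n)$ is Lagrangian if there are Lagrangian subspaces $L_1,\dots,L_\ell$ with $\rho(\gamma_s)=\sigma_{L_s}\sigma_{L_{s+1}}$ for all $s$ ($L_{\ell+1}=L_1$). $\mathcal{L}\mathrm{Rep}^{irr.}(\Gamma_\ell,U(n))$ is the set of $U(n)$-conjugacy classes of irreducible Lagrangian representations. Spectra. For $A\in U(n)$ with eigenvalues $e^{2\pi i\alpha_1},\dots,e^{2\pi i\alpha_n}$, $0\le\alpha_1\le\cdots\le\alpha_n<1$, write $\mathrm{spec}(A)=(\alpha_1,\dots,\alpha_n)$. The spectral projection is $\pi(\rho)=(\alpha^s_j)_{1\le s\le\ell,1\le j\le n}$ with $\alpha^s=\mathrm{spec}(\rho(\gamma_s))$; it depends only on the conjugacy class of $\rho$. Its index is $I=\sum_{s,j}\alpha^s_j$, an integer. Strata. Let $\mathfrak{m}=(m^1,\dots,m^\ell)$, where each $m^s$ is a partition $0=m^s_0<m^s_1<\cdots<m^s_{l_s}=n$ of length $l_s$, with multiplicities $\mu^s_j=m^s_j-m^s_{j-1}$, and let $z\subset\{1,\dots,\ell\}$. $\alpha^s$ has the multiplicity structure of $m^s$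 if its distinct entries are $\hat\alpha^s_1<\cdots<\hat\alpha^s_{l_s}$ with $\alpha^s_i=\hat\alpha^s_j$ for $m^s_{j-1}<i\le m^s_j$. $\mathcal{P}_{I,\ell}(n,\mathfrak{m},z)$ is the set of $\mathfrak{a}=(\alpha^s_j)$ with $0\le\alpha^s_1\le\cdots\le\alpha^s_n<1$ for each $s$, $\sum_{s,j}\alpha^s_j=I$, $\alpha^s$ of multiplicity structure $m^s$ for all $s$, and $\hat\alpha^s_1=0$ if and only if $s\in z$. $\mathcal{L}_{I,\ell}(n,\mathfrak{m},z)$ is the set of $\mathfrak{a}\in\mathcal{P}_{I,\ell}(n,\mathfrak{m},z)$ with $\mathfrak{a}=\pi(\rho')$ for some Lagrangian representation $\rho'$. $\mathcal{L}\mathrm{Rep}^{irr.}_{\mathfrak a}(\Gamma_\ell,U(n))$ is the set of classes $[\rho']\in\mathcal{L}\mathrm{Rep}^{irr.}(\Gamma_\ell,U(n))$ with $\pi(\rho')=\mathfrak{a}$. *)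

theory Defs
  imports "HOL-Analysis.Analysis"
begin

text \<open>
  Both dimensions are types: $n$ is \<open>CARD('n)\<close>, $\ell$ is \<open>CARD('l)\<close>. The linear orders on
  \<open>'n\<close> and \<open>'l\<close> stand for the numberings $1,\dots,n$ and $1,\dots,\ell$.
  A representation of $\Gamma_\ell = \langle\gamma_1,\dots,\gamma_\ell : \gamma_1\cdots\gamma_\ell=1\rangle$
  is the tuple \<open>\<rho>\<close> of images \<open>\<rho> $ s\<close> of the generators $\gamma_s$; so the space of representations
  is a subset of a Euclidean space.
\<close>

type_synonym 'n cmat = "complex^'n^'n"
type_synonym ('n, 'l) mats = "complex^'n^'n^'l"
type_synonym ('n, 'l) spectra = "real^'n^'l"

subsection \<open>Unitary representations of \<open>\<Gamma>\<^sub>\<ell>\<close>\<close>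

definition adj :: "('n::finite) cmat \<Rightarrow> ('n::finite) cmat" where
  "adj A = (\<chi> i j. cnj (A $ j $ i))"

definition unitary :: "('n::finite) cmat \<Rightarrow> bool" where
  "unitary A \<longleftrightarrow> A ** adj A = mat 1 \<and> adj A ** A = mat 1"

definition is_rep :: "('n::finite, 'l::{finite,linorder}) mats \<Rightarrow> bool" where
  "is_rep \<rho> \<longleftrightarrow> (\<forall>s. unitary (\<rho> $ s)) \<and>
     foldr (\<lambda>s M. \<rho> $ s ** M) (sorted_list_of_set UNIV) (mat 1) = mat 1"

text \<open>\<^const>\<open>vec.subspace\<close> is the notion of complex linear subspace of $\mathbb{C}^n$
  (\<^const>\<open>subspace\<close> is the real one).\<close>

definition irreducible_rep :: "('n::finite, 'l::{finite,linorder}) mats \<Rightarrow> bool" where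
  "irreducible_rep \<rho> \<longleftrightarrow> is_rep \<rho> \<and>
     (\<forall>W. vec.subspace W \<and> (\<forall>s. \<forall>w\<in>W. \<rho> $ s *v w \<in> W) \<longrightarrow> W = {0} \<or> W = UNIV)"

definition conj_class :: "('n::finite, 'l::finite) mats \<Rightarrow> ('n::finite, 'l) mats set" where
  "conj_class \<rho> = {(\<chi> s. g ** \<rho> $ s ** adj g) | g. unitary g}"

subsection \<open>Lagrangian representations\<close>

definition real_form :: "'n cmat \<Rightarrow> (complex^'n) set" where
  "real_form g = range (\<lambda>x::real^'n. g *v (\<chi> i. complex_of_real (x $ i)))"

definition lagrangian_subspace :: "(complex^'n) set \<Rightarrow> bool" where
  "lagrangian_subspace L \<longleftrightarrow> (\<exists>g. unitary g \<and> L = real_form g)"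

text \<open>$\sigma_L = g\sigma_0g^{-1}$ for any unitary $g$ with $L = g\mathbb{R}^n$; two such $g$ differ by a
  real orthogonal matrix, which commutes with $\sigma_0$, so the choice of $g$ is immaterial.\<close>

definition lagrangian_inv :: "(complex^'n) set \<Rightarrow> complex^'n \<Rightarrow> complex^'n" where
  "lagrangian_inv L = (let g = (SOME g. unitary g \<and> L = real_form g)
     in (\<lambda>v. g *v (\<chi> i. cnj ((adj g *v v) $ i))))"

definition cyc_next :: "'l::{finite,linorder} \<Rightarrow> 'l" where
  "cyc_next s = (if s = Max UNIV then Min UNIV else Min {t. s < t})"

definition lagrangian_rep :: "('n::finite, 'l::{finite,linorder}) mats \<Rightarrow> bool" where
  "lagrangian_rep \<rho> \<longleftrightarrow> is_rep \<rho> \<and>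
     (\<exists>L. (\<forall>s. lagrangian_subspace (L s)) \<and>
          (\<forall>s. (\<lambda>v. \<rho> $ s *v v) = lagrangian_inv (L s) \<circ> lagrangian_inv (L (cyc_next s))))"

definition LRep_irr :: "('n::finite, 'l::{finite,linorder}) mats set set" where
  "LRep_irr = conj_class ` {\<rho>. lagrangian_rep \<rho> \<and> irreducible_rep \<rho>}"

subsection \<open>Spectra\<close>

text \<open>The eigenvalues of \<open>A\<close> are listed with multiplicity, as the roots of its characteristic
  polynomial.\<close>

definition is_spec :: "('n::{finite,linorder}) cmat \<Rightarrow> real^('n::{finite,linorder}) \<Rightarrow> bool" where
  "is_spec A \<alpha> \<longleftrightarrow> (\<forall>x. det (mat x - A) = (\<Prod>j\<in>UNIV. x - exp (2 * of_real pi * \<i> * of_real (\<alpha> $ j)))) \<and>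
     (\<forall>i j. i \<le> j \<longrightarrow> \<alpha> $ i \<le> \<alpha> $ j) \<and> (\<forall>j. 0 \<le> \<alpha> $ j \<and> \<alpha> $ j < 1)"

definition spec :: "('n::{finite,linorder}) cmat \<Rightarrow> real^('n::{finite,linorder})" where
  "spec A = (THE \<alpha>. is_spec A \<alpha>)"

definition spec_proj :: "('n::{finite,linorder}, 'l::finite) mats \<Rightarrow> ('n::{finite,linorder}, 'l) spectra" where
  "spec_proj \<rho> = (\<chi> s. spec (\<rho> $ s))"

definition spec_proj_class :: "('n::{finite,linorder}, 'l::finite) mats set \<Rightarrow> ('n::{finite,linorder}, 'l) spectra" where
  "spec_proj_class C = the_elem (spec_proj ` C)"

definition LRep_irr_at ::
    "('n::{finite,linorder}, 'l::{finite,linorder}) spectra \<Rightarrow> ('n::{finite,linorder}, 'l) mats set set" where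
  "LRep_irr_at a = {C \<in> LRep_irr. spec_proj_class C = a}"

subsection \<open>Strata\<close>

definition is_partition :: "nat \<Rightarrow> nat \<Rightarrow> (nat \<Rightarrow> nat) \<Rightarrow> bool" where
  "is_partition n k m \<longleftrightarrow> m 0 = 0 \<and> m k = n \<and> (\<forall>j<k. m j < m (Suc j))"

definition multiplicity_of :: "(nat \<Rightarrow> nat) \<Rightarrow> nat \<Rightarrow> nat" where
  "multiplicity_of m j = m j - m (j - 1)"

text \<open>The number in $\{1,\dots,n\}$ of an index.\<close>

definition pos :: "'n::{finite,linorder} \<Rightarrow> nat" where
  "pos i = card {..i}"

text \<open>\<open>h 1 < \<dots> < h k\<close> are the distinct entries $\hat\alpha_1 < \dots < \hat\alpha_k$ of \<open>\<alpha>\<close>.\<close>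

definition mult_structure ::
    "real^('n::{finite,linorder}) \<Rightarrow> nat \<Rightarrow> (nat \<Rightarrow> nat) \<Rightarrow> (nat \<Rightarrow> real) \<Rightarrow> bool" where
  "mult_structure \<alpha> k m h \<longleftrightarrow> strict_mono_on {1..k} h \<and>
     (\<forall>j\<in>{1..k}. \<forall>i. m (j - 1) < pos i \<and> pos i \<le> m j \<longrightarrow> \<alpha> $ i = h j)"

definition P_stratum ::
    "int \<Rightarrow> ('l::finite \<Rightarrow> nat) \<Rightarrow> ('l \<Rightarrow> nat \<Rightarrow> nat) \<Rightarrow> 'l set \<Rightarrow> ('n::{finite,linorder}, 'l) spectra set" where
  "P_stratum I l m z = {a.
     (\<forall>s i j. i \<le> j \<longrightarrow> a $ s $ i \<le> a $ s $ j) \<and>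
     (\<forall>s j. 0 \<le> a $ s $ j \<and> a $ s $ j < 1) \<and>
     (\<Sum>s\<in>UNIV. \<Sum>j\<in>UNIV. a $ s $ j) = of_int I \<and>
     (\<forall>s. \<exists>h. mult_structure (a $ s) (l s) (m s) h \<and> (h 1 = 0 \<longleftrightarrow> s \<in> z))}"

definition L_stratum ::
    "int \<Rightarrow> ('l::{finite,linorder} \<Rightarrow> nat) \<Rightarrow> ('l \<Rightarrow> nat \<Rightarrow> nat) \<Rightarrow> 'l set
      \<Rightarrow> ('n::{finite,linorder}, 'l) spectra set" where
  "L_stratum I l m z = {a \<in> P_stratum I l m z. \<exists>\<rho>. lagrangian_rep \<rho> \<and> spec_proj \<rho> = a}"

definition LRep_irr_over ::
    "int \<Rightarrow> ('l::{finite,linorder} \<Rightarrow> nat) \<Rightarrow> ('l \<Rightarrow> nat \<Rightarrow> nat) \<Rightarrow> 'l set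
      \<Rightarrow> ('n::{finite,linorder}, 'l) mats set set" where
  "LRep_irr_over I l m z = LRep_irr \<inter> {C. spec_proj_class C \<in> L_stratum I l m z}"

subsection \<open>Smooth maps\<close>

primrec Ck_on :: "nat \<Rightarrow> 'a::euclidean_space set \<Rightarrow> ('a \<Rightarrow> 'b::euclidean_space) \<Rightarrow> bool" where
  "Ck_on 0 U f \<longleftrightarrow> continuous_on U f"
| "Ck_on (Suc k) U f \<longleftrightarrow> (\<forall>x\<in>U. f differentiable (at x)) \<and>
     (\<forall>v. Ck_on k U (\<lambda>x. frechet_derivative f (at x) v))"

text \<open>A map on an arbitrary subset of a Euclidean space is smooth if, near each point of the subset,
  it extends to a $C^\infty$ map on an open set.\<close>

definition smooth_map_on :: "'a::euclidean_space set \<Rightarrow> ('a \<Rightarrow> 'b::euclidean_space) \<Rightarrow> bool" where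
  "smooth_map_on A f \<longleftrightarrow> (\<forall>x\<in>A. \<exists>U g. open U \<and> x \<in> U \<and> (\<forall>k. Ck_on k U g) \<and> (\<forall>y\<in>A \<inter> U. g y = f y))"

subsection \<open>Spaces of conjugacy classes\<close>

text \<open>A set \<open>Q\<close> of conjugacy classes carries the quotient topology.\<close>

definition class_topology :: "('n::finite, 'l::finite) mats set set \<Rightarrow> ('n::finite, 'l) mats set topology" where
  "class_topology Q = topology (\<lambda>W. W \<subseteq> Q \<and>
     openin (top_of_set (conj_class -` Q)) (conj_class -` W))"

lemma openin_class_topology:
  "openin (class_topology Q) W \<longleftrightarrow> W \<subseteq> Q \<and>
     openin (top_of_set (conj_class -` Q)) (conj_class -` W)"
proof -
  have "istopology (\<lambda>W. W \<subseteq> Q \<and> openin (top_of_set (conj_class -` Q)) (conj_class -` W))"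
    unfolding istopology_def by (auto simp: vimage_Union intro: openin_Int openin_Union)
  then show ?thesis
    by (simp add: class_topology_def topology_inverse')
qed

text \<open>A diffeomorphism from a set \<open>W\<close> of conjugacy classes onto a subset \<open>A\<close> of a Euclidean space,
  for the quotient smooth structure on \<open>W\<close>: \<open>\<phi>\<close> is smooth as a function of the representation, and
  \<open>\<phi>\<^sup>-\<^sup>1\<close> lifts locally to smooth maps into the representations.\<close>

definition class_diffeo ::
    "('n::finite, 'l::finite) mats set set \<Rightarrow> 'b::euclidean_space set
      \<Rightarrow> (('n::finite, 'l) mats set \<Rightarrow> 'b) \<Rightarrow> bool" where
  "class_diffeo W A \<phi> \<longleftrightarrow> bij_betw \<phi> W A \<and>
     smooth_map_on (conj_class -` W) (\<phi> \<circ> conj_class) \<and>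
     (\<forall>y\<in>A. \<exists>V \<tau>. openin (top_of_set A) V \<and> y \<in> V \<and> smooth_map_on V \<tau> \<and>
        (\<forall>u\<in>V. conj_class (\<tau> u) \<in> W \<and> \<phi> (conj_class (\<tau> u)) = u))"

text \<open>A $d$-dimensional subspace \<open>S\<close> of the ambient matrix space plays the role of $\mathbb{R}^d$.
  This does not bound \<open>d\<close>: the dimension of a space of classes never exceeds that of the ambient space,
  since local lifts of inverse charts are immersions.\<close>

definition smooth_manifold_near ::
    "('n::finite, 'l::finite) mats set set \<Rightarrow> ('n::finite, 'l) mats set \<Rightarrow> nat \<Rightarrow> bool" where
  "smooth_manifold_near Q C d \<longleftrightarrow>
     (\<exists>W (S :: ('n, 'l) mats set) A \<phi>.
        openin (class_topology Q) W \<and> C \<in> W \<and>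
        subspace S \<and> dim S = d \<and> openin (top_of_set S) A \<and> class_diffeo W A \<phi>)"

text \<open>Smooth local triviality near \<open>C\<close> of a map \<open>p\<close> to \<open>B\<close>: some neighbourhood of \<open>C\<close> is diffeomorphic
  over an open subset \<open>U\<close> of \<open>B\<close> to a product of \<open>U\<close> with a fibre \<open>F\<close>, a $d$-dimensional manifold
  which (shrinking the neighbourhood) is taken to be open in $\mathbb{R}^d$.\<close>

definition smooth_fibration_near ::
    "('n::finite, 'l::finite) mats set set \<Rightarrow> 'b::euclidean_space set
      \<Rightarrow> (('n::finite, 'l) mats set \<Rightarrow> 'b) \<Rightarrow> ('n::finite, 'l) mats set \<Rightarrow> nat \<Rightarrow> bool" where
  "smooth_fibration_near Q B p C d \<longleftrightarrow>
     (\<exists>N U (S :: ('n, 'l) mats set) F \<phi>.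
        openin (class_topology Q) N \<and> C \<in> N \<and> openin (top_of_set B) U \<and>
        subspace S \<and> dim S = d \<and> openin (top_of_set S) F \<and>
        class_diffeo N (U \<times> F) \<phi> \<and> (\<forall>D\<in>N. fst (\<phi> D) = p D))"

definition locally_surjective :: "'a topology \<Rightarrow> 'b topology \<Rightarrow> ('a \<Rightarrow> 'b) \<Rightarrow> bool" where
  "locally_surjective X Y p \<longleftrightarrow> p \<in> topspace X \<rightarrow> topspace Y \<and>
     (\<forall>x N. openin X N \<and> x \<in> N \<longrightarrow> (\<exists>V. openin Y V \<and> p x \<in> V \<and> V \<subseteq> p ` N))"

end

theory Submission
  imports Defs
begin

text \<open>A Lagrangian L = g R^n is recorded by the symmetric unitary matrix S = g g^T, because
  its involution is v -> S cnj(v). A Lagrangian representation is then a cyclic chain \<rho>_s = S_s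
  S_(s+1)^(-1), and the defining relation holds by telescoping (\<open>lagrangian_rep_iff\<close>).
  The central object is a \<open>frame\<close>: unitary matrices p_s whose columns are a basis of
  L_s consisting of eigenvectors of \<rho>_s. It exists because \<rho>_s, written in a basis of L_s,
  is a symmetric unitary matrix, whose real and imaginary parts are commuting real symmetric
  matrices (\<open>symmetric_unitary_diagonalizable\<close>,
  \<open>lagrangian_rep_imp_frame\<close>). Writing D for \<open>dg\<close>, the frames with spectra
  b are the unitary tuples with p_s D(-b_s) p_s^T = p_(s+1) p_(s+1)^T. They are considered modulo a
  unitary factor on the left and real orthogonal factors commuting with D(b_s) on the right.

  Near a frame p0 of \<rho> the problem is the system \<open>eqs\<close> in (y, t), where p = p0 + y
  and b = a + t: unitarity, vanishing of the trace-free part of the imaginary part of the symmetric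
  unitary matrices \<open>mismatch\<close>, and orthogonality of y to the gauge orbit of p0. One
  common trace can be left out of the equations, because the determinants of the mismatches multiply
  to exp(-2 pi i sum b), and the sum of b is fixed on the stratum (\<open>mismatch_rigid\<close>).
  The linearization is onto the space of equations already with the spectrum held fixed
  (\<open>range_lin_eqs\<close>): a vector orthogonal to the range gives one skew-Hermitian matrix
  that anticommutes with all the involutions, hence commutes with all \<rho>_s, hence is scalar by
  Schur's lemma, and the trace condition kills it. Therefore \<open>implicit_zero_set\<close>
  expresses y through (f, t), with f in the kernel \<open>fibre_space\<close> and t a free
  parameter. This is why every nearby spectrum of the stratum is attained and why the space is
  locally a product.

  The dimension is rank-nullity. From the 2 l n^2 real coordinates of a tuple one subtracts l n^2
  for unitarity, l n(n+1)/2 - 1 for the mismatches, and n^2 + sum_s (sum_j mu_j^2 - n)/2 for the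
  gauge directions (\<open>dim_fibre_space\<close>).

  It remains to see that (f, t) are coordinates on conjugacy classes. Every nearby representation in
  the stratum has a frame near p0 by compactness (\<open>frames_nearby\<close>), and the point of
  its gauge orbit closest to p0 satisfies the slice condition (\<open>slice\<close>), so it is
  conjugate to the model \<open>tau (f, t)\<close> (\<open>coverage\<close>). Conversely, a unitary
  matrix conjugating one nearby representation to another is nearly scalar
  (\<open>conjugators_near_scalar\<close>), and the map \<open>Theta\<close>, which conjugates
  \<open>tau (f, t)\<close> by 1 + z with one diagonal entry of z normalized to zero, is an
  immersion (\<open>Theta_immersion\<close>). Its smooth left inverse, defined on an open set of the
  ambient space, reads off (f, t) and is constant on nearby conjugates (\<open>local_chart\<close>).

  \<open>smooth_fibration_near_stratum\<close> carries this to classes as a local product over the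
  stratum. The fibre of that product over a is the manifold, and lifting nearby spectra along the
  product at an arbitrary class gives local surjectivity.\<close>

subsection \<open>Maps of class \<open>C\<^sup>k\<close>\<close>

lemma Ck_on_Suc_has_derivative:
  assumes "Ck_on (Suc k) U f" "x \<in> U"
  shows "(f has_derivative frechet_derivative f (at x)) (at x)"
  using assms by (simp add: frechet_derivative_works)

lemma Ck_on_Suc_imp_Ck_on: "Ck_on (Suc k) U f \<Longrightarrow> Ck_on k U f"
proof (induction k arbitrary: f)
  case 0
  then show ?case
    by (auto intro!: differentiable_imp_continuous_on simp: differentiable_on_def differentiable_at_withinI)
next
  case (Suc k)
  then show ?case by simp
qed

lemma Ck_on_imp_continuous_on: "Ck_on k U f \<Longrightarrow> continuous_on U f"
proof (induction k)
  case (Suc k)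
  then show ?case using Ck_on_Suc_imp_Ck_on by blast
qed simp

lemma Ck_on_subset: "Ck_on k U f \<Longrightarrow> V \<subseteq> U \<Longrightarrow> Ck_on k V f"
  by (induction k arbitrary: f) (auto intro: continuous_on_subset)

lemma Ck_on_cong:
  assumes "open U" "\<And>x. x \<in> U \<Longrightarrow> f x = g x" "Ck_on k U f"
  shows "Ck_on k U g"
  using assms(2,3)
proof (induction k arbitrary: f g)
  case 0
  then show ?case by (simp cong: continuous_on_cong_simp)
next
  case (Suc k)
  have fg: "frechet_derivative f (at x) = frechet_derivative g (at x)" "g differentiable (at x)"
    if "x \<in> U" for x
  proof -
    have "f differentiable (at x)" using Suc.prems(2) that by simp
    then show "frechet_derivative f (at x) = frechet_derivative g (at x)"
      using frechet_derivative_transform_within_open[OF _ \<open>open U\<close> that] Suc.prems(1) by blast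
    from \<open>f differentiable (at x)\<close> show "g differentiable (at x)"
      unfolding differentiable_def
      using has_derivative_transform_within_open[OF _ \<open>open U\<close> that] Suc.prems(1) by blast
  qed
  have "Ck_on k U (\<lambda>x. frechet_derivative g (at x) v)" for v
    using Suc.IH[of "\<lambda>x. frechet_derivative f (at x) v" "\<lambda>x. frechet_derivative g (at x) v"]
      fg(1) Suc.prems(2) by simp
  then show ?case using fg(2) by simp
qed

text \<open>Any formula for the derivative may be supplied: it agrees with
  \<open>frechet_derivative\<close> on \<open>U\<close>, and openness of \<open>U\<close> carries
  the agreement over to all higher derivatives.\<close>

lemma Ck_on_SucI:
  assumes "open U" "\<And>x. x \<in> U \<Longrightarrow> (f has_derivative f' x) (at x)" "\<And>v. Ck_on k U (\<lambda>x. f' x v)"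
  shows "Ck_on (Suc k) U f"
proof -
  have "frechet_derivative f (at x) = f' x" if "x \<in> U" for x
    using frechet_derivative_at[OF assms(2)[OF that]] by simp
  moreover have "f differentiable (at x)" if "x \<in> U" for x
    using assms(2)[OF that] by (auto simp: differentiable_def)
  ultimately show ?thesis
    using Ck_on_cong[OF assms(1) _ assms(3)] by auto
qed

lemma Ck_on_const: "open U \<Longrightarrow> Ck_on k U (\<lambda>x. c)"
proof (induction k arbitrary: c)
  case (Suc k)
  show ?case by (rule Ck_on_SucI[where f' = "\<lambda>_ _. 0"]) (use Suc in auto)
qed simp

lemma Ck_on_id: "open U \<Longrightarrow> Ck_on k U (\<lambda>x. x)"
  by (cases k) (auto intro!: Ck_on_SucI[where f' = "\<lambda>_ v. v"] Ck_on_const simp del: Ck_on.simps(2))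

lemma Ck_on_bounded_linear:
  assumes "bounded_linear L" "open U" "Ck_on k U f"
  shows "Ck_on k U (\<lambda>x. L (f x))"
  using assms(3)
proof (induction k arbitrary: f)
  case 0
  then show ?case using assms(1) by (simp add: bounded_linear.continuous_on)
next
  case (Suc k)
  show ?case
  proof (rule Ck_on_SucI[OF assms(2)])
    show "((\<lambda>x. L (f x)) has_derivative (\<lambda>v. L (frechet_derivative f (at x) v))) (at x)"
      if "x \<in> U" for x
      using bounded_linear.has_derivative[OF assms(1) Ck_on_Suc_has_derivative[OF Suc.prems that]] .
  qed (use Suc in simp)
qed

lemma Ck_on_add:
  assumes "open U" "Ck_on k U f" "Ck_on k U g"
  shows "Ck_on k U (\<lambda>x. f x + g x)"
  using assms(2,3)
proof (induction k arbitrary: f g)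
  case 0
  then show ?case by (simp add: continuous_on_add)
next
  case (Suc k)
  show ?case
    by (rule Ck_on_SucI[OF assms(1)
          has_derivative_add[OF Ck_on_Suc_has_derivative[OF Suc.prems(1)] Ck_on_Suc_has_derivative[OF Suc.prems(2)]]])
       (use Suc in auto)
qed

lemma Ck_on_sum:
  assumes "open U" "\<And>i. i \<in> A \<Longrightarrow> Ck_on k U (f i)"
  shows "Ck_on k U (\<lambda>x. \<Sum>i\<in>A. f i x)"
  using assms(2) by (induction A rule: infinite_finite_induct) (auto intro: Ck_on_const Ck_on_add assms(1))

lemma Ck_on_bounded_bilinear:
  assumes "bounded_bilinear B" "open U" "Ck_on k U f" "Ck_on k U g"
  shows "Ck_on k U (\<lambda>x. B (f x) (g x))"
  using assms(3,4)
proof (induction k arbitrary: f g)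
  case 0
  then show ?case using assms(1) by (simp add: bounded_bilinear.continuous_on)
next
  case (Suc k)
  show ?case
    by (rule Ck_on_SucI[OF assms(2) bounded_bilinear.FDERIV[OF assms(1)
          Ck_on_Suc_has_derivative[OF Suc.prems(1)] Ck_on_Suc_has_derivative[OF Suc.prems(2)]]])
       (use Suc Ck_on_Suc_imp_Ck_on[OF Suc.prems(1)] Ck_on_Suc_imp_Ck_on[OF Suc.prems(2)] in
          \<open>auto intro!: Ck_on_add assms(2)\<close>)
qed

lemma linear_family_expand:
  fixes M :: "'a::euclidean_space \<Rightarrow> 'b::real_vector"
  assumes "linear M"
  shows "M u = (\<Sum>b\<in>Basis. (u \<bullet> b) *\<^sub>R M b)"
proof -
  have "M u = M (\<Sum>b\<in>Basis. (u \<bullet> b) *\<^sub>R b)" by (simp only: euclidean_representation)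
  also have "\<dots> = (\<Sum>b\<in>Basis. (u \<bullet> b) *\<^sub>R M b)"
    by (simp only: linear_sum[OF assms] linear_cmul[OF assms])
  finally show ?thesis .
qed

text \<open>Smoothness of an operator-valued map is only stated after evaluation at a fixed vector.
  Expanding \<open>u x\<close> in the basis reduces evaluation at a moving vector to finitely many
  products.\<close>

lemma Ck_on_linear_family_apply:
  fixes M :: "'a::euclidean_space \<Rightarrow> 'b::euclidean_space \<Rightarrow> 'c::euclidean_space"
  assumes "open U" "\<And>x. x \<in> U \<Longrightarrow> linear (M x)" "\<And>v. Ck_on k U (\<lambda>x. M x v)" "Ck_on k U u"
  shows "Ck_on k U (\<lambda>x. M x (u x))"
proof (rule Ck_on_cong[OF assms(1)])
  show "(\<Sum>b\<in>Basis. (u x \<bullet> b) *\<^sub>R M x b) = M x (u x)" if "x \<in> U" for x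
    by (rule linear_family_expand[OF assms(2)[OF that], symmetric])
  show "Ck_on k U (\<lambda>x. \<Sum>b\<in>Basis. (u x \<bullet> b) *\<^sub>R M x b)"
    by (intro Ck_on_sum assms(1) Ck_on_bounded_bilinear[OF bounded_bilinear_scaleR]
        Ck_on_bounded_linear[OF bounded_linear_inner_left] assms(3,4))
qed

text \<open>By the chain rule the derivative is the linear family Dg (f x) applied to the moving
  vector Df x v, so the induction runs over all \<open>g\<close> at once.\<close>

lemma Ck_on_compose:
  fixes f :: "'a::euclidean_space \<Rightarrow> 'b::euclidean_space" and g :: "'b \<Rightarrow> 'c::euclidean_space"
  assumes "open U" "Ck_on k U f" "Ck_on k V g" "\<And>x. x \<in> U \<Longrightarrow> f x \<in> V"
  shows "Ck_on k U (\<lambda>x. g (f x))"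
  using assms(2,3)
proof (induction k arbitrary: g)
  case 0
  then show ?case using assms(4) by (auto intro: continuous_on_compose2)
next
  case (Suc k)
  have g': "(g has_derivative frechet_derivative g (at (f x))) (at (f x))" if "x \<in> U" for x
    using Ck_on_Suc_has_derivative[OF Suc.prems(2)] assms(4)[OF that] .
  show ?case
  proof (rule Ck_on_SucI[OF assms(1)])
    show "((\<lambda>x. g (f x)) has_derivative
        (\<lambda>v. frechet_derivative g (at (f x)) (frechet_derivative f (at x) v))) (at x)"
      if "x \<in> U" for x
      using has_derivative_compose[OF Ck_on_Suc_has_derivative[OF Suc.prems(1) that] g'[OF that]] .
    show "Ck_on k U (\<lambda>x. frechet_derivative g (at (f x)) (frechet_derivative f (at x) v))" for v
    proof (rule Ck_on_linear_family_apply[OF assms(1), where M = "\<lambda>x. frechet_derivative g (at (f x))"])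
      show "linear (frechet_derivative g (at (f x)))" if "x \<in> U" for x
        using has_derivative_linear[OF g'[OF that]] .
      show "Ck_on k U (\<lambda>x. frechet_derivative g (at (f x)) w)" for w
        using Suc.IH[of "\<lambda>y. frechet_derivative g (at y) w"] Suc.prems Ck_on_Suc_imp_Ck_on[OF Suc.prems(1)]
        by simp
    qed (use Suc.prems in simp)
  qed
qed

text \<open>At a zero of \<phi> the product rule needs only continuity of \<psi>. This allows an
  inverse family to be differentiated before it is known to be differentiable.\<close>

lemma has_derivative_scaleR_vanishing:
  fixes \<phi> :: "'a::real_normed_vector \<Rightarrow> real" and \<psi> :: "'a \<Rightarrow> 'b::real_normed_vector"
  assumes "(\<phi> has_derivative \<phi>') (at x)" "\<phi> x = 0" "continuous (at x) \<psi>"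
  shows "((\<lambda>y. \<phi> y *\<^sub>R \<psi> y) has_derivative (\<lambda>h. \<phi>' h *\<^sub>R \<psi> x)) (at x)"
proof -
  have bl: "bounded_linear \<phi>'" using assms(1) by (rule has_derivative_bounded_linear)
  obtain K where K: "\<And>h. norm (\<phi>' h) \<le> norm h * K" using bounded_linear.bounded[OF bl] by blast
  let ?q = "\<lambda>y. norm (\<phi> y - \<phi> x - \<phi>' (y - x)) / norm (y - x)"
  have q: "(?q \<longlongrightarrow> 0) (at x)"
    using assms(1) by (simp add: has_derivative_iff_norm)
  have p: "((\<lambda>y. norm (\<psi> y - \<psi> x)) \<longlongrightarrow> 0) (at x)" "((\<lambda>y. norm (\<psi> y)) \<longlongrightarrow> norm (\<psi> x)) (at x)"
    using assms(3) by (auto simp: continuous_at tendsto_norm LIM_zero tendsto_norm_zero)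
  have lim: "((\<lambda>y. ?q y * norm (\<psi> y) + \<bar>K\<bar> * norm (\<psi> y - \<psi> x)) \<longlongrightarrow> 0 * norm (\<psi> x) + \<bar>K\<bar> * 0) (at x)"
    by (intro tendsto_intros q p)
  have "norm (\<phi> y *\<^sub>R \<psi> y - \<phi> x *\<^sub>R \<psi> x - \<phi>' (y - x) *\<^sub>R \<psi> x) / norm (y - x)
      \<le> ?q y * norm (\<psi> y) + \<bar>K\<bar> * norm (\<psi> y - \<psi> x)" for y
  proof (cases "y = x")
    case False
    have "\<phi> y *\<^sub>R \<psi> y - \<phi> x *\<^sub>R \<psi> x - \<phi>' (y - x) *\<^sub>R \<psi> x =
        (\<phi> y - \<phi> x - \<phi>' (y - x)) *\<^sub>R \<psi> y + \<phi>' (y - x) *\<^sub>R (\<psi> y - \<psi> x)"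
      using assms(2) by (simp add: algebra_simps)
    also have "norm \<dots> \<le> norm (\<phi> y - \<phi> x - \<phi>' (y - x)) * norm (\<psi> y) + norm (\<phi>' (y - x)) * norm (\<psi> y - \<psi> x)"
      by (rule order_trans[OF norm_triangle_ineq]) simp
    also have "\<dots> \<le> norm (\<phi> y - \<phi> x - \<phi>' (y - x)) * norm (\<psi> y) + (norm (y - x) * \<bar>K\<bar>) * norm (\<psi> y - \<psi> x)"
    proof -
      have "norm (\<phi>' (y - x)) \<le> norm (y - x) * \<bar>K\<bar>"
        using K[of "y - x"] by (meson abs_ge_self mult_left_mono norm_ge_zero order_trans)
      then show ?thesis by (simp add: mult_right_mono)
    qed
    finally show ?thesis using False by (simp add: field_simps)
  qed simp
  then have "((\<lambda>y. norm (\<phi> y *\<^sub>R \<psi> y - \<phi> x *\<^sub>R \<psi> x - \<phi>' (y - x) *\<^sub>R \<psi> x) / norm (y - x)) \<longlongrightarrow> 0) (at x)"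
    by (intro tendsto_sandwich[OF _ _ tendsto_const lim[simplified]]) auto
  moreover have "bounded_linear (\<lambda>h. \<phi>' h *\<^sub>R \<psi> x)"
    using bl by (rule bounded_linear_compose[OF bounded_linear_scaleR_left])
  ultimately show ?thesis by (simp add: has_derivative_iff_norm)
qed

text \<open>Continuity of \<open>N x w\<close> comes from a lower bound on \<open>M x\<close> that
  survives small perturbations. The derivative is then -N (DM) N w, and each further order of
  smoothness follows by reading this formula with the order already known.\<close>

lemma Ck_on_inverse_family:
  fixes M N :: "'a::euclidean_space \<Rightarrow> 'b::euclidean_space \<Rightarrow> 'b"
  assumes U: "open U" and lin: "\<And>x. x \<in> U \<Longrightarrow> linear (M x)"
    and MN: "\<And>x w. x \<in> U \<Longrightarrow> M x (N x w) = w" and NM: "\<And>x w. x \<in> U \<Longrightarrow> N x (M x w) = w"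
    and M: "\<And>v. Ck_on k U (\<lambda>x. M x v)"
  shows "Ck_on k U (\<lambda>x. N x w)"
proof -
  have linN: "linear (N x)" if "x \<in> U" for x
  proof (rule linearI)
    show "N x (u + v) = N x u + N x v" for u v
      using NM[OF that, of "N x u + N x v"] by (simp add: linear_add[OF lin[OF that]] MN that)
    show "N x (r *\<^sub>R u) = r *\<^sub>R N x u" for r u
      using NM[OF that, of "r *\<^sub>R N x u"] by (simp add: linear_cmul[OF lin[OF that]] MN that)
  qed
  \<comment> \<open>The resolvent identity: the increment of \<open>N\<close> in terms of the
    increment of \<open>M\<close> at the fixed vector \<open>N x0 w\<close>.\<close>
  have step: "N x w = N x0 w - N x (M x (N x0 w) - M x0 (N x0 w))" if "x \<in> U" "x0 \<in> U" for x x0 w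
    using that by (simp add: linear_diff[OF linN] NM MN)
  have cont: "continuous (at x0) (\<lambda>x. N x w)" if x0: "x0 \<in> U" for x0 w
  proof -
    have "inj (M x0)" by (metis NM[OF x0] injI)
    then obtain B where B: "B > 0" "\<And>w. B * norm w \<le> norm (M x0 w)"
      using linear_inj_bounded_below_pos[OF lin[OF x0]] by blast
    have Mt: "((\<lambda>x. M x v) \<longlongrightarrow> M x0 v) (at x0)" for v
      using Ck_on_imp_continuous_on[OF M[of v]] x0 U continuous_on_eq_continuous_at
      by (auto simp: continuous_at)
    have "((\<lambda>x. \<Sum>b\<in>Basis. norm (M x b - M x0 b)) \<longlongrightarrow> 0) (at x0)"
      using Mt by (intro tendsto_null_sum tendsto_norm_zero) (auto simp: LIM_zero)
    \<comment> \<open>\<open>B\<close> bounds \<open>M x0\<close> from below, so a perturbation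
      below \<open>B / 2\<close> leaves the lower bound \<open>B / 2\<close> for \<open>M x\<close>,
      that is, the upper bound \<open>2 / B\<close> for \<open>N x\<close>.\<close>
    then have "eventually (\<lambda>x. (\<Sum>b\<in>Basis. norm (M x b - M x0 b)) < B / 2) (at x0)"
      by (rule order_tendstoD(2)) (use B(1) in simp)
    moreover have "eventually (\<lambda>x. x \<in> U) (at x0)" using U x0 by (simp add: eventually_at_topological) blast
    ultimately have ev: "eventually (\<lambda>x. x \<in> U \<and> (\<forall>w. norm (N x w) \<le> (2 / B) * norm w)) (at x0)"
    proof eventually_elim
      case (elim x)
      have "norm (N x w) \<le> (2 / B) * norm w" for w
      proof -
        let ?v = "N x w"
        have "M x ?v - M x0 ?v = (\<Sum>b\<in>Basis. (?v \<bullet> b) *\<^sub>R (M x b - M x0 b))"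
          using linear_family_expand[OF lin[OF elim(2)], of ?v] linear_family_expand[OF lin[OF x0], of ?v]
          by (simp add: sum_subtractf scaleR_diff_right)
        then have "norm (M x ?v - M x0 ?v) \<le> (\<Sum>b\<in>Basis. norm ((?v \<bullet> b) *\<^sub>R (M x b - M x0 b)))"
          by (simp only: norm_sum)
        also have "\<dots> \<le> (\<Sum>b\<in>Basis. norm ?v * norm (M x b - M x0 b))"
          by (intro sum_mono) (simp add: Basis_le_norm mult_right_mono)
        also have "\<dots> \<le> norm ?v * (B / 2)"
          unfolding sum_distrib_left[symmetric] using elim(1) by (intro mult_left_mono) auto
        finally have "norm (M x ?v - M x0 ?v) \<le> norm ?v * (B / 2)" .
        moreover have "B * norm ?v \<le> norm (M x ?v) + norm (M x ?v - M x0 ?v)"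
          using B(2)[of ?v] norm_triangle_sub[of "M x0 ?v" "M x ?v"] by (simp add: norm_minus_commute)
        ultimately have "B * norm ?v \<le> 2 * norm w" by (simp add: MN elim(2) mult.commute)
        then show ?thesis using B(1) by (simp add: field_simps)
      qed
      with elim(2) show ?case by blast
    qed
    have "((\<lambda>x. N x w - N x0 w) \<longlongrightarrow> 0) (at x0)"
    proof (rule Lim_null_comparison)
      show "\<forall>\<^sub>F x in at x0. norm (N x w - N x0 w) \<le> (2 / B) * norm (M x (N x0 w) - M x0 (N x0 w))"
        using ev by eventually_elim (subst step[OF _ x0], auto)
      show "((\<lambda>x. (2 / B) * norm (M x (N x0 w) - M x0 (N x0 w))) \<longlongrightarrow> 0) (at x0)"
        using tendsto_mult_left[OF tendsto_norm_zero[OF LIM_zero[OF Mt[of "N x0 w"]]], of "2 / B"] by simp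
    qed
    then show ?thesis by (simp add: continuous_at LIM_zero_iff)
  qed
  show ?thesis
    using M
  proof (induction k arbitrary: w)
    case 0
    then show ?case
      using cont by (auto simp: continuous_at_imp_continuous_on)
  next
    case (Suc k)
    note M' = Ck_on_Suc_imp_Ck_on[OF Suc.prems]
    show ?case
    proof (rule Ck_on_SucI[OF U])
      fix x0 assume x0: "x0 \<in> U"
      let ?u = "N x0 w"
      let ?F = "\<lambda>x. M x ?u - M x0 ?u" and ?F' = "frechet_derivative (\<lambda>x. M x ?u) (at x0)"
      have F: "(?F has_derivative ?F') (at x0)"
        using has_derivative_diff[OF Ck_on_Suc_has_derivative[OF Suc.prems x0] has_derivative_const]
        by simp
      \<comment> \<open>Each summand is a coefficient vanishing at \<open>x0\<close> times the
        merely continuous map \<open>N x b\<close>.\<close>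
      have "((\<lambda>x. \<Sum>b\<in>Basis. (?F x \<bullet> b) *\<^sub>R N x b) has_derivative
          (\<lambda>h. \<Sum>b\<in>Basis. (?F' h \<bullet> b) *\<^sub>R N x0 b)) (at x0)"
        by (intro has_derivative_sum has_derivative_scaleR_vanishing cont x0
            bounded_linear.has_derivative[OF bounded_linear_inner_left F]) simp
      then have "((\<lambda>x. ?u - (\<Sum>b\<in>Basis. (?F x \<bullet> b) *\<^sub>R N x b)) has_derivative (\<lambda>h. - N x0 (?F' h))) (at x0)"
        using has_derivative_diff[OF has_derivative_const[of ?u]]
        unfolding linear_family_expand[OF linN[OF x0], symmetric] by force
      then show "((\<lambda>x. N x w) has_derivative
           (\<lambda>h. - N x0 (frechet_derivative (\<lambda>x. M x (N x0 w)) (at x0) h))) (at x0)"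
      proof (rule has_derivative_transform_within_open[OF _ U x0])
        fix x assume x: "x \<in> U"
        show "?u - (\<Sum>b\<in>Basis. (?F x \<bullet> b) *\<^sub>R N x b) = N x w"
          unfolding step[OF x x0, of w] linear_family_expand[OF linN[OF x], symmetric] ..
      qed
    next
      fix h
      have lin': "linear (\<lambda>w. frechet_derivative (\<lambda>x. M x w) (at x0) h)" if "x0 \<in> U" for x0
      proof (rule linearI)
        note d = Ck_on_Suc_has_derivative[OF Suc.prems that]
        show "frechet_derivative (\<lambda>x. M x (u + v)) (at x0) h =
            frechet_derivative (\<lambda>x. M x u) (at x0) h + frechet_derivative (\<lambda>x. M x v) (at x0) h" for u v
        proof -
          have "((\<lambda>x. M x (u + v)) has_derivative (\<lambda>h. frechet_derivative (\<lambda>x. M x u) (at x0) h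
              + frechet_derivative (\<lambda>x. M x v) (at x0) h)) (at x0)"
            by (rule has_derivative_transform_within_open[OF has_derivative_add[OF d[of u] d[of v]] U that])
               (simp add: linear_add[OF lin])
          from has_derivative_unique[OF d this] show ?thesis by (rule fun_cong)
        qed
        show "frechet_derivative (\<lambda>x. M x (r *\<^sub>R u)) (at x0) h =
            r *\<^sub>R frechet_derivative (\<lambda>x. M x u) (at x0) h" for r u
        proof -
          have "((\<lambda>x. M x (r *\<^sub>R u)) has_derivative (\<lambda>h. r *\<^sub>R frechet_derivative (\<lambda>x. M x u) (at x0) h)) (at x0)"
            by (rule has_derivative_transform_within_open[OF has_derivative_scaleR_right[OF d[of u]] U that])
               (simp add: linear_cmul[OF lin])
          from has_derivative_unique[OF d this] show ?thesis by (rule fun_cong)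
        qed
      qed
      have IH: "Ck_on k U (\<lambda>x. N x w)" for w using Suc.IH M' by blast
      have "Ck_on k U (\<lambda>x. frechet_derivative (\<lambda>y. M y (N x w)) (at x) h)"
        by (rule Ck_on_linear_family_apply[OF U, where u = "\<lambda>x. N x w"
              and M = "\<lambda>x w. frechet_derivative (\<lambda>y. M y w) (at x) h"])
           (use lin' IH Suc.prems in auto)
      then have "Ck_on k U (\<lambda>x. N x (frechet_derivative (\<lambda>y. M y (N x w)) (at x) h))"
        by (intro Ck_on_linear_family_apply[where M = N and k = k, OF U _ IH]) (auto intro: linN)
      then show "Ck_on k U (\<lambda>x. - N x (frechet_derivative (\<lambda>y. M y (N x w)) (at x) h))"
        by (rule Ck_on_bounded_linear[OF bounded_linear_minus[OF bounded_linear_ident] U])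
    qed
  qed
qed

definition smooth_on :: "'a::euclidean_space set \<Rightarrow> ('a \<Rightarrow> 'b::euclidean_space) \<Rightarrow> bool" where
  "smooth_on U f \<longleftrightarrow> (\<forall>k. Ck_on k U f)"

lemma smooth_on_has_derivative:
  "smooth_on U f \<Longrightarrow> x \<in> U \<Longrightarrow> (f has_derivative frechet_derivative f (at x)) (at x)"
  using Ck_on_Suc_has_derivative[of 0] by (auto simp: smooth_on_def simp del: Ck_on.simps)

lemma smooth_on_frechet_derivative:
  "smooth_on U f \<Longrightarrow> smooth_on U (\<lambda>x. frechet_derivative f (at x) v)"
  unfolding smooth_on_def by (metis Ck_on.simps(2))

lemma smooth_on_imp_continuous_on: "smooth_on U f \<Longrightarrow> continuous_on U f"
  unfolding smooth_on_def by (meson Ck_on_imp_continuous_on)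

lemma smooth_on_subset: "smooth_on U f \<Longrightarrow> V \<subseteq> U \<Longrightarrow> smooth_on V f"
  unfolding smooth_on_def by (meson Ck_on_subset)

lemma smooth_on_cong: "open U \<Longrightarrow> (\<And>x. x \<in> U \<Longrightarrow> f x = g x) \<Longrightarrow> smooth_on U f \<Longrightarrow> smooth_on U g"
  unfolding smooth_on_def by (meson Ck_on_cong)

lemma smooth_on_const: "open U \<Longrightarrow> smooth_on U (\<lambda>x. c)"
  by (simp add: smooth_on_def Ck_on_const)

lemma smooth_on_id: "open U \<Longrightarrow> smooth_on U (\<lambda>x. x)"
  by (simp add: smooth_on_def Ck_on_id)

lemma smooth_on_bounded_linear: "bounded_linear L \<Longrightarrow> open U \<Longrightarrow> smooth_on U f \<Longrightarrow> smooth_on U (\<lambda>x. L (f x))"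
  by (simp add: smooth_on_def Ck_on_bounded_linear)

lemma smooth_on_linear:
  fixes L :: "'b::euclidean_space \<Rightarrow> 'c::euclidean_space"
  shows "linear L \<Longrightarrow> open U \<Longrightarrow> smooth_on U f \<Longrightarrow> smooth_on U (\<lambda>x. L (f x))"
  by (simp add: smooth_on_bounded_linear linear_conv_bounded_linear)

lemma smooth_on_bounded_bilinear:
  "bounded_bilinear B \<Longrightarrow> open U \<Longrightarrow> smooth_on U f \<Longrightarrow> smooth_on U g \<Longrightarrow> smooth_on U (\<lambda>x. B (f x) (g x))"
  by (simp add: smooth_on_def Ck_on_bounded_bilinear)

lemma smooth_on_add: "open U \<Longrightarrow> smooth_on U f \<Longrightarrow> smooth_on U g \<Longrightarrow> smooth_on U (\<lambda>x. f x + g x)"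
  by (simp add: smooth_on_def Ck_on_add)

lemma smooth_on_sum: "open U \<Longrightarrow> (\<And>i. i \<in> A \<Longrightarrow> smooth_on U (f i)) \<Longrightarrow> smooth_on U (\<lambda>x. \<Sum>i\<in>A. f i x)"
  by (simp add: smooth_on_def Ck_on_sum)

lemma smooth_on_minus: "open U \<Longrightarrow> smooth_on U f \<Longrightarrow> smooth_on U (\<lambda>x. - f x)"
  by (rule smooth_on_bounded_linear[OF bounded_linear_minus[OF bounded_linear_ident]])

lemma smooth_on_diff: "open U \<Longrightarrow> smooth_on U f \<Longrightarrow> smooth_on U g \<Longrightarrow> smooth_on U (\<lambda>x. f x - g x)"
  using smooth_on_add[of U f "\<lambda>x. - g x"] smooth_on_minus by auto

lemma smooth_on_fst: "open U \<Longrightarrow> smooth_on U f \<Longrightarrow> smooth_on U (\<lambda>x. fst (f x))"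
  and smooth_on_snd: "open U \<Longrightarrow> smooth_on U f \<Longrightarrow> smooth_on U (\<lambda>x. snd (f x))"
  by (rule smooth_on_bounded_linear[OF bounded_linear_fst] smooth_on_bounded_linear[OF bounded_linear_snd]; assumption)+

lemma smooth_on_Pair:
  assumes "open U" "smooth_on U f" "smooth_on U g"
  shows "smooth_on U (\<lambda>x. (f x, g x))"
proof -
  have "smooth_on U (\<lambda>x. (f x, 0) + (0, g x))"
    by (intro smooth_on_add assms(1) smooth_on_linear[OF _ assms(1,2), of "\<lambda>y. (y, 0)"]
        smooth_on_linear[OF _ assms(1,3), of "\<lambda>y. (0, y)"]) (auto intro!: linearI)
  then show ?thesis by simp
qed

lemma smooth_on_compose:
  "open U \<Longrightarrow> smooth_on U f \<Longrightarrow> smooth_on V g \<Longrightarrow> (\<And>x. x \<in> U \<Longrightarrow> f x \<in> V) \<Longrightarrow> smooth_on U (\<lambda>x. g (f x))"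
  unfolding smooth_on_def using Ck_on_compose by blast

text \<open>The inverse function theorem gives an inverse \<open>g\<close> whose derivative at
  \<open>y\<close> is the inverse of Df (g y). If \<open>g\<close> is of class C^k, this family is
  of class C^k by \<open>Ck_on_inverse_family\<close>, so \<open>g\<close> is of class
  C^(k+1).\<close>

lemma smooth_inverse_function:
  fixes f :: "'a::euclidean_space \<Rightarrow> 'a"
  assumes "open U" "x0 \<in> U" "smooth_on U f" "inj (frechet_derivative f (at x0))"
  obtains U' V g where "open U'" "U' \<subseteq> U" "x0 \<in> U'" "open V" "homeomorphism U' V f g" "smooth_on V g"
proof -
  define f' where "f' x = Blinfun (frechet_derivative f (at x))" for x
  have f': "blinfun_apply (f' x) = frechet_derivative f (at x)" if "x \<in> U" for x
    unfolding f'_def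
    by (rule bounded_linear_Blinfun_apply[OF has_derivative_bounded_linear[OF
          smooth_on_has_derivative[OF assms(3) that]]])
  have cont: "continuous_on U f'"
  proof (rule continuous_on_blinfun_componentwise)
    fix i :: 'a
    have "continuous_on U (\<lambda>x. frechet_derivative f (at x) i)"
      by (intro smooth_on_imp_continuous_on smooth_on_frechet_derivative assms(3))
    then show "continuous_on U (\<lambda>x. blinfun_apply (f' x) i)"
      by (rule continuous_on_eq) (simp add: f')
  qed
  have der: "(f has_derivative blinfun_apply (f' x)) (at x)" if "x \<in> U" for x
    using smooth_on_has_derivative[OF assms(3) that] f'[OF that] by simp
  have lin: "linear (frechet_derivative f (at x0))"
    using has_derivative_linear[OF smooth_on_has_derivative[OF assms(3,2)]] .
  obtain h where h: "linear h" "h \<circ> frechet_derivative f (at x0) = id"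
    using linear_injective_left_inverse[OF lin assms(4)] by blast
  have "Blinfun h o\<^sub>L f' x0 = id_blinfun"
    using h by (intro blinfun_eqI) (simp add: f'[OF assms(2)] bounded_linear_Blinfun_apply
        linear_conv_bounded_linear pointfree_idE)
  from inverse_function_theorem[OF assms(1) der cont assms(2) this]
  obtain U' V g g' where g: "open U'" "U' \<subseteq> U" "x0 \<in> U'" "open V" "f x0 \<in> V" "homeomorphism U' V f g"
    "\<And>y. y \<in> V \<Longrightarrow> (g has_derivative (g' y)) (at y)"
    "\<And>y. y \<in> V \<Longrightarrow> g' y = inv (blinfun_apply (f'(g y)))"
    "\<And>y. y \<in> V \<Longrightarrow> bij (blinfun_apply (f'(g y)))"
    by metis
  have gV: "g y \<in> U" if "y \<in> V" for y
    using g(2,6) that unfolding homeomorphism_def by blast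
  have "Ck_on k V g" for k
  proof (induction k)
    case 0
    then show ?case using g(6) by (simp add: homeomorphism_def)
  next
    case (Suc k)
    show ?case
    proof (rule Ck_on_SucI[OF g(4) g(7)])
      fix v
      show "Ck_on k V (\<lambda>y. g' y v)"
      proof (rule Ck_on_inverse_family[OF g(4), where M = "\<lambda>y. frechet_derivative f (at (g y))"])
        fix y assume y: "y \<in> V"
        note e = f'[OF gV[OF y]]
        show "linear (frechet_derivative f (at (g y)))"
          using has_derivative_linear[OF smooth_on_has_derivative[OF assms(3) gV[OF y]]] .
        show "frechet_derivative f (at (g y)) (g' y w) = w" for w
          using g(8,9)[OF y] by (simp add: e bij_is_surj surj_f_inv_f)
        show "g' y (frechet_derivative f (at (g y)) w) = w" for w
          using g(8,9)[OF y] by (simp add: e bij_is_inj)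
      next
        fix w
        show "Ck_on k V (\<lambda>y. frechet_derivative f (at (g y)) w)"
          using smooth_on_frechet_derivative[OF assms(3)] gV
          by (intro Ck_on_compose[OF g(4) Suc.IH, of U "\<lambda>x. frechet_derivative f (at x) w"])
             (auto simp: smooth_on_def)
      qed
    qed
  qed
  then show ?thesis using that[OF g(1-4) g(6)] by (simp add: smooth_on_def)
qed

section \<open>Unitary matrices: adjoints, Schur's lemma, spectra, Cayley transforms, real
  diagonalization\<close>

subsection \<open>Complex matrices\<close>

text \<open>Conjugation of a matrix by the standard involution of C^n. Real matrices are its fixed
  points, and \<open>adj\<close> is \<open>transpose\<close> composed with
  \<open>cj\<close>.\<close>

definition cj :: "complex^'m^'n \<Rightarrow> complex^'m^'n" where
  "cj A = (\<chi> i j. cnj (A $ i $ j))"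

lemma cj_mult: "cj (A ** B) = cj A ** cj B"
  by (simp add: cj_def matrix_matrix_mult_def vec_eq_iff)

lemma adj_mult: "adj (A ** B) = adj B ** adj A"
  by (simp add: adj_def matrix_matrix_mult_def vec_eq_iff mult.commute)

lemma transpose_mult: "transpose (A ** B) = transpose B ** transpose (A :: complex^'m^'n)"
  by (rule matrix_transpose_mul)

lemma cj_nth [simp]: "cj A $ i $ j = cnj (A $ i $ j)" by (simp add: cj_def)
lemma adj_nth [simp]: "adj A $ i $ j = cnj (A $ j $ i)" by (simp add: adj_def)
lemma transpose_nth [simp]: "transpose A $ i $ j = A $ j $ i" by (simp add: transpose_def)

lemma cj_cj [simp]: "cj (cj A) = A"
  and adj_adj [simp]: "adj (adj B) = B"
  and cj_adj [simp]: "cj (adj B) = transpose B"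
  and adj_cj [simp]: "adj (cj B) = transpose B"
  and transpose_cj [simp]: "transpose (cj B) = adj B"
  and cj_transpose [simp]: "cj (transpose B) = adj B"
  and adj_transpose [simp]: "adj (transpose B) = cj B"
  and transpose_adj [simp]: "transpose (adj B) = cj B"
  by (simp_all add: vec_eq_iff)

lemma mat_nth: "mat c $ i $ j = (if i = j then c else 0)" by (simp add: mat_def)

lemma cj_mat [simp]: "cj (mat c) = mat (cnj c)"
  and adj_mat [simp]: "adj (mat c) = mat (cnj c)"
  by (simp_all add: vec_eq_iff mat_nth)

lemma linear_cj: "linear cj" and linear_adj: "linear adj"
  and linear_transpose: "linear (transpose :: complex^'n^'m \<Rightarrow> _)"
  by (auto intro!: linearI simp: vec_eq_iff)

lemmas matrix_linear_simps =
  linear_add[OF linear_cj] linear_diff[OF linear_cj] linear_0[OF linear_cj] linear_neg[OF linear_cj]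
  linear_cmul[OF linear_cj]
  linear_add[OF linear_adj] linear_diff[OF linear_adj] linear_0[OF linear_adj] linear_neg[OF linear_adj]
  linear_cmul[OF linear_adj]
  linear_add[OF linear_transpose] linear_diff[OF linear_transpose] linear_0[OF linear_transpose]
  linear_neg[OF linear_transpose] linear_cmul[OF linear_transpose]

lemma bounded_bilinear_matrix_mult:
  "bounded_bilinear ((**) :: complex^'n^'m \<Rightarrow> complex^'k^'n \<Rightarrow> complex^'k^'m)"
  unfolding bilinear_conv_bounded_bilinear[symmetric] bilinear_def
  by (auto intro!: linearI
      simp: vec_eq_iff matrix_matrix_mult_def algebra_simps sum.distrib scaleR_sum_right)

lemmas matrix_mult_linear_simps =
  bounded_bilinear.add_left[OF bounded_bilinear_matrix_mult]
  bounded_bilinear.add_right[OF bounded_bilinear_matrix_mult]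
  bounded_bilinear.diff_left[OF bounded_bilinear_matrix_mult]
  bounded_bilinear.diff_right[OF bounded_bilinear_matrix_mult]
  bounded_bilinear.zero_left[OF bounded_bilinear_matrix_mult]
  bounded_bilinear.zero_right[OF bounded_bilinear_matrix_mult]
  bounded_bilinear.minus_left[OF bounded_bilinear_matrix_mult]
  bounded_bilinear.minus_right[OF bounded_bilinear_matrix_mult]
  bounded_bilinear.scaleR_left[OF bounded_bilinear_matrix_mult]
  bounded_bilinear.scaleR_right[OF bounded_bilinear_matrix_mult]

lemma mat_mult_nth: "(mat c ** A) $ i $ j = c * A $ i $ j" for A :: "complex^'m^'n"
  by (simp add: matrix_matrix_mult_def mat_nth if_distrib[of "\<lambda>x. x * _"] cong: if_cong)

lemma mult_mat_nth: "(A ** mat c) $ i $ j = A $ i $ j * c" for A :: "complex^'m^'n"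
  by (simp add: matrix_matrix_mult_def mat_nth if_distrib[of "\<lambda>x. _ * x"] cong: if_cong)

lemma mat_mult_commute: "mat c ** A = A ** mat c" for A :: "complex^'n^'n"
  by (simp add: vec_eq_iff mat_mult_nth mult_mat_nth mult.commute)

lemma mat_mult_left_commute: "A ** (mat c ** B) = mat c ** (A ** B)" for A B :: "complex^'n^'n"
  by (metis mat_mult_commute matrix_mul_assoc)

lemma mat_mult_mat: "mat c ** mat d = mat (c * d)" for c d :: complex
  by (simp add: vec_eq_iff mat_mult_nth mat_nth)

lemma mat_mult_mat_assoc: "mat c ** (mat d ** A) = mat (c * d) ** A" for A :: "complex^'n^'n"
  by (simp add: matrix_mul_assoc mat_mult_mat)

lemma mat_of_real_mult: "mat (of_real r) ** A = r *\<^sub>R A" for A :: "complex^'m^'n"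
  by (simp add: vec_eq_iff mat_mult_nth scaleR_conv_of_real[where 'a = complex])

lemma mat_add: "mat c + mat d = mat (c + d)" for c d :: complex
  by (simp add: vec_eq_iff mat_nth)

lemma mat_eq_iff [simp]: "(mat c :: complex^'n^'n) = mat d \<longleftrightarrow> c = d"
  by (auto simp: vec_eq_iff mat_nth)

lemma mat_zero [simp]: "(mat 0 :: complex^'n^'n) = 0"
  by (simp add: vec_eq_iff mat_nth)

lemma scaleR_mat: "r *\<^sub>R mat c = mat (r *\<^sub>R c)" for c :: complex
  by (simp add: vec_eq_iff mat_nth)

text \<open>The Euclidean inner product of the ambient space is the real part of the Hilbert-Schmidt
  product, so matrix factors can be moved across it as adjoints.\<close>

lemma inner_matrix: "inner A B = Re (trace (adj A ** B))" for A B :: "complex^'n^'n"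
proof -
  have "inner A B = (\<Sum>i\<in>UNIV. \<Sum>j\<in>UNIV. Re (cnj (A $ i $ j) * B $ i $ j))"
    by (simp add: inner_vec_def inner_complex_def)
  also have "\<dots> = (\<Sum>j\<in>UNIV. \<Sum>i\<in>UNIV. Re (cnj (A $ i $ j) * B $ i $ j))"
    by (rule sum.swap)
  finally show ?thesis
    by (simp add: trace_def matrix_matrix_mult_def)
qed

lemma inner_mult_left: "inner (X ** A) B = inner A (adj X ** B)" for A B X :: "complex^'n^'n"
  by (simp add: inner_matrix adj_mult matrix_mul_assoc)

lemma inner_mult_right: "inner (A ** X) B = inner A (B ** adj X)" for A B X :: "complex^'n^'n"
  using trace_mul_sym[of "adj X" "adj A ** B"]
  by (simp add: inner_matrix adj_mult matrix_mul_assoc)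

lemma inner_cj: "inner (cj A) (cj B) = inner A B" for A B :: "complex^'n^'n"
  by (simp add: inner_vec_def inner_complex_def)

lemma inner_adj: "inner (adj A) (adj B) = inner A B" for A B :: "complex^'n^'n"
  unfolding inner_vec_def inner_complex_def
  by (subst sum.swap) simp

lemma inner_skew_hermitian:
  assumes "adj Z = - Z" "adj H = H"
  shows "inner Z H = 0"
  using inner_adj[of Z H] assms by simp

lemma unitaryD [simp]:
  assumes "unitary p"
  shows "adj p ** p = mat 1" "p ** adj p = mat 1" "adj p ** (p ** X) = X" "p ** (adj p ** X) = X"
    "transpose p ** cj p = mat 1" "cj p ** transpose p = mat 1"
    "transpose p ** (cj p ** X) = X" "cj p ** (transpose p ** X) = X"
proof -
  show 1: "adj p ** p = mat 1" "p ** adj p = mat 1" using assms by (auto simp: unitary_def)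
  have 2: "cj (adj p ** p) = mat 1" "cj (p ** adj p) = mat 1" using 1 by simp_all
  then show 3: "transpose p ** cj p = mat 1" "cj p ** transpose p = mat 1" by (simp_all add: cj_mult)
  show "adj p ** (p ** X) = X" "p ** (adj p ** X) = X"
    "transpose p ** (cj p ** X) = X" "cj p ** (transpose p ** X) = X"
    by (simp_all add: matrix_mul_assoc 1 3)
qed

lemma unitaryI: "adj p ** p = mat 1 \<Longrightarrow> unitary p"
  unfolding unitary_def using matrix_left_right_inverse by blast

lemma unitary_mult: "unitary p \<Longrightarrow> unitary q \<Longrightarrow> unitary (p ** q)"
  by (rule unitaryI) (simp add: adj_mult matrix_mul_assoc[symmetric])

lemma unitary_adj: "unitary p \<Longrightarrow> unitary (adj p)"
  unfolding unitary_def adj_adj by blast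

lemma unitary_cj: "unitary p \<Longrightarrow> unitary (cj p)"
  by (rule unitaryI) simp

lemma unitary_transpose: "unitary p \<Longrightarrow> unitary (transpose p)"
  by (rule unitaryI) simp

lemma unitary_1: "unitary (mat 1)"
  by (rule unitaryI) simp

lemma unitary_mat: "cmod c = 1 \<Longrightarrow> unitary (mat c)"
  by (rule unitaryI) (simp add: mat_mult_mat complex_norm_square[symmetric] mult.commute)

lemma unitary_cancel_left: "unitary p \<Longrightarrow> p ** A = p ** B \<longleftrightarrow> A = B"
  by (metis unitaryD(3))

lemma unitary_cancel_right: "unitary p \<Longrightarrow> A ** p = B ** p \<longleftrightarrow> A = B"
  by (metis matrix_mul_assoc matrix_mul_rid unitaryD(2))

lemma unitary_move_left: "unitary p \<Longrightarrow> p ** A = B \<longleftrightarrow> A = adj p ** B"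
  by (metis unitaryD(3,4))

lemma continuous_on_matrix_mult [continuous_intros]:
  fixes f :: "'a::topological_space \<Rightarrow> complex^'n^'m" and g :: "'a \<Rightarrow> complex^'k^'n"
  shows "continuous_on S f \<Longrightarrow> continuous_on S g \<Longrightarrow> continuous_on S (\<lambda>x. f x ** g x)"
  by (rule bounded_bilinear.continuous_on[OF bounded_bilinear_matrix_mult])

lemmas bounded_linear_adj = linear_adj[unfolded linear_conv_bounded_linear]
  and bounded_linear_cj = linear_cj[unfolded linear_conv_bounded_linear]
  and bounded_linear_transpose = linear_transpose[unfolded linear_conv_bounded_linear]

lemmas [continuous_intros] = bounded_linear.continuous_on[OF bounded_linear_adj]
  bounded_linear.continuous_on[OF bounded_linear_cj]
  bounded_linear.continuous_on[OF bounded_linear_transpose]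

lemmas [tendsto_intros] = bounded_linear.tendsto[OF bounded_linear_adj]
  bounded_linear.tendsto[OF bounded_linear_cj]
  bounded_linear.tendsto[OF bounded_linear_transpose]

lemma tendsto_matrix_mult [tendsto_intros]:
  fixes f :: "'a \<Rightarrow> complex^'n^'m" and g :: "'a \<Rightarrow> complex^'k^'n"
  shows "(f \<longlongrightarrow> A) F \<Longrightarrow> (g \<longlongrightarrow> B) F \<Longrightarrow> ((\<lambda>x. f x ** g x) \<longlongrightarrow> A ** B) F"
  by (rule bounded_bilinear.tendsto[OF bounded_bilinear_matrix_mult])

lemma norm_unitary: "unitary p \<Longrightarrow> norm (p :: complex^'n^'n) = sqrt (CARD('n))"
  by (simp add: norm_eq_sqrt_inner inner_matrix trace_I)

lemma compact_unitary: "compact {p :: complex^'n^'n. unitary p}"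
proof (rule compact_eq_bounded_closed[THEN iffD2], intro conjI)
  show "bounded {p :: complex^'n^'n. unitary p}"
    by (rule boundedI[of _ "sqrt (CARD('n))"]) (simp add: norm_unitary)
  show "closed {p :: complex^'n^'n. unitary p}"
    unfolding unitary_def by (intro closed_Collect_conj closed_Collect_eq continuous_intros)
qed

text \<open>A maximum of \<open>inner (f v) v\<close> on the unit sphere is an eigenvector. Working
  over the reals yields a real eigenvalue of a Hermitian matrix directly.\<close>

lemma self_adjoint_has_eigenvector:
  fixes f :: "'a::euclidean_space \<Rightarrow> 'a"
  assumes "linear f" "\<And>x y. inner (f x) y = inner x (f y)"
  obtains v r where "v \<noteq> 0" "f v = r *\<^sub>R v"
proof -
  have "\<exists>v\<in>sphere 0 1. \<forall>w\<in>sphere 0 1. inner (f w) w \<le> inner (f v) v"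
    by (intro continuous_attains_sup continuous_intros linear_continuous_on
        assms(1)[unfolded linear_conv_bounded_linear]) auto
  then obtain v where v: "norm v = 1" and max: "\<And>w. norm w = 1 \<Longrightarrow> inner (f w) w \<le> inner (f v) v"
    by auto
  define r where "r = inner (f v) v"
  have vv: "inner v v = 1" using v by (simp add: dot_square_norm)
  have bound: "inner (f w) w \<le> r * (norm w)\<^sup>2" for w
  proof (cases "w = 0")
    case False
    have "inner (f (w /\<^sub>R norm w)) (w /\<^sub>R norm w) \<le> r" unfolding r_def using False by (intro max) simp
    then show ?thesis using False
      by (simp add: linear_cmul[OF assms(1)] power2_eq_square field_simps)
  qed (simp add: linear_0[OF assms(1)])
  have "inner (r *\<^sub>R v - f v) w = 0" for w
  proof -
    define b where "b = inner (r *\<^sub>R v - f v) w"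
    define c where "c = r * (norm w)\<^sup>2 - inner (f w) w"
    \<comment> \<open>This is \<open>bound\<close> at v + e w, where the constant terms cancel. A
      quadratic of this shape that is nonnegative for every \<open>e\<close> has
      \<open>b = 0\<close>.\<close>
    have "0 \<le> 2 * e * b + e\<^sup>2 * c" for e
    proof -
      have "inner (f (v + e *\<^sub>R w)) (v + e *\<^sub>R w) = r + 2 * e * inner (f v) w + e\<^sup>2 * inner (f w) w"
        by (simp add: linear_add[OF assms(1)] linear_cmul[OF assms(1)] algebra_simps r_def
            power2_eq_square assms(2)[of w v] inner_commute[of w "f v"])
      moreover have "(norm (v + e *\<^sub>R w))\<^sup>2 = 1 + 2 * e * inner v w + e\<^sup>2 * (norm w)\<^sup>2"
        unfolding power2_norm_eq_inner
        by (simp add: algebra_simps power2_eq_square inner_commute[of w v] vv)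
      ultimately show ?thesis
        using bound[of "v + e *\<^sub>R w"] by (simp add: b_def c_def algebra_simps)
    qed
    note q = this
    have "b = 0"
    proof (rule ccontr)
      assume "b \<noteq> 0"
      show False
      proof (cases "c \<le> 0")
        case True
        then show False using q[of 1] q[of "-1"] \<open>b \<noteq> 0\<close> by auto
      next
        case False
        have "2 * (- b / c) * b + (- b / c)\<^sup>2 * c = - (b\<^sup>2 / c)"
          using False by (simp add: field_simps power2_eq_square)
        moreover have "b\<^sup>2 / c > 0" using False \<open>b \<noteq> 0\<close> by simp
        ultimately show False using q[of "- b / c"] by linarith
      qed
    qed
    then show ?thesis by (simp add: b_def)
  qed
  then have "f v = r *\<^sub>R v" by (metis inner_eq_zero_iff right_minus_eq)
  moreover have "v \<noteq> 0" using v by auto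
  ultimately show ?thesis using that by blast
qed

lemma inner_mult_vec: "inner (A *v x) y = inner x (adj A *v y)" for A :: "complex^'n^'n"
proof -
  have "inner (A *v x) y = (\<Sum>i\<in>UNIV. \<Sum>j\<in>UNIV. Re (cnj (A $ i $ j * x $ j) * y $ i))"
    by (simp add: inner_vec_def inner_complex_def matrix_vector_mult_def sum_distrib_right
        flip: sum.distrib) (simp add: algebra_simps)
  also have "\<dots> = (\<Sum>j\<in>UNIV. \<Sum>i\<in>UNIV. Re (cnj (A $ i $ j * x $ j) * y $ i))" by (rule sum.swap)
  also have "\<dots> = (\<Sum>j\<in>UNIV. \<Sum>i\<in>UNIV. Re (cnj (x $ j) * (cnj (A $ i $ j) * y $ i)))"
    by (simp only: complex_cnj_mult ac_simps)
  finally have eq: "inner (A *v x) y = \<dots>" .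
  show ?thesis
    unfolding eq
    by (simp add: inner_vec_def inner_complex_def matrix_vector_mult_def sum_distrib_left flip: sum.distrib)
qed

lemma linear_matrix_vector_complex: "linear ((*v) A)" for A :: "complex^'n^'m"
  by (rule bounded_linear.linear) simp

lemma mat_vec_mult: "mat c *v x = c *s x" for x :: "complex^'n"
  by (simp add: vec_eq_iff matrix_vector_mult_def mat_nth if_distrib[of "\<lambda>x. x * _"] cong: if_cong)

subsection \<open>Schur's lemma\<close>

text \<open>An eigenspace of \<open>Q\<close> for a real eigenvalue is invariant under every
  \<open>\<rho> $ s\<close> and nonzero, hence everything.\<close>

lemma commuting_hermitian_scalar:
  assumes irr: "irreducible_rep \<rho>" and herm: "adj Q = Q" and comm: "\<And>s. Q ** \<rho> $ s = \<rho> $ s ** Q"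
  obtains r :: real where "Q = mat (of_real r)"
proof -
  obtain v r where v: "v \<noteq> 0" "Q *v v = r *\<^sub>R v"
    by (rule self_adjoint_has_eigenvector[OF linear_matrix_vector_complex, of Q])
       (auto simp: inner_mult_vec herm)
  define W where "W = {w. Q *v w = of_real r *s w}"
  have "vec.subspace W"
    unfolding vec.subspace_def W_def
    by (auto simp: matrix_vector_right_distrib vec.scale_right_distrib vector_scalar_commute
        matrix_vector_mult_0_right vector_smult_assoc mult.commute)
  moreover have "\<rho> $ s *v w \<in> W" if "w \<in> W" for s w
    using that by (simp add: W_def matrix_vector_mul_assoc comm)
      (simp flip: matrix_vector_mul_assoc add: vector_scalar_commute)
  ultimately have "W = {0} \<or> W = UNIV"
    using irr unfolding irreducible_rep_def by blast
  moreover have "v \<in> W" using v(2) by (simp add: W_def scaleR_conv_of_real[where 'a = complex] vec_eq_iff)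
  ultimately have "W = UNIV" using v(1) by auto
  then have "Q *v w = mat (of_real r) *v w" for w by (auto simp: W_def mat_vec_mult)
  then have "Q = mat (of_real r)" by (simp add: matrix_eq)
  then show ?thesis using that by blast
qed

text \<open>Since the \<open>\<rho> $ s\<close> are unitary, \<open>adj X\<close> commutes with them
  as well; thus the Hermitian matrices X + adj X and i (X - adj X) are scalar, and they determine
  \<open>X\<close>.\<close>

lemma commuting_scalar:
  assumes irr: "irreducible_rep \<rho>" and comm: "\<And>s. X ** \<rho> $ s = \<rho> $ s ** X"
  obtains c where "X = mat c"
proof -
  have u: "unitary (\<rho> $ s)" for s using irr by (simp add: irreducible_rep_def is_rep_def)
  have comm': "adj X ** \<rho> $ s = \<rho> $ s ** adj X" for s
  proof -
    have "adj (X ** \<rho> $ s) = adj (\<rho> $ s ** X)" by (simp add: comm)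
    then have "\<rho> $ s ** (adj (\<rho> $ s) ** adj X) ** \<rho> $ s = \<rho> $ s ** (adj X ** adj (\<rho> $ s)) ** \<rho> $ s"
      by (simp add: adj_mult)
    then show ?thesis by (simp add: u matrix_mul_assoc[symmetric])
  qed
  obtain r where r: "X + adj X = mat (of_real r)"
    by (rule commuting_hermitian_scalar[OF irr, of "X + adj X"])
       (simp_all add: matrix_linear_simps matrix_mult_linear_simps comm comm' add.commute)
  let ?Y = "mat \<i> ** (X - adj X)"
  have "?Y ** \<rho> $ s = \<rho> $ s ** ?Y" for s
    by (simp add: matrix_mult_linear_simps comm comm' mat_mult_left_commute matrix_mul_assoc[symmetric])
  moreover have "adj ?Y = ?Y"
    by (simp add: vec_eq_iff mat_mult_nth algebra_simps)
  ultimately obtain q where q: "?Y = mat (of_real q)"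
    using commuting_hermitian_scalar[OF irr, of ?Y] by metis
  have "X $ i $ j = (mat ((of_real r - \<i> * of_real q) / 2)) $ i $ j" for i j
    using arg_cong[OF r, of "\<lambda>A. A $ i $ j"] arg_cong[OF q, of "\<lambda>A. A $ i $ j"]
    by (auto simp: mat_nth mat_mult_nth complex_eq_iff split: if_splits)
  then show ?thesis using that by (metis vec_eq_iff)
qed

subsection \<open>Diagonal unitary matrices and spectra\<close>

definition expi :: "real \<Rightarrow> complex" where
  "expi t = exp (2 * of_real pi * \<i> * of_real t)"

definition dg :: "real^'n \<Rightarrow> complex^'n^'n" where
  "dg \<alpha> = (\<chi> i j. if i = j then expi (\<alpha> $ i) else 0)"

lemma expi_0 [simp]: "expi 0 = 1" by (simp add: expi_def)

lemma expi_add: "expi (s + t) = expi s * expi t"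
  by (simp add: expi_def exp_add[symmetric] algebra_simps)

lemma expi_minus_mult [simp]: "expi (- t) * expi t = 1" "expi t * expi (- t) = 1"
  by (simp_all add: expi_add[symmetric])

lemma cnj_expi [simp]: "cnj (expi t) = expi (- t)"
  by (simp add: expi_def exp_cnj)

lemma norm_expi [simp]: "cmod (expi t) = 1"
  by (simp add: expi_def)

lemma expi_eq_cis: "expi t = cis (2 * pi * t)"
  by (simp add: expi_def cis_conv_exp mult.commute mult.left_commute)

lemma expi_of_int: "expi (of_int k) = 1"
  unfolding expi_eq_cis by (metis cis_multiple_2pi Ints_of_int)

lemma expi_inj:
  assumes "expi s = expi t" "0 \<le> s" "s < 1" "0 \<le> t" "t < 1"
  shows "s = t"
proof -
  obtain n :: int where "2 * of_real pi * \<i> * of_real s = 2 * of_real pi * \<i> * of_real t + complex_of_real (real_of_int (2 * n) * pi) * \<i>"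
    using assms(1) unfolding expi_def exp_eq by blast
  then have "of_real (2 * pi * s) * \<i> = of_real (2 * pi * t + 2 * of_int n * pi) * \<i>"
    by (simp add: algebra_simps)
  then have "2 * pi * s = 2 * pi * t + 2 * of_int n * pi"
    unfolding mult_cancel_right of_real_eq_iff by simp
  then have "2 * pi * s = 2 * pi * (t + of_int n)" by (simp add: algebra_simps)
  then have eq: "s = t + of_int n" by simp
  then have "of_int n < (1::real)" "of_int n > (-1::real)" using assms by linarith+
  then have "n = 0" by linarith
  then show ?thesis using eq by simp
qed

lemma ex_expi: "cmod c = 1 \<Longrightarrow> \<exists>t. 0 \<le> t \<and> t < 1 \<and> expi t = c"
proof -
  assume c: "cmod c = 1"
  obtain u where u: "0 \<le> u" "u < 2 * pi" "c = cis u"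
    using c complex_unit_circle[of c] sincos_total_2pi[of "Re c" "Im c"]
    by (metis cmod_power2 complex_eq_iff cis.sel one_power2)
  show ?thesis
    by (rule exI[of _ "u / (2 * pi)"]) (use u in \<open>auto simp: expi_eq_cis field_simps\<close>)
qed

lemma dg_nth: "dg \<alpha> $ i $ j = (if i = j then expi (\<alpha> $ i) else 0)" by (simp add: dg_def)

lemma dg_mult_nth: "(dg \<alpha> ** A) $ i $ j = expi (\<alpha> $ i) * A $ i $ j"
  by (simp add: matrix_matrix_mult_def dg_nth if_distrib[of "\<lambda>x. x * _"] cong: if_cong)

lemma mult_dg_nth: "(A ** dg \<alpha>) $ i $ j = A $ i $ j * expi (\<alpha> $ j)"
  by (simp add: matrix_matrix_mult_def dg_nth if_distrib[of "\<lambda>x. _ * x"] cong: if_cong)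

lemma transpose_dg [simp]: "transpose (dg \<alpha>) = dg \<alpha>"
  and adj_dg [simp]: "adj (dg \<alpha>) = dg (- \<alpha>)"
  and cj_dg [simp]: "cj (dg \<alpha>) = dg (- \<alpha>)"
  by (simp_all add: vec_eq_iff dg_nth)

lemma dg_minus_mult [simp]: "dg (- \<alpha>) ** dg \<alpha> = mat 1" "dg \<alpha> ** dg (- \<alpha>) = mat 1"
  "dg (- \<alpha>) ** (dg \<alpha> ** A) = A" "dg \<alpha> ** (dg (- \<alpha>) ** A) = A"
  by (simp_all add: vec_eq_iff dg_mult_nth dg_nth mat_nth mult.assoc[symmetric])

lemma unitary_dg: "unitary (dg \<alpha>)"
  by (rule unitaryI) simp

lemma dg_commute:
  assumes "\<And>i j. \<alpha> $ i \<noteq> \<alpha> $ j \<Longrightarrow> c $ i $ j = 0"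
  shows "dg \<alpha> ** c = c ** dg \<alpha>"
proof -
  have "expi (\<alpha> $ i) * c $ i $ j = c $ i $ j * expi (\<alpha> $ j)" for i j
    by (cases "\<alpha> $ i = \<alpha> $ j") (auto simp: assms)
  then show ?thesis by (simp add: vec_eq_iff dg_mult_nth mult_dg_nth)
qed

lemma dg_commute_iff:
  assumes "\<And>i. 0 \<le> \<alpha> $ i \<and> \<alpha> $ i < 1"
  shows "dg \<alpha> ** c = c ** dg \<alpha> \<longleftrightarrow> (\<forall>i j. \<alpha> $ i \<noteq> \<alpha> $ j \<longrightarrow> c $ i $ j = 0)"
proof (intro iffI allI impI)
  fix i j assume *: "dg \<alpha> ** c = c ** dg \<alpha>" "\<alpha> $ i \<noteq> \<alpha> $ j"
  then have "expi (\<alpha> $ i) * c $ i $ j = c $ i $ j * expi (\<alpha> $ j)"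
    by (metis dg_mult_nth mult_dg_nth)
  then show "c $ i $ j = 0" using expi_inj[of "\<alpha> $ i" "\<alpha> $ j"] assms *(2) by auto
qed (auto intro: dg_commute)

lemma det_diagonal_form:
  fixes p :: "complex^'n^'n"
  assumes "unitary p"
  shows "det (mat x - p ** dg \<alpha> ** adj p) = (\<Prod>j\<in>UNIV. x - expi (\<alpha> $ j))"
proof -
  have "p ** (mat x - dg \<alpha>) ** adj p = mat x ** (p ** adj p) - p ** dg \<alpha> ** adj p"
    unfolding matrix_mult_linear_simps mat_mult_commute[of x p, symmetric] matrix_mul_assoc ..
  then have "mat x - p ** dg \<alpha> ** adj p = p ** (mat x - dg \<alpha>) ** adj p"
    using assms by simp
  moreover have "det p * det (adj p) = 1"
    using assms det_mul[of p "adj p"] by simp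
  ultimately have "det (mat x - p ** dg \<alpha> ** adj p) = det (mat x - dg \<alpha>)"
    by (simp add: det_mul)
  also have "\<dots> = (\<Prod>j\<in>UNIV. (mat x - dg \<alpha>) $ j $ j)"
    by (rule det_diagonal) (simp add: mat_nth dg_nth)
  finally show ?thesis by (simp add: mat_nth dg_nth)
qed

lemma is_spec_diagonal_form:
  assumes "unitary p" "\<And>i j. i \<le> j \<Longrightarrow> \<alpha> $ i \<le> \<alpha> $ j" "\<And>j. 0 \<le> \<alpha> $ j \<and> \<alpha> $ j < 1"
  shows "is_spec (p ** dg \<alpha> ** adj p) \<alpha>"
  using assms det_diagonal_form[OF assms(1)] by (simp add: is_spec_def expi_def)

text \<open>Both products are polynomials in \<open>x\<close> that agree as functions, so they have
  the same multiset of roots.\<close>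

lemma prod_linear_eq_imp_image_mset_eq:
  fixes f g :: "'a::finite \<Rightarrow> complex"
  assumes "\<And>x. (\<Prod>j\<in>UNIV. x - f j) = (\<Prod>j\<in>UNIV. x - g j)"
  shows "image_mset f (mset_set UNIV) = image_mset g (mset_set UNIV)"
proof -
  let ?P = "\<lambda>f. \<Prod>j\<in>UNIV. [:- (f j :: complex), 1:]"
  have "poly (?P f) = poly (?P g)" using assms by (simp add: poly_prod fun_eq_iff)
  then have "proots (?P f) = proots (?P g)" by (simp add: poly_eq_poly_eq_iff)
  moreover have "proots (?P f) = image_mset f (mset_set UNIV)" for f :: "'a \<Rightarrow> complex"
  proof -
    have "proots (?P f) = (\<Sum>j\<in>UNIV. {#f j#})" by (subst proots_prod) auto
    also have "(\<Sum>j\<in>A. {#f j#}) = image_mset f (mset_set A)" for A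
      by (induction A rule: infinite_finite_induct) auto
    finally show ?thesis .
  qed
  ultimately show ?thesis by simp
qed

lemma monotone_image_mset_unique:
  fixes f g :: "'a::{finite,linorder} \<Rightarrow> real"
  assumes "image_mset f (mset_set UNIV) = image_mset g (mset_set UNIV)" "mono f" "mono g"
  shows "f = g"
proof -
  let ?xs = "sorted_list_of_set (UNIV :: 'a set)"
  have "mset (map f ?xs) = mset (map g ?xs)"
    using assms(1) by (simp add: mset_set_set[symmetric] flip: sorted_list_of_mset_set)
  moreover have "sorted (map h ?xs)" if "mono h" for h :: "'a \<Rightarrow> real"
    using that by (intro sorted_map_mono[where f = h]) (auto intro: mono_on_subset)
  ultimately have "map f ?xs = map g ?xs"
    using properties_for_sort assms(2,3) by metis
  then show ?thesis by (auto simp: fun_eq_iff)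
qed

text \<open>The characteristic polynomial determines the multiset of the values \<open>expi\<close>;
  on [0,1) the map \<open>expi\<close> is injective, and a monotone listing of a multiset is unique.
  This makes the description in \<open>spec\<close> proper.\<close>

lemma is_spec_unique:
  assumes "is_spec A \<alpha>" "is_spec A \<beta>"
  shows "\<alpha> = \<beta>"
proof -
  have "image_mset (\<lambda>j. expi (\<alpha> $ j)) (mset_set UNIV) = image_mset (\<lambda>j. expi (\<beta> $ j)) (mset_set UNIV)"
    by (rule prod_linear_eq_imp_image_mset_eq) (use assms in \<open>simp add: is_spec_def expi_def\<close>)
  then have "image_mset (inv_into {0..<1} expi) (image_mset (\<lambda>j. expi (\<alpha> $ j)) (mset_set UNIV)) =
      image_mset (inv_into {0..<1} expi) (image_mset (\<lambda>j. expi (\<beta> $ j)) (mset_set UNIV))"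
    by simp
  moreover have inj: "inj_on expi {0..<1}" by (auto intro!: inj_onI expi_inj)
  have "inv_into {0..<1} expi (expi (\<gamma> $ j)) = \<gamma> $ j" if "is_spec A \<gamma>" for \<gamma> j
    using that by (intro inv_into_f_f[OF inj]) (auto simp: is_spec_def)
  ultimately have "image_mset (($) \<alpha>) (mset_set UNIV) = image_mset (($) \<beta>) (mset_set UNIV)"
    using assms by (simp add: image_mset.compositionality o_def)
  then have "($) \<alpha> = ($) \<beta>"
    by (rule monotone_image_mset_unique) (use assms in \<open>auto simp: is_spec_def mono_def\<close>)
  then show ?thesis by (simp add: vec_eq_iff)
qed

lemma spec_eqI: "is_spec A \<alpha> \<Longrightarrow> spec A = \<alpha>"
  unfolding spec_def by (rule the_equality) (auto intro: is_spec_unique)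

lemma is_spec_conj:
  assumes "unitary g"
  shows "is_spec (g ** A ** adj g) = is_spec A"
proof -
  have "det (mat x - g ** A ** adj g) = det (mat x - A)" for x
  proof -
    have "g ** (mat x - A) ** adj g = mat x ** (g ** adj g) - g ** A ** adj g"
      unfolding matrix_mult_linear_simps mat_mult_commute[of x g, symmetric] matrix_mul_assoc ..
    then have "mat x - g ** A ** adj g = g ** (mat x - A) ** adj g"
      using assms by simp
    then show ?thesis using assms det_mul[of g "adj g"] by (simp add: det_mul)
  qed
  then show ?thesis by (simp add: is_spec_def fun_eq_iff)
qed

lemma ex_sorting_permutation:
  fixes f :: "'a::{finite,linorder} \<Rightarrow> real"
  shows "\<exists>\<pi> :: 'a \<Rightarrow> 'a. bij \<pi> \<and> mono (\<lambda>i. f (\<pi> i))"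
proof -
  let ?ys = "sorted_list_of_set (UNIV :: 'a set)"
  let ?xs = "sort_key f ?ys"
  define r where "r i = card {..<i}" for i :: 'a
  have r_mono: "r i < r j" if "i < j" for i j
    unfolding r_def by (rule psubset_card_mono) (use that in auto)
  have "bij_betw r UNIV {..<CARD('a)}"
  proof -
    have "inj r" by (rule linorder_injI) (metis r_mono less_irrefl)
    moreover have "r ` UNIV \<subseteq> {..<CARD('a)}"
      unfolding r_def by (auto intro!: psubset_card_mono)
    ultimately show ?thesis
      by (simp add: bij_betw_def card_image card_subset_eq)
  qed
  moreover have "bij_betw ((!) ?xs) {..<CARD('a)} UNIV"
    by (rule bij_betw_nth) auto
  ultimately have "bij (\<lambda>i. ?xs ! r i)"
    using bij_betw_trans by (fastforce simp: o_def)
  moreover have "mono (\<lambda>i. f (?xs ! r i))"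
  proof (rule monoI)
    fix i j :: 'a assume "i \<le> j"
    then have "r i \<le> r j" using r_mono by (metis le_less)
    moreover have "r j < length ?xs"
      unfolding r_def by (auto intro!: psubset_card_mono)
    ultimately show "f (?xs ! r i) \<le> f (?xs ! r j)"
      using sorted_nth_mono[of "map f ?xs" "r i" "r j"] by simp
  qed
  ultimately show ?thesis by (intro exI[of _ "\<lambda>i. ?xs ! r i"]) simp
qed

subsection \<open>The Cayley transform\<close>

text \<open>The Cayley transform (1 + Z) (1 - Z)^(-1) serves as the exponential of a skew-Hermitian
  \<open>Z\<close>. It is unitary, the displayed identity is its second-order expansion with
  explicit remainder, and it inherits reality and all commutation relations from
  \<open>Z\<close>.\<close>

lemma cayley:
  fixes Z :: "complex^'n^'n"
  assumes "adj Z = - Z"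
  obtains c where "unitary c" "c = mat 1 + 2 *\<^sub>R Z + Z ** Z ** (mat 1 + c)"
    "cj Z = Z \<Longrightarrow> cj c = c" "\<And>A. A ** Z = Z ** A \<Longrightarrow> A ** c = c ** A"
proof -
  \<comment> \<open>If x = Z x with \<open>Z\<close> skew, then \<open>inner x x\<close> equals its
    own negative; so 1 - Z is invertible.\<close>
  have "(mat 1 - Z) *v x = 0 \<Longrightarrow> x = 0" for x
  proof -
    assume "(mat 1 - Z) *v x = 0"
    then have x: "x = Z *v x" by (simp add: matrix_vector_mult_diff_rdistrib)
    have "inner x x = inner (Z *v x) x" using x by simp
    also have "\<dots> = - inner x (Z *v x)"
      by (simp only: inner_mult_vec assms) (simp add: matrix_vector_mult_def inner_vec_def sum_negf)
    finally show "x = 0" using x by simp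
  qed
  then obtain N where N: "N ** (mat 1 - Z) = mat 1"
    using matrix_left_invertible_ker[of "mat 1 - Z"] by blast
  then have N': "(mat 1 - Z) ** N = mat 1" by (simp add: matrix_left_right_inverse)
  have NZ: "N ** A = A ** N" if "A ** Z = Z ** A" for A
  proof -
    have "N ** (A ** (mat 1 - Z)) ** N = N ** ((mat 1 - Z) ** A) ** N"
      by (simp add: matrix_mult_linear_simps that)
    then show ?thesis by (simp add: N N' matrix_mul_assoc[symmetric]) (simp add: N N' matrix_mul_assoc)
  qed
  define c where "c = (mat 1 + Z) ** N"
  have ZN: "Z ** N = N - mat 1" "N ** Z = N - mat 1"
    using N N' by (simp_all add: matrix_mult_linear_simps algebra_simps)
  have cN: "mat 1 + c = 2 *\<^sub>R N" by (simp add: c_def matrix_mult_linear_simps ZN scaleR_2)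
  have "adj c ** c = mat 1"
  proof -
    have "adj N ** (mat 1 + Z) = mat 1"
      using arg_cong[OF N', of adj] assms by (simp add: adj_mult matrix_linear_simps)
    moreover have "(mat 1 - Z) ** (mat 1 + Z) = (mat 1 + Z) ** (mat 1 - Z)"
      by (simp add: matrix_mult_linear_simps)
    moreover have "adj c ** c = adj N ** ((mat 1 - Z) ** (mat 1 + Z)) ** N"
      by (simp add: c_def adj_mult matrix_linear_simps assms matrix_mul_assoc)
    ultimately have "adj c ** c = (adj N ** (mat 1 + Z)) ** ((mat 1 - Z) ** N)"
      by (simp only: matrix_mul_assoc)
    then show ?thesis by (simp add: \<open>adj N ** (mat 1 + Z) = mat 1\<close> N')
  qed
  then have "unitary c" by (rule unitaryI)
  moreover have "c = mat 1 + 2 *\<^sub>R Z + Z ** Z ** (mat 1 + c)"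
  proof -
    have "c = 2 *\<^sub>R N - mat 1" by (simp add: cN[symmetric])
    moreover have "Z ** Z ** (mat 1 + c) = 2 *\<^sub>R (N - mat 1 - Z)"
      by (simp add: cN matrix_mult_linear_simps matrix_mul_assoc[symmetric] ZN)
    ultimately show ?thesis by (simp add: scaleR_diff_right scaleR_2)
  qed
  moreover have "cj c = c" if "cj Z = Z"
  proof -
    have "cj N ** (mat 1 - Z) = mat 1" using arg_cong[OF N, of cj] that by (simp add: cj_mult matrix_linear_simps)
    then have "cj N ** (mat 1 - Z) ** N = N" by simp
    then have "cj N = N" by (simp add: N' matrix_mul_assoc[symmetric])
    then show ?thesis using that by (simp add: c_def cj_mult matrix_linear_simps)
  qed
  moreover have "A ** c = c ** A" if "A ** Z = Z ** A" for A
    using NZ[OF that] that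
    by (simp add: c_def matrix_mult_linear_simps matrix_mul_assoc) (metis matrix_mul_assoc)
  ultimately show ?thesis using that by blast
qed

text \<open>With a bounded \<open>r\<close> the linear term dominates near zero and changes sign
  with \<open>e\<close>, so it must vanish. In this form, Cayley variations at a maximum give the
  equations of a critical point.\<close>

lemma first_order_zero:
  fixes a :: real
  assumes "\<And>e. \<bar>e\<bar> \<le> 1 \<Longrightarrow> e * a + e\<^sup>2 * r e \<le> 0" "\<And>e. \<bar>e\<bar> \<le> 1 \<Longrightarrow> \<bar>r e\<bar> \<le> K"
  shows "a = 0"
proof (rule ccontr)
  assume "a \<noteq> 0"
  define L where "L = K + \<bar>a\<bar> + 1"
  have K: "K \<ge> 0" using assms(2)[of 0] by linarith
  then have L: "L > 0" by (simp add: L_def add_nonneg_pos)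
  \<comment> \<open>Small enough that half of the linear term survives a remainder bounded by
    \<open>L\<close>; the summand for \<open>a\<close> inside \<open>L\<close> makes the absolute
    value of \<open>d\<close> at most 1.\<close>
  define d where "d = a / (2 * L)"
  have "\<bar>d\<bar> \<le> 1" using L K by (simp add: d_def L_def abs_divide field_simps)
  have "d * a + d\<^sup>2 * r d \<le> 0" by (rule assms(1)[OF \<open>\<bar>d\<bar> \<le> 1\<close>])
  moreover have "d\<^sup>2 * (- L) \<le> d\<^sup>2 * r d"
    using assms(2)[OF \<open>\<bar>d\<bar> \<le> 1\<close>] by (intro mult_left_mono) (auto simp: L_def)
  moreover have "d * L = a / 2" using L by (simp add: d_def)
  then have "d\<^sup>2 * (- L) = - (d * a / 2)" by (simp add: power2_eq_square)
  moreover have "d * a > 0"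
    using \<open>a \<noteq> 0\<close> L by (simp add: d_def zero_less_divide_iff) (metis not_real_square_gt_zero)
  ultimately show False by linarith
qed

subsection \<open>Diagonalization of symmetric unitary matrices\<close>

text \<open>Rotating \<open>M\<close> along the commutator Z = H M - M H changes
  \<open>inner M H\<close> to first order by twice \<open>inner Z Z\<close>, so \<open>Z = 0\<close>
  at a maximum. Only rotations commuting with the whole commutant of \<open>Z\<close> compete, which
  makes the lemma applicable to a maximum constrained by an earlier one.\<close>

lemma argmax_commutes:
  fixes M H :: "complex^'n^'n"
  assumes real: "cj M = M" "cj H = H" and sym: "transpose M = M" "transpose H = H"
    and max: "\<And>c. unitary c \<Longrightarrow> cj c = c \<Longrightarrow>
      (\<And>A. A ** (H ** M - M ** H) = (H ** M - M ** H) ** A \<Longrightarrow> A ** c = c ** A) \<Longrightarrow>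
      inner (c ** M ** adj c) H \<le> inner M H"
  shows "H ** M = M ** H"
proof -
  define Z where "Z = H ** M - M ** H"
  have herm: "adj M = M" "adj H = H" using real sym by (metis transpose_cj)+
  have Z: "adj Z = - Z" "cj Z = Z"
    by (simp_all add: Z_def matrix_linear_simps adj_mult cj_mult herm real)
  have "\<exists>c. unitary c \<and> c = mat 1 + 2 *\<^sub>R (e *\<^sub>R Z) + (e *\<^sub>R Z) ** (e *\<^sub>R Z) ** (mat 1 + c) \<and> cj c = c \<and>
      (\<forall>A. A ** Z = Z ** A \<longrightarrow> A ** c = c ** A)" for e :: real
  proof -
    have "adj (e *\<^sub>R Z) = - (e *\<^sub>R Z)" by (simp add: matrix_linear_simps Z)
    then obtain c where c: "unitary c" "c = mat 1 + 2 *\<^sub>R (e *\<^sub>R Z) + (e *\<^sub>R Z) ** (e *\<^sub>R Z) ** (mat 1 + c)"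
      "cj (e *\<^sub>R Z) = e *\<^sub>R Z \<Longrightarrow> cj c = c"
      "\<And>A. A ** (e *\<^sub>R Z) = (e *\<^sub>R Z) ** A \<Longrightarrow> A ** c = c ** A"
      by (rule cayley) (blast intro: that)
    then show ?thesis
      by (intro exI[of _ c] conjI) (auto simp: matrix_linear_simps Z matrix_mult_linear_simps)
  qed
  then obtain c where c: "\<And>e. unitary (c e)" "\<And>e. cj (c e) = c e"
    "\<And>e. c e = mat 1 + 2 *\<^sub>R (e *\<^sub>R Z) + (e *\<^sub>R Z) ** (e *\<^sub>R Z) ** (mat 1 + c e)"
    "\<And>e A. A ** Z = Z ** A \<Longrightarrow> A ** c e = c e ** A"
    by metis
  define R where "R e = Z ** Z ** (mat 1 + c e)" for e
  have cR: "c e = mat 1 + (2 * e) *\<^sub>R Z + e\<^sup>2 *\<^sub>R R e" for e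
    by (subst c(3)) (simp add: R_def matrix_mult_linear_simps power2_eq_square scaleR_add_right)
  have adjcR: "adj (c e) = mat 1 - (2 * e) *\<^sub>R Z + e\<^sup>2 *\<^sub>R adj (R e)" for e
    by (subst cR) (simp add: matrix_linear_simps Z)
  \<comment> \<open>The remainder beyond first order, as a function of \<open>e\<close> and of the
    rotation, so that compactness of the unitary group bounds it.\<close>
  define G where "G e b = inner (Z ** Z ** (mat 1 + b) ** M ** adj b) H + inner (M ** adj (Z ** Z ** (mat 1 + b))) H
      + 2 * inner (Z ** M ** ((- 2) *\<^sub>R Z + e *\<^sub>R adj (Z ** Z ** (mat 1 + b)))) H" for e b
  have exp: "inner (c e ** M ** adj (c e)) H = inner M H + e * (2 * inner (Z ** M - M ** Z) H) + e\<^sup>2 * G e (c e)" for e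
  proof -
    have "c e ** M ** adj (c e) = M ** adj (c e) + (2 * e) *\<^sub>R (Z ** M ** adj (c e)) + e\<^sup>2 *\<^sub>R (R e ** M ** adj (c e))"
      by (subst (1) cR) (simp add: matrix_mult_linear_simps)
    also have "M ** adj (c e) = M - (2 * e) *\<^sub>R (M ** Z) + e\<^sup>2 *\<^sub>R (M ** adj (R e))"
      by (simp add: adjcR matrix_mult_linear_simps)
    also have "Z ** M ** adj (c e) = Z ** M + e *\<^sub>R (Z ** M ** ((- 2) *\<^sub>R Z + e *\<^sub>R adj (R e)))"
      by (simp add: adjcR matrix_mult_linear_simps scaleR_diff_right power2_eq_square mult.commute)
    finally have eq: "c e ** M ** adj (c e) = M - (2 * e) *\<^sub>R (M ** Z) + e\<^sup>2 *\<^sub>R (M ** adj (R e)) +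
      (2 * e) *\<^sub>R (Z ** M + e *\<^sub>R (Z ** M ** ((- 2) *\<^sub>R Z + e *\<^sub>R adj (R e)))) + e\<^sup>2 *\<^sub>R (R e ** M ** adj (c e))" .
    show ?thesis
      unfolding eq G_def R_def[symmetric] inner_add_left inner_diff_left inner_scaleR_left
      by (simp add: algebra_simps power2_eq_square)
  qed
  have "compact ((\<lambda>(e, b). G e b) ` ({-1..1} \<times> {b. unitary b}))"
    by (intro compact_continuous_image compact_Times compact_unitary compact_Icc)
       (auto simp: G_def case_prod_unfold intro!: continuous_intros)
  then obtain K where K: "\<And>e b. \<bar>e\<bar> \<le> 1 \<Longrightarrow> unitary b \<Longrightarrow> \<bar>G e b\<bar> \<le> K"
    by (force dest!: compact_imp_bounded simp: bounded_iff abs_le_iff)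
  have "2 * inner (Z ** M - M ** Z) H = 0"
  proof (rule first_order_zero)
    fix e :: real assume "\<bar>e\<bar> \<le> 1"
    show "e * (2 * inner (Z ** M - M ** Z) H) + e\<^sup>2 * G e (c e) \<le> 0"
      using max[OF c(1)[of e] c(2)] c(4) exp[of e] by (simp add: Z_def)
    show "\<bar>G e (c e)\<bar> \<le> K" using K c(1) \<open>\<bar>e\<bar> \<le> 1\<close> by blast
  qed
  moreover have "inner (Z ** M - M ** Z) H = inner Z Z"
    unfolding inner_diff_left inner_mult_right[of Z M H] inner_mult_left[of M Z H] herm
    by (simp add: Z_def inner_diff_right)
  ultimately show ?thesis by (simp add: Z_def)
qed

text \<open>Up to the factor 2, \<open>A\<close> is X - i Y with commuting real symmetric
  \<open>X\<close> and \<open>Y\<close>. Among real orthogonal \<open>k\<close>, first maximize the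
  pairing of k W k^T with \<open>X\<close>, then among the maximizers the pairing with
  \<open>Y\<close>. By \<open>argmax_commutes\<close> both commute with k W k^T, which has simple
  spectrum, so \<open>k\<close> diagonalizes \<open>A\<close>.\<close>

lemma symmetric_unitary_diagonalizable:
  fixes A :: "('n::{finite,linorder}) cmat"
  assumes "unitary A" "transpose A = A"
  obtains k \<alpha> where "unitary k" "cj k = k" "A = k ** dg \<alpha> ** adj k"
    "\<And>i j. i \<le> j \<Longrightarrow> \<alpha> $ i \<le> \<alpha> $ j" "\<And>j. 0 \<le> \<alpha> $ j \<and> \<alpha> $ j < 1"
proof -
  define X where "X = A + cj A"
  define Y where "Y = mat \<i> ** (A - cj A)"
  have adjA: "adj A = cj A" using assms(2) by (metis transpose_cj cj_transpose)
  have XY: "cj X = X" "cj Y = Y" "transpose X = X" "transpose Y = Y"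
    using assms(2) adjA
    by (simp_all add: X_def Y_def matrix_linear_simps cj_mult transpose_mult vec_eq_iff mat_mult_nth mult_mat_nth algebra_simps)
  have AcA: "A ** cj A = cj A ** A" using assms(1) by (simp add: adjA[symmetric])
  have com: "X ** Y = Y ** X"
    by (simp add: X_def Y_def matrix_mult_linear_simps mat_mult_left_commute matrix_mul_assoc[symmetric] AcA)
  have A_XY: "2 *\<^sub>R A = X - mat \<i> ** Y"
    by (simp add: X_def Y_def vec_eq_iff mat_mult_nth algebra_simps scaleR_conv_of_real[where 'a = complex])
  \<comment> \<open>A diagonal matrix with distinct entries: whatever commutes with it is
    diagonal.\<close>
  define W :: "'n cmat" where "W = (\<chi> i j. if i = j then of_nat (pos i) else (0::complex))"
  have Wc: "cj W = W" "transpose W = W" by (simp_all add: W_def vec_eq_iff)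
  have pos_inj: "pos i = pos j \<longleftrightarrow> i = j" for i j :: 'n
  proof -
    have "pos i < pos j" if "i < j" for i j :: 'n
      unfolding pos_def by (rule psubset_card_mono) (use that in auto)
    then show ?thesis by (metis less_irrefl linorder_less_linear)
  qed
  define O1 where "O1 = {k :: 'n cmat. unitary k \<and> cj k = k}"
  define F where "F k = k ** W ** adj k" for k :: "'n cmat"
  have "O1 = {k. unitary k} \<inter> {k. cj k = k}" by (auto simp: O1_def)
  then have "compact O1"
    by (simp add: compact_unitary compact_Int_closed closed_Collect_eq continuous_intros)
  have O1F: "continuous_on S (\<lambda>k. inner (F k) B)" for B S
    unfolding F_def by (intro continuous_intros)
  have "mat 1 \<in> O1" by (simp add: O1_def unitary_1)
  then obtain k0 where k0: "k0 \<in> O1" "\<And>k. k \<in> O1 \<Longrightarrow> inner (F k) X \<le> inner (F k0) X"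
    using continuous_attains_sup[OF \<open>compact O1\<close> _ O1F] by blast
  define O2 where "O2 = {k \<in> O1. inner (F k) X = inner (F k0) X}"
  have "O2 = O1 \<inter> {k. inner (F k) X = inner (F k0) X}" by (auto simp: O2_def)
  then have "compact O2"
    by (simp add: \<open>compact O1\<close> compact_Int_closed closed_Collect_eq O1F)
  moreover have "k0 \<in> O2" using k0 by (simp add: O2_def)
  ultimately obtain k where k: "k \<in> O2" "\<And>k'. k' \<in> O2 \<Longrightarrow> inner (F k') Y \<le> inner (F k) Y"
    using continuous_attains_sup[OF \<open>compact O2\<close> _ O1F] by blast
  have kO: "unitary k" "cj k = k" "adj k = transpose k" and kX: "\<And>k'. k' \<in> O1 \<Longrightarrow> inner (F k') X \<le> inner (F k) X"
    using k(1) k0(2) by (auto simp: O2_def O1_def) (metis cj_adj cj_cj cj_transpose adj_cj)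
  have FM: "cj (F k) = F k" "transpose (F k) = F k"
    using kO Wc by (simp_all add: F_def cj_mult transpose_mult matrix_mul_assoc)
  have ck: "c ** F k ** adj c = F (c ** k)" "unitary c \<Longrightarrow> cj c = c \<Longrightarrow> c ** k \<in> O1" for c
    using kO by (auto simp: F_def O1_def adj_mult matrix_mul_assoc unitary_mult cj_mult)
  have 1: "X ** F k = F k ** X"
    by (rule argmax_commutes) (use FM XY ck kX in auto)
  have 2: "Y ** F k = F k ** Y"
  proof (rule argmax_commutes)
    fix c assume c: "unitary c" "cj c = c"
      "\<And>A. A ** (Y ** F k - F k ** Y) = (Y ** F k - F k ** Y) ** A \<Longrightarrow> A ** c = c ** A"
    \<comment> \<open>\<open>X\<close> commutes with \<open>Y\<close> and \<open>F k\<close>, hence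
      with the competing rotation \<open>c\<close>. Such a rotation leaves the first functional
      unchanged, so \<open>c ** k\<close> remains in \<open>O2\<close>.\<close>
    have "X ** (Y ** F k - F k ** Y) = (Y ** F k - F k ** Y) ** X"
      by (simp add: matrix_mult_linear_simps) (metis com 1 matrix_mul_assoc)
    then have "X ** c = c ** X" by (rule c(3))
    then have "adj c ** X ** c = X" using c(1) by (simp add: matrix_mul_assoc[symmetric])
    moreover have "inner (c ** F k ** adj c) X = inner (F k) (adj c ** (X ** c))"
      unfolding inner_mult_right[of "c ** F k"] inner_mult_left[of c "F k"] by simp
    ultimately have "inner (F (c ** k)) X = inner (F k) X"
      by (simp add: ck(1)[symmetric] matrix_mul_assoc)
    then have "c ** k \<in> O2" using ck(2)[OF c(1,2)] k(1) by (simp add: O2_def)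
    then show "inner (c ** F k ** adj c) Y \<le> inner (F k) Y" using k(2) by (simp add: ck(1))
  qed (use FM XY in auto)
  have "2 *\<^sub>R (A ** F k) = (X - mat \<i> ** Y) ** F k"
    by (simp only: A_XY[symmetric] matrix_mult_linear_simps)
  also have "\<dots> = F k ** (X - mat \<i> ** Y)"
    by (simp add: matrix_mult_linear_simps 1 2 mat_mult_left_commute matrix_mul_assoc[symmetric])
  also have "\<dots> = 2 *\<^sub>R (F k ** A)"
    by (simp only: A_XY[symmetric] matrix_mult_linear_simps)
  finally have "2 *\<^sub>R (A ** F k) = 2 *\<^sub>R (F k ** A)" .
  then have AF: "A ** F k = F k ** A" by simp
  define B where "B = adj k ** A ** k"
  have "B ** W = W ** B"
  proof -
    have "adj k ** (A ** F k) ** k = adj k ** (F k ** A) ** k" by (simp add: AF)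
    then show ?thesis using kO(1) by (simp add: B_def F_def matrix_mul_assoc[symmetric])
  qed
  then have "B $ i $ j = 0" if "i \<noteq> j" for i j
  proof -
    have "(B ** W) $ i $ j = (W ** B) $ i $ j" by (simp add: \<open>B ** W = W ** B\<close>)
    then have "B $ i $ j * of_nat (pos j) = of_nat (pos i) * B $ i $ j"
      by (simp add: W_def matrix_matrix_mult_def if_distrib[of "\<lambda>x. _ * x"] if_distrib[of "\<lambda>x. x * _"] cong: if_cong)
    then show ?thesis using that pos_inj by auto
  qed
  note Boff = this
  have uB: "unitary B" using kO(1) assms(1) by (simp add: B_def unitary_mult unitary_adj)
  have "cmod (B $ i $ i) = 1" for i
  proof -
    have "(adj B ** B) $ i $ i = 1" using uB by (simp add: mat_nth)
    moreover have "(adj B ** B) $ i $ i = cnj (B $ i $ i) * B $ i $ i"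
      unfolding matrix_matrix_mult_def
      by (simp, subst sum.remove[of _ i]) (auto simp: Boff intro!: sum.neutral)
    ultimately have "(cmod (B $ i $ i))\<^sup>2 = 1"
      by (metis complex_norm_square mult.commute of_real_eq_1_iff)
    then show ?thesis by (simp add: abs_square_eq_1)
  qed
  then have "\<forall>i. \<exists>t. 0 \<le> t \<and> t < 1 \<and> expi t = B $ i $ i"
    by (intro allI ex_expi)
  from choice[OF this] obtain f where f': "\<forall>i. 0 \<le> f i \<and> f i < 1 \<and> expi (f i) = B $ i $ i"
    by (rule exE)
  note f = f'[rule_format]
  obtain \<pi> :: "'n \<Rightarrow> 'n" where \<pi>: "bij \<pi>" "mono (\<lambda>i. f (\<pi> i))" using ex_sorting_permutation[of f] by blast
  define \<alpha> where "\<alpha> = (\<chi> i. f (\<pi> i))"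
  define q :: "'n cmat" where "q = (\<chi> i j. if i = \<pi> j then 1 else (0 :: complex))"
  have q: "unitary q" "cj q = q"
  proof -
    have "(\<Sum>k\<in>UNIV. (if k = \<pi> i then 1 else 0) * (if k = \<pi> j then 1 else 0)) = (if i = j then 1 else (0 :: complex))" for i j
      using \<pi>(1) by (auto simp: bij_def inj_def if_distrib[of "\<lambda>x. x * _"] cong: if_cong)
    then show "unitary q"
      by (intro unitaryI) (simp add: vec_eq_iff matrix_matrix_mult_def q_def mat_nth if_distrib[of cnj] cong: if_cong)
    show "cj q = q" by (simp add: vec_eq_iff q_def)
  qed
  have "B ** q = q ** dg \<alpha>"
  proof -
    have "(B ** q) $ i $ j = B $ i $ (\<pi> j)" for i j
      by (simp add: matrix_matrix_mult_def q_def if_distrib[of "\<lambda>x. _ * x"] cong: if_cong)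
    then show ?thesis
      by (auto simp: vec_eq_iff mult_dg_nth q_def \<alpha>_def f Boff)
  qed
  then have "B = q ** dg \<alpha> ** adj q" using q(1) by (metis matrix_mul_assoc matrix_mul_rid unitaryD(2))
  moreover have "A = k ** B ** adj k" using kO(1) by (simp add: B_def matrix_mul_assoc[symmetric])
  ultimately have "A = (k ** q) ** dg \<alpha> ** adj (k ** q)" by (simp add: adj_mult matrix_mul_assoc)
  moreover have "unitary (k ** q)" "cj (k ** q) = k ** q"
    using kO q by (simp_all add: unitary_mult cj_mult)
  moreover have "\<alpha> $ i \<le> \<alpha> $ j" if "i \<le> j" for i j using \<pi>(2) that by (simp add: \<alpha>_def mono_def)
  moreover have "0 \<le> \<alpha> $ j \<and> \<alpha> $ j < 1" for j using f by (simp add: \<alpha>_def)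
  ultimately show ?thesis using that by blast
qed

section \<open>Lagrangian representations as cyclic chains of symmetric unitary matrices, and their
  frames\<close>

subsection \<open>The cyclic successor\<close>

lemma cyc_next_Max [simp]: "cyc_next (Max UNIV) = Min UNIV"
  by (simp add: cyc_next_def)

lemma cyc_next_greater: "s \<noteq> Max UNIV \<Longrightarrow> s < cyc_next s"
proof -
  assume s: "s \<noteq> Max UNIV"
  have "Max UNIV \<in> {t. s < t}" using s Max_ge[of UNIV s] by (simp add: less_le)
  then have "{t. s < t} \<noteq> {}" by blast
  then have "Min {t. s < t} \<in> {t. s < t}" by (intro Min_in) auto
  then show ?thesis using s by (simp add: cyc_next_def)
qed

text \<open>Iterating \<open>cyc_next\<close> reaches the maximum from every element; the induction
  is on the number of larger elements.\<close>

lemma cyc_invariant: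
  assumes "\<And>s :: 'l::{finite,linorder}. f (cyc_next s) = f s"
  shows "f s = f t"
proof -
  have "f s = f (Max UNIV)" for s
  proof (induction "card {t. s < t}" arbitrary: s rule: less_induct)
    case less
    show ?case
    proof (cases "s = Max UNIV")
      case False
      have "card {t. cyc_next s < t} < card {t. s < t}"
        using cyc_next_greater[OF False] by (intro psubset_card_mono) auto
      then show ?thesis using less assms by metis
    qed simp
  qed
  then show ?thesis by metis
qed

lemma bij_cyc_next: "bij (cyc_next :: 'l::{finite,linorder} \<Rightarrow> 'l)"
proof -
  have "t \<in> range cyc_next" for t :: 'l
  proof (cases "t = Min UNIV")
    case True
    then show ?thesis using cyc_next_Max by (metis rangeI)
  next
    case False
    have "Min UNIV \<in> {s. s < t}" using False Min_le[of UNIV t] by (simp add: less_le)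
    then have ne: "{s. s < t} \<noteq> {}" by blast
    define s where "s = Max {s. s < t}"
    have s: "s < t" using Max_in[OF _ ne] by (simp add: s_def)
    have "t \<le> u" if "s < u" for u
      using that Max_ge[of "{s. s < t}" u] by (fastforce simp: s_def)
    then have "Min {u. s < u} = t" using s by (intro Min_eqI) auto
    moreover have "s \<noteq> Max UNIV" using s by (metis Max_ge UNIV_I finite leD)
    ultimately show ?thesis by (auto simp: cyc_next_def intro!: image_eqI[of _ _ s])
  qed
  then have "surj (cyc_next :: 'l \<Rightarrow> 'l)" by blast
  then show ?thesis by (simp add: bij_def finite_UNIV_surj_inj)
qed

lemma sum_cyc_next: "(\<Sum>s\<in>UNIV. f (cyc_next s)) = (\<Sum>s\<in>UNIV. f s)"
  using sum.reindex_bij_betw[OF bij_cyc_next] .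

lemma prod_cyc_next: "(\<Prod>s\<in>UNIV. f (cyc_next s)) = (\<Prod>s\<in>UNIV. f s)"
  using prod.reindex_bij_betw[OF bij_cyc_next] .

text \<open>The product over a final segment starting at \<open>a\<close> is \<open>S a\<close>
  times the inverse of \<open>S (Min UNIV)\<close>, because the successor of the maximum is the
  minimum; for \<open>a = Min UNIV\<close> this is the identity.\<close>

lemma telescoping_product:
  fixes S :: "'l::{finite,linorder} \<Rightarrow> complex^'n^'n"
  assumes "\<And>s. unitary (S s)"
  shows "foldr (\<lambda>s M. S s ** adj (S (cyc_next s)) ** M) (sorted_list_of_set UNIV) (mat 1) = mat 1"
proof -
  let ?f = "\<lambda>s M. S s ** adj (S (cyc_next s)) ** M"
  have "foldr ?f xs (mat 1) = S a ** adj (S (Min UNIV))"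
    if "sorted_wrt (<) xs" "set xs = {a..}" for xs a
    using that
  proof (induction xs arbitrary: a)
    case Nil
    then show ?case by auto
  next
    case (Cons x ys)
    have x: "x = a"
    proof (rule antisym)
      have "a \<in> set (x # ys)" using Cons.prems(2) by simp
      then show "x \<le> a" using Cons.prems(1) by (auto simp: less_imp_le)
      have "x \<in> {a..}" using Cons.prems(2) by auto
      then show "a \<le> x" by simp
    qed
    have ys: "set ys = {a<..}"
      using Cons.prems by (auto simp: x set_eq_iff)
    show ?case
    proof (cases "a = Max UNIV")
      case True
      then have "ys = []" using ys by (metis Max_ge UNIV_I finite greaterThan_iff leD list.set_sel(1))
      then show ?thesis using True by (simp add: x)
    next
      case False
      have b: "cyc_next a = Min {t. a < t}" using False by (simp add: cyc_next_def)
      have "set ys = {cyc_next a..}"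
        unfolding ys b
      proof (intro set_eqI iffI)
        fix t assume "t \<in> {Min {t. a < t}..}"
        moreover have "a < Min {t. a < t}" using cyc_next_greater[OF False] b by simp
        ultimately show "t \<in> {a<..}" by auto
      qed auto
      then have "foldr ?f ys (mat 1) = S (cyc_next a) ** adj (S (Min UNIV))"
        using Cons.IH Cons.prems(1) by simp
      then show ?thesis using assms by (simp add: x matrix_mul_assoc[symmetric])
    qed
  qed
  moreover have "set (sorted_list_of_set (UNIV :: 'l set)) = {Min UNIV..}" by auto
  ultimately show ?thesis using assms by simp
qed

subsection \<open>Lagrangian representations and frames\<close>

definition cjv :: "complex^'n \<Rightarrow> complex^'n" where
  "cjv v = (\<chi> i. cnj (v $ i))"

lemma cjv_mult: "cjv (A *v v) = cj A *v cjv v"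
  by (simp add: cjv_def vec_eq_iff matrix_vector_mult_def)

lemma cjv_cjv [simp]: "cjv (cjv v) = v"
  by (simp add: cjv_def vec_eq_iff)

text \<open>The quotient of \<open>g'\<close> by \<open>g\<close> maps R^n to R^n, so it is real and
  orthogonal and cancels in g' g'^T. Hence g g^T depends on the Lagrangian alone, and the choice
  made in \<open>lagrangian_inv\<close> does not affect the involution.\<close>

lemma real_form_eq_imp:
  fixes g g' :: "complex^'n^'n"
  assumes "unitary g" "unitary g'" "real_form g = real_form g'"
  shows "g' ** transpose g' = g ** transpose g"
proof -
  define h where "h = adj g ** g'"
  have g': "g' = g ** h" using assms by (simp add: h_def)
  have "\<exists>y::real^'n. h *v axis j 1 = (\<chi> i. complex_of_real (y $ i))" for j
  proof -
    have "g' *v (\<chi> i. complex_of_real (axis j 1 $ i)) \<in> real_form g"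
      unfolding assms(3) by (auto simp: real_form_def)
    then obtain y where "g' *v (\<chi> i. complex_of_real (axis j 1 $ i)) = g *v (\<chi> i. complex_of_real (y $ i))"
      by (auto simp: real_form_def)
    moreover have "(\<chi> i. complex_of_real (axis j 1 $ i)) = axis j 1"
      by (simp add: vec_eq_iff axis_def)
    ultimately have "h *v axis j 1 = adj g *v (g *v (\<chi> i. complex_of_real (y $ i)))"
      by (simp add: h_def matrix_vector_mul_assoc[symmetric])
    then show ?thesis using assms(1) by (auto simp: matrix_vector_mul_assoc)
  qed
  then have "h $ i $ j \<in> \<real>" for i j :: 'n
  proof -
    obtain y :: "real^'n" where "h *v axis j 1 = (\<chi> i. complex_of_real (y $ i))"
      using \<open>\<And>j. \<exists>y::real^'n. h *v axis j 1 = (\<chi> i. complex_of_real (y $ i))\<close> by blast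
    moreover have "h $ i $ j = (h *v axis j 1) $ i"
      by (simp add: matrix_vector_mult_def axis_def if_distrib[of "\<lambda>x. _ * x"] cong: if_cong)
    ultimately show ?thesis by simp
  qed
  then have "cj h = h" by (simp add: vec_eq_iff Reals_cnj_iff)
  then have "transpose h = adj h" by (metis adj_cj)
  then have "h ** transpose h = mat 1"
    using assms by (simp add: h_def unitary_mult unitary_adj)
  then show ?thesis unfolding g' transpose_mult
    by (metis matrix_mul_assoc matrix_mul_rid)
qed

lemma lagrangian_inv_real_form:
  assumes "unitary g"
  shows "lagrangian_inv (real_form g) v = (g ** transpose g) *v cjv v"
proof -
  define g' where "g' = (SOME g'. unitary g' \<and> real_form g = real_form g')"
  have g': "unitary g' \<and> real_form g = real_form g'"
    unfolding g'_def by (rule someI[of _ g]) (use assms in simp)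
  have "lagrangian_inv (real_form g) v = g' *v cjv (adj g' *v v)"
    by (simp add: lagrangian_inv_def g'_def Let_def cjv_def)
  also have "\<dots> = (g' ** transpose g') *v cjv v"
    by (simp add: cjv_mult matrix_vector_mul_assoc del: transpose_matrix_vector)
  finally show ?thesis using real_form_eq_imp[OF assms] g' by simp
qed

lemma lagrangian_inv_comp:
  assumes "unitary g" "unitary h"
  shows "lagrangian_inv (real_form g) \<circ> lagrangian_inv (real_form h) =
    (\<lambda>v. (g ** transpose g ** adj (h ** transpose h)) *v v)"
  using assms
  by (simp add: fun_eq_iff lagrangian_inv_real_form cjv_mult matrix_vector_mul_assoc cj_mult adj_mult)

lemma is_rep_telescoping:
  assumes "\<And>s. unitary (S s)" "\<And>s. \<rho> $ s = S s ** adj (S (cyc_next s))"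
  shows "is_rep \<rho>"
  using telescoping_product[of S] assms
  by (simp add: is_rep_def unitary_mult unitary_adj)

text \<open>The product of two involutions v -> S cnj(v) and v -> T cnj(v) is the linear map S
  T^(-1), since a symmetric unitary \<open>T\<close> satisfies cj T = T^(-1). The relation of the
  group comes for free by telescoping.\<close>

lemma lagrangian_rep_iff:
  "lagrangian_rep \<rho> \<longleftrightarrow> (\<exists>g. (\<forall>s. unitary (g s)) \<and>
     (\<forall>s. \<rho> $ s = g s ** transpose (g s) ** adj (g (cyc_next s) ** transpose (g (cyc_next s)))))"
  (is "_ \<longleftrightarrow> ?R")
proof
  assume "lagrangian_rep \<rho>"
  then obtain L where L: "\<And>s. lagrangian_subspace (L s)"
    "\<And>s. (\<lambda>v. \<rho> $ s *v v) = lagrangian_inv (L s) \<circ> lagrangian_inv (L (cyc_next s))"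
    unfolding lagrangian_rep_def by blast
  obtain g where g: "\<And>s. unitary (g s)" "\<And>s. L s = real_form (g s)"
    using L(1) unfolding lagrangian_subspace_def by metis
  have "\<rho> $ s = g s ** transpose (g s) ** adj (g (cyc_next s) ** transpose (g (cyc_next s)))" for s
    using L(2)[of s] by (simp add: g lagrangian_inv_comp matrix_eq fun_eq_iff)
  then show ?R using g(1) by blast
next
  assume ?R
  then obtain g where g: "\<And>s. unitary (g s)"
    "\<And>s. \<rho> $ s = g s ** transpose (g s) ** adj (g (cyc_next s) ** transpose (g (cyc_next s)))"
    by blast
  have "is_rep \<rho>"
    by (rule is_rep_telescoping[of "\<lambda>s. g s ** transpose (g s)"]) (use g in \<open>auto intro: unitary_mult unitary_transpose\<close>)
  moreover have "lagrangian_subspace (real_form (g s))" for s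
    using g(1) unfolding lagrangian_subspace_def by blast
  ultimately show "lagrangian_rep \<rho>"
    unfolding lagrangian_rep_def
    by (intro conjI exI[of _ "\<lambda>s. real_form (g s)"]) (auto simp: g lagrangian_inv_comp)
qed

text \<open>The columns of \<open>p $ s\<close> are an orthonormal basis of $L_s$ consisting of eigenvectors of
  $\rho(\gamma_s)$; scaling them by $e^{-\pi i\alpha^s_j}$ gives an orthonormal basis of $L_{s+1}$,
  which is the last condition.\<close>

definition frame :: "('n::finite, 'l::{finite,linorder}) mats \<Rightarrow> ('n, 'l) mats \<Rightarrow> ('n, 'l) spectra \<Rightarrow> bool" where
  "frame \<rho> p a \<longleftrightarrow> (\<forall>s. unitary (p $ s) \<and> \<rho> $ s = p $ s ** dg (a $ s) ** adj (p $ s) \<and>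
     p $ s ** dg (- (a $ s)) ** transpose (p $ s) = p $ cyc_next s ** transpose (p $ cyc_next s))"

lemma frame_imp_lagrangian_rep:
  assumes "frame \<rho> p a"
  shows "lagrangian_rep \<rho>"
  unfolding lagrangian_rep_iff
proof (intro exI[of _ "\<lambda>s. p $ s"] conjI allI)
  fix s
  note f = assms[unfolded frame_def, rule_format, of s]
  show "unitary (p $ s)" using f by simp
  have E: "p $ cyc_next s ** transpose (p $ cyc_next s) = p $ s ** dg (- (a $ s)) ** transpose (p $ s)"
    using f by simp
  have "p $ s ** transpose (p $ s) ** adj (p $ cyc_next s ** transpose (p $ cyc_next s)) =
     p $ s ** transpose (p $ s) ** adj (p $ s ** dg (- (a $ s)) ** transpose (p $ s))"
    by (simp only: E)
  moreover have u: "unitary (p $ s)" using f by simp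
  have "p $ s ** transpose (p $ s) ** adj (p $ s ** dg (- (a $ s)) ** transpose (p $ s)) =
      p $ s ** dg (a $ s) ** adj (p $ s)"
    using u by (simp add: adj_mult matrix_mul_assoc[symmetric])
  ultimately show "\<rho> $ s = p $ s ** transpose (p $ s) ** adj (p $ cyc_next s ** transpose (p $ cyc_next s))"
    using f by simp
qed

lemma frame_spec_proj:
  assumes "frame \<rho> p a" "\<And>s i j. i \<le> j \<Longrightarrow> a $ s $ i \<le> a $ s $ j" "\<And>s j. 0 \<le> a $ s $ j \<and> a $ s $ j < 1"
  shows "spec_proj \<rho> = a"
proof -
  have "is_spec (\<rho> $ s) (a $ s)" for s
    using assms is_spec_diagonal_form by (metis frame_def)
  then show ?thesis by (simp add: spec_proj_def vec_eq_iff[of _ a] spec_eqI)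
qed

text \<open>In a basis \<open>g s\<close> of the s-th Lagrangian, \<open>\<rho> $ s\<close> becomes
  a symmetric unitary matrix, which a real orthogonal \<open>k s\<close> diagonalizes. Since
  \<open>k s\<close> is real, \<open>g s ** k s\<close> is still a basis of the same
  Lagrangian.\<close>

lemma lagrangian_rep_imp_frame:
  fixes \<rho> :: "('n::{finite,linorder}, 'l::{finite,linorder}) mats"
  assumes "lagrangian_rep \<rho>"
  obtains p where "frame \<rho> p (spec_proj \<rho>)"
    "\<And>s i j. i \<le> j \<Longrightarrow> spec_proj \<rho> $ s $ i \<le> spec_proj \<rho> $ s $ j"
    "\<And>s j. 0 \<le> spec_proj \<rho> $ s $ j \<and> spec_proj \<rho> $ s $ j < 1"
proof -
  obtain g where g: "\<And>s. unitary (g s)"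
    "\<And>s. \<rho> $ s = g s ** transpose (g s) ** adj (g (cyc_next s) ** transpose (g (cyc_next s)))"
    using assms unfolding lagrangian_rep_iff by blast
  define A where "A s = adj (g s) ** \<rho> $ s ** g s" for s
  have A: "unitary (A s)" "transpose (A s) = A s" for s
  proof -
    have "unitary (\<rho> $ s)" using g by (simp only:) (intro unitary_mult unitary_adj unitary_transpose g)
    then show "unitary (A s)" using g(1) by (simp add: A_def unitary_mult unitary_adj)
    show "transpose (A s) = A s"
      using g(1) by (simp add: A_def g(2) adj_mult transpose_mult matrix_mul_assoc[symmetric])
  qed
  have "\<exists>k \<alpha>. unitary k \<and> cj k = k \<and> A s = k ** dg \<alpha> ** adj k \<and>
      (\<forall>i j. i \<le> j \<longrightarrow> \<alpha> $ i \<le> \<alpha> $ j) \<and> (\<forall>j. 0 \<le> \<alpha> $ j \<and> \<alpha> $ j < 1)" for s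
    by (rule symmetric_unitary_diagonalizable[OF A, of s]) blast
  then obtain k \<alpha> where k: "\<And>s. unitary (k s)" "\<And>s. cj (k s) = k s" "\<And>s. A s = k s ** dg (\<alpha> s) ** adj (k s)"
    "\<And>s i j. i \<le> j \<Longrightarrow> \<alpha> s $ i \<le> \<alpha> s $ j" "\<And>s j. 0 \<le> \<alpha> s $ j \<and> \<alpha> s $ j < 1"
    by metis
  define p :: "('n, 'l) mats" where "p = (\<chi> s. g s ** k s)"
  define a :: "('n, 'l) spectra" where "a = (\<chi> s. \<alpha> s)"
  have kt: "transpose (k s) = adj (k s)" for s using k(2) by (metis adj_cj)
  have pp: "p $ s ** transpose (p $ s) = g s ** transpose (g s)" for s
    using k by (simp add: p_def transpose_mult kt matrix_mul_assoc[symmetric])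
  have rho: "\<rho> $ s = p $ s ** dg (a $ s) ** adj (p $ s)" for s
  proof -
    have "\<rho> $ s = g s ** A s ** adj (g s)" using g(1) by (simp add: A_def matrix_mul_assoc[symmetric])
    then show ?thesis by (simp add: k(3) p_def a_def adj_mult matrix_mul_assoc)
  qed
  have u: "unitary (p $ s)" for s using g k by (simp add: p_def unitary_mult)
  have "p $ s ** dg (- (a $ s)) ** transpose (p $ s) = p $ cyc_next s ** transpose (p $ cyc_next s)" for s
  proof -
    have "adj (\<rho> $ s) ** (p $ s ** transpose (p $ s)) = p $ cyc_next s ** transpose (p $ cyc_next s)"
      unfolding pp using g by (simp add: adj_mult matrix_mul_assoc[symmetric])
    then show ?thesis unfolding rho using u by (simp add: adj_mult matrix_mul_assoc[symmetric])
  qed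
  then have f: "frame \<rho> p a" using rho u by (simp add: frame_def)
  moreover have "spec_proj \<rho> = a"
    using frame_spec_proj[OF f] k by (simp add: a_def)
  ultimately show ?thesis using k(4,5) by (intro that) (auto simp: a_def)
qed

lemma frame_rho: "frame \<rho> p a \<Longrightarrow> \<rho> = (\<chi> s. p $ s ** dg (a $ s) ** adj (p $ s))"
  by (simp add: frame_def vec_eq_iff)

subsection \<open>Conjugation\<close>

definition conj_by :: "('n::finite) cmat \<Rightarrow> ('n, 'l::finite) mats \<Rightarrow> ('n, 'l) mats" where
  "conj_by g \<rho> = (\<chi> s. g ** \<rho> $ s ** adj g)"

lemma conj_by_nth [simp]: "conj_by g \<rho> $ s = g ** \<rho> $ s ** adj g"
  by (simp add: conj_by_def)

lemma conj_by_conj_by: "conj_by g (conj_by h \<rho>) = conj_by (g ** h) \<rho>"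
  by (simp add: vec_eq_iff[of "conj_by _ _"] adj_mult matrix_mul_assoc)

lemma conj_by_1 [simp]: "conj_by (mat 1) \<rho> = \<rho>"
  by (simp add: vec_eq_iff[of "conj_by _ _"])

lemma conj_by_adj: "unitary g \<Longrightarrow> conj_by (adj g) (conj_by g \<rho>) = \<rho>"
  "unitary g \<Longrightarrow> conj_by g (conj_by (adj g) \<rho>) = \<rho>"
  by (simp_all add: conj_by_conj_by)

lemma conj_class_def': "conj_class \<rho> = {conj_by g \<rho> | g. unitary g}"
  by (simp add: conj_class_def conj_by_def)

lemma in_conj_class: "\<rho> \<in> conj_class \<rho>"
  unfolding conj_class_def' by (auto intro!: exI[of _ "mat 1"] unitary_1)

lemma conj_class_conj_by: "unitary g \<Longrightarrow> conj_class (conj_by g \<rho>) = conj_class \<rho>"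
proof -
  assume g: "unitary g"
  have "conj_by h \<rho> = conj_by (h ** adj g) (conj_by g \<rho>)" for h
    using g by (simp add: conj_by_conj_by matrix_mul_assoc[symmetric])
  then show ?thesis
    unfolding conj_class_def' using g
    by (auto simp: conj_by_conj_by intro: unitary_mult unitary_adj)
qed

lemma conj_class_eq_iff: "conj_class \<rho> = conj_class \<rho>' \<longleftrightarrow> (\<exists>g. unitary g \<and> \<rho>' = conj_by g \<rho>)"
proof
  assume "conj_class \<rho> = conj_class \<rho>'"
  then have "\<rho>' \<in> conj_class \<rho>" using in_conj_class by metis
  then show "\<exists>g. unitary g \<and> \<rho>' = conj_by g \<rho>" by (auto simp: conj_class_def')
qed (auto simp: conj_class_conj_by)

lemma frame_conj_by:
  assumes "frame \<rho> p a" "unitary g"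
  shows "frame (conj_by g \<rho>) (\<chi> s. g ** p $ s) a"
  unfolding frame_def
proof (intro allI conjI)
  fix s
  note f = assms(1)[unfolded frame_def, rule_format, of s]
  show "unitary ((\<chi> s. g ** p $ s) $ s)" using f assms(2) by (simp add: unitary_mult)
  show "conj_by g \<rho> $ s = (\<chi> s. g ** p $ s) $ s ** dg (a $ s) ** adj ((\<chi> s. g ** p $ s) $ s)"
    using f by (simp add: adj_mult matrix_mul_assoc)
  have "g ** (p $ s ** dg (- (a $ s)) ** transpose (p $ s)) ** transpose g =
      g ** (p $ cyc_next s ** transpose (p $ cyc_next s)) ** transpose g"
    using f by simp
  then show "(\<chi> s. g ** p $ s) $ s ** dg (- (a $ s)) ** transpose ((\<chi> s. g ** p $ s) $ s) =
      (\<chi> s. g ** p $ s) $ cyc_next s ** transpose ((\<chi> s. g ** p $ s) $ cyc_next s)"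
    by (simp add: transpose_mult matrix_mul_assoc)
qed

lemma spec_proj_conj_by: "unitary g \<Longrightarrow> spec_proj (conj_by g \<rho>) = spec_proj \<rho>"
  by (simp add: spec_proj_def spec_def is_spec_conj vec_eq_iff)

lemma spec_proj_class_conj_class: "spec_proj_class (conj_class \<rho>) = spec_proj \<rho>"
proof -
  have "spec_proj ` conj_class \<rho> = {spec_proj \<rho>}"
  proof (intro equalityI subsetI)
    show "a \<in> {spec_proj \<rho>}" if "a \<in> spec_proj ` conj_class \<rho>" for a
      using that by (auto simp: conj_class_def' spec_proj_conj_by)
    show "a \<in> spec_proj ` conj_class \<rho>" if "a \<in> {spec_proj \<rho>}" for a
      using that in_conj_class[of \<rho>] by blast
  qed
  then show ?thesis by (simp add: spec_proj_class_def)
qed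

lemma lagrangian_rep_conj_by:
  fixes \<rho> :: "('n::{finite,linorder}, 'l::{finite,linorder}) mats"
  assumes "lagrangian_rep \<rho>" "unitary g"
  shows "lagrangian_rep (conj_by g \<rho>)"
proof -
  obtain p where "frame \<rho> p (spec_proj \<rho>)"
    by (rule lagrangian_rep_imp_frame[OF assms(1)])
  from frame_imp_lagrangian_rep[OF frame_conj_by[OF this assms(2)]] show ?thesis .
qed

section \<open>Irreducibility through the Hermitian commutant, its stability, and the ambiguity of
  frames\<close>

subsection \<open>Irreducibility and the commutant\<close>

text \<open>The nearest-point projection for the real inner product is complex linear, because
  \<open>W\<close> and its orthogonal complement are stable under complex scalars and the projection
  is unique.\<close>

lemma hermitian_projection:
  fixes W :: "(complex^'n) set"
  assumes W: "vec.subspace W"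
  obtains Q where "adj Q = Q" "\<And>v. Q *v v \<in> W" "\<And>v w. w \<in> W \<Longrightarrow> inner (v - Q *v v) w = 0"
proof -
  have add: "x + y \<in> W" and scale: "c *s x \<in> W" and zero: "0 \<in> W" if "x \<in> W" "y \<in> W" for x y c
    using W that by (auto simp: vec.subspace_def)
  have zero: "0 \<in> W" using W by (auto simp: vec.subspace_def)
  have sub: "subspace W"
    unfolding subspace_def
  proof (intro conjI ballI allI zero add)
    fix c :: real and x assume "x \<in> W"
    then have "of_real c *s x \<in> W" by (intro scale)
    moreover have "c *\<^sub>R x = of_real c *s x" by (simp add: vec_eq_iff scaleR_conv_of_real[where 'a = complex])
    ultimately show "c *\<^sub>R x \<in> W" by simp
  qed
  have "\<exists>y\<in>W. \<forall>w\<in>W. inner (v - y) w = 0" for v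
  proof -
    obtain y z where "y \<in> span W" "\<And>w. w \<in> span W \<Longrightarrow> orthogonal z w" "v = y + z"
      by (rule orthogonal_subspace_decomp_exists[of W v]) (rule that)
    then show ?thesis using sub by (intro bexI[of _ y]) (auto simp: span_eq_iff[THEN iffD2] orthogonal_def)
  qed
  then obtain f where f: "\<And>v. f v \<in> W" "\<And>v w. w \<in> W \<Longrightarrow> inner (v - f v) w = 0" by metis
  have uniq: "f v = y" if "y \<in> W" "\<And>w. w \<in> W \<Longrightarrow> inner (v - y) w = 0" for v y
  proof -
    have "f v - y \<in> W" using sub f(1) that(1) by (simp add: subspace_diff)
    then have "inner (v - y) (f v - y) - inner (v - f v) (f v - y) = 0" using f(2) that(2) by simp
    then have "inner (f v - y) (f v - y) = 0" by (simp flip: inner_diff_left)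
    then show ?thesis by simp
  qed
  have lin: "Vector_Spaces.linear (*s) (*s) f"
  proof (unfold_locales)
    show "f (x + y) = f x + f y" for x y
    proof (rule uniq)
      show "inner (x + y - (f x + f y)) w = 0" if "w \<in> W" for w
        using f(2)[OF that, of x] f(2)[OF that, of y] by (simp add: inner_diff_left inner_add_left)
    qed (intro add f(1))
    show "f (c *s x) = c *s f x" for c x
    proof (rule uniq)
      fix w assume w: "w \<in> W"
      have "inner (c *s x - c *s f x) w = inner (mat c *v (x - f x)) w"
        by (simp add: mat_vec_mult vec.scale_right_diff_distrib)
      also have "\<dots> = inner (x - f x) (cnj c *s w)"
        unfolding inner_mult_vec adj_mat by (simp only: mat_vec_mult)
      also have "\<dots> = 0" using f(2) scale[OF w w] by blast
      finally show "inner (c *s x - c *s f x) w = 0" .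
    qed (intro scale[of _ 0] f(1) zero)
  qed
  define Q where "Q = matrix f"
  have Q: "Q *v v = f v" for v unfolding Q_def using lin by (rule matrix_works)
  have herm: "adj Q *v y = Q *v y" for y
  proof -
    have "inner x (adj Q *v y) = inner x (Q *v y)" for x
    proof -
      have "inner (f x) (y - f y) = 0" "inner (x - f x) (f y) = 0"
        using f(2)[OF f(1), of y x] f(2)[OF f(1), of x y] by (simp_all add: inner_commute)
      then show ?thesis by (simp add: inner_mult_vec[symmetric] Q inner_diff_left inner_diff_right)
    qed
    then show ?thesis using vector_eq_ldot by blast
  qed
  have "adj Q = Q" unfolding matrix_eq using herm by blast
  then show ?thesis using f by (intro that[of Q]) (auto simp: Q)
qed

text \<open>Unitary matrices preserving a subspace also preserve its orthogonal complement, so the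
  projection onto an invariant subspace commutes with them. Irreducibility thereby becomes the
  absence of non-scalar Hermitian solutions of linear equations, which is suited to compactness
  arguments.\<close>

lemma irreducible_rep_iff:
  "irreducible_rep \<rho> \<longleftrightarrow> is_rep \<rho> \<and>
    (\<forall>Q. adj Q = Q \<and> (\<forall>s. Q ** \<rho> $ s = \<rho> $ s ** Q) \<longrightarrow> (\<exists>r::real. Q = mat (of_real r)))"
proof (intro iffI conjI)
  assume "irreducible_rep \<rho>"
  then show "\<forall>Q. adj Q = Q \<and> (\<forall>s. Q ** \<rho> $ s = \<rho> $ s ** Q) \<longrightarrow> (\<exists>r::real. Q = mat (of_real r))"
    using commuting_hermitian_scalar by metis
next
  assume R: "is_rep \<rho> \<and>
    (\<forall>Q. adj Q = Q \<and> (\<forall>s. Q ** \<rho> $ s = \<rho> $ s ** Q) \<longrightarrow> (\<exists>r::real. Q = mat (of_real r)))"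
  show "irreducible_rep \<rho>"
    unfolding irreducible_rep_def
  proof (intro conjI allI impI)
    show "is_rep \<rho>" using R by blast
    fix W assume W: "vec.subspace W \<and> (\<forall>s. \<forall>w\<in>W. \<rho> $ s *v w \<in> W)"
    then obtain Q where Q: "adj Q = Q" "\<And>v. Q *v v \<in> W" "\<And>v w. w \<in> W \<Longrightarrow> inner (v - Q *v v) w = 0"
      using hermitian_projection[of W] by blast
    have u: "unitary (\<rho> $ s)" for s using R by (simp add: is_rep_def)
    have diff: "x - y \<in> W" if "x \<in> W" "y \<in> W" for x y using W vec.subspace_diff that by blast
    have Qw: "Q *v w = w" if "w \<in> W" for w
      using Q(3)[OF diff[OF that Q(2)], of w w] by simp
    \<comment> \<open>An injective linear map of the finite-dimensional \<open>W\<close> into itself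
      is onto.\<close>
    have surj: "\<exists>w'\<in>W. w = \<rho> $ s *v w'" if "w \<in> W" for s w
    proof -
      have inj: "inj_on ((*v) (\<rho> $ s)) (vec.span W)"
      proof (rule inj_onI)
        fix x y assume "\<rho> $ s *v x = \<rho> $ s *v y"
        then have "adj (\<rho> $ s) *v (\<rho> $ s *v x) = adj (\<rho> $ s) *v (\<rho> $ s *v y)" by simp
        then show "x = y" using u by (simp add: matrix_vector_mul_assoc)
      qed
      have "vec.dim ((*v) (\<rho> $ s) ` W) = vec.dim W"
        by (rule vec.dim_image_eq[OF matrix_vector_mul_linear_gen inj])
      moreover have "(*v) (\<rho> $ s) ` W \<subseteq> W" using W by blast
      moreover have "vec.subspace ((*v) (\<rho> $ s) ` W)"
        using W vec.linear_subspace_image[OF matrix_vector_mul_linear_gen] by blast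
      ultimately have "(*v) (\<rho> $ s) ` W = W"
        using W by (intro vec.subspace_dim_equal) auto
      then show ?thesis using that by blast
    qed
    have "Q ** \<rho> $ s = \<rho> $ s ** Q" for s
    proof -
      have "Q *v (\<rho> $ s *v v) = \<rho> $ s *v (Q *v v)" for v
      proof -
        \<comment> \<open>\<open>?y\<close> lies in \<open>W\<close> and is a difference of two
          vectors orthogonal to it, hence zero.\<close>
        let ?y = "Q *v (\<rho> $ s *v v) - \<rho> $ s *v (Q *v v)"
        have yW: "?y \<in> W" using Q(2) W by (intro diff) auto
        have 1: "inner (\<rho> $ s *v v - Q *v (\<rho> $ s *v v)) ?y = 0" by (rule Q(3)[OF yW])
        obtain w where w: "w \<in> W" "?y = \<rho> $ s *v w" using surj[OF yW] by blast
        have "inner (\<rho> $ s *v (v - Q *v v)) ?y = inner (v - Q *v v) w"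
          unfolding w(2) inner_mult_vec using u by (simp add: matrix_vector_mul_assoc)
        then have 2: "inner (\<rho> $ s *v v - \<rho> $ s *v (Q *v v)) ?y = 0"
          using Q(3)[OF w(1)] by (simp add: matrix_vector_mult_diff_distrib)
        have "inner ?y ?y = inner (\<rho> $ s *v v - \<rho> $ s *v (Q *v v)) ?y - inner (\<rho> $ s *v v - Q *v (\<rho> $ s *v v)) ?y"
          unfolding inner_diff_left[symmetric] by simp
        then have "inner ?y ?y = 0" using 1 2 by simp
        then show ?thesis by simp
      qed
      then show ?thesis by (simp add: matrix_eq matrix_vector_mul_assoc)
    qed
    then obtain r :: real where r: "Q = mat (of_real r)" using R Q(1) by blast
    show "W = {0} \<or> W = UNIV"
    proof (cases "W \<subseteq> {0}")
      case True
      then show ?thesis using W by (auto simp: vec.subspace_def)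
    next
      case False
      then obtain w where w: "w \<in> W" "w \<noteq> 0" by auto
      then have "of_real r *s w = 1 *s w" using Qw[OF w(1)] by (simp add: r mat_vec_mult)
      then have "of_real r = (1::complex)" using w(2) vec.scale_cancel_right by blast
      then have "Q *v v = v" for v by (simp add: r)
      then show ?thesis using Q(2) by (metis UNIV_eq_I)
    qed
  qed
qed (auto simp: irreducible_rep_def)

lemma is_rep_conj_by:
  assumes "is_rep \<rho>" "unitary g"
  shows "is_rep (conj_by g \<rho>)"
proof -
  have "foldr (\<lambda>s M. conj_by g \<rho> $ s ** M) xs (mat 1) = g ** foldr (\<lambda>s M. \<rho> $ s ** M) xs (mat 1) ** adj g" for xs
    using assms(2) by (induction xs) (simp_all add: matrix_mul_assoc[symmetric])
  then show ?thesis using assms by (simp add: is_rep_def unitary_mult unitary_adj)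
qed

lemma irreducible_rep_conj_by:
  assumes "irreducible_rep \<rho>" "unitary g"
  shows "irreducible_rep (conj_by g \<rho>)"
  unfolding irreducible_rep_iff
proof (intro conjI allI impI)
  show "is_rep (conj_by g \<rho>)" using assms is_rep_conj_by by (auto simp: irreducible_rep_def)
  fix Q assume Q: "adj Q = Q \<and> (\<forall>s. Q ** conj_by g \<rho> $ s = conj_by g \<rho> $ s ** Q)"
  let ?Q = "adj g ** Q ** g"
  have "?Q ** \<rho> $ s = \<rho> $ s ** ?Q" for s
  proof -
    have "adj g ** (Q ** (g ** \<rho> $ s ** adj g)) ** g = adj g ** ((g ** \<rho> $ s ** adj g) ** Q) ** g"
      using Q by simp
    then show ?thesis using assms(2) by (simp add: matrix_mul_assoc[symmetric])
  qed
  moreover have "adj ?Q = ?Q" using Q by (simp add: adj_mult matrix_mul_assoc)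
  ultimately obtain r :: real where r: "?Q = mat (of_real r)"
    using assms(1) commuting_hermitian_scalar by blast
  have "Q = g ** ?Q ** adj g" using assms(2) by (simp add: matrix_mul_assoc[symmetric])
  also have "\<dots> = mat (of_real r)"
    unfolding r mat_mult_commute[of _ g, symmetric] using assms(2) by (simp add: matrix_mul_assoc[symmetric])
  finally show "\<exists>r::real. Q = mat (of_real r)" by blast
qed

subsection \<open>Consequences of compactness\<close>

text \<open>Projection along a compact factor maps closed sets to closed sets; applied to the part
  of \<open>C\<close> over \<open>K - V\<close>, it yields a whole ball around \<open>x0\<close>
  that this part misses.\<close>

lemma compact_fibre_neighbourhood:
  fixes K :: "'k::euclidean_space set" and x0 :: "'x::euclidean_space"
  assumes "compact K" "closed C" "open V" "\<And>k. k \<in> K \<Longrightarrow> (k, x0) \<in> C \<Longrightarrow> k \<in> V"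
  obtains e where "e > 0" "\<And>x k. dist x x0 < e \<Longrightarrow> k \<in> K \<Longrightarrow> (k, x) \<in> C \<Longrightarrow> k \<in> V"
proof -
  have "compact (K - V)" using assms(1,3) by (simp add: compact_diff)
  then have "closed {x. \<exists>k. k \<in> K - V \<and> (k, x) \<in> C}"
    using closed_compact_projection[of "K - V" C] assms(2) by simp
  then have "open (- {x. \<exists>k. k \<in> K - V \<and> (k, x) \<in> C})" by (simp add: open_Compl)
  moreover have "x0 \<in> - {x. \<exists>k. k \<in> K - V \<and> (k, x) \<in> C}" using assms(4) by blast
  ultimately obtain e where "e > 0" "\<And>x. dist x x0 < e \<Longrightarrow> x \<in> - {x. \<exists>k. k \<in> K - V \<and> (k, x) \<in> C}"
    unfolding open_dist by blast
  then show ?thesis by (intro that) auto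
qed

text \<open>No trace-free Hermitian matrix of norm one commutes with \<open>\<rho>\<close>. Such
  matrices form a compact set, so the same holds for all tuples near \<open>\<rho>\<close>.\<close>

lemma irreducible_rep_nearby:
  fixes \<rho> :: "('n::finite, 'l::{finite,linorder}) mats"
  assumes "irreducible_rep \<rho>"
  obtains e where "e > 0" "\<And>\<rho>'. dist \<rho>' \<rho> < e \<Longrightarrow> is_rep \<rho>' \<Longrightarrow> irreducible_rep \<rho>'"
proof -
  define K :: "'n cmat set" where "K = sphere 0 1 \<inter> {Q. adj Q = Q \<and> trace Q = 0}"
  define C :: "('n cmat \<times> ('n, 'l) mats) set" where "C = {(Q, \<rho>). \<forall>s. Q ** \<rho> $ s = \<rho> $ s ** Q}"
  have "closed {Q :: 'n cmat. adj Q = Q \<and> trace Q = 0}"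
    unfolding trace_def by (intro closed_Collect_conj closed_Collect_eq continuous_intros)
  then have "compact K" unfolding K_def by (intro compact_Int_closed compact_sphere)
  moreover have "closed C"
    unfolding C_def case_prod_unfold by (intro closed_Collect_all closed_Collect_eq continuous_intros)
  moreover have "Q \<in> {}" if Q: "Q \<in> K" "(Q, \<rho>) \<in> C" for Q
  proof -
    obtain r :: real where "Q = mat (of_real r)"
      using commuting_hermitian_scalar[OF assms, of Q] Q by (auto simp: K_def C_def)
    moreover have "trace Q = 0" "Q \<noteq> 0" using Q by (auto simp: K_def)
    ultimately show ?thesis by (simp add: trace_def mat_nth)
  qed
  ultimately obtain e where e: "e > 0"
    "\<And>\<rho>' Q. dist \<rho>' \<rho> < e \<Longrightarrow> Q \<in> K \<Longrightarrow> (Q, \<rho>') \<in> C \<Longrightarrow> Q \<in> {}"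
    using compact_fibre_neighbourhood[of K C "{}" \<rho>] by (metis open_empty)
  show ?thesis
  proof (rule that[OF e(1)])
    fix \<rho>' :: "('n, 'l) mats" assume \<rho>': "dist \<rho>' \<rho> < e" "is_rep \<rho>'"
    show "irreducible_rep \<rho>'"
      unfolding irreducible_rep_iff
    proof (intro conjI allI impI \<rho>'(2))
      fix Q assume Q: "adj Q = Q \<and> (\<forall>s. Q ** \<rho>' $ s = \<rho>' $ s ** Q)"
      \<comment> \<open>Subtracting the mean of the diagonal leaves a trace-free Hermitian matrix in
        the commutant, which can be normalized to lie in \<open>K\<close> unless it is zero.\<close>
      define r where "r = Re (trace Q) / CARD('n)"
      have tr: "trace Q = of_real (Re (trace Q))"
      proof -
        have "cnj (trace Q) = trace (adj Q)" by (simp add: trace_def)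
        then show ?thesis using Q by (metis Reals_cnj_iff of_real_Re)
      qed
      define Q0 where "Q0 = Q - mat (of_real r)"
      have Q0: "adj Q0 = Q0" "trace Q0 = 0" "Q0 ** \<rho>' $ s = \<rho>' $ s ** Q0" for s
      proof -
        show "adj Q0 = Q0" using Q by (simp add: Q0_def matrix_linear_simps)
        have "trace (mat (of_real r) :: 'n cmat) = of_real (Re (trace Q))"
          by (simp add: trace_def mat_nth r_def)
        then show "trace Q0 = 0" using tr by (simp add: Q0_def trace_sub)
        show "Q0 ** \<rho>' $ s = \<rho>' $ s ** Q0"
          using Q by (simp add: Q0_def matrix_mult_linear_simps mat_mult_commute)
      qed
      have "Q0 = 0"
      proof (rule ccontr)
        assume "Q0 \<noteq> 0"
        let ?Q = "Q0 /\<^sub>R norm Q0"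
        have "trace ?Q = (1 / norm Q0) *\<^sub>R trace Q0" by (simp add: trace_def scaleR_sum_right divide_inverse)
        then have "?Q \<in> K" using Q0 \<open>Q0 \<noteq> 0\<close> by (simp add: K_def matrix_linear_simps)
        moreover have "(?Q, \<rho>') \<in> C" using Q0(3) by (simp add: C_def matrix_mult_linear_simps)
        ultimately show False using e(2)[OF \<rho>'(1)] by blast
      qed
      then show "\<exists>r::real. Q = mat (of_real r)" by (auto simp: Q0_def)
    qed
  qed
qed

text \<open>By Schur's lemma the unitary matrices conjugating \<open>\<rho>\<close> to itself are
  scalars of modulus one; compactness of the unitary group spreads this, approximately, to pairs
  near \<open>(\<rho>, \<rho>)\<close>.\<close>

lemma conjugators_near_scalar:
  fixes \<rho> :: "('n::finite, 'l::{finite,linorder}) mats"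
  assumes "irreducible_rep \<rho>" "\<epsilon> > 0"
  obtains e where "e > 0" "\<And>\<sigma> \<sigma>' g. dist \<sigma> \<rho> < e \<Longrightarrow> dist \<sigma>' \<rho> < e \<Longrightarrow> unitary g \<Longrightarrow> \<sigma> = conj_by g \<sigma>' \<Longrightarrow>
    \<exists>c. cmod c = 1 \<and> dist g (mat c) < \<epsilon>"
proof -
  define C :: "('n cmat \<times> ('n, 'l) mats \<times> ('n, 'l) mats) set"
    where "C = {(g, x). \<forall>s. fst x $ s = g ** snd x $ s ** adj g}"
  define V :: "'n cmat set" where "V = (\<Union>c\<in>{c. cmod c = 1}. ball (mat c) \<epsilon>)"
  have "closed C"
    unfolding C_def case_prod_unfold by (intro closed_Collect_all closed_Collect_eq continuous_intros)
  moreover have "open V" unfolding V_def by blast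
  moreover have "g \<in> V" if "g \<in> {g. unitary g}" "(g, (\<rho>, \<rho>)) \<in> C" for g
  proof -
    have u: "unitary g" and c: "\<rho> $ s = g ** \<rho> $ s ** adj g" for s using that by (auto simp: C_def)
    have "g ** \<rho> $ s = \<rho> $ s ** g" for s
      by (subst (2) c) (simp add: u matrix_mul_assoc[symmetric])
    then obtain c where c: "g = mat c" using commuting_scalar[OF assms(1)] by blast
    then have "mat (cnj c * c) = (mat 1 :: 'n cmat)" using u by (metis adj_mat mat_mult_mat unitaryD(1))
    then have "cmod c = 1"
      by (metis complex_norm_square mat_eq_iff mult.commute norm_of_real abs_norm_cancel norm_one
          of_real_power power2_eq_1_iff norm_not_less_zero zero_less_one neg_less_0_iff_less of_real_eq_1_iff)
    then show ?thesis using c assms(2) by (auto simp: V_def intro!: exI[of _ c])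
  qed
  ultimately obtain e where e: "e > 0"
    "\<And>x g. dist x (\<rho>, \<rho>) < e \<Longrightarrow> g \<in> {g. unitary g} \<Longrightarrow> (g, x) \<in> C \<Longrightarrow> g \<in> V"
    using compact_fibre_neighbourhood[OF compact_unitary, of C V "(\<rho>, \<rho>)"] by metis
  show ?thesis
  proof (rule that[of "e / 2"])
    fix \<sigma> \<sigma>' g assume *: "dist \<sigma> \<rho> < e / 2" "dist \<sigma>' \<rho> < e / 2" "unitary g" "\<sigma> = conj_by g \<sigma>'"
    have "dist (\<sigma>, \<sigma>') (\<rho>, \<rho>) \<le> dist \<sigma> \<rho> + dist \<sigma>' \<rho>"
      by (simp add: dist_prod_def sqrt_sum_squares_le_sum)
    then have "dist (\<sigma>, \<sigma>') (\<rho>, \<rho>) < e" using * by linarith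
    moreover have "(g, (\<sigma>, \<sigma>')) \<in> C" using * by (simp add: C_def)
    ultimately have "g \<in> V" using e(2) *(3) by blast
    then show "\<exists>c. cmod c = 1 \<and> dist g (mat c) < \<epsilon>" by (auto simp: V_def dist_commute)
  qed (use e in simp)
qed

text \<open>A real orthogonal change of basis inside the eigenspaces changes neither the Lagrangians
  nor the eigenspaces.\<close>

lemma frame_gauge:
  assumes "frame \<rho> p a" "\<And>s. unitary (c s)" "\<And>s. cj (c s) = c s" "\<And>s. dg (a $ s) ** c s = c s ** dg (a $ s)"
  shows "frame \<rho> (\<chi> s. p $ s ** c s) a"
  unfolding frame_def
proof (intro allI conjI)
  fix s
  note f = assms(1)[unfolded frame_def, rule_format, of s]
  have ct: "transpose (c s) = adj (c s)" for s using assms(3) by (metis adj_cj)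
  have comm: "dg (- (a $ s)) ** c s = c s ** dg (- (a $ s))"
  proof -
    have "dg (- (a $ s)) ** (dg (a $ s) ** c s) ** dg (- (a $ s)) =
        dg (- (a $ s)) ** (c s ** dg (a $ s)) ** dg (- (a $ s))"
      by (simp add: assms(4))
    then show ?thesis by (simp add: matrix_mul_assoc[symmetric])
  qed
  have ac: "c s ** (adj (c s) ** X) = X" "dg (a $ s) ** (c s ** X) = c s ** (dg (a $ s) ** X)"
    "dg (- (a $ s)) ** (c s ** X) = c s ** (dg (- (a $ s)) ** X)" for X
    using assms(2,4) comm by (simp_all add: matrix_mul_assoc)
  show "unitary ((\<chi> s. p $ s ** c s) $ s)" using f assms(2) by (simp add: unitary_mult)
  show "\<rho> $ s = (\<chi> s. p $ s ** c s) $ s ** dg (a $ s) ** adj ((\<chi> s. p $ s ** c s) $ s)"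
    using f by (simp add: adj_mult matrix_mul_assoc[symmetric] ac(2)[symmetric])
      (simp add: ac assms(2))
  have "(\<chi> s. p $ s ** c s) $ s ** dg (- (a $ s)) ** transpose ((\<chi> s. p $ s ** c s) $ s) =
      p $ s ** dg (- (a $ s)) ** transpose (p $ s)"
    by (simp add: transpose_mult ct matrix_mul_assoc[symmetric]) (simp add: ac(3)[symmetric] assms(2))
  also have "\<dots> = p $ cyc_next s ** transpose (p $ cyc_next s)" using f by blast
  also have "\<dots> = (\<chi> s. p $ s ** c s) $ cyc_next s ** transpose ((\<chi> s. p $ s ** c s) $ cyc_next s)"
    by (simp add: transpose_mult ct matrix_mul_assoc[symmetric] assms(2))
  finally show "(\<chi> s. p $ s ** c s) $ s ** dg (- (a $ s)) ** transpose ((\<chi> s. p $ s ** c s) $ s) =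
      (\<chi> s. p $ s ** c s) $ cyc_next s ** transpose ((\<chi> s. p $ s ** c s) $ cyc_next s)" .
qed

lemma norm_vec_le_card:
  fixes x :: "'a::real_normed_vector^'n" and B :: real
  assumes "\<And>i. norm (x $ i) \<le> B"
  shows "norm x \<le> CARD('n) * B"
proof -
  have "norm x \<le> (\<Sum>i\<in>UNIV. norm (x $ i))" unfolding norm_vec_def by (rule L2_set_le_sum) simp
  also have "\<dots> \<le> CARD('n) * B" using sum_bounded_above[of UNIV "\<lambda>i. norm (x $ i)" B] assms by simp
  finally show ?thesis .
qed

lemma continuous_on_dg [continuous_intros]: "continuous_on S f \<Longrightarrow> continuous_on S (\<lambda>x. dg (f x))"
  unfolding dg_def expi_def
  by (intro continuous_on_vec_lambda) (case_tac "i = j"; simp; intro continuous_intros)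

text \<open>A common phase multiplies all Lagrangians, and it cancels in the product of two
  anti-linear involutions.\<close>

lemma frame_scalar:
  assumes "frame \<rho> p a" "cmod \<mu> = 1"
  shows "frame \<rho> (\<chi> s. mat \<mu> ** p $ s) a"
  unfolding frame_def
proof (intro allI conjI)
  fix s
  note f = assms(1)[unfolded frame_def, rule_format, of s]
  have u: "unitary (mat \<mu> :: 'a cmat)" using assms(2) by (rule unitary_mat)
  show "unitary ((\<chi> s. mat \<mu> ** p $ s) $ s)" using f u by (simp add: unitary_mult)
  have mm: "\<mu> * cnj \<mu> = 1" using assms(2) by (simp add: complex_norm_square[symmetric])
  have "(mat \<mu> ** p $ s) ** dg (a $ s) ** adj (mat \<mu> ** p $ s) = mat \<mu> ** (p $ s ** dg (a $ s) ** adj (p $ s)) ** mat (cnj \<mu>)"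
    by (simp add: adj_mult matrix_mul_assoc)
  also have "\<dots> = p $ s ** dg (a $ s) ** adj (p $ s)"
    unfolding mat_mult_commute[of \<mu>] by (simp add: matrix_mul_assoc[symmetric] mat_mult_mat mm)
  finally show "\<rho> $ s = (\<chi> s. mat \<mu> ** p $ s) $ s ** dg (a $ s) ** adj ((\<chi> s. mat \<mu> ** p $ s) $ s)"
    using f by simp
  have "mat \<mu> ** (p $ s ** dg (- (a $ s)) ** transpose (p $ s)) ** mat \<mu> =
      mat \<mu> ** (p $ cyc_next s ** transpose (p $ cyc_next s)) ** mat \<mu>"
    using f by simp
  then show "(\<chi> s. mat \<mu> ** p $ s) $ s ** dg (- (a $ s)) ** transpose ((\<chi> s. mat \<mu> ** p $ s) $ s) =
      (\<chi> s. mat \<mu> ** p $ s) $ cyc_next s ** transpose ((\<chi> s. mat \<mu> ** p $ s) $ cyc_next s)"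
    by (simp add: transpose_mult matrix_mul_assoc)
qed

text \<open>The group acting on frames from the right: for every \<open>s\<close>, the real
  orthogonal matrices preserving the eigenspaces of \<open>dg (a $ s)\<close>.\<close>

definition in_gauge :: "('n::finite, 'l::finite) spectra \<Rightarrow> ('l \<Rightarrow> 'n cmat) \<Rightarrow> bool" where
  "in_gauge a c \<longleftrightarrow> (\<forall>s. unitary (c s) \<and> cj (c s) = c s \<and> dg (a $ s) ** c s = c s ** dg (a $ s))"

text \<open>Irreducibility makes the Lagrangians of a representation unique up to a common phase.\<close>

lemma frame_unique:
  fixes \<rho> :: "('n::{finite,linorder}, 'l::{finite,linorder}) mats"
  assumes irr: "irreducible_rep \<rho>" and p: "frame \<rho> p a" and q: "frame \<rho> q a"
  obtains \<mu> c where "cmod \<mu> = 1" "in_gauge a c" "q = (\<chi> s. mat \<mu> ** p $ s ** c s)"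
proof -
  have up: "unitary (p $ s)" and uq: "unitary (q $ s)" for s using p q by (auto simp: frame_def)
  define S where "S s = p $ s ** transpose (p $ s)" for s
  define S0 where "S0 s = q $ s ** transpose (q $ s)" for s
  have uS: "unitary (S s)" "unitary (S0 s)" for s
    using up uq by (simp_all add: S_def S0_def unitary_mult unitary_transpose)
  have tS: "transpose (S s) = S s" "transpose (S0 s) = S0 s" for s
    by (simp_all add: S_def S0_def transpose_mult)
  have rho: "\<rho> $ s = r $ s ** transpose (r $ s) ** adj (r $ cyc_next s ** transpose (r $ cyc_next s))"
    if r: "frame \<rho> r a" for r s
  proof -
    note f = r[unfolded frame_def, rule_format, of s]
    have E: "r $ cyc_next s ** transpose (r $ cyc_next s) = r $ s ** dg (- (a $ s)) ** transpose (r $ s)"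
      using f by simp
    have u: "unitary (r $ s)" using f by simp
    have "\<rho> $ s = r $ s ** dg (a $ s) ** adj (r $ s)" using f by simp
    then show ?thesis unfolding E using u by (simp add: adj_mult matrix_mul_assoc[symmetric])
  qed
  have r1: "\<rho> $ s = S s ** adj (S (cyc_next s))" and r2: "\<rho> $ s = S0 s ** adj (S0 (cyc_next s))" for s
    unfolding S_def S0_def by (rule rho[OF p], rule rho[OF q])
  \<comment> \<open>Both chains of symmetric matrices have the same consecutive quotients
    \<open>\<rho> $ s\<close>, so their own quotient is constant along the cycle.\<close>
  define Y where "Y s = adj (S0 s) ** S s" for s
  have "Y (cyc_next s) = Y s" for s
  proof -
    have "adj (S0 s) ** (S s ** adj (S (cyc_next s))) ** S (cyc_next s) =
        adj (S0 s) ** (S0 s ** adj (S0 (cyc_next s))) ** S (cyc_next s)"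
      using r1 r2 by simp
    then show ?thesis using uS by (simp add: Y_def matrix_mul_assoc[symmetric])
  qed
  then obtain Y0 where Y0: "\<And>s. Y s = Y0" using cyc_invariant[of Y] by metis
  have SY: "S s = S0 s ** Y0" for s using Y0[of s] uS by (simp add: Y_def flip: matrix_mul_assoc) (metis unitaryD(4))
  \<comment> \<open>Symmetry of \<open>S s\<close>, the product of \<open>S0 s\<close> and
    \<open>Y0\<close>, shows that every \<open>S0 s\<close> conjugates \<open>Y0\<close> to the same
    matrix \<open>transpose Y0\<close>, which therefore commutes with every
    \<open>\<rho> $ s\<close>.\<close>
  have YS: "transpose Y0 ** S0 s = S0 s ** Y0" for s
    by (metis SY tS transpose_mult)
  have YS': "transpose Y0 = S0 s ** Y0 ** adj (S0 s)" for s
    unfolding YS[symmetric] using uS by (simp add: matrix_mul_assoc[symmetric])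
  have "transpose Y0 ** \<rho> $ s = \<rho> $ s ** transpose Y0" for s
  proof -
    have "\<rho> $ s ** transpose Y0 = S0 s ** (adj (S0 (cyc_next s)) ** (S0 (cyc_next s) ** Y0 ** adj (S0 (cyc_next s))))"
      unfolding r2 YS'[symmetric] by (simp add: matrix_mul_assoc)
    also have "\<dots> = (S0 s ** Y0) ** adj (S0 (cyc_next s))" using uS by (simp add: matrix_mul_assoc[symmetric])
    also have "\<dots> = transpose Y0 ** \<rho> $ s" unfolding YS[symmetric] r2 by (simp add: matrix_mul_assoc)
    finally show ?thesis ..
  qed
  then obtain w where "transpose Y0 = mat w" using commuting_scalar[OF irr] by blast
  then have Yl: "Y0 = mat w" by (metis transpose_mat transpose_transpose)
  have "unitary Y0" using Y0 uS by (metis Y_def unitary_mult unitary_adj)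
  then have "cnj w * w = 1" unfolding Yl by (metis adj_mat mat_mult_mat mat_eq_iff unitaryD(1))
  then have "(cmod w)\<^sup>2 = 1" by (metis complex_norm_square mult.commute of_real_eq_1_iff)
  then have l1: "cmod w = 1" by (simp add: abs_square_eq_1)
  \<comment> \<open>A square root is needed because a phase on the frame enters p p^T
    squared.\<close>
  define \<mu> where "\<mu> = inverse (csqrt w)"
  have \<mu>: "cmod \<mu> = 1" "\<mu> * \<mu> * w = 1"
  proof -
    have l: "csqrt w * csqrt w = w" by (metis power2_csqrt power2_eq_square)
    have "w \<noteq> 0" using l1 by auto
    then show "\<mu> * \<mu> * w = 1" using l by (simp add: \<mu>_def field_simps)
    have "(cmod (csqrt w))\<^sup>2 = 1" using l l1 by (metis norm_power power2_csqrt)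
    then show "cmod \<mu> = 1" by (simp add: \<mu>_def norm_inverse abs_square_eq_1)
  qed
  define r where "r s = mat \<mu> ** p $ s" for s
  have ur: "unitary (r s)" for s using up \<mu>(1) by (simp add: r_def unitary_mult unitary_mat)
  have rS: "r s ** transpose (r s) = S0 s" for s
  proof -
    have "r s ** transpose (r s) = mat \<mu> ** S s ** mat \<mu>"
      by (simp add: r_def S_def transpose_mult matrix_mul_assoc)
    also have "\<dots> = mat (\<mu> * \<mu> * w) ** S0 s"
      unfolding SY Yl by (simp only: mat_mult_commute[of w, symmetric] mat_mult_commute[of \<mu> "_ ** _", symmetric]
          matrix_mul_assoc mat_mult_mat mult_ac)
    finally show ?thesis by (simp add: \<mu>(2))
  qed
  have f: "frame \<rho> (\<chi> s. r s) a" using frame_scalar[OF p \<mu>(1)] by (simp add: r_def)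
  define c where "c s = adj (r s) ** q $ s" for s
  have "in_gauge a c"
    unfolding in_gauge_def
  proof (intro allI conjI)
    fix s
    show uc: "unitary (c s)" using ur uq by (simp add: c_def unitary_mult unitary_adj)
    have "c s ** transpose (c s) = adj (r s) ** S0 s ** cj (r s)"
      by (simp add: c_def transpose_mult S0_def matrix_mul_assoc)
    also have "\<dots> = mat 1" unfolding rS[symmetric] using ur by (simp add: matrix_mul_assoc[symmetric])
    finally have "transpose (c s) = adj (c s)" using uc by (metis matrix_mul_rid unitaryD(3))
    then show "cj (c s) = c s" by (metis adj_transpose adj_adj)
    have "r s ** dg (a $ s) ** adj (r s) = q $ s ** dg (a $ s) ** adj (q $ s)"
      using f q by (simp add: frame_def)
    then have "adj (r s) ** (r s ** dg (a $ s) ** adj (r s)) ** q $ s =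
        adj (r s) ** (q $ s ** dg (a $ s) ** adj (q $ s)) ** q $ s" by simp
    then show "dg (a $ s) ** c s = c s ** dg (a $ s)"
      using ur uq by (simp add: c_def matrix_mul_assoc[symmetric])
  qed
  moreover have "q = (\<chi> s. mat \<mu> ** p $ s ** c s)"
    unfolding r_def[symmetric] using ur by (simp add: vec_eq_iff[of q] c_def)
  ultimately show ?thesis using \<mu>(1) that by blast
qed

section \<open>Compactness of the space of frames with bounded spectra\<close>

subsection \<open>Frames of nearby representations\<close>

text \<open>Every coincidence and every zero of \<open>a\<close> is shared by \<open>b\<close>,
  while \<open>b\<close> may have more. Unlike an exact multiplicity structure, this is a closed
  condition on \<open>b\<close>.\<close>

definition pattern_le :: "('n::finite, 'l::finite) spectra \<Rightarrow> ('n, 'l) spectra \<Rightarrow> bool" where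
  "pattern_le a b \<longleftrightarrow> (\<forall>s i j. a $ s $ i = a $ s $ j \<longrightarrow> b $ s $ i = b $ s $ j) \<and>
     (\<forall>s i. a $ s $ i = 0 \<longrightarrow> b $ s $ i = 0)"

definition spectral :: "('n::{finite,linorder}, 'l::finite) spectra \<Rightarrow> bool" where
  "spectral a \<longleftrightarrow> (\<forall>s i j. i \<le> j \<longrightarrow> a $ s $ i \<le> a $ s $ j) \<and> (\<forall>s j. 0 \<le> a $ s $ j \<and> a $ s $ j < 1)"

text \<open>Commuting with \<open>dg (a $ s)\<close> forces the block form of \<open>a\<close>, and
  \<open>b\<close> is constant on these blocks.\<close>

lemma in_gauge_pattern_le:
  assumes "in_gauge a c" "spectral a" "pattern_le a b"
  shows "in_gauge b c"
  unfolding in_gauge_def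
proof (intro allI conjI)
  fix s
  show "unitary (c s)" "cj (c s) = c s" using assms(1) by (auto simp: in_gauge_def)
  have "\<forall>i j. a $ s $ i \<noteq> a $ s $ j \<longrightarrow> c s $ i $ j = 0"
    using assms(1,2) dg_commute_iff[of "a $ s" "c s"] by (auto simp: in_gauge_def spectral_def)
  moreover have "\<forall>i j. a $ s $ i = a $ s $ j \<longrightarrow> b $ s $ i = b $ s $ j"
    using assms(3) unfolding pattern_le_def by blast
  ultimately have "b $ s $ i \<noteq> b $ s $ j \<Longrightarrow> c s $ i $ j = 0" for i j by blast
  then show "dg (b $ s) ** c s = c s ** dg (b $ s)" by (rule dg_commute)
qed

text \<open>A limit of spectra may contain the entry 1, reached from below, although 1 and 0 give
  the same eigenvalue. But all zeros of \<open>a\<close> are zeros of \<open>b\<close>, so an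
  additional entry 1 in \<open>b\<close> would make the multiplicity of the eigenvalue 1 too
  large.\<close>

lemma limit_spectrum_eq:
  fixes a :: "('n::{finite,linorder}, 'l::finite) spectra"
  assumes a: "spectral a" and pat: "pattern_le a b"
    and b: "\<And>s i j. i \<le> j \<Longrightarrow> b $ s $ i \<le> b $ s $ j" "\<And>s j. 0 \<le> b $ s $ j \<and> b $ s $ j \<le> 1"
    and u: "\<And>s. unitary (p $ s)" "\<And>s. unitary (q $ s)"
    and eq: "\<And>s. p $ s ** dg (a $ s) ** adj (p $ s) = q $ s ** dg (b $ s) ** adj (q $ s)"
  shows "b = a"
proof -
  have "b $ s = a $ s" for s
  proof -
    have ms: "image_mset (\<lambda>j. expi (a $ s $ j)) (mset_set UNIV) = image_mset (\<lambda>j. expi (b $ s $ j)) (mset_set UNIV)"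
    proof (rule prod_linear_eq_imp_image_mset_eq)
      fix x
      show "(\<Prod>j\<in>UNIV. x - expi (a $ s $ j)) = (\<Prod>j\<in>UNIV. x - expi (b $ s $ j))"
        using arg_cong[OF eq[of s], of "\<lambda>A. det (mat x - A)"]
        by (simp only: det_diagonal_form[OF u(1)] det_diagonal_form[OF u(2)])
    qed
    have "b $ s $ i < 1" for i
    proof (rule ccontr)
      assume "\<not> b $ s $ i < 1"
      then have bi: "b $ s $ i = 1" using b(2)[of s i] by linarith
      have "count (image_mset (\<lambda>j. expi (a $ s $ j)) (mset_set UNIV)) 1 = card {j. expi (a $ s $ j) = 1}"
        "count (image_mset (\<lambda>j. expi (b $ s $ j)) (mset_set UNIV)) 1 = card {j. expi (b $ s $ j) = 1}"
        by (auto simp: count_image_mset vimage_def Int_def intro!: arg_cong[where f = card])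
      then have eqc: "card {j. expi (a $ s $ j) = 1} = card {j. expi (b $ s $ j) = 1}" using ms by simp
      have az: "expi (a $ s $ j) = 1 \<longleftrightarrow> a $ s $ j = 0" for j
        using expi_inj[of "a $ s $ j" 0] a by (auto simp: spectral_def)
      have "expi 1 = 1" using expi_of_int[of 1] by simp
      have pat0: "b $ s $ j = 0" if "a $ s $ j = 0" for j
        using pat that unfolding pattern_le_def by blast
      have "{j. a $ s $ j = 0} \<subset> {j. expi (b $ s $ j) = 1}"
      proof
        show "{j. a $ s $ j = 0} \<subseteq> {j. expi (b $ s $ j) = 1}" by (auto simp: pat0)
        have "a $ s $ i \<noteq> 0" using pat0[of i] bi by linarith
        then have "i \<notin> {j. a $ s $ j = 0}" by simp
        moreover have "i \<in> {j. expi (b $ s $ j) = 1}" using bi \<open>expi 1 = 1\<close> by simp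
        ultimately show "{j. a $ s $ j = 0} \<noteq> {j. expi (b $ s $ j) = 1}" by blast
      qed
      then have "card {j. a $ s $ j = 0} < card {j. expi (b $ s $ j) = 1}" by (intro psubset_card_mono) auto
      then show False using eqc by (simp add: az)
    qed
    then have "is_spec (q $ s ** dg (b $ s) ** adj (q $ s)) (b $ s)"
      by (intro is_spec_diagonal_form u conjI b(1)) (use b(2) in auto)
    moreover have "is_spec (q $ s ** dg (b $ s) ** adj (q $ s)) (a $ s)"
      unfolding eq[of s, symmetric]
      by (rule is_spec_diagonal_form[OF u(1)]) (use a in \<open>simp_all add: spectral_def\<close>)
    ultimately show ?thesis by (rule is_spec_unique)
  qed
  then show ?thesis by (simp add: vec_eq_iff)
qed

lemma compact_unitary_tuples: "compact {p :: ('n::finite, 'l::finite) mats. \<forall>s. unitary (p $ s)}"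
proof (rule compact_eq_bounded_closed[THEN iffD2], intro conjI)
  show "bounded {p :: ('n, 'l) mats. \<forall>s. unitary (p $ s)}"
  proof (rule boundedI)
    fix p :: "('n, 'l) mats" assume "p \<in> {p. \<forall>s. unitary (p $ s)}"
    then show "norm p \<le> CARD('l) * sqrt (CARD('n))"
      using norm_vec_le_card[of p "sqrt (CARD('n))"] by (simp add: norm_unitary)
  qed
  show "closed {p :: ('n, 'l) mats. \<forall>s. unitary (p $ s)}"
    unfolding unitary_def by (intro closed_Collect_all closed_Collect_conj closed_Collect_eq continuous_intros)
qed

lemma frames_nearby:
  fixes \<rho> :: "('n::{finite,linorder}, 'l::{finite,linorder}) mats"
  assumes irr: "irreducible_rep \<rho>" and f0: "frame \<rho> p0 a" and a: "spectral a" and "\<epsilon> > 0"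
  obtains e where "e > 0" "\<And>\<rho>'. dist \<rho>' \<rho> < e \<Longrightarrow> lagrangian_rep \<rho>' \<Longrightarrow> pattern_le a (spec_proj \<rho>') \<Longrightarrow>
    \<exists>p. frame \<rho>' p (spec_proj \<rho>') \<and> dist p p0 < \<epsilon> \<and> dist (spec_proj \<rho>') a < \<epsilon>"
proof -
  define A :: "('n, 'l) spectra set" where
    "A = {b. (\<forall>s i j. i \<le> j \<longrightarrow> b $ s $ i \<le> b $ s $ j) \<and> (\<forall>s j. 0 \<le> b $ s $ j \<and> b $ s $ j \<le> 1) \<and> pattern_le a b}"
  have "closed A"
    unfolding A_def pattern_le_def
    by (intro closed_Collect_conj closed_Collect_all closed_Collect_imp open_Collect_const closed_Collect_eq
        closed_Collect_le continuous_intros)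
  moreover have "bounded A"
  proof (rule boundedI)
    fix b assume "b \<in> A"
    then have "norm (b $ s) \<le> real CARD('n) * 1" for s
      by (intro norm_vec_le_card) (auto simp: A_def)
    then show "norm b \<le> real CARD('l) * (real CARD('n) * 1)" by (rule norm_vec_le_card)
  qed
  ultimately have "compact A" by (simp add: compact_eq_bounded_closed)
  define K :: "(('n, 'l) mats \<times> ('n, 'l) spectra) set" where "K = {p. \<forall>s. unitary (p $ s)} \<times> A"
  have "compact K" unfolding K_def by (intro compact_Times compact_unitary_tuples \<open>compact A\<close>)
  define C :: "((('n, 'l) mats \<times> ('n, 'l) spectra) \<times> ('n, 'l) mats) set" where
    "C = {x. \<forall>s. snd x $ s = fst (fst x) $ s ** dg (snd (fst x) $ s) ** adj (fst (fst x) $ s) \<and>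
      fst (fst x) $ s ** dg (- (snd (fst x) $ s)) ** transpose (fst (fst x) $ s) =
      fst (fst x) $ cyc_next s ** transpose (fst (fst x) $ cyc_next s)}"
  have frame_C: "frame \<rho>' p b \<longleftrightarrow> (\<forall>s. unitary (p $ s)) \<and> ((p, b), \<rho>') \<in> C" for \<rho>' p b
    by (auto simp: frame_def C_def)
  have "closed C"
    unfolding C_def by (intro closed_Collect_all closed_Collect_conj closed_Collect_eq continuous_intros)
  \<comment> \<open>All pairs that some phase and some gauge transformation for \<open>a\<close>
    bring close to \<open>(p0, a)\<close>.\<close>
  define V where "V = (\<Union>(\<mu>, c)\<in>{(\<mu>, c). cmod \<mu> = 1 \<and> in_gauge a c}.
    {x :: ('n, 'l) mats \<times> ('n, 'l) spectra. dist (\<chi> s. mat \<mu> ** fst x $ s ** c s) p0 < \<epsilon> \<and> dist (snd x) a < \<epsilon>})"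
  have "open V"
    unfolding V_def
    by (intro open_UN ballI, clarify, intro open_Collect_conj open_Collect_less continuous_intros continuous_on_vec_lambda)
  moreover have "k \<in> V" if k: "k \<in> K" "(k, \<rho>) \<in> C" for k
  proof -
    obtain p b where pb: "k = (p, b)" by (cases k)
    have f: "frame \<rho> p b" using k by (simp add: frame_C pb K_def)
    have "b = a"
      by (rule limit_spectrum_eq[OF a, of _ p0 p]) (use k f f0 in \<open>auto simp: pb K_def A_def frame_def\<close>)
    then obtain \<mu> c where \<mu>: "cmod \<mu> = 1" "in_gauge a c" "p0 = (\<chi> s. mat \<mu> ** p $ s ** c s)"
      using frame_unique[OF irr _ f0, of p] f by metis
    have "dist (\<chi> s. mat \<mu> ** p $ s ** c s) p0 < \<epsilon>" unfolding \<mu>(3)[symmetric] using \<open>\<epsilon> > 0\<close> by simp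
    then show ?thesis using \<mu>(1,2) \<open>\<epsilon> > 0\<close> \<open>b = a\<close> by (auto simp: V_def pb)
  qed
  ultimately obtain e where e: "e > 0" "\<And>x k. dist x \<rho> < e \<Longrightarrow> k \<in> K \<Longrightarrow> (k, x) \<in> C \<Longrightarrow> k \<in> V"
    using compact_fibre_neighbourhood[OF \<open>compact K\<close> \<open>closed C\<close>, of V \<rho>] by metis
  show ?thesis
  proof (rule that[OF e(1)])
    fix \<rho>' :: "('n, 'l) mats"
    assume \<rho>': "dist \<rho>' \<rho> < e" "lagrangian_rep \<rho>'" "pattern_le a (spec_proj \<rho>')"
    let ?b = "spec_proj \<rho>'"
    obtain p where p: "frame \<rho>' p ?b" "\<And>s i j. i \<le> j \<Longrightarrow> ?b $ s $ i \<le> ?b $ s $ j"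
      "\<And>s j. 0 \<le> ?b $ s $ j \<and> ?b $ s $ j < 1"
      by (rule lagrangian_rep_imp_frame[OF \<rho>'(2)]) blast
    have "(p, ?b) \<in> K" using p \<rho>'(3) by (auto simp: K_def A_def frame_C less_imp_le)
    moreover have "((p, ?b), \<rho>') \<in> C" using p(1) by (simp add: frame_C)
    ultimately have "(p, ?b) \<in> V" by (rule e(2)[OF \<rho>'(1)])
    then obtain \<mu> c where \<mu>: "cmod \<mu> = 1" "in_gauge a c" "dist (\<chi> s. mat \<mu> ** p $ s ** c s) p0 < \<epsilon>" "dist ?b a < \<epsilon>"
      by (auto simp: V_def)
    have "in_gauge ?b c" using in_gauge_pattern_le[OF \<mu>(2) a \<rho>'(3)] .
    then have "frame \<rho>' (\<chi> s. (\<chi> s. mat \<mu> ** p $ s) $ s ** c s) ?b"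
      by (intro frame_gauge[OF frame_scalar[OF p(1) \<mu>(1)]]) (auto simp: in_gauge_def)
    then show "\<exists>p. frame \<rho>' p ?b \<and> dist p p0 < \<epsilon> \<and> dist ?b a < \<epsilon>"
      using \<mu>(3,4) by auto
  qed
qed

section \<open>Strata of spectra as open pieces of affine spaces\<close>

subsection \<open>Strata\<close>

lemma pos_less: "i < j \<Longrightarrow> pos i < pos j"
  unfolding pos_def by (rule psubset_card_mono) auto

lemma pos_less_iff: "pos i < pos j \<longleftrightarrow> i < j"
  by (metis pos_less less_asym' less_irrefl linorder_cases)

lemma inj_pos: "inj pos"
  by (rule linorder_injI) (metis pos_less less_irrefl)

lemma range_pos: "range (pos :: 'n::{finite,linorder} \<Rightarrow> nat) = {1..CARD('n)}"
proof (rule card_subset_eq)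
  show "range (pos :: 'n \<Rightarrow> nat) \<subseteq> {1..CARD('n)}"
    unfolding pos_def by (auto simp: Suc_le_eq card_gt_0_iff intro!: card_mono)
qed (simp_all add: card_image inj_pos)

lemma partition_mono: "is_partition n k m \<Longrightarrow> i \<le> j \<Longrightarrow> j \<le> k \<Longrightarrow> m i \<le> m j"
proof -
  assume m: "is_partition n k m" and "i \<le> j" "j \<le> k"
  from this(2,3) show ?thesis
  proof (induction j rule: dec_induct)
    case (step j)
    then have "m j < m (Suc j)" using m by (simp add: is_partition_def)
    then show ?case using step by simp
  qed simp
qed

text \<open>\<open>b i\<close> numbers the block of the partition that contains the index
  \<open>i\<close>; it is the least \<open>j\<close> whose endpoint \<open>m j\<close> is not passed
  by \<open>pos i\<close>.\<close>

lemma partition_blocks: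
  fixes m :: "nat \<Rightarrow> nat"
  assumes m: "is_partition CARD('n::{finite,linorder}) k m"
  obtains b :: "'n::{finite,linorder} \<Rightarrow> nat" where "\<And>i. b i \<in> {1..k}"
    "\<And>i j. j \<in> {1..k} \<Longrightarrow> m (j - 1) < pos i \<and> pos i \<le> m j \<longleftrightarrow> b i = j"
    "\<And>j. j \<in> {1..k} \<Longrightarrow> card {i. b i = j} = multiplicity_of m j"
    "\<And>j. j \<in> {1..k} \<Longrightarrow> \<exists>i. b i = j" "mono b"
proof -
  define b where "b i = (LEAST j. pos i \<le> m j)" for i :: 'n
  have mk: "m k = CARD('n)" "m 0 = 0" using m by (auto simp: is_partition_def)
  have pr: "pos i \<in> {1..CARD('n)}" for i :: 'n using range_pos by blast
  have le: "pos i \<le> m (b i)" for i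
    unfolding b_def by (rule LeastI[of _ k]) (use pr[of i] mk in simp)
  have bk: "b i \<le> k" for i unfolding b_def by (rule Least_le) (use pr[of i] mk in simp)
  have b1: "b i \<ge> 1" for i using le[of i] pr[of i] mk by (cases "b i") auto
  have gt: "m j < pos i" if "j < b i" for i j
    using not_less_Least[of j "\<lambda>j. pos i \<le> m j"] that by (simp add: b_def)
  have blk: "m (j - 1) < pos i \<and> pos i \<le> m j \<longleftrightarrow> b i = j" if "j \<in> {1..k}" for i j
  proof
    assume *: "m (j - 1) < pos i \<and> pos i \<le> m j"
    show "b i = j"
    proof (rule antisym)
      show "b i \<le> j" unfolding b_def by (rule Least_le) (use * in simp)
      show "j \<le> b i"
      proof (rule ccontr)
        assume "\<not> j \<le> b i"
        then have "b i \<le> j - 1" by simp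
        then have "m (b i) \<le> m (j - 1)" using that by (intro partition_mono[OF m]) auto
        then show False using * le[of i] by simp
      qed
    qed
  next
    assume "b i = j"
    then show "m (j - 1) < pos i \<and> pos i \<le> m j" using le[of i] gt[of "j - 1" i] b1[of i] by auto
  qed
  have card: "card {i. b i = j} = multiplicity_of m j" if "j \<in> {1..k}" for j
  proof -
    have "m j \<le> CARD('n)" using that partition_mono[OF m, of j k] mk by simp
    then have "{m (j - 1)<..m j} \<subseteq> range (pos :: 'n \<Rightarrow> nat)" unfolding range_pos by auto
    then have "pos ` {i. b i = j} = {m (j - 1)<..m j}" using blk[OF that] by auto
    then have "card {i. b i = j} = card {m (j - 1)<..m j}"
      by (metis card_image inj_pos inj_on_subset subset_UNIV)
    then show ?thesis by (simp add: multiplicity_of_def)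
  qed
  show ?thesis
  proof (rule that[of b])
    show "b i \<in> {1..k}" for i using b1 bk by simp
    show "\<exists>i. b i = j" if "j \<in> {1..k}" for j
    proof -
      obtain j' where j': "j = Suc j'" "j' < k" using \<open>j \<in> {1..k}\<close> by (cases j) auto
      then have "m j' < m (Suc j')" using m by (simp add: is_partition_def)
      then have "multiplicity_of m j > 0" by (simp add: multiplicity_of_def j')
      then have "{i. b i = j} \<noteq> {}" using card[OF that] by (metis card.empty less_irrefl)
      then show ?thesis by blast
    qed
    show "mono b"
    proof (rule monoI)
      fix i j :: 'n assume "i \<le> j"
      then have "pos i \<le> pos j" using pos_less[of i j] by (auto simp: le_less)
      then show "b i \<le> b j" unfolding b_def[of i] by (intro Least_le) (use le[of j] in simp)
    qed
  qed (use blk card in auto)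
qed

text \<open>The multiplicity structure says that the entries factor through the block number by a
  strictly increasing function.\<close>

lemma stratum_blocks:
  fixes l :: "'l::finite \<Rightarrow> nat" and m :: "'l \<Rightarrow> nat \<Rightarrow> nat"
  assumes "\<And>s. is_partition CARD('n::{finite,linorder}) (l s) (m s)"
  obtains b :: "'l::finite \<Rightarrow> 'n::{finite,linorder} \<Rightarrow> nat" where "\<And>s i. b s i \<in> {1..l s}"
    "\<And>s j. j \<in> {1..l s} \<Longrightarrow> card {i. b s i = j} = multiplicity_of (m s) j"
    "\<And>s j. j \<in> {1..l s} \<Longrightarrow> \<exists>i. b s i = j" "\<And>s. mono (b s)"
    "\<And>I z (a :: ('n::{finite,linorder}, 'l::finite) spectra). a \<in> P_stratum I l m z \<longleftrightarrow> spectral a \<and> (\<Sum>s\<in>UNIV. \<Sum>j\<in>UNIV. a $ s $ j) = of_int I \<and>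
      (\<forall>s. \<exists>h. strict_mono_on {1..l s} h \<and> (\<forall>i. a $ s $ i = h (b s i)) \<and> (h 1 = 0 \<longleftrightarrow> s \<in> z))"
proof -
  have "\<exists>b :: 'n \<Rightarrow> nat. (\<forall>i. b i \<in> {1..l s}) \<and>
    (\<forall>i. \<forall>j\<in>{1..l s}. m s (j - 1) < pos i \<and> pos i \<le> m s j \<longleftrightarrow> b i = j) \<and>
    (\<forall>j\<in>{1..l s}. card {i. b i = j} = multiplicity_of (m s) j) \<and>
    (\<forall>j\<in>{1..l s}. \<exists>i. b i = j) \<and> mono b" for s
    by (rule partition_blocks[OF assms[of s]]) blast
  then have "\<forall>s. \<exists>b :: 'n \<Rightarrow> nat. (\<forall>i. b i \<in> {1..l s}) \<and>
    (\<forall>i. \<forall>j\<in>{1..l s}. m s (j - 1) < pos i \<and> pos i \<le> m s j \<longleftrightarrow> b i = j) \<and>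
    (\<forall>j\<in>{1..l s}. card {i. b i = j} = multiplicity_of (m s) j) \<and>
    (\<forall>j\<in>{1..l s}. \<exists>i. b i = j) \<and> mono b" ..
  from choice[OF this] obtain b :: "'l \<Rightarrow> 'n \<Rightarrow> nat" where b: "\<forall>s. (\<forall>i. b s i \<in> {1..l s}) \<and>
    (\<forall>i. \<forall>j\<in>{1..l s}. m s (j - 1) < pos i \<and> pos i \<le> m s j \<longleftrightarrow> b s i = j) \<and>
    (\<forall>j\<in>{1..l s}. card {i. b s i = j} = multiplicity_of (m s) j) \<and>
    (\<forall>j\<in>{1..l s}. \<exists>i. b s i = j) \<and> mono (b s)" by (rule exE)
  have ms: "mult_structure \<alpha> (l s) (m s) h \<longleftrightarrow> strict_mono_on {1..l s} h \<and> (\<forall>i. \<alpha> $ i = h (b s i))"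
    for \<alpha> :: "(real, 'n) vec" and s h
  proof -
    have "(\<forall>j\<in>{1..l s}. \<forall>i. m s (j - 1) < pos i \<and> pos i \<le> m s j \<longrightarrow> \<alpha> $ i = h j) \<longleftrightarrow> (\<forall>i. \<alpha> $ i = h (b s i))"
    proof (intro iffI ballI allI impI)
      have b': "b s i \<in> {1..l s}" "j \<in> {1..l s} \<Longrightarrow> m s (j - 1) < pos i \<and> pos i \<le> m s j \<longleftrightarrow> b s i = j" for i j
        using b by auto
      show "\<alpha> $ i = h (b s i)"
        if "\<forall>j\<in>{1..l s}. \<forall>i. m s (j - 1) < pos i \<and> pos i \<le> m s j \<longrightarrow> \<alpha> $ i = h j" for i
        using that b'(1)[of i] b'(2)[OF b'(1)[of i], of i] by blast
      show "\<alpha> $ i = h j" if "\<forall>i. \<alpha> $ i = h (b s i)" "j \<in> {1..l s}" "m s (j - 1) < pos i \<and> pos i \<le> m s j" for i j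
        using that b'(2)[of j i] by simp
    qed
    then show ?thesis by (simp add: mult_structure_def)
  qed
  show ?thesis
  proof (rule that[of b])
    show "a \<in> P_stratum I l m z \<longleftrightarrow> spectral a \<and> (\<Sum>s\<in>UNIV. \<Sum>j\<in>UNIV. a $ s $ j) = of_int I \<and>
      (\<forall>s. \<exists>h. strict_mono_on {1..l s} h \<and> (\<forall>i. a $ s $ i = h (b s i)) \<and> (h 1 = 0 \<longleftrightarrow> s \<in> z))" for I z and a :: "('n, 'l) spectra"
      unfolding P_stratum_def spectral_def ms by auto
  qed (use b in blast)+
qed

text \<open>The directions of the stratum through \<open>a\<close>: constant on the blocks of equal
  entries, zero where \<open>a\<close> is zero, and of total sum zero since the index is
  fixed.\<close>

definition tangent_dirs :: "('n::finite, 'l::finite) spectra \<Rightarrow> ('n, 'l) spectra set" where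
  "tangent_dirs a = {t. pattern_le a t \<and> (\<Sum>s\<in>UNIV. \<Sum>j\<in>UNIV. t $ s $ j) = 0}"

lemma pattern_leD:
  "pattern_le a b \<Longrightarrow> a $ s $ i = a $ s $ j \<Longrightarrow> b $ s $ i = b $ s $ j"
  "pattern_le a b \<Longrightarrow> a $ s $ i = 0 \<Longrightarrow> b $ s $ i = 0"
  unfolding pattern_le_def by blast+

lemma pattern_leI:
  assumes "\<And>s i j. a $ s $ i = a $ s $ j \<Longrightarrow> b $ s $ i = b $ s $ j" "\<And>s i. a $ s $ i = 0 \<Longrightarrow> b $ s $ i = 0"
  shows "pattern_le a b"
  using assms unfolding pattern_le_def by blast

lemma pattern_le_add:
  assumes "pattern_le a x" "pattern_le a y"
  shows "pattern_le a (x + y)"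
proof (rule pattern_leI)
  show "(x + y) $ s $ i = (x + y) $ s $ j" if "a $ s $ i = a $ s $ j" for s i j
    unfolding vector_add_component pattern_leD(1)[OF assms(1) that] pattern_leD(1)[OF assms(2) that] ..
  show "(x + y) $ s $ i = 0" if "a $ s $ i = 0" for s i
    by (simp add: pattern_leD(2)[OF assms(1) that] pattern_leD(2)[OF assms(2) that])
qed

lemma pattern_le_scaleR:
  assumes "pattern_le a x"
  shows "pattern_le a (r *\<^sub>R x)"
proof (rule pattern_leI)
  show "(r *\<^sub>R x) $ s $ i = (r *\<^sub>R x) $ s $ j" if "a $ s $ i = a $ s $ j" for s i j
    unfolding vector_scaleR_component pattern_leD(1)[OF assms(1) that] ..
  show "(r *\<^sub>R x) $ s $ i = 0" if "a $ s $ i = 0" for s i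
    by (simp add: pattern_leD(2)[OF assms(1) that])
qed

lemma subspace_tangent_dirs: "subspace (tangent_dirs a)"
proof (rule subspaceI)
  show "0 \<in> tangent_dirs a" by (simp add: tangent_dirs_def pattern_le_def)
next
  fix x y assume xy: "x \<in> tangent_dirs a" "y \<in> tangent_dirs a"
  then have "pattern_le a (x + y)" by (auto simp: tangent_dirs_def intro: pattern_le_add)
  with xy show "x + y \<in> tangent_dirs a" by (simp add: tangent_dirs_def sum.distrib)
next
  fix r x assume x: "x \<in> tangent_dirs a"
  then have "pattern_le a (r *\<^sub>R x)" by (auto simp: tangent_dirs_def intro: pattern_le_scaleR)
  with x show "r *\<^sub>R x \<in> tangent_dirs a" by (simp add: tangent_dirs_def flip: sum_distrib_left)
qed

text \<open>Near \<open>a\<close> the stratum is the affine space \<open>a + tangent_dirs a\<close>: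
  small displacements that respect the equalities of \<open>a\<close> cannot disturb its strict
  inequalities. The last claim turns the multiplicities of the partition into a count of pairs of
  equal entries.\<close>

lemma
  fixes l :: "'l::finite \<Rightarrow> nat" and m :: "'l \<Rightarrow> nat \<Rightarrow> nat" and a :: "('n::{finite,linorder}, 'l) spectra"
  assumes part: "\<And>s. is_partition CARD('n) (l s) (m s)" and a: "a \<in> P_stratum I l m z"
  shows P_stratum_spectral: "spectral a"
    and P_stratum_pattern_le: "a' \<in> P_stratum I l m z \<Longrightarrow> pattern_le a a'"
    and P_stratum_diff: "a' \<in> P_stratum I l m z \<Longrightarrow> a' - a \<in> tangent_dirs a"
    and P_stratum_near: "\<exists>e>0. \<forall>t\<in>tangent_dirs a. norm t < e \<longrightarrow> a + t \<in> P_stratum I l m z"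
    and P_stratum_card: "card {(i, j). a $ s $ i = a $ s $ j} = (\<Sum>j=1..l s. (multiplicity_of (m s) j)\<^sup>2)"
proof -
  obtain b :: "'l \<Rightarrow> 'n \<Rightarrow> nat" where b: "\<And>s i. b s i \<in> {1..l s}"
    "\<And>s j. j \<in> {1..l s} \<Longrightarrow> card {i. b s i = j} = multiplicity_of (m s) j"
    "\<And>s j. j \<in> {1..l s} \<Longrightarrow> \<exists>i. b s i = j" "\<And>s. mono (b s)"
    and P: "\<And>I z (a :: ('n, 'l) spectra). a \<in> P_stratum I l m z \<longleftrightarrow> spectral a \<and> (\<Sum>s\<in>UNIV. \<Sum>j\<in>UNIV. a $ s $ j) = of_int I \<and>
      (\<forall>s. \<exists>h. strict_mono_on {1..l s} h \<and> (\<forall>i. a $ s $ i = h (b s i)) \<and> (h 1 = 0 \<longleftrightarrow> s \<in> z))"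
    by (rule stratum_blocks[where l = l and m = m, OF part]) (rule that; assumption)
  note PD = iffD1[OF P, THEN conjunct1] iffD1[OF P, THEN conjunct2, THEN conjunct1]
    iffD1[OF P, THEN conjunct2, THEN conjunct2, THEN spec]
  have eq: "a $ s $ i = a $ s $ j \<longleftrightarrow> b s i = b s j" and zero: "a $ s $ i = 0 \<longleftrightarrow> b s i = 1 \<and> s \<in> z"
    if aP: "a \<in> P_stratum I l m z" for a s i j
  proof -
    obtain h where h: "strict_mono_on {1..l s} h" "\<And>i. a $ s $ i = h (b s i)" "h 1 = 0 \<longleftrightarrow> s \<in> z"
      using PD(3)[OF aP, of s] by blast
    have inj: "inj_on h {1..l s}" using h(1) by (rule strict_mono_on_imp_inj_on)
    show "a $ s $ i = a $ s $ j \<longleftrightarrow> b s i = b s j"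
      using inj_on_eq_iff[OF inj b(1) b(1)] by (simp add: h(2))
    \<comment> \<open>Beyond the first block an entry exceeds \<open>h 1\<close>, and
      \<open>h 1\<close> is nonnegative because it is attained on the first block.\<close>
    show "a $ s $ i = 0 \<longleftrightarrow> b s i = 1 \<and> s \<in> z"
    proof (cases "b s i = 1")
      case False
      have "1 \<in> {1..l s}" using b(1)[of s i] by simp
      then obtain i1 where "b s i1 = 1" using b(3) by blast
      moreover have "0 \<le> a $ s $ i1" using PD(1)[OF aP] by (simp add: spectral_def)
      ultimately have "0 \<le> h 1" using h(2)[of i1] by simp
      also have "h 1 < h (b s i)" using False b(1)[of s i] by (intro strict_mono_onD[OF h(1)]) auto
      finally show ?thesis using False by (simp add: h(2))
    qed (use h in simp)
  qed
  show sp: "spectral a" by (rule PD(1)[OF a])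
  have pat: "pattern_le a a'" if "a' \<in> P_stratum I l m z" for a'
    by (rule pattern_leI) (simp_all add: eq[OF a] eq[OF that] zero[OF a] zero[OF that])
  then show "a' \<in> P_stratum I l m z \<Longrightarrow> pattern_le a a'" by blast
  show "a' - a \<in> tangent_dirs a" if a': "a' \<in> P_stratum I l m z"
  proof -
    have "pattern_le a (a' - a)"
    proof (rule pattern_leI)
      fix s i j assume "a $ s $ i = a $ s $ j"
      moreover from this have "a' $ s $ i = a' $ s $ j" by (simp add: eq[OF a] eq[OF a'])
      ultimately show "(a' - a) $ s $ i = (a' - a) $ s $ j" by simp
    next
      fix s i assume "a $ s $ i = 0"
      moreover from this have "a' $ s $ i = 0" by (simp add: zero[OF a] zero[OF a'])
      ultimately show "(a' - a) $ s $ i = 0" by simp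
    qed
    moreover have "(\<Sum>s\<in>UNIV. \<Sum>j\<in>UNIV. (a' - a) $ s $ j) = 0"
      using PD(2)[OF a] PD(2)[OF a'] by (simp add: sum_subtractf)
    ultimately show ?thesis by (simp add: tangent_dirs_def)
  qed
  show "card {(i, j). a $ s $ i = a $ s $ j} = (\<Sum>j=1..l s. (multiplicity_of (m s) j)\<^sup>2)"
  proof -
    have "{(i, j). a $ s $ i = a $ s $ j} = (\<Union>k\<in>{1..l s}. {i. b s i = k} \<times> {i. b s i = k})"
      using b(1) by (auto simp: eq[OF a])
    also have "card \<dots> = (\<Sum>k=1..l s. card ({i. b s i = k} \<times> {i. b s i = k}))"
      by (rule card_UN_disjoint) auto
    also have "\<dots> = (\<Sum>j=1..l s. (multiplicity_of (m s) j)\<^sup>2)"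
      by (intro sum.cong refl) (simp add: card_cartesian_product b(2) power2_eq_square)
    finally show ?thesis .
  qed
  \<comment> \<open>Positive differences of entries, positive entries, and distances to 1. Changing
    entries by less than half of the least of these keeps every strict inequality.\<close>
  define gaps where "gaps = {x. x > 0 \<and> ((\<exists>s i j. x = a $ s $ j - a $ s $ i) \<or> (\<exists>s i. x = a $ s $ i) \<or> (\<exists>s i. x = 1 - a $ s $ i))}"
  have "gaps \<subseteq> (\<Union>s. \<Union>i. (range (\<lambda>j. a $ s $ j - a $ s $ i) \<union> {a $ s $ i, 1 - a $ s $ i}))"
    by (auto simp: gaps_def)
  then have fin: "finite gaps" by (rule finite_subset) auto
  define e where "e = Min (insert 1 gaps) / 2"
  have "Min (insert 1 gaps) > 0" using fin by (subst Min_gr_iff) (auto simp: gaps_def)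
  then have e0: "e > 0" by (simp add: e_def)
  have e: "2 * e \<le> x" if "x \<in> gaps" for x using fin that by (simp add: e_def)
  show "\<exists>e>0. \<forall>t\<in>tangent_dirs a. norm t < e \<longrightarrow> a + t \<in> P_stratum I l m z"
  proof (intro exI[of _ e] conjI ballI impI e0)
    fix t assume t: "t \<in> tangent_dirs a" "norm t < e"
    have tl: "\<bar>t $ s $ i\<bar> < e" for s i
      using component_le_norm_cart[of "t $ s" i] Finite_Cartesian_Product.norm_nth_le[of t s] t(2) by simp
    have t1: "t $ s $ i = t $ s $ j" if "b s i = b s j" for s i j
      using pattern_leD(1)[where a = a and b = t and s = s and i = i and j = j] t(1) that eq[OF a] by (simp add: tangent_dirs_def)
    have t0: "t $ s $ i = 0" if "a $ s $ i = 0" for s i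
      using pattern_leD(2)[where a = a and b = t and s = s and i = i] t(1) that by (simp add: tangent_dirs_def)
    have gap: "(a + t) $ s $ i < (a + t) $ s $ j" if "a $ s $ i < a $ s $ j" for s i j
      using e[of "a $ s $ j - a $ s $ i"] tl[of s i] tl[of s j] that by (fastforce simp: gaps_def abs_less_iff)
    have pos: "(a + t) $ s $ i > 0" if "a $ s $ i > 0" for s i
      using e[of "a $ s $ i"] tl[of s i] that e0 by (fastforce simp: gaps_def abs_less_iff)
    have less1: "(a + t) $ s $ i < 1" for s i
      using e[of "1 - a $ s $ i"] tl[of s i] sp e0 by (fastforce simp: gaps_def abs_less_iff spectral_def)
    have nonneg: "(a + t) $ s $ i \<ge> 0" for s i
      using pos[of s i] t0[of s i] sp by (cases "a $ s $ i = 0") (auto simp: spectral_def less_le)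
    have "spectral (a + t)"
      unfolding spectral_def
    proof (intro conjI allI impI nonneg less1)
      fix s and i j :: 'n assume "i \<le> j"
      then have "a $ s $ i \<le> a $ s $ j" using sp by (simp add: spectral_def)
      then show "(a + t) $ s $ i \<le> (a + t) $ s $ j"
        using gap[where s = s and i = i and j = j] t1[where s = s and i = i and j = j]
          iffD1[OF eq[OF a], of s i j] by (cases "a $ s $ i = a $ s $ j") (auto simp: less_le)
    qed
    moreover have "(\<Sum>s\<in>UNIV. \<Sum>j\<in>UNIV. (a + t) $ s $ j) = of_int I"
      using PD(2)[OF a] t(1) by (simp add: sum.distrib tangent_dirs_def)
    moreover have "\<exists>h. strict_mono_on {1..l s} h \<and> (\<forall>i. (a + t) $ s $ i = h (b s i)) \<and> (h 1 = 0 \<longleftrightarrow> s \<in> z)" for s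
    proof -
      obtain h where h: "strict_mono_on {1..l s} h" "\<And>i. a $ s $ i = h (b s i)" "h 1 = 0 \<longleftrightarrow> s \<in> z"
        using PD(3)[OF a, of s] by blast
      define h' where "h' j = (a + t) $ s $ (SOME i. b s i = j)" for j
      have h': "(a + t) $ s $ i = h' (b s i)" for i
      proof -
        have "b s (SOME i'. b s i' = b s i) = b s i" by (rule someI[of _ i]) simp
        from t1[OF this] show ?thesis
          using eq[OF a, of s "SOME i'. b s i' = b s i" i] \<open>b s (SOME i'. b s i' = b s i) = b s i\<close> by (simp add: h'_def)
      qed
      moreover have "strict_mono_on {1..l s} h'"
      proof (rule strict_mono_onI)
        fix j k assume jk: "j \<in> {1..l s}" "k \<in> {1..l s}" "j < k"
        obtain i i' where i: "b s i = j" "b s i' = k" using b(3) jk by metis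
        have "a $ s $ i < a $ s $ i'" using strict_mono_onD[OF h(1) jk] by (simp add: h(2) i)
        from gap[OF this] show "h' j < h' k" by (simp only: h' i)
      qed
      moreover have "h' 1 = 0 \<longleftrightarrow> s \<in> z"
      proof -
        have "1 \<in> {1..l s}" using b(1)[of s undefined] by simp
        then obtain i where i: "b s i = 1" using b(3) by blast
        have "a $ s $ i = 0 \<longleftrightarrow> (a + t) $ s $ i = 0"
          using pos[of s i] t0[of s i] sp by (cases "a $ s $ i = 0") (auto simp: spectral_def less_le)
        then show ?thesis using h'[of i] i h(3) h(2)[of i] by simp
      qed
      ultimately show ?thesis by blast
    qed
    ultimately show "a + t \<in> P_stratum I l m z" by (intro iffD2[OF P] conjI allI)
  qed
qed

section \<open>Implicit functions, left inverses of immersions, and dimension counts\<close>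

subsection \<open>Orthogonal projections and dimensions\<close>

definition proj :: "'a::euclidean_space set \<Rightarrow> 'a \<Rightarrow> 'a" where
  "proj S x = (SOME y. y \<in> S \<and> (\<forall>w\<in>S. inner (x - y) w = 0))"

lemma
  assumes S: "subspace S"
  shows proj_in: "proj S x \<in> S" and proj_orth: "w \<in> S \<Longrightarrow> inner (x - proj S x) w = 0"
    and proj_unique: "y \<in> S \<Longrightarrow> (\<And>w. w \<in> S \<Longrightarrow> inner (x - y) w = 0) \<Longrightarrow> proj S x = y"
    and linear_proj: "linear (proj S)"
proof -
  have pr: "proj S x \<in> S \<and> (\<forall>w\<in>S. inner (x - proj S x) w = 0)" for x
  proof -
    obtain y z where "y \<in> span S" "\<And>w. w \<in> span S \<Longrightarrow> orthogonal z w" "x = y + z"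
      by (rule orthogonal_subspace_decomp_exists[of S x]) (rule that)
    then have "\<exists>y. y \<in> S \<and> (\<forall>w\<in>S. inner (x - y) w = 0)"
      using S by (intro exI[of _ y]) (auto simp: span_eq_iff[THEN iffD2] orthogonal_def)
    then show ?thesis unfolding proj_def by (rule someI_ex)
  qed
  then show "proj S x \<in> S" "w \<in> S \<Longrightarrow> inner (x - proj S x) w = 0" by auto
  have uniq: "proj S x = y" if "y \<in> S" "\<And>w. w \<in> S \<Longrightarrow> inner (x - y) w = 0" for x y
  proof -
    have "proj S x - y \<in> S" using S pr that(1) by (simp add: subspace_diff)
    then have "inner (x - y) (proj S x - y) - inner (x - proj S x) (proj S x - y) = 0" using pr that(2) by simp
    then have "inner (proj S x - y) (proj S x - y) = 0" by (simp flip: inner_diff_left)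
    then show ?thesis by simp
  qed
  then show "y \<in> S \<Longrightarrow> (\<And>w. w \<in> S \<Longrightarrow> inner (x - y) w = 0) \<Longrightarrow> proj S x = y" by blast
  show "linear (proj S)"
  proof (rule linearI)
    show "proj S (x + y) = proj S x + proj S y" for x y
    proof (rule uniq)
      show "inner (x + y - (proj S x + proj S y)) w = 0" if "w \<in> S" for w
        using pr[of x] pr[of y] that by (simp add: inner_diff_left inner_add_left)
    qed (use S pr in \<open>simp add: subspace_add\<close>)
    show "proj S (r *\<^sub>R x) = r *\<^sub>R proj S x" for r x
    proof (rule uniq)
      show "inner (r *\<^sub>R x - r *\<^sub>R proj S x) w = 0" if "w \<in> S" for w
        using pr[of x] that by (simp flip: scaleR_diff_right)
    qed (use S pr in \<open>simp add: subspace_scale\<close>)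
  qed
qed

lemma proj_id: "subspace S \<Longrightarrow> x \<in> S \<Longrightarrow> proj S x = x"
  by (rule proj_unique) auto

lemma subspace_kernel: "linear R \<Longrightarrow> subspace {x. R x = 0}"
  by (auto simp: subspace_def linear_add linear_cmul linear_0)

text \<open>The orthogonal complement of the kernel is mapped isomorphically onto the range.\<close>

lemma dim_kernel_add_dim_range:
  fixes R :: "'a::euclidean_space \<Rightarrow> 'b::euclidean_space"
  assumes R: "linear R"
  shows "dim {x. R x = 0} + dim (range R) = DIM('a)"
proof -
  let ?K = "{x. R x = 0}" and ?O = "{y \<in> UNIV. \<forall>x\<in>{x. R x = 0}. orthogonal x y}"
  have K: "subspace ?K" by (rule subspace_kernel[OF R])
  have sO: "subspace ?O" by (auto simp: subspace_def orthogonal_def inner_add_right)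
  have "R x \<in> R ` ?O" for x
  proof (rule image_eqI)
    show "R x = R (x - proj ?K x)" using proj_in[OF K, of x] by (simp add: linear_diff[OF R])
    show "x - proj ?K x \<in> ?O" using proj_orth[OF K, of _ x] by (simp add: orthogonal_def inner_commute)
  qed
  then have "range R = R ` ?O" by blast
  also have "dim \<dots> = dim ?O"
  proof (rule dim_image_eq[OF R])
    have "x = 0" if "x \<in> ?O" "R x = 0" for x using that by (auto simp: orthogonal_def)
    then show "inj_on R (span ?O)"
      using sO by (subst linear_inj_on_iff_eq_0[OF R]) (auto simp: span_eq_iff[THEN iffD2])
  qed
  finally show ?thesis
    using dim_subspace_orthogonal_to_vectors[OF K subspace_UNIV subset_UNIV] by simp
qed

text \<open>The device for counting dimensions of spaces of matrices: exhibit them as injective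
  images of a coordinate subspace with index set \<open>I\<close>.\<close>

lemma dim_coordinate_image:
  fixes f :: "real^'i \<Rightarrow> 'b::euclidean_space"
  assumes f: "linear f" and inj: "\<And>x. (\<And>i. i \<notin> I \<Longrightarrow> x $ i = 0) \<Longrightarrow> f x = 0 \<Longrightarrow> x = 0"
  shows "dim (f ` {x. \<forall>i. i \<notin> I \<longrightarrow> x $ i = 0}) = card I"
proof -
  let ?S = "{x :: real^'i. \<forall>i. i \<notin> I \<longrightarrow> x $ i = 0}"
  have S: "subspace ?S" by (auto simp: subspace_def)
  have "inj_on f (span ?S)"
    using S inj by (subst linear_inj_on_iff_eq_0[OF f]) (auto simp: span_eq_iff[THEN iffD2])
  then have "dim (f ` ?S) = dim ?S" by (rule dim_image_eq[OF f])
  also have "dim ?S = card ((\<lambda>i. axis i 1) ` I :: (real^'i) set)"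
  proof -
    have "?S = {x. \<forall>i\<in>Basis. i \<notin> (\<lambda>i. axis i 1) ` I \<longrightarrow> x \<bullet> i = 0}"
      by (auto simp: Basis_vec_def inner_axis axis_eq_axis image_iff)
    then show ?thesis using dim_substandard[of "(\<lambda>i. axis i 1) ` I :: (real^'i) set"]
      by (auto simp: Basis_vec_def)
  qed
  also have "\<dots> = card I" by (rule card_image) (auto intro!: inj_onI simp: axis_eq_axis)
  finally show ?thesis .
qed

subsection \<open>Regular zero sets and immersions\<close>

lemma smooth_on_cong_derivative:
  assumes "smooth_on U f" "x \<in> U" "(f has_derivative D) (at x)"
  shows "frechet_derivative f (at x) = D"
  using has_derivative_unique[OF smooth_on_has_derivative[OF assms(1,2)] assms(3)] .

text \<open>\<open>H x = (proj F (fst x) + adjoint R (C x), snd x)\<close> is a local diffeomorphism that maps the zero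
  set of \<open>C\<close> to the kernel of \<open>R\<close>, since \<open>adjoint R\<close> is injective on the range of \<open>R\<close>.\<close>

lemma implicit_zero_set:
  fixes C :: "'y::euclidean_space \<times> 't::euclidean_space \<Rightarrow> 'q::euclidean_space"
  assumes W: "open W" "(0, 0) \<in> W" "smooth_on W C" "C (0, 0) = 0"
    and R: "((\<lambda>y. C (y, 0)) has_derivative R) (at 0)" and ran: "\<And>x. x \<in> W \<Longrightarrow> C x \<in> range R"
  obtains \<Omega> \<Omega>' Y where "open \<Omega>" "(0, 0) \<in> \<Omega>" "\<Omega> \<subseteq> W" "open \<Omega>'" "(0, 0) \<in> \<Omega>'" "smooth_on \<Omega>' Y" "Y (0, 0) = 0"
    "\<And>y t. (y, t) \<in> \<Omega> \<Longrightarrow> C (y, t) = 0 \<Longrightarrow> (proj {y. R y = 0} y, t) \<in> \<Omega>' \<and> Y (proj {y. R y = 0} y, t) = y"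
    "\<And>f t. (f, t) \<in> \<Omega>' \<Longrightarrow> R f = 0 \<Longrightarrow>
      (Y (f, t), t) \<in> \<Omega> \<and> C (Y (f, t), t) = 0 \<and> proj {y. R y = 0} (Y (f, t)) = f"
    "\<And>f. R f = 0 \<Longrightarrow> frechet_derivative Y (at (0, 0)) (f, 0) = f"
proof -
  let ?F = "{y. R y = 0}"
  have lin: "linear R" using R by (rule has_derivative_linear)
  have F: "subspace ?F" using lin by (rule subspace_kernel)
  note adj = adjoint_works[OF lin] and linadj = adjoint_linear[OF lin]
  \<comment> \<open>Thus \<open>adjoint R\<close> is injective on the range of \<open>R\<close>,
    where \<open>C\<close> takes its values.\<close>
  have zero: "R v = 0" if "adjoint R (R v) = 0" for v
    using adj[of v "R v"] that by simp
  have projadj: "proj ?F (adjoint R q) = 0" for q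
    by (rule proj_unique[OF F]) (use F in \<open>auto simp: subspace_0 linear_0[OF lin] inner_commute adj\<close>)
  define H where "H x = (proj ?F (fst x) + adjoint R (C x), snd x)" for x
  have smH: "smooth_on W H"
    unfolding H_def
    by (intro smooth_on_Pair smooth_on_add smooth_on_linear[OF linear_proj[OF F]] smooth_on_linear[OF linadj]
        smooth_on_fst smooth_on_snd smooth_on_id W)
  define DC where "DC = frechet_derivative C (at (0, 0))"
  have DC: "(C has_derivative DC) (at (0, 0))"
    unfolding DC_def by (rule smooth_on_has_derivative[OF W(3,2)])
  have DC0: "DC (v, 0) = R v" for v
  proof -
    have "((\<lambda>y. C (y, 0)) has_derivative (\<lambda>v. DC (v, 0))) (at 0)"
      by (rule has_derivative_compose[where f = "\<lambda>y. (y, 0)", OF _ DC]) (auto intro!: derivative_eq_intros)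
    then show ?thesis using has_derivative_unique[OF R] by (metis)
  qed
  have DH: "(H has_derivative (\<lambda>x. (proj ?F (fst x) + adjoint R (DC x), snd x))) (at (0, 0))"
    unfolding H_def
    by (intro has_derivative_Pair has_derivative_add has_derivative_snd has_derivative_ident
        bounded_linear.has_derivative[OF linear_proj[OF F, unfolded linear_conv_bounded_linear]]
        bounded_linear.has_derivative[OF linadj[unfolded linear_conv_bounded_linear] DC] has_derivative_fst)
  have fH: "frechet_derivative H (at (0, 0)) = (\<lambda>x. (proj ?F (fst x) + adjoint R (DC x), snd x))"
    by (rule smooth_on_cong_derivative[OF smH W(2) DH])
  have "inj (frechet_derivative H (at (0, 0)))"
  proof (rule linear_injective_0[THEN iffD2, rule_format])
    show "linear (frechet_derivative H (at (0, 0)))" unfolding fH by (rule has_derivative_linear[OF DH])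
    fix x assume "frechet_derivative H (at (0, 0)) x = 0"
    then obtain v where v: "x = (v, 0)" "proj ?F v + adjoint R (R v) = 0"
      by (cases x) (auto simp: fH zero_prod_def DC0)
    \<comment> \<open>Pairing the equation with \<open>v\<close> turns it into a vanishing sum of
      two squares.\<close>
    have "inner v (proj ?F v) = inner (proj ?F v) (proj ?F v)"
      using proj_orth[OF F proj_in[OF F], of v v] by (simp add: inner_diff_left)
    then have "inner (proj ?F v) (proj ?F v) + inner (R v) (R v) = 0"
      using v(2) adj[of v "R v"] by (metis inner_add_right inner_zero_right)
    then have "R v = 0" "proj ?F v = 0" by (simp_all add: add_nonneg_eq_0_iff)
    then have "v = 0" using proj_id[OF F, of v] by simp
    then show "x = 0" using v(1) by (simp add: zero_prod_def)
  qed
  then obtain U' V g where g: "open U'" "U' \<subseteq> W" "(0, 0) \<in> U'" "open V" "homeomorphism U' V H g" "smooth_on V g"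
    by (rule smooth_inverse_function[OF W(1,2) smH])
  have gH: "g (H x) = x" "H x \<in> V" if "x \<in> U'" for x
    using g(5) that by (auto simp: homeomorphism_def)
  have Hg: "H (g x) = x" "g x \<in> U'" if "x \<in> V" for x
    using g(5) that by (auto simp: homeomorphism_def)
  have H0: "H (0, 0) = (0, 0)"
    by (simp add: H_def W(4) linear_0[OF linear_proj[OF F]] linear_0[OF linadj])
  show ?thesis
  proof (rule that[of U' V "\<lambda>x. fst (g x)"])
    show "(0, 0) \<in> V" using gH(2)[OF g(3)] by (simp add: H0)
    show "fst (g (0, 0)) = 0" using gH(1)[OF g(3)] by (simp add: H0)
    show "smooth_on V (\<lambda>x. fst (g x))" by (intro smooth_on_fst g)
    show "(proj ?F y, t) \<in> V \<and> fst (g (proj ?F y, t)) = y" if "(y, t) \<in> U'" "C (y, t) = 0" for y t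
      using gH[OF that(1)] that(2) by (simp add: H_def linear_0[OF linadj])
    show "(fst (g (f, t)), t) \<in> U' \<and> C (fst (g (f, t)), t) = 0 \<and> proj ?F (fst (g (f, t))) = f"
      if V: "(f, t) \<in> V" and Rf: "R f = 0" for f t
    proof -
      obtain y where y: "g (f, t) = (y, t)" and f: "proj ?F y + adjoint R (C (y, t)) = f"
        using Hg(1)[OF V] by (cases "g (f, t)") (auto simp: H_def)
      have yU: "(y, t) \<in> U'" using Hg(2)[OF V] by (simp add: y)
      \<comment> \<open>Projecting to the kernel of \<open>R\<close> annihilates the image of
        \<open>adjoint R\<close> and so isolates the first summand of \<open>H\<close>.\<close>
      have "proj ?F f = proj ?F (proj ?F y) + proj ?F (adjoint R (C (y, t)))"
        unfolding f[symmetric] by (rule linear_add[OF linear_proj[OF F]])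
      then have "f = proj ?F y"
        using proj_id[OF F, of f] proj_id[OF F proj_in[OF F]] Rf by (simp add: projadj)
      moreover have "adjoint R (C (y, t)) = 0" using f calculation by simp
      moreover obtain v where "C (y, t) = R v" using ran[of "(y, t)"] g(2) yU by blast
      ultimately have "C (y, t) = 0" using zero[of v] by simp
      with \<open>f = proj ?F y\<close> show ?thesis using y yU by simp
    qed
    \<comment> \<open>The derivative of \<open>H\<close> fixes \<open>(f, 0)\<close> for
      \<open>f\<close> in the kernel, hence so does that of its inverse \<open>g\<close>.\<close>
    show "frechet_derivative (\<lambda>x. fst (g x)) (at (0, 0)) (f, 0) = f" if "R f = 0" for f
    proof -
      have "(g has_derivative frechet_derivative g (at (H (0, 0)))) (at (H (0, 0)))"
        using gH(2)[OF g(3)] by (rule smooth_on_has_derivative[OF g(6)])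
      from has_derivative_compose[OF DH this]
      have "((\<lambda>x. g (H x)) has_derivative
          (\<lambda>x. frechet_derivative g (at (0, 0)) (proj ?F (fst x) + adjoint R (DC x), snd x))) (at (0, 0))"
        by (simp add: H0)
      then have "((\<lambda>x. x) has_derivative
          (\<lambda>x. frechet_derivative g (at (0, 0)) (proj ?F (fst x) + adjoint R (DC x), snd x))) (at (0, 0))"
        by (rule has_derivative_transform_within_open[OF _ g(1,3)]) (simp add: gH)
      from fun_cong[OF has_derivative_unique[OF has_derivative_ident this], of "(f, 0)"]
      have "frechet_derivative g (at (0, 0)) (proj ?F f + adjoint R (DC (f, 0)), 0) = (f, 0)" by simp
      then have "frechet_derivative g (at (0, 0)) (f, 0) = (f, 0)"
        using that by (simp add: DC0 linear_0[OF linadj] proj_id[OF F])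
      moreover have "frechet_derivative (\<lambda>x. fst (g x)) (at (0, 0)) = (\<lambda>x. fst (frechet_derivative g (at (0, 0)) x))"
        using gH(2)[OF g(3)] H0
        by (intro smooth_on_cong_derivative[of V] smooth_on_fst g has_derivative_fst smooth_on_has_derivative[OF g(6)]) auto
      ultimately show ?thesis by simp
    qed
  qed (use g in auto)
qed

text \<open>Let \<open>R\<close> be the derivative of \<Theta> after projection to \<open>X\<close>.
  Then x -> adjoint R (\<Theta> (P x)) + (x - P x) is a local diffeomorphism, and for
  \<open>x\<close> in \<open>X\<close> it sees only \<open>\<Theta> x\<close>; its inverse composed
  with \<open>adjoint R\<close> is a left inverse, smooth on an open set of the ambient
  space.\<close>

lemma smooth_left_inverse:
  fixes \<Theta> :: "'x::euclidean_space \<Rightarrow> 'm::euclidean_space"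
  assumes U: "open U" "0 \<in> U" "smooth_on U \<Theta>" and X: "subspace X"
    and inj: "\<And>x. x \<in> X \<Longrightarrow> frechet_derivative \<Theta> (at 0) x = 0 \<Longrightarrow> x = 0"
  obtains U' O' \<Lambda> where "open U'" "0 \<in> U'" "U' \<subseteq> U" "open O'" "smooth_on O' \<Lambda>"
    "\<And>x. x \<in> U' \<Longrightarrow> x \<in> X \<Longrightarrow> \<Theta> x \<in> O' \<and> \<Lambda> (\<Theta> x) = x"
proof -
  define D where "D = frechet_derivative \<Theta> (at 0)"
  have D: "(\<Theta> has_derivative D) (at 0)" unfolding D_def by (rule smooth_on_has_derivative[OF U(3,2)])
  have linD: "linear D" by (rule has_derivative_linear[OF D])
  let ?P = "proj X"
  have linP: "linear ?P" by (rule linear_proj[OF X])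
  define R where "R x = D (?P x)" for x
  have linR: "linear R" unfolding R_def using linear_compose[OF linP linD] by (simp add: o_def)
  note adj = adjoint_works[OF linR] and linadj = adjoint_linear[OF linR]
  define K where "K x = adjoint R (\<Theta> x) + (x - ?P x)" for x
  have smK: "smooth_on U K"
    unfolding K_def
    by (intro smooth_on_add smooth_on_diff smooth_on_linear[OF linP] smooth_on_linear[OF linadj] smooth_on_id U)
  have DK: "(K has_derivative (\<lambda>x. adjoint R (D x) + (x - ?P x))) (at 0)"
    unfolding K_def
    by (intro has_derivative_add has_derivative_diff has_derivative_ident
        bounded_linear.has_derivative[OF linP[unfolded linear_conv_bounded_linear]]
        bounded_linear.has_derivative[OF linadj[unfolded linear_conv_bounded_linear] D])
  define K' where "K' x = adjoint R (\<Theta> (?P x)) + (x - ?P x)" for x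
  define U1 where "U1 = U \<inter> ?P -` U"
  have U1: "open U1"
    unfolding U1_def
    by (intro open_Int U open_vimage linear_continuous_on linP[unfolded linear_conv_bounded_linear])
  have P0: "?P 0 = 0" by (rule linear_0[OF linP])
  have U10: "0 \<in> U1" using U(2) by (simp add: U1_def P0)
  have smK': "smooth_on U1 K'"
    unfolding K'_def
    by (intro smooth_on_add smooth_on_diff smooth_on_linear[OF linP] smooth_on_linear[OF linadj] smooth_on_id U1
        smooth_on_compose[OF U1 _ U(3)]) (simp add: U1_def)
  have "(\<Theta> has_derivative D) (at (?P 0))" using D by (simp add: P0)
  from has_derivative_compose[OF bounded_linear.has_derivative[OF linP[unfolded linear_conv_bounded_linear] has_derivative_ident] this]
  have D': "((\<lambda>x. \<Theta> (?P x)) has_derivative R) (at 0)" by (simp add: R_def[abs_def])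
  have DK': "(K' has_derivative (\<lambda>x. adjoint R (R x) + (x - ?P x))) (at 0)"
    unfolding K'_def
    by (intro has_derivative_add has_derivative_diff has_derivative_ident
        bounded_linear.has_derivative[OF linP[unfolded linear_conv_bounded_linear]]
        bounded_linear.has_derivative[OF linadj[unfolded linear_conv_bounded_linear] D'])
  have fK': "frechet_derivative K' (at 0) = (\<lambda>x. adjoint R (R x) + (x - ?P x))"
    by (rule smooth_on_cong_derivative[OF smK' U10 DK'])
  have "inj (frechet_derivative K' (at 0))"
  proof (rule linear_injective_0[THEN iffD2, rule_format])
    show "linear (frechet_derivative K' (at 0))" unfolding fK' by (rule has_derivative_linear[OF DK'])
    fix x assume "frechet_derivative K' (at 0) x = 0"
    then have e: "adjoint R (R x) + (x - ?P x) = 0" by (simp add: fK')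
    have "inner x (x - ?P x) = inner (x - ?P x) (x - ?P x)"
      using proj_orth[OF X proj_in[OF X], of x x] by (simp add: inner_diff_left inner_diff_right inner_commute)
    then have "inner (R x) (R x) + inner (x - ?P x) (x - ?P x) = 0"
      using e adj[of x "R x"] by (metis inner_add_right inner_zero_right)
    then have "R x = 0" "x = ?P x" by (simp_all add: add_nonneg_eq_0_iff)
    then have "x \<in> X" "D x = 0" using proj_in[OF X, of x] by (simp_all add: R_def)
    then show "x = 0" using inj by (simp add: D_def)
  qed
  then obtain U' V g where g: "open U'" "U' \<subseteq> U1" "0 \<in> U'" "open V" "homeomorphism U' V K' g" "smooth_on V g"
    by (rule smooth_inverse_function[OF U1 U10 smK'])
  have gK: "g (K' x) = x" "K' x \<in> V" if "x \<in> U'" for x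
    using g(5) that by (auto simp: homeomorphism_def)
  let ?O = "adjoint R -` V"
  have O: "open ?O"
    by (intro g open_vimage linear_continuous_on linadj[unfolded linear_conv_bounded_linear])
  show ?thesis
  proof (rule that[of U' ?O "\<lambda>y. g (adjoint R y)"])
    show "smooth_on ?O (\<lambda>y. g (adjoint R y))"
      by (rule smooth_on_compose[OF O _ g(6)]) (auto intro: smooth_on_linear[OF linadj O smooth_on_id[OF O]])
    show "\<Theta> x \<in> ?O \<and> g (adjoint R (\<Theta> x)) = x" if "x \<in> U'" "x \<in> X" for x
      using gK[OF that(1)] proj_id[OF X that(2)] by (simp add: K'_def)
  qed (use g U1_def O in auto)
qed

subsection \<open>Dimensions of some spaces of matrices\<close>

text \<open>A real matrix x is encoded as x + x^T + i (x - x^T), which is a linear bijection onto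
  Hermitian matrices; exchanging real and imaginary parts treats the skew-Hermitian case.\<close>

lemma dim_hermitian_tuples:
  "dim {h :: ('n::finite, 'l::finite) mats. \<forall>s. adj (h $ s) = h $ s} = CARD('l) * CARD('n)^2"
proof -
  let ?f = "\<lambda>x :: real^('l \<times> 'n \<times> 'n). (\<chi> s i j. Complex (x $ (s, i, j) + x $ (s, j, i)) (x $ (s, i, j) - x $ (s, j, i))) :: ('n, 'l) mats"
  have lin: "linear ?f" by (rule linearI) (simp_all add: vec_eq_iff complex_eq_iff algebra_simps)
  have "dim (?f ` {x. \<forall>i. i \<notin> UNIV \<longrightarrow> x $ i = 0}) = card (UNIV :: ('l \<times> 'n \<times> 'n) set)"
  proof (rule dim_coordinate_image[OF lin])
    fix x assume x: "?f x = 0"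
    have "x $ (s, i, j) = 0" for s i j
    proof -
      have "?f x $ s $ i $ j = 0" by (simp only: x zero_index)
      then have "x $ (s, i, j) + x $ (s, j, i) = 0" "x $ (s, i, j) - x $ (s, j, i) = 0"
        by (simp_all add: Complex_eq_0)
      then show ?thesis by linarith
    qed
    then show "x = 0" by (simp add: vec_eq_iff split_paired_all)
  qed
  moreover have "?f ` {x. \<forall>i. i \<notin> UNIV \<longrightarrow> x $ i = 0} = {h. \<forall>s. adj (h $ s) = h $ s}"
  proof (intro equalityI subsetI)
    fix h :: "('n, 'l) mats" assume "h \<in> {h. \<forall>s. adj (h $ s) = h $ s}"
    then have hh: "adj (h $ s) = h $ s" for s by simp
    have h: "Re (h $ s $ j $ i) = Re (h $ s $ i $ j)" "Im (h $ s $ j $ i) = - Im (h $ s $ i $ j)" for s i j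
      using arg_cong[OF hh[of s], of "\<lambda>A. Re (A $ i $ j)"] arg_cong[OF hh[of s], of "\<lambda>A. Im (A $ j $ i)"] by simp_all
    show "h \<in> ?f ` {x. \<forall>i. i \<notin> UNIV \<longrightarrow> x $ i = 0}"
    proof (rule image_eqI[of _ _ "\<chi> k. case k of (s, i, j) \<Rightarrow> (Re (h $ s $ i $ j) + Im (h $ s $ i $ j)) / 2"])
      show "h = ?f (\<chi> k. case k of (s, i, j) \<Rightarrow> (Re (h $ s $ i $ j) + Im (h $ s $ i $ j)) / 2)"
      proof -
        have "h $ s $ i $ j = Complex ((Re (h $ s $ i $ j) + Im (h $ s $ i $ j)) / 2 + (Re (h $ s $ j $ i) + Im (h $ s $ j $ i)) / 2)
            ((Re (h $ s $ i $ j) + Im (h $ s $ i $ j)) / 2 - (Re (h $ s $ j $ i) + Im (h $ s $ j $ i)) / 2)" for s i j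
          unfolding h[of s j i] by (simp add: complex_eq_iff field_simps)
        then show ?thesis by (simp add: vec_eq_iff)
      qed
    qed simp
  qed (auto simp: vec_eq_iff complex_eq_iff)
  ultimately show ?thesis by (simp add: power2_eq_square)
qed

lemma dim_skew_hermitian: "dim {z :: ('n::finite) cmat. adj z = - z} = CARD('n)^2"
proof -
  let ?f = "\<lambda>x :: real^('n \<times> 'n). (\<chi> i j. Complex (x $ (i, j) - x $ (j, i)) (x $ (i, j) + x $ (j, i))) :: 'n cmat"
  have lin: "linear ?f" by (rule linearI) (simp_all add: vec_eq_iff complex_eq_iff algebra_simps)
  have "dim (?f ` {x. \<forall>i. i \<notin> UNIV \<longrightarrow> x $ i = 0}) = card (UNIV :: ('n \<times> 'n) set)"
  proof (rule dim_coordinate_image[OF lin])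
    fix x assume x: "?f x = 0"
    have "x $ (i, j) = 0" for i j
    proof -
      have "?f x $ i $ j = 0" by (simp only: x zero_index)
      then have "x $ (i, j) + x $ (j, i) = 0" "x $ (i, j) - x $ (j, i) = 0"
        by (simp_all add: Complex_eq_0)
      then show ?thesis by linarith
    qed
    then show "x = 0" by (simp add: vec_eq_iff split_paired_all)
  qed
  moreover have "?f ` {x. \<forall>i. i \<notin> UNIV \<longrightarrow> x $ i = 0} = {z. adj z = - z}"
  proof (intro equalityI subsetI)
    fix h :: "'n cmat" assume "h \<in> {z. adj z = - z}"
    then have hh: "adj h = - h" by simp
    have h: "Re (h $ j $ i) = - Re (h $ i $ j)" "Im (h $ j $ i) = Im (h $ i $ j)" for i j
      using arg_cong[OF hh, of "\<lambda>A. Re (A $ i $ j)"] arg_cong[OF hh, of "\<lambda>A. Im (A $ i $ j)"] by simp_all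
    show "h \<in> ?f ` {x. \<forall>i. i \<notin> UNIV \<longrightarrow> x $ i = 0}"
    proof (rule image_eqI[of _ _ "\<chi> k. case k of (i, j) \<Rightarrow> (Re (h $ i $ j) + Im (h $ i $ j)) / 2"])
      show "h = ?f (\<chi> k. case k of (i, j) \<Rightarrow> (Re (h $ i $ j) + Im (h $ i $ j)) / 2)"
      proof -
        have "h $ i $ j = Complex ((Re (h $ i $ j) + Im (h $ i $ j)) / 2 - (Re (h $ j $ i) + Im (h $ j $ i)) / 2)
            ((Re (h $ i $ j) + Im (h $ i $ j)) / 2 + (Re (h $ j $ i) + Im (h $ j $ i)) / 2)" for i j
          unfolding h[of j i] by (simp add: complex_eq_iff field_simps)
        then show ?thesis by (simp add: vec_eq_iff)
      qed
    qed simp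
  qed (auto simp: vec_eq_iff complex_eq_iff)
  ultimately show ?thesis by (simp add: power2_eq_square)
qed

lemma card_le_pairs: "2 * card {(i, j). i \<le> (j :: 'n::{finite,linorder})} = CARD('n)^2 + CARD('n)"
proof -
  let ?A = "{(i, j). i \<le> (j :: 'n)}" and ?B = "{(i, j). j \<le> (i :: 'n)}"
  have "?B = prod.swap ` ?A" by auto
  then have "card ?B = card ?A" by (simp add: card_image)
  moreover have "card ?A + card ?B = card (?A \<union> ?B) + card (?A \<inter> ?B)" by (rule card_Un_Int) auto
  moreover have "?A \<union> ?B = UNIV" by auto
  moreover have "card (?A \<inter> ?B) = CARD('n)"
  proof -
    have "?A \<inter> ?B = (\<lambda>i. (i, i)) ` UNIV" by auto
    then show ?thesis by (simp add: card_image inj_on_def)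
  qed
  ultimately show ?thesis by (simp add: power2_eq_square)
qed

lemma dim_imaginary_symmetric_tuples:
  "2 * dim {q :: ('n::{finite,linorder}, 'l::finite) mats. \<forall>s. transpose (q $ s) = q $ s \<and> cj (q $ s) = - (q $ s)} =
    CARD('l) * (CARD('n)^2 + CARD('n))"
proof -
  let ?I = "(UNIV :: 'l set) \<times> {(i, j). i \<le> (j :: 'n)}"
  let ?f = "\<lambda>x :: (real, 'l \<times> 'n \<times> 'n) vec. (\<chi> s i j. Complex 0 (x $ (s, i, j) + x $ (s, j, i))) :: ('n, 'l) mats"
  have lin: "linear ?f" by (rule linearI) (simp_all add: vec_eq_iff complex_eq_iff algebra_simps)
  have "dim (?f ` {x. \<forall>i. i \<notin> ?I \<longrightarrow> x $ i = 0}) = card ?I"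
  proof (rule dim_coordinate_image[OF lin])
    fix x assume x: "\<And>i. i \<notin> ?I \<Longrightarrow> x $ i = 0" and "?f x = 0"
    then have e: "x $ (s, i, j) + x $ (s, j, i) = 0" for s i j
      by (simp add: vec_eq_iff complex_eq_iff)
    have "x $ (s, i, j) = 0" for s i j
      using e[of s i j] x[of "(s, i, j)"] x[of "(s, j, i)"] by (cases i j rule: linorder_cases) auto
    then show "x = 0" by (simp add: vec_eq_iff split_paired_all)
  qed
  moreover have "?f ` {x. \<forall>i. i \<notin> ?I \<longrightarrow> x $ i = 0} = {q. \<forall>s. transpose (q $ s) = q $ s \<and> cj (q $ s) = - (q $ s)}"
  proof (intro equalityI subsetI)
    fix q :: "('n, 'l) mats" assume q: "q \<in> {q. \<forall>s. transpose (q $ s) = q $ s \<and> cj (q $ s) = - (q $ s)}"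
    then have tr: "transpose (q $ s) = q $ s" for s by simp
    have sym: "q $ s $ j $ i = q $ s $ i $ j" for s i j
      using arg_cong[OF tr[of s], of "\<lambda>A. A $ i $ j"] by simp
    have cq: "cj (q $ s) = - q $ s" for s using q by simp
    have re: "Re (q $ s $ i $ j) = 0" for s i j
      using arg_cong[OF cq[of s], of "\<lambda>A. Re (A $ i $ j)"] by simp
    let ?x = "(\<chi> k. case k of (s, i, j) \<Rightarrow> if i < j then Im (q $ s $ i $ j) else if i = j then Im (q $ s $ i $ j) / 2 else 0)"
    show "q \<in> ?f ` {x. \<forall>i. i \<notin> ?I \<longrightarrow> x $ i = 0}"
    proof (rule image_eqI[of _ _ ?x])
      show "q = ?f ?x"
        using sym by (auto simp: vec_eq_iff complex_eq_iff re not_less)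
    qed auto
  qed (auto simp: vec_eq_iff complex_eq_iff)
  moreover have "2 * card ?I = CARD('l) * (CARD('n)^2 + CARD('n))"
    by (simp add: card_cartesian_product card_le_pairs[symmetric])
  ultimately show ?thesis by simp
qed

text \<open>The Lie algebra of the group \<open>in_gauge\<close>: real skew-symmetric matrices that
  are block diagonal for the eigenspaces.\<close>

definition gauge_algebra :: "('n::finite, 'l::finite) spectra \<Rightarrow> ('n, 'l) mats set" where
  "gauge_algebra a = {x. \<forall>s. cj (x $ s) = x $ s \<and> transpose (x $ s) = - (x $ s) \<and>
     (\<forall>i j. a $ s $ i \<noteq> a $ s $ j \<longrightarrow> x $ s $ i $ j = 0)}"

text \<open>The coordinates are the pairs \<open>i < j\<close> within a block. Twice their number
  plus the diagonal is the number of ordered pairs of equal entries.\<close>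

lemma dim_gauge_algebra:
  fixes a :: "('n::{finite,linorder}, 'l::finite) spectra"
  shows "2 * dim (gauge_algebra a) + CARD('l) * CARD('n) = (\<Sum>s\<in>UNIV. card {(i, j). a $ s $ i = a $ s $ j})"
proof -
  let ?I = "SIGMA s:UNIV. {(i, j). i < j \<and> a $ s $ i = a $ s $ j}"
  let ?f = "\<lambda>x :: (real, 'l \<times> 'n \<times> 'n) vec. (\<chi> s i j. complex_of_real (x $ (s, i, j) - x $ (s, j, i))) :: ('n, 'l) mats"
  have lin: "linear ?f" by (rule linearI) (simp_all add: vec_eq_iff complex_eq_iff algebra_simps)
  have "dim (?f ` {x. \<forall>i. i \<notin> ?I \<longrightarrow> x $ i = 0}) = card ?I"
  proof (rule dim_coordinate_image[OF lin])
    fix x assume x: "\<And>i. i \<notin> ?I \<Longrightarrow> x $ i = 0" and "?f x = 0"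
    then have e: "x $ (s, i, j) - x $ (s, j, i) = 0" for s i j
      by (simp add: vec_eq_iff complex_eq_iff)
    have x0: "x $ (s, i, j) = 0" if "\<not> i < j" for s i j using x[of "(s, i, j)"] that by auto
    have "x $ (s, i, j) = 0" for s i j
      using e[of s i j] x0[of i j s] x0[of j i s] by (cases "i < j") auto
    then show "x = 0" by (simp add: vec_eq_iff split_paired_all)
  qed
  moreover have "?f ` {x. \<forall>i. i \<notin> ?I \<longrightarrow> x $ i = 0} = gauge_algebra a"
  proof (intro equalityI subsetI)
    fix q :: "('n, 'l) mats" assume q: "q \<in> gauge_algebra a"
    have q0: "q $ s $ i $ j = 0" if "a $ s $ i \<noteq> a $ s $ j" for s i j using q that by (simp add: gauge_algebra_def)
    have tr: "transpose (q $ s) = - q $ s" for s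
      using q by (simp add: gauge_algebra_def)
    have sk: "q $ s $ j $ i = - q $ s $ i $ j" for s i j
      using arg_cong[OF tr[of s], of "\<lambda>A. A $ i $ j"] by simp
    have cq: "cj (q $ s) = q $ s" for s using q by (simp add: gauge_algebra_def)
    have im: "Im (q $ s $ i $ j) = 0" for s i j
      using arg_cong[OF cq[of s], of "\<lambda>A. Im (A $ i $ j)"] by simp
    have sk': "Re (q $ s $ j $ i) = - Re (q $ s $ i $ j)" for s i j
      using arg_cong[OF sk[of s j i], of Re] by simp
    have diag: "Re (q $ s $ i $ i) = 0" for s i using sk'[of s i i] by linarith
    let ?x = "(\<chi> k. case k of (s, i, j) \<Rightarrow> if i < j then Re (q $ s $ i $ j) else 0)"
    show "q \<in> ?f ` {x. \<forall>i. i \<notin> ?I \<longrightarrow> x $ i = 0}"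
    proof (rule image_eqI[of _ _ ?x])
      have "q $ s $ i $ j = ?f ?x $ s $ i $ j" for s i j
        using sk'[of s i j] by (cases i j rule: linorder_cases) (auto simp: complex_eq_iff im diag)
      then show "q = ?f ?x" by (simp add: vec_eq_iff)
      show "?x \<in> {x. \<forall>i. i \<notin> ?I \<longrightarrow> x $ i = 0}" by (auto simp: q0)
    qed
  next
    fix q assume "q \<in> ?f ` {x. \<forall>i. i \<notin> ?I \<longrightarrow> x $ i = 0}"
    then obtain x where x: "\<And>i. i \<notin> ?I \<Longrightarrow> x $ i = 0" "q = ?f x" by blast
    show "q \<in> gauge_algebra a"
      using x(1) by (auto simp: gauge_algebra_def x(2) vec_eq_iff)
  qed
  moreover have "2 * card ?I + CARD('l) * CARD('n) = (\<Sum>s\<in>UNIV. card {(i, j). a $ s $ i = a $ s $ j})"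
  proof -
    have "2 * card {(i, j). i < j \<and> a $ s $ i = a $ s $ j} + CARD('n) = card {(i, j). a $ s $ i = a $ s $ j}" for s
    proof -
      let ?A = "{(i, j). i < j \<and> a $ s $ i = a $ s $ j}" and ?B = "{(i, j). j < i \<and> a $ s $ i = a $ s $ j}"
        and ?D = "(\<lambda>i :: 'n. (i, i)) ` UNIV"
      have "?B = prod.swap ` ?A" by auto
      then have "card ?B = card ?A" by (simp add: card_image)
      moreover have "{(i, j). a $ s $ i = a $ s $ j} = (?A \<union> ?B) \<union> ?D" by auto
      moreover have "card ((?A \<union> ?B) \<union> ?D) = card (?A \<union> ?B) + card ?D" by (rule card_Un_disjoint) auto
      moreover have "card (?A \<union> ?B) = card ?A + card ?B" by (rule card_Un_disjoint) auto
      moreover have "card ?D = CARD('n)" by (simp add: card_image inj_on_def)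
      ultimately show ?thesis by simp
    qed
    then have "(\<Sum>s\<in>UNIV. card {(i, j). a $ s $ i = a $ s $ j}) =
        (\<Sum>s\<in>UNIV. 2 * card {(i, j). i < j \<and> a $ s $ i = a $ s $ j} + CARD('n))" by simp
    then show ?thesis by (simp add: card_SigmaI sum.distrib sum_distrib_left)
  qed
  ultimately show ?thesis by simp
qed

subsection \<open>Smoothness of matrix expressions\<close>

lemma vec_lambda_eq_sum_axis: "(\<chi> i. f i) = (\<Sum>i\<in>UNIV. axis i (f i))" for f :: "'i::finite \<Rightarrow> 'a::real_vector"
  by (simp add: vec_eq_iff axis_def)

lemma linear_axis: "linear (axis i :: 'a::real_vector \<Rightarrow> 'a^'i)"
  by (rule linearI) (simp_all add: vec_eq_iff axis_def)

lemma bounded_linear_axis: "bounded_linear (axis i :: 'a::euclidean_space \<Rightarrow> 'a^'i)"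
  unfolding linear_conv_bounded_linear[symmetric] by (rule linear_axis)

lemma smooth_on_vec_lambda:
  fixes f :: "'a::euclidean_space \<Rightarrow> 'i::finite \<Rightarrow> 'b::euclidean_space"
  assumes "open U" "\<And>i. smooth_on U (\<lambda>x. f x i)"
  shows "smooth_on U (\<lambda>x. \<chi> i. f x i)"
  unfolding vec_lambda_eq_sum_axis by (intro smooth_on_sum smooth_on_linear[OF linear_axis] assms)

lemma has_derivative_vec_lambda:
  fixes f :: "'a::euclidean_space \<Rightarrow> 'i::finite \<Rightarrow> 'b::euclidean_space"
  assumes "\<And>i. ((\<lambda>x. f x i) has_derivative (\<lambda>h. f' h i)) F"
  shows "((\<lambda>x. \<chi> i. f x i) has_derivative (\<lambda>h. \<chi> i. f' h i)) F"
  unfolding vec_lambda_eq_sum_axis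
  by (intro has_derivative_sum bounded_linear.has_derivative[OF bounded_linear_axis] assms)

lemma smooth_on_nth: "open U \<Longrightarrow> smooth_on U f \<Longrightarrow> smooth_on U (\<lambda>x. f x $ i)" for f :: "'a::euclidean_space \<Rightarrow> 'b::euclidean_space^'i"
  by (rule smooth_on_bounded_linear[OF bounded_linear_vec_nth])

lemma Ck_on_expi: "Ck_on k UNIV expi"
proof (induction k)
  case 0
  then show ?case unfolding expi_def by (auto intro!: continuous_intros)
next
  case (Suc k)
  show ?case
  proof (rule Ck_on_SucI)
    show "(expi has_derivative (\<lambda>v. v *\<^sub>R (2 * of_real pi * \<i> * expi x))) (at x)" for x
    proof -
      have "((\<lambda>t. 2 * of_real pi * \<i> * complex_of_real t) has_derivative (\<lambda>v. 2 * of_real pi * \<i> * of_real v)) (at x)"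
        by (intro bounded_linear.has_derivative[OF bounded_linear_mult_right] has_derivative_of_real has_derivative_ident)
      from has_derivative_compose[OF this DERIV_exp[unfolded has_field_derivative_def]]
      show ?thesis unfolding expi_def by (simp add: scaleR_conv_of_real mult_ac)
    qed
    show "Ck_on k UNIV (\<lambda>x. v *\<^sub>R (2 * of_real pi * \<i> * expi x))" for v
      by (rule Ck_on_bounded_linear[where L = "\<lambda>z. v *\<^sub>R (2 * of_real pi * \<i> * z)", OF _ open_UNIV Suc])
         (intro bounded_linear_const_scaleR bounded_linear_mult_right)
  qed auto
qed

lemma smooth_on_expi: "open U \<Longrightarrow> smooth_on U f \<Longrightarrow> smooth_on U (\<lambda>x. expi (f x))"
  by (rule smooth_on_compose[where V = UNIV]) (auto simp: smooth_on_def Ck_on_expi)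

lemma smooth_on_dg: "open U \<Longrightarrow> smooth_on U f \<Longrightarrow> smooth_on U (\<lambda>x. dg (f x))"
  unfolding dg_def
proof (intro smooth_on_vec_lambda)
  fix i j assume "open U" "smooth_on U f"
  then show "smooth_on U (\<lambda>x. if i = j then expi (f x $ i) else 0)"
    by (cases "i = j") (auto intro!: smooth_on_expi smooth_on_nth smooth_on_const)
qed

lemmas smooth_on_matrix_mult = smooth_on_bounded_bilinear[OF bounded_bilinear_matrix_mult]
lemmas smooth_on_matrix_linear = smooth_on_linear[OF linear_adj] smooth_on_linear[OF linear_cj]
  smooth_on_linear[OF linear_transpose]
lemmas smooth_intros = smooth_on_vec_lambda smooth_on_matrix_mult smooth_on_matrix_linear smooth_on_dg
  smooth_on_add smooth_on_diff smooth_on_minus smooth_on_nth smooth_on_fst smooth_on_snd smooth_on_Pair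
  smooth_on_const smooth_on_id

lemmas has_derivative_matrix_mult = bounded_bilinear.FDERIV[OF bounded_bilinear_matrix_mult]
lemmas has_derivative_matrix_linear = bounded_linear.has_derivative[OF bounded_linear_adj]
  bounded_linear.has_derivative[OF bounded_linear_cj] bounded_linear.has_derivative[OF bounded_linear_transpose]

section \<open>The system of equations for frames and its linearization at the base frame\<close>

subsection \<open>The equations for frames\<close>

text \<open>The matrix p_s D(-b_s) p_s^T that should be p_(s+1) p_(s+1)^T, expressed in the frame
  p_(s+1). For unitary \<open>p\<close> it is symmetric and unitary, and the frame condition says
  that it is the identity.\<close>

definition mismatch :: "('n::finite, 'l::{finite,linorder}) mats \<Rightarrow> ('n, 'l) spectra \<Rightarrow> 'l \<Rightarrow> 'n cmat" where
  "mismatch p b s = adj (p $ cyc_next s) ** (p $ s ** dg (- (b $ s)) ** transpose (p $ s)) ** cj (p $ cyc_next s)"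

definition mean_trace :: "('n::finite, 'l::finite) mats \<Rightarrow> complex" where
  "mean_trace q = (\<Sum>s\<in>UNIV. trace (q $ s)) / of_nat (CARD('l) * CARD('n))"

text \<open>Subtracts the average trace over all positions \<open>s\<close> together, a single
  scalar; the individual traces stay constrained.\<close>

definition trace_free :: "('n::finite, 'l::finite) mats \<Rightarrow> ('n, 'l) mats" where
  "trace_free q = (\<chi> s. q $ s - mat (mean_trace q))"

lemma linear_trace: "linear (trace :: complex^'n^'n \<Rightarrow> complex)"
  by (rule linearI) (simp_all add: trace_def sum.distrib scaleR_sum_right)

lemma linear_trace_free: "linear (trace_free :: ('n::finite, 'l::finite) mats \<Rightarrow> _)"
proof (rule linearI)
  show "trace_free (x + y) = trace_free x + trace_free y"
    for x y :: "('n::finite, 'l::finite) mats"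
    by (simp add: trace_free_def mean_trace_def vec_eq_iff mat_nth linear_add[OF linear_trace] sum.distrib add_divide_distrib)
  show "trace_free (r *\<^sub>R x) = r *\<^sub>R trace_free x"
    for r and x :: "('n::finite, 'l::finite) mats"
    by (simp add: trace_free_def mean_trace_def vec_eq_iff mat_nth linear_cmul[OF linear_trace] scaleR_diff_right
        divide_inverse flip: scaleR_sum_right)
qed

lemma trace_mat: "trace (mat c :: complex^'n^'n) = of_nat CARD('n) * c"
  by (simp add: trace_def mat_nth)

lemma sum_trace_trace_free: "(\<Sum>s\<in>UNIV. trace (trace_free q $ s)) = 0" for q :: "('n::finite, 'l::finite) mats"
  by (simp add: trace_free_def trace_sub trace_mat sum_subtractf mean_trace_def)

lemma trace_cj: "trace (cj A) = cnj (trace A)" by (simp add: trace_def)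

definition hermitian_tuples :: "('n::finite, 'l::finite) mats set" where
  "hermitian_tuples = {h. \<forall>s. adj (h $ s) = h $ s}"

definition imaginary_symmetric_tuples :: "('n::finite, 'l::finite) mats set" where
  "imaginary_symmetric_tuples = {q. \<forall>s. transpose (q $ s) = q $ s \<and> cj (q $ s) = - (q $ s)}"

definition trace_free_tuples :: "('n::finite, 'l::finite) mats set" where
  "trace_free_tuples = {q \<in> imaginary_symmetric_tuples. (\<Sum>s\<in>UNIV. trace (q $ s)) = 0}"

lemma subspace_hermitian_tuples: "subspace hermitian_tuples"
  by (auto simp: subspace_def hermitian_tuples_def matrix_linear_simps)

lemma subspace_imaginary_symmetric_tuples: "subspace imaginary_symmetric_tuples"
  by (auto simp: subspace_def imaginary_symmetric_tuples_def matrix_linear_simps)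

lemma subspace_trace_free_tuples: "subspace trace_free_tuples"
  using subspace_imaginary_symmetric_tuples
  by (auto simp: subspace_def trace_free_tuples_def sum.distrib linear_add[OF linear_trace]
      linear_cmul[OF linear_trace] linear_0[OF linear_trace] simp flip: scaleR_sum_right)

lemma subspace_gauge_algebra: "subspace (gauge_algebra a)"
  by (auto simp: subspace_def gauge_algebra_def matrix_linear_simps)

lemma subspace_skew_hermitian: "subspace {z. adj z = - z}"
  by (auto simp: subspace_def matrix_linear_simps)

lemma trace_free_in:
  assumes "q \<in> imaginary_symmetric_tuples"
  shows "trace_free q \<in> trace_free_tuples"
proof -
  have cj: "cj (q $ s) = - q $ s" and tr: "transpose (q $ s) = q $ s" for s
    using assms by (auto simp: imaginary_symmetric_tuples_def)
  have "cnj (trace (q $ s)) = - trace (q $ s)" for s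
    unfolding trace_cj[symmetric] cj by (rule linear_neg[OF linear_trace])
  then have "cnj (mean_trace q) = - mean_trace q"
    by (simp add: mean_trace_def sum_negf)
  then have "cj (mat (mean_trace q) :: 'a cmat) = - mat (mean_trace q)"
    by (simp add: vec_eq_iff mat_nth)
  then have "trace_free q \<in> imaginary_symmetric_tuples"
    by (simp add: imaginary_symmetric_tuples_def trace_free_def matrix_linear_simps cj tr)
  then show ?thesis by (simp add: trace_free_tuples_def sum_trace_trace_free)
qed

lemma inner_trace_free:
  assumes "q \<in> trace_free_tuples"
  shows "inner (trace_free x) q = inner x q"
proof -
  have "inner (mat c) (q $ s) = Re (cnj c * trace (q $ s))" for c s
    by (simp add: inner_matrix trace_def mat_mult_nth sum_distrib_left)
  then have "(\<Sum>s\<in>UNIV. inner (mat (mean_trace x)) (q $ s)) = Re (cnj (mean_trace x) * (\<Sum>s\<in>UNIV. trace (q $ s)))"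
    by (simp only: sum_distrib_left Re_sum)
  also have "\<dots> = 0" using assms by (simp add: trace_free_tuples_def)
  finally show ?thesis by (simp add: inner_vec_def[of _ q] trace_free_def inner_diff_left sum_subtractf)
qed

lemma trace_free_id: "(\<Sum>s\<in>UNIV. trace (q $ s)) = 0 \<Longrightarrow> trace_free q = q"
  by (simp add: trace_free_def mean_trace_def vec_eq_iff)

text \<open>The orthogonal complement of the single vector with all components i times the
  identity.\<close>

lemma dim_trace_free_tuples:
  "2 * dim (trace_free_tuples :: ('n::{finite,linorder}, 'l::finite) mats set) + 2 = CARD('l) * (CARD('n)^2 + CARD('n))"
proof -
  let ?e = "(\<chi> s. mat \<i>) :: ('n, 'l) mats"
  let ?V = "imaginary_symmetric_tuples :: ('n, 'l) mats set"
  have e: "?e \<in> ?V" by (simp add: imaginary_symmetric_tuples_def vec_eq_iff mat_nth)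
  have ie: "inner ?e q = Im (\<Sum>s\<in>UNIV. trace (q $ s))" for q
    by (simp add: inner_vec_def[of _ q] inner_matrix trace_def mat_mult_nth)
  have re: "Re (\<Sum>s\<in>UNIV. trace (q $ s)) = 0" if "q \<in> ?V" for q
  proof -
    have "cj (q $ s) = - q $ s" for s using that by (simp add: imaginary_symmetric_tuples_def)
    from arg_cong[OF this, of trace] have "cnj (trace (q $ s)) = - trace (q $ s)" for s
      by (simp add: trace_cj linear_neg[OF linear_trace])
    from arg_cong[OF this, of Re] have "Re (trace (q $ s)) = 0" for s by simp
    then show ?thesis by simp
  qed
  have "trace_free_tuples = {y \<in> ?V. \<forall>x\<in>span {?e}. orthogonal x y}"
    using re ie by (auto simp: trace_free_tuples_def orthogonal_def span_singleton complex_eq_iff dest: spec[of _ 1])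
  moreover have "dim {y \<in> ?V. \<forall>x\<in>span {?e}. orthogonal x y} + dim (span {?e}) = dim ?V"
  proof (intro dim_subspace_orthogonal_to_vectors subspace_span subspace_imaginary_symmetric_tuples)
    show "span {?e} \<subseteq> ?V"
      using e by (intro span_minimal subspace_imaginary_symmetric_tuples) simp
  qed
  moreover have "dim (span {?e}) = 1"
  proof -
    have "?e \<noteq> 0" by (simp add: vec_eq_iff mat_nth)
    then show ?thesis by (simp add: dim_singleton)
  qed
  moreover have "2 * dim ?V = CARD('l) * (CARD('n)^2 + CARD('n))"
    using dim_imaginary_symmetric_tuples[where 'n = 'n and 'l = 'l] by (simp add: imaginary_symmetric_tuples_def)
  ultimately show ?thesis by simp
qed

text \<open>The base point: an irreducible representation with a chosen frame \<open>p0\<close> and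
  sorted spectrum \<open>a\<close>.\<close>

locale irreducible_frame =
  fixes \<rho> :: "('n::{finite,linorder}, 'l::{finite,linorder}) mats" and p0 :: "('n, 'l) mats" and a :: "('n, 'l) spectra"
  assumes irr: "irreducible_rep \<rho>" and frame0: "frame \<rho> p0 a" and spec_a: "spectral a"
begin

text \<open>The involution of the s-th Lagrangian is v -> \<open>sym s\<close> cnj(v).\<close>

definition sym :: "'l \<Rightarrow> 'n cmat" where "sym s = p0 $ s ** transpose (p0 $ s)"

lemma unitary_p0 [simp]: "unitary (p0 $ s)" using frame0 by (simp add: frame_def)

lemma unitary_sym [simp]: "unitary (sym s)" by (simp add: sym_def unitary_mult unitary_transpose)

lemma transpose_sym [simp]: "transpose (sym s) = sym s" by (simp add: sym_def transpose_mult)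

lemma cj_sym [simp]: "cj (sym s) = adj (sym s)" by (metis adj_transpose transpose_sym)

lemma sym_next: "sym (cyc_next s) = p0 $ s ** dg (- (a $ s)) ** transpose (p0 $ s)"
  using frame0 by (simp add: frame_def sym_def)

lemma rho_frame: "\<rho> $ s = p0 $ s ** dg (a $ s) ** adj (p0 $ s)"
  using frame0 by (simp add: frame_def)

lemma rho_sym: "\<rho> $ s = sym s ** adj (sym (cyc_next s))"
  unfolding sym_next
  unfolding rho_frame sym_def by (simp add: adj_mult matrix_mul_assoc[symmetric])

text \<open>The assumption says that \<open>Q\<close> anticommutes with the involution of each
  Lagrangian. It then commutes with products of two of them, which include all
  \<open>\<rho> $ s\<close>, and Schur's lemma applies.\<close>

lemma anticommuting_scalar:
  assumes "\<And>s. sym s ** cj Q = - (Q ** sym s)"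
  obtains c where "Q = mat c"
proof -
  have 1: "cj Q ** adj (sym s) = - (adj (sym s) ** Q)" for s
  proof -
    have "cj (sym s ** cj Q) = cj (- (Q ** sym s))" by (simp only: assms)
    then have "adj (sym s) ** Q = - (cj Q ** adj (sym s))" by (simp add: cj_mult matrix_linear_simps)
    then show ?thesis by simp
  qed
  have "Q ** \<rho> $ s = \<rho> $ s ** Q" for s
  proof -
    have "Q ** \<rho> $ s = - (sym s ** cj Q ** adj (sym (cyc_next s)))"
      using assms[of s] by (simp add: rho_sym matrix_mul_assoc matrix_mult_linear_simps)
    also have "\<dots> = - (sym s ** (cj Q ** adj (sym (cyc_next s))))" by (simp add: matrix_mul_assoc)
    also have "\<dots> = \<rho> $ s ** Q" unfolding 1 rho_sym by (simp add: matrix_mult_linear_simps matrix_mul_assoc)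
    finally show ?thesis .
  qed
  then show ?thesis using commuting_scalar[OF irr] that by blast
qed

text \<open>The velocity at \<open>p0\<close> of the action of left unitary and right gauge factors;
  its image \<open>gauge_dirs\<close> is the tangent space of the gauge orbit.\<close>

definition lin_gauge :: "'n cmat \<times> ('n, 'l) mats \<Rightarrow> ('n, 'l) mats" where
  "lin_gauge x = (\<chi> s. fst x ** p0 $ s + p0 $ s ** snd x $ s)"

definition gauge_dirs :: "('n, 'l) mats set" where
  "gauge_dirs = lin_gauge ` ({z. adj z = - z} \<times> gauge_algebra a)"

lemma linear_lin_gauge: "linear lin_gauge"
  by (rule linearI) (simp_all add: lin_gauge_def vec_eq_iff[of "vec_lambda _"] matrix_mult_linear_simps scaleR_add_right)

lemma subspace_gauge_dirs: "subspace gauge_dirs"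
  unfolding gauge_dirs_def
  by (intro linear_subspace_image[OF linear_lin_gauge] subspace_Times subspace_skew_hermitian subspace_gauge_algebra)

definition lin_mismatch :: "('n, 'l) mats \<Rightarrow> 'l \<Rightarrow> 'n cmat" where
  "lin_mismatch y s = adj (y $ cyc_next s) ** sym (cyc_next s) ** cj (p0 $ cyc_next s)
    + adj (p0 $ cyc_next s) ** (y $ s ** dg (- (a $ s)) ** transpose (p0 $ s) + p0 $ s ** dg (- (a $ s)) ** transpose (y $ s)) ** cj (p0 $ cyc_next s)
    + adj (p0 $ cyc_next s) ** sym (cyc_next s) ** cj (y $ cyc_next s)"

text \<open>Three groups of equations: unitarity, the frame condition, and the slice condition. The
  frame condition uses only the imaginary part of the mismatch, which determines a symmetric unitary
  matrix near the identity, and only modulo a common trace, which determinants control. In this form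
  the derivative at the base point can be surjective onto a linear space.\<close>

definition eqs :: "('n, 'l) mats \<times> ('n, 'l) spectra \<Rightarrow> ('n, 'l) mats \<times> ('n, 'l) mats \<times> ('n, 'l) mats" where
  "eqs x = (let p = p0 + fst x in ((\<chi> s. adj (p $ s) ** p $ s - mat 1),
     trace_free (\<chi> s. mismatch p (a + snd x) s - cj (mismatch p (a + snd x) s)), proj gauge_dirs (fst x)))"

definition lin_eqs :: "('n, 'l) mats \<Rightarrow> ('n, 'l) mats \<times> ('n, 'l) mats \<times> ('n, 'l) mats" where
  "lin_eqs y = ((\<chi> s. adj (y $ s) ** p0 $ s + adj (p0 $ s) ** y $ s),
     trace_free (\<chi> s. lin_mismatch y s - cj (lin_mismatch y s)), proj gauge_dirs y)"

lemma smooth_on_eqs: "smooth_on UNIV eqs"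
  unfolding eqs_def Let_def mismatch_def
  by (intro smooth_on_linear[OF linear_trace_free] smooth_on_linear[OF linear_proj[OF subspace_gauge_dirs]]
      smooth_intros open_UNIV)

lemma mismatch_base: "mismatch p0 a s = mat 1"
  unfolding mismatch_def sym_next[symmetric] by (simp add: sym_def matrix_mul_assoc[symmetric])

lemma eqs_0: "eqs (0, 0) = 0"
  by (simp add: eqs_def mismatch_base linear_0[OF linear_proj[OF subspace_gauge_dirs]] zero_prod_def
      trace_free_def mean_trace_def vec_eq_iff trace_def mat_nth)

lemma has_derivative_eqs: "((\<lambda>y. eqs (y, 0)) has_derivative lin_eqs) (at 0)"
proof -
  have nth: "((\<lambda>y. (p0 + y) $ s) has_derivative (\<lambda>y. y $ s)) (at 0)" for s
    by (rule has_derivative_eq_rhs, simp only: vector_add_component,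
        rule has_derivative_add[OF has_derivative_const bounded_linear.has_derivative[OF bounded_linear_vec_nth has_derivative_ident]])
       simp
  have m: "((\<lambda>y. mismatch (p0 + y) a s) has_derivative (\<lambda>y. lin_mismatch y s)) (at 0)" for s
  proof -
    note X = has_derivative_matrix_mult[OF has_derivative_matrix_mult[OF
        bounded_linear.has_derivative[OF bounded_linear_adj nth[of "cyc_next s"]]
        has_derivative_matrix_mult[OF has_derivative_matrix_mult[OF nth[of s] has_derivative_const]
          bounded_linear.has_derivative[OF bounded_linear_transpose nth[of s]]]]
        bounded_linear.has_derivative[OF bounded_linear_cj nth[of "cyc_next s"]]]
    show ?thesis
      unfolding mismatch_def
      by (rule has_derivative_eq_rhs[OF X])
         (simp add: fun_eq_iff lin_mismatch_def sym_next matrix_mult_linear_simps matrix_mul_assoc algebra_simps)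
  qed
  have e: "((\<lambda>y. adj ((p0 + y) $ s) ** (p0 + y) $ s - mat 1) has_derivative (\<lambda>y. adj (y $ s) ** p0 $ s + adj (p0 $ s) ** y $ s)) (at 0)" for s
    by (rule has_derivative_eq_rhs[OF has_derivative_diff[OF has_derivative_matrix_mult[OF
          bounded_linear.has_derivative[OF bounded_linear_adj nth[of s]] nth[of s]] has_derivative_const]])
       (simp add: fun_eq_iff add.commute)
  show ?thesis
    unfolding eqs_def lin_eqs_def[abs_def] Let_def fst_conv snd_conv add_0_right
    by (intro has_derivative_Pair has_derivative_vec_lambda e has_derivative_diff has_derivative_matrix_linear m
        bounded_linear.has_derivative[OF linear_trace_free[unfolded linear_conv_bounded_linear]]
        bounded_linear.has_derivative[OF linear_proj[OF subspace_gauge_dirs, unfolded linear_conv_bounded_linear]]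
        has_derivative_ident)
qed

text \<open>The linear space in which \<open>eqs\<close> takes its values; it turns out to be
  exactly the range of the linearization.\<close>

definition eq_space :: "(('n, 'l) mats \<times> ('n, 'l) mats \<times> ('n, 'l) mats) set" where
  "eq_space = hermitian_tuples \<times> trace_free_tuples \<times> gauge_dirs"

lemma subspace_eq_space: "subspace eq_space"
  unfolding eq_space_def
  by (intro subspace_Times subspace_hermitian_tuples subspace_trace_free_tuples subspace_gauge_dirs)

lemma transpose_mismatch: "transpose (mismatch p b s) = mismatch p b s"
  by (simp add: mismatch_def transpose_mult matrix_mul_assoc)

lemma transpose_lin_mismatch: "transpose (lin_mismatch y s) = lin_mismatch y s"
  by (simp add: lin_mismatch_def transpose_mult matrix_linear_simps matrix_mult_linear_simps matrix_mul_assoc add_ac)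

lemma diff_cj_in:
  assumes "\<And>s. transpose (B s) = B s"
  shows "(\<chi> s. B s - cj (B s)) \<in> imaginary_symmetric_tuples"
proof -
  have "adj (B s) = cj (B s)" for s using assms by (metis transpose_cj cj_transpose)
  then show ?thesis by (simp add: imaginary_symmetric_tuples_def matrix_linear_simps assms)
qed

lemma eqs_in_eq_space: "eqs x \<in> eq_space"
  unfolding eqs_def Let_def eq_space_def
  by (intro mem_Times_iff[THEN iffD2] conjI)
     (auto simp: hermitian_tuples_def matrix_linear_simps adj_mult
       intro!: trace_free_in diff_cj_in transpose_mismatch proj_in subspace_gauge_dirs)

lemma lin_eqs_in_eq_space: "lin_eqs y \<in> eq_space"
  unfolding lin_eqs_def eq_space_def
  by (intro mem_Times_iff[THEN iffD2] conjI)
     (auto simp: hermitian_tuples_def matrix_linear_simps adj_mult add.commute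
       intro!: trace_free_in diff_cj_in transpose_lin_mismatch proj_in subspace_gauge_dirs)

lemma linear_lin_eqs: "linear lin_eqs" by (rule has_derivative_linear[OF has_derivative_eqs])

end

context irreducible_frame
begin

section \<open>Transversality from irreducibility, and the dimension of the fibre\<close>

subsection \<open>Transversality\<close>

text \<open>For a frame moving by infinitesimal rotations e_s, the relative rotation of two
  consecutive frames, written in the basis of the Lagrangian shared by both conditions.\<close>

definition link :: "('n, 'l) mats \<Rightarrow> 'l \<Rightarrow> 'n cmat" where
  "link e s = adj (p0 $ cyc_next s) ** (e $ s - e $ cyc_next s) ** p0 $ cyc_next s"

text \<open>To first order the mismatch is the imaginary part of the relative rotation: rotations
  real in a basis of the next Lagrangian preserve that Lagrangian.\<close>

lemma lin_mismatch_skew: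
  assumes sk: "\<And>s. adj (e $ s) = - (e $ s)" and y: "\<And>s. y $ s = e $ s ** p0 $ s"
  shows "lin_mismatch y s = link e s - cj (link e s)"
proof -
  let ?n = "cyc_next s"
  have te: "transpose (e $ s) = - cj (e $ s)" for s
    using arg_cong[OF sk[of s], of cj] by (simp add: matrix_linear_simps)
  have t1: "adj (y $ ?n) ** sym ?n ** cj (p0 $ ?n) = - (adj (p0 $ ?n) ** e $ ?n ** p0 $ ?n)"
    by (simp add: y sym_def adj_mult sk matrix_mult_linear_simps matrix_mul_assoc[symmetric])
  have t2: "y $ s ** dg (- (a $ s)) ** transpose (p0 $ s) = e $ s ** sym ?n"
    by (simp add: y sym_next matrix_mul_assoc)
  have t3: "p0 $ s ** dg (- (a $ s)) ** transpose (y $ s) = - (sym ?n ** cj (e $ s))"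
    by (simp add: y sym_next transpose_mult te matrix_mult_linear_simps matrix_mul_assoc)
  have t4: "adj (p0 $ ?n) ** sym ?n ** cj (y $ ?n) = transpose (p0 $ ?n) ** cj (e $ ?n) ** cj (p0 $ ?n)"
    by (simp add: y sym_def cj_mult matrix_mul_assoc)
  have t5: "adj (p0 $ ?n) ** (e $ s ** sym ?n) ** cj (p0 $ ?n) = adj (p0 $ ?n) ** e $ s ** p0 $ ?n"
    by (simp add: sym_def matrix_mul_assoc[symmetric])
  have t6: "adj (p0 $ ?n) ** (sym ?n ** cj (e $ s)) ** cj (p0 $ ?n) = transpose (p0 $ ?n) ** cj (e $ s) ** cj (p0 $ ?n)"
    by (simp add: sym_def matrix_mul_assoc)
  show ?thesis
    unfolding lin_mismatch_def t1 t2 t3 t4 matrix_mult_linear_simps t5 t6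
    by (simp add: link_def matrix_mult_linear_simps matrix_linear_simps cj_mult)
qed

lemma trace_link: "trace (link e s) = trace (e $ s) - trace (e $ cyc_next s)"
proof -
  have "trace (link e s) = trace (p0 $ cyc_next s ** (adj (p0 $ cyc_next s) ** (e $ s - e $ cyc_next s)))"
    unfolding link_def by (rule trace_mul_sym)
  then show ?thesis by (simp add: trace_sub)
qed

text \<open>The traces of the links telescope around the cycle, so \<open>trace_free\<close> acts as
  the identity here.\<close>

lemma lin_eqs_skew:
  assumes sk: "\<And>s. adj (e $ s) = - (e $ s)" and y: "\<And>s. y $ s = e $ s ** p0 $ s"
  shows "lin_eqs y = (0, (\<chi> s. 2 *\<^sub>R (link e s - cj (link e s))), proj gauge_dirs y)"
proof -
  have 1: "adj (y $ s) ** p0 $ s + adj (p0 $ s) ** y $ s = 0" for s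
    by (simp add: y adj_mult sk matrix_mult_linear_simps matrix_mul_assoc)
  have 2: "lin_mismatch y s - cj (lin_mismatch y s) = 2 *\<^sub>R (link e s - cj (link e s))" for s
    by (simp add: lin_mismatch_skew[OF sk y] matrix_linear_simps scaleR_2)
  have "trace (e $ s) = - cnj (trace (e $ s))" for s
  proof -
    have "cnj (trace (e $ s)) = trace (adj (e $ s))" by (simp add: trace_def)
    then show ?thesis by (simp add: sk linear_neg[OF linear_trace])
  qed
  then have tr: "cnj (trace (e $ s)) = - trace (e $ s)" for s by (metis minus_minus)
  have "(\<Sum>s\<in>UNIV. trace ((\<chi> s. 2 *\<^sub>R (link e s - cj (link e s))) $ s)) =
      (\<Sum>s\<in>UNIV. 4 * (trace (e $ s) - trace (e $ cyc_next s)))"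
    by (intro sum.cong refl)
       (simp add: linear_cmul[OF linear_trace] trace_sub trace_cj trace_link tr scaleR_conv_of_real[where 'a = complex])
  also have "\<dots> = 0"
    unfolding sum_distrib_left[symmetric] sum_subtractf sum_cyc_next[of "\<lambda>s. trace (e $ s)"] by simp
  finally have 3: "trace_free (\<chi> s. 2 *\<^sub>R (link e s - cj (link e s))) = (\<chi> s. 2 *\<^sub>R (link e s - cj (link e s)))"
    by (rule trace_free_id)
  show ?thesis unfolding lin_eqs_def 1 2 3 by (simp add: vec_eq_iff)
qed

text \<open>A gauge direction is the rotation by z + p_s x_s p_s^(-1). The global part
  \<open>z\<close> cancels in the links, and the remaining terms are real because
  \<open>x $ s\<close> commutes with \<open>dg (a $ s)\<close>.\<close>

lemma gauge_dirs_obtain: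
  assumes "y \<in> gauge_dirs"
  obtains e where "\<And>s. adj (e $ s) = - (e $ s)" "\<And>s. y $ s = e $ s ** p0 $ s" "\<And>s. cj (link e s) = link e s"
proof -
  obtain z x where z: "adj z = - z" and x: "x \<in> gauge_algebra a" and y: "y = lin_gauge (z, x)"
    using assms by (auto simp: gauge_dirs_def)
  define e where "e = (\<chi> s. z + p0 $ s ** x $ s ** adj (p0 $ s))"
  have xr: "cj (x $ s) = x $ s" "transpose (x $ s) = - x $ s" for s using x by (auto simp: gauge_algebra_def)
  then have xs: "adj (x $ s) = - x $ s" for s by (metis transpose_cj)
  have "x $ s $ i $ j = 0" if "(- a $ s) $ i \<noteq> (- a $ s) $ j" for s i j
    using x that by (simp add: gauge_algebra_def)
  then have xd: "dg (- a $ s) ** x $ s = x $ s ** dg (- a $ s)" for s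
    by (rule dg_commute)
  have "cj (link e s) = link e s" for s
  proof -
    \<comment> \<open>The transition between consecutive frames; the frame condition gives u u^T =
      D(-a_s), so conjugating a real matrix that commutes with D by \<open>u\<close> gives a real
      matrix.\<close>
    define u where "u = adj (p0 $ s) ** p0 $ cyc_next s"
    have u: "unitary u" by (simp add: u_def unitary_mult unitary_adj)
    have uu: "u ** transpose u = dg (- a $ s)"
    proof -
      have "u ** transpose u = adj (p0 $ s) ** sym (cyc_next s) ** cj (p0 $ s)"
        by (simp add: u_def transpose_mult sym_def matrix_mul_assoc)
      then show ?thesis by (simp add: sym_next matrix_mul_assoc[symmetric])
    qed
    have l: "link e s = adj u ** x $ s ** u - x $ cyc_next s"
      by (simp add: link_def e_def u_def adj_mult matrix_mult_linear_simps matrix_mul_assoc[symmetric])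
    have "u ** (transpose u ** x $ s ** cj u) = dg (- a $ s) ** x $ s ** cj u"
      unfolding uu[symmetric] by (simp add: matrix_mul_assoc)
    also have "\<dots> = x $ s ** (u ** transpose u) ** cj u"
      unfolding xd uu ..
    also have "\<dots> = u ** (adj u ** x $ s ** u)" using u by (simp add: matrix_mul_assoc[symmetric])
    finally have "transpose u ** x $ s ** cj u = adj u ** x $ s ** u"
      using unitary_cancel_left[OF u] by blast
    then show ?thesis unfolding l by (simp add: matrix_linear_simps cj_mult xr)
  qed
  moreover have "adj (e $ s) = - (e $ s)" for s
    by (simp add: e_def matrix_linear_simps adj_mult z xs matrix_mult_linear_simps matrix_mul_assoc)
  moreover have "y $ s = e $ s ** p0 $ s" for s
    by (simp add: y lin_gauge_def e_def matrix_mult_linear_simps matrix_mul_assoc[symmetric])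
  ultimately show ?thesis using that by blast
qed

lemma lin_eqs_gauge: "y \<in> gauge_dirs \<Longrightarrow> lin_eqs y = (0, 0, y)"
proof -
  assume y: "y \<in> gauge_dirs"
  then obtain e where e: "\<And>s. adj (e $ s) = - (e $ s)" "\<And>s. y $ s = e $ s ** p0 $ s" "\<And>s. cj (link e s) = link e s"
    by (rule gauge_dirs_obtain) (rule that)
  show ?thesis
    unfolding lin_eqs_skew[OF e(1,2)] e(3) by (simp add: proj_id[OF subspace_gauge_dirs y] vec_eq_iff[of "vec_lambda _"])
qed

text \<open>A direction orthogonal to the range gives one skew-Hermitian matrix that anticommutes with all the
  involutions, hence is scalar by irreducibility.\<close>

lemma orthogonal_to_range:
  assumes x: "(h, q, g) \<in> eq_space" and orth: "\<And>y. inner (lin_eqs y) (h, q, g) = 0"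
  shows "(h, q, g) = 0"
proof -
  have h: "\<And>s. adj (h $ s) = h $ s" and q: "q \<in> trace_free_tuples" and g: "g \<in> gauge_dirs"
    using x by (auto simp: eq_space_def hermitian_tuples_def)
  have qs: "transpose (q $ s) = q $ s" "cj (q $ s) = - q $ s" for s
    using q by (auto simp: trace_free_tuples_def imaginary_symmetric_tuples_def)
  then have qa: "adj (q $ s) = - q $ s" for s by (metis transpose_cj cj_transpose)
  \<comment> \<open>On gauge directions the linearization is the identity into the third
    component.\<close>
  have g0: "g = 0" using orth[of g] by (simp add: lin_eqs_gauge[OF g])
  define Q where "Q s = p0 $ cyc_next s ** q $ s ** adj (p0 $ cyc_next s)" for s
  have Qa: "adj (Q s) = - Q s" for s
    by (simp add: Q_def adj_mult qa matrix_mult_linear_simps matrix_mul_assoc)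
  define prv where "prv = inv (cyc_next :: 'l \<Rightarrow> 'l)"
  have prv: "prv (cyc_next s) = s" "cyc_next (prv s) = s" for s
    by (simp_all add: prv_def inv_f_f[OF bij_is_inj[OF bij_cyc_next]] surj_f_inv_f[OF bij_is_surj[OF bij_cyc_next]])
  \<comment> \<open>This test direction turns the pairing, after summation by parts around the
    cycle, into a multiple of the sum of \<open>inner (e $ s) (e $ s)\<close>.\<close>
  define e where "e = (\<chi> s. Q s - Q (prv s))"
  have e: "adj (e $ s) = - (e $ s)" for s by (simp add: e_def matrix_linear_simps Qa)
  have "0 = inner (lin_eqs (\<chi> s. e $ s ** p0 $ s)) (h, q, g)" using orth by simp
  also have "\<dots> = (\<Sum>s\<in>UNIV. inner (2 *\<^sub>R (link e s - cj (link e s))) (q $ s))"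
    by (subst lin_eqs_skew[OF e]) (simp_all add: g0 inner_vec_def[of _ q])
  also have "\<dots> = (\<Sum>s\<in>UNIV. 4 * inner (link e s) (q $ s))"
  proof (intro sum.cong refl)
    fix s
    have "inner (cj (link e s)) (q $ s) = inner (link e s) (cj (q $ s))"
      using inner_cj[of "link e s" "cj (q $ s)"] unfolding cj_cj .
    then have "inner (cj (link e s)) (q $ s) = - inner (link e s) (q $ s)" by (simp add: qs)
    then show "inner (2 *\<^sub>R (link e s - cj (link e s))) (q $ s) = 4 * inner (link e s) (q $ s)"
      by (simp add: inner_diff_left)
  qed
  also have "\<dots> = 4 * (\<Sum>s\<in>UNIV. inner (e $ s - e $ cyc_next s) (Q s))"
  proof -
    have "inner (link e s) (q $ s) = inner (e $ s - e $ cyc_next s) (Q s)" for s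
      unfolding link_def inner_mult_right[of "adj (p0 $ cyc_next s) ** (e $ s - e $ cyc_next s)"]
        inner_mult_left[of "adj (p0 $ cyc_next s)" "e $ s - e $ cyc_next s"]
      by (simp add: Q_def matrix_mul_assoc)
    then show ?thesis by (simp add: sum_distrib_left)
  qed
  also have "(\<Sum>s\<in>UNIV. inner (e $ s - e $ cyc_next s) (Q s)) = (\<Sum>s\<in>UNIV. inner (e $ s) (e $ s))"
  proof -
    have "(\<Sum>s\<in>UNIV. inner (e $ cyc_next s) (Q (prv (cyc_next s)))) = (\<Sum>s\<in>UNIV. inner (e $ s) (Q (prv s)))"
      by (rule sum_cyc_next)
    then show ?thesis
      by (simp add: inner_diff_left sum_subtractf prv) (simp add: e_def inner_diff_right sum_subtractf inner_diff_left)
  qed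
  finally have "(\<Sum>s\<in>UNIV. inner (e $ s) (e $ s)) = 0" by simp
  then have "\<forall>s\<in>UNIV. inner (e $ s) (e $ s) = 0" by (subst (asm) sum_nonneg_eq_0_iff) auto
  then have "Q s = Q (prv s)" for s by (simp add: e_def)
  from this[of "cyc_next s" for s] have "Q (cyc_next s) = Q s" for s by (simp add: prv)
  then have Qc: "Q s = Q t" for s t by (rule cyc_invariant)
  define Q0 where "Q0 = Q undefined"
  have Q0: "Q s = Q0" for s using Qc by (simp add: Q0_def)
  have "sym s ** cj Q0 = - (Q0 ** sym s)" for s
  proof -
    have "sym (cyc_next (prv s)) ** cj (Q (prv s)) = - (Q (prv s) ** sym (cyc_next (prv s)))"
      by (simp add: Q_def sym_def cj_mult qs matrix_mult_linear_simps matrix_mul_assoc[symmetric])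
    then show ?thesis by (simp add: prv Q0)
  qed
  then obtain c where c: "Q0 = mat c" by (rule anticommuting_scalar)
  have qc: "q $ s = mat c" for s
  proof -
    have "q $ s = adj (p0 $ cyc_next s) ** Q s ** p0 $ cyc_next s"
      by (simp add: Q_def matrix_mul_assoc[symmetric])
    also have "\<dots> = mat c" unfolding Q0 c mat_mult_commute[of c, symmetric] by (simp add: matrix_mul_assoc[symmetric])
    finally show ?thesis .
  qed
  \<comment> \<open>All \<open>q $ s\<close> are the same scalar, which the trace condition makes
    zero.\<close>
  have "(\<Sum>s\<in>UNIV. trace (q $ s)) = of_nat CARD('l) * (of_nat CARD('n) * c)" by (simp add: qc trace_mat)
  then have "c = 0" using q by (simp add: trace_free_tuples_def)
  then have q0: "q = 0" by (simp add: vec_eq_iff[of q] qc)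
  \<comment> \<open>With \<open>q\<close> and \<open>g\<close> gone, stretching the frame by the
    Hermitian \<open>h\<close> itself detects \<open>h\<close>.\<close>
  have "0 = inner (lin_eqs (\<chi> s. p0 $ s ** h $ s)) (h, q, g)" using orth by simp
  also have "\<dots> = inner (\<chi> s. h $ s + h $ s) h"
    by (simp add: lin_eqs_def q0 g0 adj_mult h matrix_mul_assoc[symmetric])
  also have "(\<chi> s. h $ s + h $ s) = h + h" by (simp only: vec_eq_iff vector_add_component vec_lambda_beta) blast
  also have "inner (h + h) h = 2 * inner h h" by (simp only: inner_add_left mult_2)
  finally have "h = 0" by simp
  then show ?thesis using q0 g0 by (simp add: zero_prod_def)
qed

lemma range_lin_eqs: "range lin_eqs = eq_space"
proof
  show "range lin_eqs \<subseteq> eq_space" using lin_eqs_in_eq_space by blast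
  have R: "subspace (range lin_eqs)" by (rule linear_subspace_image[OF linear_lin_eqs subspace_UNIV])
  show "eq_space \<subseteq> range lin_eqs"
  proof
    fix w assume w: "w \<in> eq_space"
    let ?p = "proj (range lin_eqs) w"
    have pr: "?p \<in> range lin_eqs" by (rule proj_in[OF R])
    then have "?p \<in> eq_space" using lin_eqs_in_eq_space by auto
    then have d: "w - ?p \<in> eq_space" using w by (rule subspace_diff[OF subspace_eq_space, rotated])
    have "inner (lin_eqs y) (w - ?p) = 0" for y
      using proj_orth[OF R, of "lin_eqs y" w] by (simp add: inner_commute)
    then have "w - ?p = 0" using orthogonal_to_range d by (metis prod.exhaust)
    then show "w \<in> range lin_eqs" using pr by simp
  qed
qed

text \<open>The tangent space at \<open>p0\<close> of frames with fixed spectrum inside the slice;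
  it is the model of the fibre.\<close>

definition fibre_space :: "('n, 'l) mats set" where "fibre_space = {y. lin_eqs y = 0}"

lemma subspace_fibre_space: "subspace fibre_space"
  unfolding fibre_space_def by (rule subspace_kernel[OF linear_lin_eqs])

lemma fibre_space_obtain:
  assumes "f \<in> fibre_space"
  obtains e where "\<And>s. adj (e $ s) = - (e $ s)" "\<And>s. f $ s = e $ s ** p0 $ s" "\<And>s. cj (link e s) = link e s"
    "\<And>g. g \<in> gauge_dirs \<Longrightarrow> inner f g = 0"
proof -
  define e where "e = (\<chi> s. f $ s ** adj (p0 $ s))"
  have f: "f $ s = e $ s ** p0 $ s" for s by (simp add: e_def matrix_mul_assoc[symmetric])
  have L: "lin_eqs f = 0" using assms by (simp add: fibre_space_def)
  then have 1: "adj (f $ s) ** p0 $ s + adj (p0 $ s) ** f $ s = 0" for s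
    by (auto simp: lin_eqs_def zero_prod_def vec_eq_iff[of _ 0])
  have e: "adj (e $ s) = - (e $ s)" for s
  proof -
    have "p0 $ s ** (adj (f $ s) ** p0 $ s + adj (p0 $ s) ** f $ s) ** adj (p0 $ s) = 0"
      by (simp only: 1 matrix_mult_linear_simps)
    then have "adj (e $ s) + e $ s = 0"
      by (simp add: e_def adj_mult matrix_mult_linear_simps matrix_mul_assoc[symmetric])
    then show ?thesis by (simp add: add_eq_0_iff2)
  qed
  have "(0 :: ('n, 'l) mats, (\<chi> s. 2 *\<^sub>R (link e s - cj (link e s))) :: ('n, 'l) mats, proj gauge_dirs f) = 0"
    using L unfolding lin_eqs_skew[OF e f] .
  then have p: "proj gauge_dirs f = 0" and l: "(\<chi> s. 2 *\<^sub>R (link e s - cj (link e s))) = (0 :: ('n, 'l) mats)"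
    by (simp_all add: zero_prod_def)
  have "cj (link e s) = link e s" for s
    using arg_cong[OF l, of "\<lambda>A. A $ s"] by simp
  moreover have "inner f g = 0" if "g \<in> gauge_dirs" for g
    using proj_orth[OF subspace_gauge_dirs that, of f] p by simp
  ultimately show ?thesis using e f that[of e] by simp
qed

text \<open>The commutation hypothesis says that the first-order change of the representation is
  that of a conjugation. Such an \<open>f\<close> is shown to be a gauge direction, and vectors of
  \<open>fibre_space\<close> are orthogonal to gauge directions.\<close>

lemma fibre_space_immersion:
  assumes f: "f \<in> fibre_space" and e: "\<And>s. adj (e $ s) = - (e $ s)" "\<And>s. f $ s = e $ s ** p0 $ s"
    "\<And>s. cj (link e s) = link e s"
    and comm: "\<And>s. (z + e $ s) ** \<rho> $ s = \<rho> $ s ** (z + e $ s)"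
  shows "f = 0" "\<exists>c. z = mat c"
proof -
  have u: "unitary (\<rho> $ s)" for s using irr by (simp add: irreducible_rep_def is_rep_def)
  have adj_comm: "adj X ** \<rho> $ s = \<rho> $ s ** adj X" if "X ** \<rho> $ s = \<rho> $ s ** X" for X s
  proof -
    have "\<rho> $ s ** adj (X ** \<rho> $ s) ** \<rho> $ s = \<rho> $ s ** adj (\<rho> $ s ** X) ** \<rho> $ s" by (simp add: that)
    then show ?thesis using u by (simp add: adj_mult matrix_mul_assoc[symmetric])
  qed
  have zz: "adj (z + adj z) = z + adj z" by (simp add: linear_add[OF linear_adj] add.commute)
  have zc: "(z + adj z) ** \<rho> $ s = \<rho> $ s ** (z + adj z)" for s
  proof -
    have "(z + e $ s + adj (z + e $ s)) ** \<rho> $ s = \<rho> $ s ** (z + e $ s + adj (z + e $ s))"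
      unfolding matrix_mult_linear_simps(1,2) using comm[of s] adj_comm[OF comm[of s]]
      by (simp add: matrix_mult_linear_simps)
    then show ?thesis by (simp add: matrix_linear_simps e)
  qed
  obtain r where r: "z + adj z = mat (of_real r)"
    using commuting_hermitian_scalar[OF irr zz zc] by blast
  \<comment> \<open>Removing the scalar Hermitian part of \<open>z\<close> changes no commutator and
    leaves a skew-Hermitian matrix.\<close>
  define w where "w = z - mat (of_real (r / 2))"
  have w: "adj w = - w"
  proof -
    have "adj z = mat (of_real r) - z" using r by (metis add_diff_cancel_left')
    moreover have "(mat (of_real r) :: 'n cmat) = mat (of_real (r / 2)) + mat (of_real (r / 2))"
      unfolding mat_add by (simp flip: of_real_add)
    ultimately show ?thesis by (simp add: w_def matrix_linear_simps)
  qed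
  define om where "om s = w + e $ s" for s
  have om_skew: "adj (om s) = - om s" for s by (simp add: om_def matrix_linear_simps w e)
  have om_comm: "om s ** \<rho> $ s = \<rho> $ s ** om s" for s
  proof -
    have "om s = z + e $ s - mat (of_real (r / 2))" by (simp add: om_def w_def)
    then show ?thesis using comm[of s] by (simp add: matrix_mult_linear_simps mat_mult_commute)
  qed
  \<comment> \<open>Conjugation by the involution of the s-th Lagrangian. Since
    \<open>\<rho> $ s\<close> is a product of two consecutive involutions, these act alike on
    matrices commuting with it.\<close>
  define tau where "tau s X = sym s ** cj X ** adj (sym s)" for s X
  have tau_tau: "tau s (tau s X) = X" for s X
    by (simp add: tau_def cj_mult matrix_mul_assoc[symmetric])
  have tau_mult: "tau s (X ** Y) = tau s X ** tau s Y" for s X Y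
    by (simp add: tau_def cj_mult matrix_mul_assoc[symmetric])
  have tau_diff: "tau s (X - Y) = tau s X - tau s Y" for s X Y
    by (simp add: tau_def matrix_linear_simps matrix_mult_linear_simps)
  have tau_mat: "tau s (mat c) = mat (cnj c)" for s c
    unfolding tau_def cj_mat mat_mult_commute[of "cnj c" "sym s", symmetric] by (simp add: matrix_mul_assoc[symmetric])
  have tau_rho: "tau (cyc_next s) (\<rho> $ s) = adj (\<rho> $ s)" for s
    by (simp add: tau_def rho_sym cj_mult adj_mult matrix_mul_assoc[symmetric])
  have tau_om: "tau s (om s) = tau (cyc_next s) (om s)" for s
  proof -
    let ?Y = "tau (cyc_next s) (om s)"
    have "?Y ** adj (\<rho> $ s) = adj (\<rho> $ s) ** ?Y"
      unfolding tau_rho[symmetric] tau_mult[symmetric] om_comm ..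
    then have "\<rho> $ s ** (?Y ** adj (\<rho> $ s)) = ?Y" using u by simp
    moreover have "tau s (om s) = \<rho> $ s ** ?Y ** adj (\<rho> $ s)"
      by (simp add: tau_def rho_sym adj_mult matrix_mul_assoc[symmetric])
    ultimately show ?thesis by (simp add: matrix_mul_assoc)
  qed
  have link_tau: "tau (cyc_next s) (om s - om (cyc_next s)) = om s - om (cyc_next s)" for s
  proof -
    let ?p = "p0 $ cyc_next s" and ?d = "e $ s - e $ cyc_next s"
    have "?p ** cj (link e s) ** adj ?p = ?p ** link e s ** adj ?p" by (simp add: e)
    then have "?p ** (transpose ?p ** cj ?d ** cj ?p) ** adj ?p = ?d"
      by (simp add: link_def cj_mult matrix_mul_assoc[symmetric])
    then have "tau (cyc_next s) ?d = ?d" by (simp add: tau_def sym_def adj_mult matrix_mul_assoc)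
    then show ?thesis by (simp add: om_def)
  qed
  \<comment> \<open>The failure of \<open>om s\<close> to be fixed by the s-th involution. Reality
    of the links makes it independent of \<open>s\<close>, so it anticommutes with all involutions
    and is scalar.\<close>
  define th where "th s = om s - tau s (om s)" for s
  have "th (cyc_next s) = th s" for s
    using link_tau[of s] unfolding th_def tau_om[of s] tau_diff by (simp add: algebra_simps)
  then have thc: "th s = th t" for s t by (rule cyc_invariant)
  define th0 where "th0 = th undefined"
  have th0: "th s = th0" for s using thc by (simp add: th0_def)
  have tau_th: "tau s th0 = - th0" for s
    unfolding th0[of s, symmetric] th_def by (simp add: tau_diff tau_tau)
  have "sym s ** cj th0 = - (th0 ** sym s)" for s
  proof -
    have "tau s th0 ** sym s = - th0 ** sym s" by (simp add: tau_th)
    then show ?thesis by (simp add: tau_def matrix_mult_linear_simps matrix_mul_assoc[symmetric])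
  qed
  then obtain c where c: "th0 = mat c" by (rule anticommuting_scalar)
  have "mat (cnj c) = (- mat c :: 'n cmat)" using tau_th unfolding c tau_mat by blast
  from arg_cong[OF this, of "\<lambda>A. A $ undefined $ undefined"]
  have cc: "cnj c = - c" by (simp add: mat_nth)
  then have cc2: "cnj (c / 2) = - (c / 2)" by simp
  \<comment> \<open>Removing half of this imaginary scalar makes \<open>k s\<close> fixed by the
    s-th involution, that is, real in the basis \<open>p0 $ s\<close>.\<close>
  define k where "k s = om s - mat (c / 2)" for s
  have half: "(mat c :: 'n cmat) = mat (c / 2) + mat (c / 2)" by (simp add: mat_add)
  have mneg: "(mat (- (c / 2)) :: 'n cmat) = - mat (c / 2)" by (simp add: vec_eq_iff mat_nth)
  have k_skew: "adj (k s) = - k s" for s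
    by (simp only: k_def matrix_linear_simps om_skew adj_mat cc2 mneg) simp
  have k_tau: "tau s (k s) = k s" for s
  proof -
    have "tau s (om s) = om s - mat c" using th0[of s] by (simp add: th_def c algebra_simps)
    then show ?thesis unfolding k_def tau_diff tau_mat cc2 mneg half by simp
  qed
  define x where "x = (\<chi> s. adj (p0 $ s) ** k s ** p0 $ s)"
  have "x \<in> gauge_algebra a"
    unfolding gauge_algebra_def
  proof (intro CollectI allI conjI impI)
    fix s
    have "adj (p0 $ s) ** tau s (k s) ** p0 $ s = cj (x $ s)"
      by (simp add: tau_def sym_def x_def cj_mult adj_mult matrix_mul_assoc[symmetric])
    then show cx: "cj (x $ s) = x $ s" by (simp add: k_tau x_def)
    have "adj (x $ s) = - x $ s" by (simp add: x_def adj_mult k_skew matrix_mult_linear_simps matrix_mul_assoc)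
    then show "transpose (x $ s) = - x $ s" by (metis cx adj_cj)
    have "k s ** \<rho> $ s = \<rho> $ s ** k s"
      using om_comm[of s] by (simp add: k_def matrix_mult_linear_simps mat_mult_commute)
    then have "adj (p0 $ s) ** (k s ** \<rho> $ s) ** p0 $ s = adj (p0 $ s) ** (\<rho> $ s ** k s) ** p0 $ s" by simp
    then have "dg (a $ s) ** x $ s = x $ s ** dg (a $ s)"
      by (simp add: x_def rho_frame matrix_mul_assoc[symmetric])
    then show "x $ s $ i $ j = 0" if "a $ s $ i \<noteq> a $ s $ j" for i j
      using dg_commute_iff[of "a $ s" "x $ s"] spec_a that by (auto simp: spectral_def)
  qed
  moreover have "adj (mat (c / 2) - w) = - (mat (c / 2) - w)"
    by (simp only: matrix_linear_simps w adj_mat cc2 mneg) simp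
  moreover have "f = lin_gauge (mat (c / 2) - w, x)"
  proof -
    have "e $ s = (mat (c / 2) - w) + k s" for s by (simp add: k_def om_def)
    then have "f $ s = (mat (c / 2) - w) ** p0 $ s + k s ** p0 $ s" for s
      unfolding e(2) by (simp add: matrix_mult_linear_simps)
    then show ?thesis by (simp add: vec_eq_iff[of f] lin_gauge_def x_def matrix_mul_assoc)
  qed
  ultimately have "f \<in> gauge_dirs" unfolding gauge_dirs_def by blast
  then have "inner f f = 0" using f by (metis fibre_space_obtain)
  then show f0: "f = 0" by simp
  then have "e $ s ** p0 $ s = 0 ** p0 $ s" for s
    using e(2)[of s] by (simp add: matrix_mult_linear_simps)
  then have "e $ s = 0" for s using unitary_cancel_right[OF unitary_p0] by blast
  then have "z ** \<rho> $ s = \<rho> $ s ** z" for s using comm[of s] by simp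
  then show "\<exists>c. z = mat c" using commuting_scalar[OF irr] by blast
qed

text \<open>\<open>lin_gauge\<close> is injective: in its kernel, \<open>z\<close> commutes with
  \<rho> and is an imaginary scalar, while the compensating \<open>x\<close> is its negative and
  real, so both vanish.\<close>

lemma dim_gauge_dirs: "dim gauge_dirs = CARD('n)^2 + dim (gauge_algebra a)"
proof -
  let ?V = "{z :: 'n cmat. adj z = - z} \<times> gauge_algebra a"
  have V: "subspace ?V" by (intro subspace_Times subspace_skew_hermitian subspace_gauge_algebra)
  have "x = 0" if xV: "x \<in> ?V" and x0: "lin_gauge x = 0" for x
  proof -
    obtain z x' where x: "x = (z, x')" by (cases x)
    have z: "adj z = - z" and x': "x' \<in> gauge_algebra a" using xV by (auto simp: x)
    have 0: "z ** p0 $ s + p0 $ s ** x' $ s = 0" for s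
      using x0 by (auto simp: lin_gauge_def x vec_eq_iff[of _ 0])
    have zs: "z = - (p0 $ s ** x' $ s ** adj (p0 $ s))" for s
    proof -
      have "(z ** p0 $ s + p0 $ s ** x' $ s) ** adj (p0 $ s) = 0" by (simp only: 0 matrix_mult_linear_simps)
      then show ?thesis by (simp add: matrix_mult_linear_simps matrix_mul_assoc[symmetric] add_eq_0_iff2)
    qed
    have xd: "dg (a $ s) ** x' $ s = x' $ s ** dg (a $ s)" for s
      using x' by (intro dg_commute) (auto simp: gauge_algebra_def)
    have "z ** \<rho> $ s = \<rho> $ s ** z" for s
      unfolding zs[of s] rho_frame
      by (simp add: matrix_mult_linear_simps matrix_mul_assoc[symmetric]) (simp add: matrix_mul_assoc xd[symmetric])
    then obtain c where c: "z = mat c" using commuting_scalar[OF irr] by blast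
    have cz: "cnj c = - c"
      using arg_cong[OF z, of "\<lambda>A. A $ undefined $ undefined"] by (simp add: c mat_nth)
    have xs: "x' $ s = - mat c" for s
    proof -
      have "p0 $ s ** x' $ s = p0 $ s ** (- mat c)"
        using 0[of s] unfolding c mat_mult_commute[of c] by (simp add: matrix_mult_linear_simps add_eq_0_iff)
      then show ?thesis using unitary_cancel_left[OF unitary_p0] by blast
    qed
    have "cj (x' $ undefined) = x' $ undefined" using x' by (simp add: gauge_algebra_def)
    then have "cnj c = c"
      unfolding xs by (drule_tac arg_cong[where f = "\<lambda>A. A $ undefined $ undefined"]) (simp add: mat_nth)
    then have "c = 0" using cz by simp
    then show "x = 0" using xs by (simp add: x c zero_prod_def vec_eq_iff[of x'])
  qed
  then have "inj_on lin_gauge (span ?V)"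
    using V by (subst linear_inj_on_iff_eq_0[OF linear_lin_gauge]) (auto simp: span_eq_iff[THEN iffD2])
  then have "dim gauge_dirs = dim ?V"
    unfolding gauge_dirs_def by (rule dim_image_eq[OF linear_lin_gauge])
  also have "\<dots> = CARD('n)^2 + dim (gauge_algebra a)"
    by (simp add: dim_Times subspace_skew_hermitian subspace_gauge_algebra dim_skew_hermitian)
  finally show ?thesis .
qed

text \<open>Rank-nullity for \<open>lin_eqs\<close>, whose range is the product
  \<open>eq_space\<close> of three spaces of known dimension.\<close>

lemma dim_fibre_space:
  "real (dim fibre_space) = (real CARD('l) - 2) / 2 * (real CARD('n))\<^sup>2 + 1
     - 1/2 * (\<Sum>s\<in>UNIV. real (card {(i, j). a $ s $ i = a $ s $ j}))"
proof -
  have "dim fibre_space + dim eq_space = DIM(('n, 'l) mats)"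
    using dim_kernel_add_dim_range[OF linear_lin_eqs] by (simp add: range_lin_eqs fibre_space_def)
  moreover have "dim eq_space = CARD('l) * CARD('n)^2 + (dim (trace_free_tuples :: ('n, 'l) mats set) + (CARD('n)^2 + dim (gauge_algebra a)))"
    unfolding eq_space_def
    by (simp add: dim_Times subspace_Times subspace_hermitian_tuples subspace_trace_free_tuples subspace_gauge_dirs
        dim_gauge_dirs dim_hermitian_tuples[folded hermitian_tuples_def])
  moreover have "DIM(('n, 'l) mats) = 2 * CARD('l) * CARD('n)^2" by (simp add: power2_eq_square)
  ultimately have "dim fibre_space + (CARD('l) * CARD('n)^2 + (dim (trace_free_tuples :: ('n, 'l) mats set) +
      (CARD('n)^2 + dim (gauge_algebra a)))) = 2 * CARD('l) * CARD('n)^2"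
    by (simp only:)
  from arg_cong[OF this, of real]
  have "real (dim fibre_space) + (real CARD('l) * (real CARD('n))\<^sup>2 + (real (dim (trace_free_tuples :: ('n, 'l) mats set)) +
      ((real CARD('n))\<^sup>2 + real (dim (gauge_algebra a))))) = 2 * real CARD('l) * (real CARD('n))\<^sup>2"
    by (simp only: of_nat_add of_nat_mult of_nat_power of_nat_numeral)
  moreover have "2 * real (dim (trace_free_tuples :: ('n, 'l) mats set)) + 2 = real CARD('l) * ((real CARD('n))\<^sup>2 + real CARD('n))"
    using arg_cong[OF dim_trace_free_tuples[where 'n = 'n and 'l = 'l], of real] by simp
  moreover have "2 * real (dim (gauge_algebra a)) + real CARD('l) * real CARD('n) = (\<Sum>s\<in>UNIV. real (card {(i, j). a $ s $ i = a $ s $ j}))"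
    using arg_cong[OF dim_gauge_algebra[of a], of real] by simp
  ultimately show ?thesis by (simp add: field_simps)
qed

end

section \<open>From the reduced equations back to the full frame condition\<close>

subsection \<open>Solutions of the equations are frames\<close>

text \<open>Here cj B = B^(-1), so \<open>B\<close> satisfies the quadratic equation B - B^(-1) = c
  with scalar roots b and -cnj b. Near the identity the factor belonging to the second root is
  invertible, which leaves B = b.\<close>

lemma symmetric_unitary_near_identity:
  fixes B :: "complex^'n^'n"
  assumes K: "K > 0" "\<And>(A :: complex^'n^'n) (B :: complex^'n^'n). norm (A ** B) \<le> norm A * norm B * K"
    and u: "unitary B" and sym: "transpose B = B" and im: "B - cj B = mat c"
    and near: "norm (B - mat 1) < 1" "norm (B - mat 1) * K < 1"
  shows "B = mat ((c + of_real (sqrt (4 - (Im c)\<^sup>2))) / 2)"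
proof -
  have cjB: "cj B = adj B" using sym by (metis adj_transpose)
  define y where "y = Im c"
  have c: "c = \<i> * of_real y" and y: "\<bar>y\<bar> \<le> 2"
  proof -
    let ?b = "B $ undefined $ undefined"
    have bc: "?b - cnj ?b = c" using arg_cong[OF im, of "\<lambda>A. A $ undefined $ undefined"] by (simp add: mat_nth)
    have "Re c = 0" using arg_cong[OF bc, of Re] by simp
    then show "c = \<i> * of_real y" by (simp add: complex_eq_iff y_def)
    have "cmod ((B - mat 1) $ undefined $ undefined) \<le> norm (B - mat 1)"
      by (meson Finite_Cartesian_Product.norm_nth_le order_trans)
    then have "cmod (?b - 1) < 1" using near(1) by (simp add: mat_nth)
    then have "\<bar>Im ?b\<bar> < 1" using abs_Im_le_cmod[of "?b - 1"] by simp
    moreover have "y = 2 * Im ?b" using arg_cong[OF bc, of Im] by (simp add: y_def)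
    ultimately show "\<bar>y\<bar> \<le> 2" by simp
  qed
  have y4: "y\<^sup>2 \<le> 4" using abs_le_square_iff[of y 2] y by simp
  \<comment> \<open>The root with nonnegative real part; it has modulus one.\<close>
  define b where "b = (c + of_real (sqrt (4 - y\<^sup>2))) / 2"
  have b: "Re b = sqrt (4 - y\<^sup>2) / 2" "Im b = y / 2" by (simp_all add: b_def c)
  have bb: "b - cnj b = c" by (simp add: complex_eq_iff b c)
  have bn: "b * cnj b = 1"
    using y4 by (simp add: complex_eq_iff b power2_eq_square[symmetric] power_divide add_divide_distrib[symmetric])
  define W where "W = B - mat b"
  have "(B + mat (cnj b)) ** W = B ** (B - cj B) + mat 1 - mat (b - cnj b) ** B - mat (b * cnj b)"
    unfolding W_def matrix_mult_linear_simps cjB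
    using u by (simp add: mat_mult_mat mat_mult_commute[of b B, symmetric] mult.commute matrix_mult_linear_simps)
      (simp add: vec_eq_iff mat_mult_nth mat_nth algebra_simps)
  also have "\<dots> = 0" unfolding bb bn im by (simp add: mat_mult_commute[of c B])
  finally have "B ** W = - (mat (cnj b) ** W)" by (simp add: matrix_mult_linear_simps add_eq_0_iff2)
  then have e: "(B - mat 1) ** W = mat (- (cnj b + 1)) ** W"
    by (simp add: matrix_mult_linear_simps vec_eq_iff mat_mult_nth algebra_simps)
  have nm: "norm (mat d ** W) = cmod d * norm W" for d
    by (simp add: norm_vec_def L2_set_def mat_mult_nth norm_mult power_mult_distrib real_sqrt_mult
        flip: sum_distrib_left)
  \<comment> \<open>\<open>B - mat 1\<close> acts on \<open>W\<close> as a scalar of modulus at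
    least one, which contradicts its smallness unless \<open>W = 0\<close>.\<close>
  have "1 \<le> cmod (- (cnj b + 1))"
  proof -
    have "0 \<le> sqrt (4 - y\<^sup>2)" using y4 by simp
    then have "0 \<le> Re b" unfolding b(1) by simp
    then have "1 \<le> Re (cnj b + 1)" by simp
    also have "\<dots> \<le> cmod (cnj b + 1)" by (rule complex_Re_le_cmod)
    finally show ?thesis by (simp only: norm_minus_cancel)
  qed
  then have "norm W \<le> norm ((B - mat 1) ** W)"
    unfolding e nm using mult_right_mono[of 1 "cmod (- (cnj b + 1))" "norm W"] by simp
  also have "\<dots> \<le> (norm (B - mat 1) * K) * norm W" using K(2)[of "B - mat 1" W] by (simp add: mult_ac)
  finally have "norm W \<le> (norm (B - mat 1) * K) * norm W" .
  then have "norm W = 0"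
    using near(2) mult_strict_right_mono[of "norm (B - mat 1) * K" 1 "norm W"] by (cases "norm W = 0") auto
  then show ?thesis by (simp add: W_def b_def y_def)
qed

lemma det_adj: "det (adj A) = cnj (det A)" for A :: "complex^'n^'n"
proof -
  have "det (cj A) = cnj (det A)" by (simp add: det_def cnj_sum cnj_prod)
  then show ?thesis by (metis det_transpose transpose_cj)
qed

lemma det_dg: "det (dg \<alpha>) = expi (\<Sum>j\<in>UNIV. \<alpha> $ j)" for \<alpha> :: "real^'n"
proof -
  have "(\<Prod>j\<in>A. expi (\<alpha> $ j)) = expi (\<Sum>j\<in>A. \<alpha> $ j)" if "finite A" for A
    using that by (induction A rule: finite_induct) (auto simp: expi_add)
  then show ?thesis by (subst det_diagonal) (simp_all add: dg_nth)
qed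

lemma prod_expi: "finite A \<Longrightarrow> (\<Prod>s\<in>A. expi (f s)) = expi (\<Sum>s\<in>A. f s)"
  by (induction A rule: finite_induct) (auto simp: expi_add)

text \<open>The determinants of the frames have modulus one and cancel around the cycle, leaving
  only those of the diagonal matrices.\<close>

lemma prod_det_mismatch:
  fixes p :: "('n::finite, 'l::{finite,linorder}) mats"
  assumes u: "\<And>s. unitary (p $ s)"
  shows "(\<Prod>s\<in>UNIV. det (mismatch p b s)) = expi (- (\<Sum>s\<in>UNIV. \<Sum>j\<in>UNIV. b $ s $ j))"
proof -
  have n: "cnj (det (p $ s)) * det (p $ s) = 1" for s
    unfolding det_adj[symmetric] det_mul[symmetric] using u by simp
  have "det (mismatch p b s) = (cnj (det (p $ cyc_next s)))\<^sup>2 * (det (p $ s))\<^sup>2 * expi (- (\<Sum>j\<in>UNIV. b $ s $ j))" for s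
  proof -
    have "det (cj (p $ cyc_next s)) = cnj (det (p $ cyc_next s))"
      using det_adj[of "p $ cyc_next s"] by (metis det_transpose transpose_adj)
    then show ?thesis by (simp add: mismatch_def det_mul det_adj det_dg sum_negf power2_eq_square)
  qed
  then have "(\<Prod>s\<in>UNIV. det (mismatch p b s)) = (\<Prod>s\<in>UNIV. (cnj (det (p $ cyc_next s)))\<^sup>2) * (\<Prod>s\<in>UNIV. (det (p $ s))\<^sup>2)
      * (\<Prod>s\<in>UNIV. expi (- (\<Sum>j\<in>UNIV. b $ s $ j)))" by (simp add: prod.distrib)
  also have "(\<Prod>s\<in>UNIV. (cnj (det (p $ cyc_next s)))\<^sup>2) = (\<Prod>s\<in>UNIV. (cnj (det (p $ s)))\<^sup>2)"
    by (rule prod_cyc_next)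
  also have "\<dots> * (\<Prod>s\<in>UNIV. (det (p $ s))\<^sup>2) = 1"
    unfolding prod.distrib[symmetric] power_mult_distrib[symmetric] n by simp
  finally show ?thesis by (simp add: prod_expi sum_negf)
qed

context irreducible_frame
begin

text \<open>Vanishing of the trace-free part makes all mismatches equal to one scalar
  \<open>b\<close>. The product of their determinants depends only on the sum of the spectra, hence
  equals its value 1 at the base point, so \<open>b\<close> is a root of unity; being close to 1, it
  is 1.\<close>

lemma mismatch_rigid:
  obtains \<epsilon> where "\<epsilon> > 0" "\<And>p t s. \<forall>s. unitary (p $ s) \<Longrightarrow> t \<in> tangent_dirs a \<Longrightarrow>
    \<forall>s. norm (mismatch p (a + t) s - mat 1) < \<epsilon> \<Longrightarrow>
    trace_free (\<chi> s. mismatch p (a + t) s - cj (mismatch p (a + t) s)) = 0 \<Longrightarrow> mismatch p (a + t) s = mat 1"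
proof -
  obtain K where K: "K > 0" "\<And>(A :: 'n cmat) (B :: 'n cmat). norm (A ** B) \<le> norm A * norm B * K"
    using bounded_bilinear.pos_bounded[OF bounded_bilinear_matrix_mult] by blast
  define N where "N = CARD('l) * CARD('n)"
  have N: "N > 0" by (simp add: N_def)
  have "finite {z :: complex. z ^ N = 1}" using finite_roots_unity[of N] N by simp
  then have "finite ((\<lambda>z. cmod (z - 1)) ` ({z. z ^ N = 1} - {1}))" by simp
  \<comment> \<open>The distance from 1 to the other \<open>N\<close>-th roots of unity, capped at
    1.\<close>
  define \<delta> where "\<delta> = Min (insert 1 ((\<lambda>z. cmod (z - 1)) ` ({z. z ^ N = 1} - {1})))"
  have \<delta>: "\<delta> > 0" unfolding \<delta>_def
    using \<open>finite ((\<lambda>z. cmod (z - 1)) ` ({z. z ^ N = 1} - {1}))\<close> by (subst Min_gr_iff) auto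
  have root: "z = 1" if "z ^ N = 1" "cmod (z - 1) < \<delta>" for z
  proof (rule ccontr)
    assume "z \<noteq> 1"
    then have "\<delta> \<le> cmod (z - 1)"
      unfolding \<delta>_def using \<open>finite ((\<lambda>z. cmod (z - 1)) ` ({z. z ^ N = 1} - {1}))\<close> that by (intro Min_le) auto
    then show False using that by simp
  qed
  have base: "expi (- (\<Sum>s\<in>UNIV. \<Sum>j\<in>UNIV. a $ s $ j)) = 1"
    using prod_det_mismatch[of p0 a] by (simp add: mismatch_base)
  show ?thesis
  proof (rule that[of "min 1 (min (1 / K) \<delta>)"])
    fix p t s
    assume u: "\<forall>s. unitary (p $ s)" and t: "t \<in> tangent_dirs a"
      and near: "\<forall>s. norm (mismatch p (a + t) s - mat 1) < min 1 (min (1 / K) \<delta>)"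
      and tf: "trace_free (\<chi> s. mismatch p (a + t) s - cj (mismatch p (a + t) s)) = 0"
    note u = u[rule_format] and near = near[rule_format]
    define c where "c = mean_trace (\<chi> s. mismatch p (a + t) s - cj (mismatch p (a + t) s))"
    define b where "b = (c + of_real (sqrt (4 - (Im c)\<^sup>2))) / 2"
    have "mismatch p (a + t) s = mat b" for s
      unfolding b_def
    proof (rule symmetric_unitary_near_identity[OF K])
      show "unitary (mismatch p (a + t) s)"
        unfolding mismatch_def by (intro unitary_mult unitary_adj unitary_transpose unitary_cj unitary_dg u)
      show "transpose (mismatch p (a + t) s) = mismatch p (a + t) s" by (rule transpose_mismatch)
      show "mismatch p (a + t) s - cj (mismatch p (a + t) s) = mat c"
        using arg_cong[OF tf, of "\<lambda>q. q $ s"] by (simp add: trace_free_def c_def)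
      show "norm (mismatch p (a + t) s - mat 1) < 1" using near[of s] by simp
      show "norm (mismatch p (a + t) s - mat 1) * K < 1" using near[of s] K(1) by (simp add: field_simps)
    qed
    note mb = this
    have "(\<Prod>s\<in>UNIV. det (mismatch p (a + t) s)) = 1"
    proof -
      have "(\<Sum>s\<in>UNIV. \<Sum>j\<in>UNIV. (a + t) $ s $ j) = (\<Sum>s\<in>UNIV. \<Sum>j\<in>UNIV. a $ s $ j)"
        using t by (simp add: tangent_dirs_def sum.distrib)
      then show ?thesis unfolding prod_det_mismatch[OF u] using base by (simp only:)
    qed
    moreover have "det (mat b :: 'n cmat) = b ^ CARD('n)"
      by (subst det_diagonal) (simp_all add: mat_nth)
    ultimately have "b ^ N = 1" by (simp add: mb N_def power_mult[symmetric] mult.commute)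
    moreover have "cmod (b - 1) < \<delta>"
    proof -
      have "cmod ((mismatch p (a + t) s - mat 1) $ undefined $ undefined) \<le> norm (mismatch p (a + t) s - mat 1)"
        by (meson Finite_Cartesian_Product.norm_nth_le order_trans)
      then show ?thesis using near[of s] by (simp add: mb mat_nth)
    qed
    ultimately show "mismatch p (a + t) s = mat 1" using root mb by simp
  qed (use K \<delta> in simp)
qed

definition rep_of :: "('n, 'l) mats \<Rightarrow> ('n, 'l) spectra \<Rightarrow> ('n, 'l) mats" where
  "rep_of p t = (\<chi> s. p $ s ** dg (a $ s + t $ s) ** adj (p $ s))"

lemma frame_imp_eqs:
  assumes "frame \<rho>' (p0 + y) (a + t)" "proj gauge_dirs y = 0"
  shows "eqs (y, t) = 0" "\<rho>' = rep_of (p0 + y) t"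
proof -
  let ?p = "p0 + y"
  have u: "unitary (?p $ s)" and E: "?p $ s ** dg (- ((a + t) $ s)) ** transpose (?p $ s) = ?p $ cyc_next s ** transpose (?p $ cyc_next s)"
    and r: "\<rho>' $ s = ?p $ s ** dg ((a + t) $ s) ** adj (?p $ s)" for s
    using assms(1) unfolding frame_def by blast+
  have m: "mismatch ?p (a + t) s = mat 1" for s
    unfolding mismatch_def E using u by (simp only: matrix_mul_assoc[symmetric] unitaryD)
  have "adj (?p $ s) ** ?p $ s - mat 1 = 0" for s using unitaryD(1)[OF u] by simp
  then show "eqs (y, t) = 0"
    unfolding eqs_def Let_def fst_conv snd_conv m assms(2)
    by (simp add: zero_prod_def trace_free_def mean_trace_def vec_eq_iff trace_def mat_nth)
  show "\<rho>' = rep_of ?p t" using r by (simp add: rep_of_def vec_eq_iff[of \<rho>'])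
qed

lemma unitary_of_eqs: "eqs (y, t) = 0 \<Longrightarrow> unitary ((p0 + y) $ s)"
proof -
  assume "eqs (y, t) = 0"
  then have "(\<chi> s. adj ((p0 + y) $ s) ** (p0 + y) $ s - mat 1) = 0" by (simp add: eqs_def Let_def zero_prod_def)
  from arg_cong[OF this, of "\<lambda>q. q $ s"] show ?thesis by (intro unitaryI) simp
qed

lemma mismatch_imp_frame:
  assumes u: "\<And>s. unitary ((p0 + y) $ s)" and m: "\<And>s. mismatch (p0 + y) (a + t) s = mat 1"
  shows "frame (rep_of (p0 + y) t) (p0 + y) (a + t)"
  unfolding frame_def
proof (intro allI conjI u)
  fix s
  let ?p = "p0 + y"
  show "rep_of ?p t $ s = ?p $ s ** dg ((a + t) $ s) ** adj (?p $ s)" by (simp add: rep_of_def)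
  have "?p $ cyc_next s ** mismatch ?p (a + t) s ** transpose (?p $ cyc_next s) = ?p $ s ** dg (- ((a + t) $ s)) ** transpose (?p $ s)"
    unfolding mismatch_def using u[of "cyc_next s"] by (simp only: matrix_mul_assoc[symmetric] unitaryD matrix_mul_rid)
  then show "?p $ s ** dg (- ((a + t) $ s)) ** transpose (?p $ s) = ?p $ cyc_next s ** transpose (?p $ cyc_next s)"
    by (simp add: m)
qed

section \<open>Moving a frame along its gauge orbit into the slice\<close>

subsection \<open>The slice\<close>

lemma compact_in_gauge: "compact {c :: ('n, 'l) mats. in_gauge a (\<lambda>s. c $ s)}"
proof -
  have "{c :: ('n, 'l) mats. in_gauge a (\<lambda>s. c $ s)} =
      {c. \<forall>s. unitary (c $ s)} \<inter> {c. \<forall>s. cj (c $ s) = c $ s \<and> dg (a $ s) ** c $ s = c $ s ** dg (a $ s)}"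
    by (auto simp: in_gauge_def)
  moreover have "closed {c :: ('n, 'l) mats. \<forall>s. cj (c $ s) = c $ s \<and> dg (a $ s) ** c $ s = c $ s ** dg (a $ s)}"
    by (intro closed_Collect_all closed_Collect_conj closed_Collect_eq continuous_intros)
  ultimately show ?thesis using compact_Int_closed[OF compact_unitary_tuples] by (simp only:)
qed

lemma norm_unitary_tuple:
  fixes p :: "('n, 'l) mats"
  assumes "\<And>s. unitary (p $ s)"
  shows "inner p p = CARD('l) * CARD('n)"
  using assms by (simp add: inner_vec_def[of p] inner_matrix trace_I)

text \<open>Within a gauge orbit, the frame closest to \<open>p0\<close> differs from \<open>p0\<close> by a vector orthogonal to the orbit
  of \<open>p0\<close>; the variations used are Cayley transforms.\<close>

lemma slice:
  fixes p :: "('n, 'l) mats"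
  assumes u: "\<And>s. unitary (p $ s)"
  obtains g c where "unitary g" "in_gauge a c" "proj gauge_dirs ((\<chi> s. g ** p $ s ** c s) - p0) = 0"
    "dist (\<chi> s. g ** p $ s ** c s) p0 \<le> dist p p0"
proof -
  define Q where "Q x = (\<chi> s. fst x ** p $ s ** snd x $ s)" for x :: "'n cmat \<times> ('n, 'l) mats"
  let ?K = "{g :: 'n cmat. unitary g} \<times> {c :: ('n, 'l) mats. in_gauge a (\<lambda>s. c $ s)}"
  have "compact ?K" by (intro compact_Times compact_unitary compact_in_gauge)
  moreover have one: "(mat 1, \<chi> s. mat 1) \<in> ?K" by (simp add: in_gauge_def unitary_1)
  moreover have "continuous_on ?K (\<lambda>x. inner (Q x) p0)"
    unfolding Q_def by (intro continuous_intros continuous_on_vec_lambda)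
  \<comment> \<open>All unitary tuples have the same norm, so a maximum of the inner product with
    \<open>p0\<close> is a minimum of the distance to \<open>p0\<close>.\<close>
  ultimately obtain x where x: "x \<in> ?K" and max: "\<And>x'. x' \<in> ?K \<Longrightarrow> inner (Q x') p0 \<le> inner (Q x) p0"
    using continuous_attains_sup[of ?K "\<lambda>x. inner (Q x) p0"] by blast
  obtain g c where gc: "x = (g, c)" by (cases x)
  have g: "unitary g" and c: "in_gauge a (\<lambda>s. c $ s)" using x by (auto simp: gc)
  define q where "q = Q x"
  have qs: "q $ s = g ** p $ s ** c $ s" for s by (simp add: q_def Q_def gc)
  have uq: "unitary (q $ s)" for s using u g c by (simp add: qs unitary_mult in_gauge_def)
  have left: "inner (\<chi> s. b ** q $ s) p0 \<le> inner q p0" if "unitary b" for b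
  proof -
    have "(b ** g, c) \<in> ?K" using that g c by (simp add: unitary_mult)
    from max[OF this] show ?thesis by (simp add: q_def Q_def gc matrix_mul_assoc)
  qed
  have right: "inner (\<chi> s. q $ s ** b s) p0 \<le> inner q p0" if b: "in_gauge a b" for b
  proof -
    have "dg (a $ s) ** (c $ s ** b s) = (c $ s ** b s) ** dg (a $ s)" for s
    proof -
      have "dg (a $ s) ** (c $ s ** b s) = (dg (a $ s) ** c $ s) ** b s" by (simp add: matrix_mul_assoc)
      also have "\<dots> = c $ s ** (dg (a $ s) ** b s)" using c by (simp add: in_gauge_def matrix_mul_assoc)
      also have "\<dots> = (c $ s ** b s) ** dg (a $ s)" using b by (simp add: in_gauge_def matrix_mul_assoc)
      finally show ?thesis .
    qed
    then have "in_gauge a (\<lambda>s. c $ s ** b s)" using b c by (simp add: in_gauge_def unitary_mult cj_mult)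
    then have "(g, \<chi> s. c $ s ** b s) \<in> ?K" using g by (simp add: in_gauge_def)
    from max[OF this] show ?thesis by (simp add: q_def Q_def gc matrix_mul_assoc)
  qed
  \<comment> \<open>The first-order condition for left factors. \<open>crit_right\<close> is its
    counterpart for gauge factors, where the Cayley transform stays real and within the commutant of
    \<open>dg (a $ s)\<close>.\<close>
  have crit_left: "inner (\<chi> s. z ** q $ s) p0 = 0" if z: "adj z = - z" for z
  proof -
    have "\<exists>b. unitary b \<and> b = mat 1 + 2 *\<^sub>R (e *\<^sub>R z) + (e *\<^sub>R z) ** (e *\<^sub>R z) ** (mat 1 + b)" for e :: real
    proof -
      have "adj (e *\<^sub>R z) = - (e *\<^sub>R z)" by (simp add: matrix_linear_simps z)
      from cayley[OF this] show ?thesis by metis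
    qed
    then obtain b where b: "\<And>e. unitary (b e)"
      "\<And>e. b e = mat 1 + 2 *\<^sub>R (e *\<^sub>R z) + (e *\<^sub>R z) ** (e *\<^sub>R z) ** (mat 1 + b e)" by metis
    define G where "G w = inner (\<chi> s. z ** z ** (mat 1 + w) ** q $ s) p0" for w
    have exp: "inner (\<chi> s. b e ** q $ s) p0 = inner q p0 + e * (2 * inner (\<chi> s. z ** q $ s) p0) + e\<^sup>2 * G (b e)" for e
    proof -
      have "(\<chi> s. b e ** q $ s) = q + (e * 2) *\<^sub>R (\<chi> s. z ** q $ s) + e\<^sup>2 *\<^sub>R (\<chi> s. z ** z ** (mat 1 + b e) ** q $ s)"
      proof (subst vec_eq_iff, intro allI)
        fix s
        have "b e ** q $ s = (mat 1 + 2 *\<^sub>R (e *\<^sub>R z) + (e *\<^sub>R z) ** (e *\<^sub>R z) ** (mat 1 + b e)) ** q $ s"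
          using b(2)[of e] by (rule arg_cong)
        then show "(\<chi> s. b e ** q $ s) $ s = (q + (e * 2) *\<^sub>R (\<chi> s. z ** q $ s) + e\<^sup>2 *\<^sub>R (\<chi> s. z ** z ** (mat 1 + b e) ** q $ s)) $ s"
          by (simp add: matrix_mult_linear_simps power2_eq_square scaleR_add_right mult.commute)
      qed
      then show ?thesis by (simp only: G_def inner_add_left inner_scaleR_left)
    qed
    have "compact (G ` {b. unitary b})"
      unfolding G_def by (intro compact_continuous_image compact_unitary continuous_intros continuous_on_vec_lambda)
    then obtain K where "\<And>w. unitary w \<Longrightarrow> \<bar>G w\<bar> \<le> K"
      by (force dest!: compact_imp_bounded simp: bounded_iff)
    then have "2 * inner (\<chi> s. z ** q $ s) p0 = 0"
      using left[OF b(1)] b(1) by (intro first_order_zero[of _ "\<lambda>e. G (b e)" K]) (auto simp: exp)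
    then show ?thesis by simp
  qed
  have crit_right: "inner (\<chi> s. q $ s ** w $ s) p0 = 0" if w: "w \<in> gauge_algebra a" for w
  proof -
    have ws: "adj (w $ s) = - w $ s" "cj (w $ s) = w $ s" "dg (a $ s) ** w $ s = w $ s ** dg (a $ s)" for s
    proof -
      show "cj (w $ s) = w $ s" using w by (simp add: gauge_algebra_def)
      have "transpose (w $ s) = - w $ s" using w by (simp add: gauge_algebra_def)
      then show "adj (w $ s) = - w $ s" using \<open>cj (w $ s) = w $ s\<close> by (metis transpose_cj)
      show "dg (a $ s) ** w $ s = w $ s ** dg (a $ s)"
        using w by (intro dg_commute) (auto simp: gauge_algebra_def)
    qed
    have "\<exists>b. unitary b \<and> cj b = b \<and> dg (a $ s) ** b = b ** dg (a $ s) \<and>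
        b = mat 1 + 2 *\<^sub>R (e *\<^sub>R w $ s) + (e *\<^sub>R w $ s) ** (e *\<^sub>R w $ s) ** (mat 1 + b)" for e :: real and s
    proof -
      have "adj (e *\<^sub>R w $ s) = - (e *\<^sub>R w $ s)" by (simp add: matrix_linear_simps ws)
      then obtain b where b: "unitary b" "b = mat 1 + 2 *\<^sub>R (e *\<^sub>R w $ s) + (e *\<^sub>R w $ s) ** (e *\<^sub>R w $ s) ** (mat 1 + b)"
        "cj (e *\<^sub>R w $ s) = e *\<^sub>R w $ s \<Longrightarrow> cj b = b"
        "\<And>A. A ** (e *\<^sub>R w $ s) = (e *\<^sub>R w $ s) ** A \<Longrightarrow> A ** b = b ** A"
        by (rule cayley) (rule that)
      then show ?thesis
        by (intro exI[of _ b] conjI) (auto simp: matrix_linear_simps ws matrix_mult_linear_simps)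
    qed
    note ex = this
    define b where "b e s = (SOME b. unitary b \<and> cj b = b \<and> dg (a $ s) ** b = b ** dg (a $ s) \<and>
        b = mat 1 + 2 *\<^sub>R (e *\<^sub>R w $ s) + (e *\<^sub>R w $ s) ** (e *\<^sub>R w $ s) ** (mat 1 + b))" for e :: real and s
    have b: "unitary (b e s)" "cj (b e s) = b e s" "dg (a $ s) ** b e s = b e s ** dg (a $ s)"
      "b e s = mat 1 + 2 *\<^sub>R (e *\<^sub>R w $ s) + (e *\<^sub>R w $ s) ** (e *\<^sub>R w $ s) ** (mat 1 + b e s)" for e s
      using someI_ex[OF ex[of s e]] unfolding b_def[symmetric] by blast+
    define G where "G v = inner (\<chi> s. q $ s ** (w $ s ** w $ s ** (mat 1 + v $ s))) p0" for v :: "('n, 'l) mats"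
    have exp: "inner (\<chi> s. q $ s ** b e s) p0 = inner q p0 + e * (2 * inner (\<chi> s. q $ s ** w $ s) p0) + e\<^sup>2 * G (\<chi> s. b e s)" for e
    proof -
      have "(\<chi> s. q $ s ** b e s) = q + (e * 2) *\<^sub>R (\<chi> s. q $ s ** w $ s) + e\<^sup>2 *\<^sub>R (\<chi> s. q $ s ** (w $ s ** w $ s ** (mat 1 + b e s)))"
      proof (subst vec_eq_iff, intro allI)
        fix s
        have "q $ s ** b e s = q $ s ** (mat 1 + 2 *\<^sub>R (e *\<^sub>R w $ s) + (e *\<^sub>R w $ s) ** (e *\<^sub>R w $ s) ** (mat 1 + b e s))"
          using b(4)[of e s] by (rule arg_cong)
        then show "(\<chi> s. q $ s ** b e s) $ s = (q + (e * 2) *\<^sub>R (\<chi> s. q $ s ** w $ s) + e\<^sup>2 *\<^sub>R (\<chi> s. q $ s ** (w $ s ** w $ s ** (mat 1 + b e s)))) $ s"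
          by (simp add: matrix_mult_linear_simps power2_eq_square scaleR_add_right mult.commute)
      qed
      then show ?thesis by (simp only: G_def inner_add_left inner_scaleR_left vec_lambda_beta)
    qed
    have "compact (G ` {b. \<forall>s. unitary (b $ s)})"
      unfolding G_def by (intro compact_continuous_image compact_unitary_tuples continuous_intros continuous_on_vec_lambda)
    then obtain K where K: "\<And>w. (\<forall>s. unitary (w $ s)) \<Longrightarrow> \<bar>G w\<bar> \<le> K"
      by (force dest!: compact_imp_bounded simp: bounded_iff)
    have "in_gauge a (b e)" for e using b by (simp add: in_gauge_def)
    then have "2 * inner (\<chi> s. q $ s ** w $ s) p0 = 0"
      using right[of "b e" for e] K[of "\<chi> s. b e s" for e] b(1)
      by (intro first_order_zero[of _ "\<lambda>e. G (\<chi> s. b e s)" K]) (auto simp: exp)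
    then show ?thesis by simp
  qed
  \<comment> \<open>The generators are skew, so they can be moved from \<open>p0\<close> to the
    other argument; this turns the critical-point equations at \<open>q\<close> into orthogonality
    to the gauge directions at \<open>p0\<close>.\<close>
  have skew: "inner v (lin_gauge (z, w)) = - inner (\<chi> s. z ** v $ s + v $ s ** w $ s) p0"
    if z: "adj z = - z" and w: "w \<in> gauge_algebra a" for v z w
  proof -
    have wa: "adj (w $ s) = - w $ s" for s
    proof -
      have "cj (w $ s) = w $ s" "transpose (w $ s) = - w $ s" using w by (simp_all add: gauge_algebra_def)
      then show ?thesis by (metis transpose_cj)
    qed
    have i1: "inner (v $ s) (z ** p0 $ s) = - inner (z ** v $ s) (p0 $ s)" for s
      unfolding inner_mult_left[of z "v $ s"] z by (simp add: matrix_mult_linear_simps)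
    have i2: "inner (v $ s) (p0 $ s ** w $ s) = - inner (v $ s ** w $ s) (p0 $ s)" for s
      unfolding inner_mult_right[of "v $ s" "w $ s"] wa by (simp add: matrix_mult_linear_simps)
    have "inner (v $ s) (lin_gauge (z, w) $ s) = - inner (z ** v $ s + v $ s ** w $ s) (p0 $ s)" for s
      by (simp add: lin_gauge_def inner_add_left inner_add_right i1 i2)
    then show ?thesis by (simp add: inner_vec_def[of v] inner_vec_def[of _ p0] sum_negf)
  qed
  have "inner (q - p0) v = 0" if "v \<in> gauge_dirs" for v
  proof -
    obtain z w where zw: "adj z = - z" "w \<in> gauge_algebra a" "v = lin_gauge (z, w)"
      using \<open>v \<in> gauge_dirs\<close> by (auto simp: gauge_dirs_def)
    have "(\<chi> s. z ** q $ s + q $ s ** w $ s) = (\<chi> s. z ** q $ s) + (\<chi> s. q $ s ** w $ s)"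
      by (simp add: vec_eq_iff[of "vec_lambda _"])
    then have "inner q v = 0"
      unfolding zw(3) skew[OF zw(1,2)] by (simp add: inner_add_left crit_left[OF zw(1)] crit_right[OF zw(2)])
    \<comment> \<open>Gauge directions are tangent to the sphere on which unitary tuples
      lie.\<close>
    moreover have "inner p0 v = 0"
    proof -
      have "inner p0 v = - inner v p0"
        unfolding zw(3) skew[OF zw(1,2)] by (simp add: lin_gauge_def)
      then show ?thesis by (simp add: inner_commute)
    qed
    ultimately show ?thesis by (simp add: inner_diff_left)
  qed
  then have "proj gauge_dirs (q - p0) = 0"
    by (intro proj_unique subspace_gauge_dirs subspace_0) simp_all
  moreover have "dist q p0 \<le> dist p p0"
  proof -
    have "inner p p0 \<le> inner q p0" using max[OF one] by (simp add: q_def Q_def)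
    then have "inner (q - p0) (q - p0) \<le> inner (p - p0) (p - p0)"
      using norm_unitary_tuple[OF u] norm_unitary_tuple[OF uq]
        inner_commute[of p0 q] inner_commute[of p0 p]
      unfolding inner_diff_left inner_diff_right by linarith
    then show ?thesis by (simp add: dist_norm norm_eq_sqrt_inner)
  qed
  moreover have "q = (\<chi> s. g ** p $ s ** c $ s)" by (simp add: vec_eq_iff[of q] qs)
  ultimately show ?thesis using g c that[of g "\<lambda>s. c $ s"] by simp
qed

end

section \<open>Local coordinates for representations up to conjugation\<close>

lemma norm_mat_mult: "norm (mat d ** W) = cmod d * norm W" for W :: "complex^'m^'n"
  by (simp add: norm_vec_def L2_set_def mat_mult_nth norm_mult power_mult_distrib real_sqrt_mult
      flip: sum_distrib_left)

lemma norm_proj_le: "subspace S \<Longrightarrow> norm (proj S x) \<le> norm x"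
proof -
  assume S: "subspace S"
  have "inner (x - proj S x) (proj S x) = 0" by (rule proj_orth[OF S proj_in[OF S]])
  then have "inner x x = inner (proj S x) (proj S x) + inner (x - proj S x) (x - proj S x)"
    by (simp add: inner_diff_left inner_diff_right inner_commute)
  then have "inner (proj S x) (proj S x) \<le> inner x x" by simp
  then show ?thesis by (simp add: norm_eq_sqrt_inner)
qed

lemma matrix_inv_mult:
  fixes A :: "complex^'n^'n"
  assumes "invertible A"
  shows "A ** matrix_inv A = mat 1" "matrix_inv A ** A = mat 1"
proof -
  have "\<exists>A'. A ** A' = mat 1 \<and> A' ** A = mat 1" using assms by (simp add: invertible_def)
  then have "A ** matrix_inv A = mat 1 \<and> matrix_inv A ** A = mat 1"
    unfolding matrix_inv_def by (rule someI_ex)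
  then show "A ** matrix_inv A = mat 1" "matrix_inv A ** A = mat 1" by auto
qed

lemma open_invertible: "open {A :: complex^'n^'n. invertible A}"
  unfolding invertible_det_nz det_def
  by (intro open_Collect_neq continuous_intros)

lemma smooth_on_matrix_inv: "smooth_on {A :: complex^'n^'n. invertible A} matrix_inv"
  unfolding smooth_on_def
proof
  fix k
  let ?U = "{A :: complex^'n^'n. invertible A}"
  have "Ck_on k ?U (\<lambda>A. matrix_inv A ** mat 1)"
  proof (rule Ck_on_inverse_family[OF open_invertible, where M = "\<lambda>A B. A ** B" and N = "\<lambda>A B. matrix_inv A ** B"])
    show "linear ((**) A)" for A :: "complex^'n^'n"
      by (rule linearI) (simp_all add: matrix_mult_linear_simps)
    show "Ck_on k ?U (\<lambda>A. A ** B)" for B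
      by (rule Ck_on_bounded_bilinear[OF bounded_bilinear_matrix_mult open_invertible Ck_on_id Ck_on_const])
         (rule open_invertible)+
  qed (simp_all add: matrix_mul_assoc matrix_inv_mult)
  then show "Ck_on k ?U matrix_inv" by simp
qed

lemma has_derivative_expi: "(expi has_derivative (\<lambda>v. v *\<^sub>R (2 * of_real pi * \<i> * expi x))) (at x)"
proof -
  have "((\<lambda>t. 2 * of_real pi * \<i> * complex_of_real t) has_derivative (\<lambda>v. 2 * of_real pi * \<i> * of_real v)) (at x)"
    by (intro bounded_linear.has_derivative[OF bounded_linear_mult_right] has_derivative_of_real has_derivative_ident)
  from has_derivative_compose[OF this DERIV_exp[unfolded has_field_derivative_def]]
  show ?thesis unfolding expi_def by (simp add: scaleR_conv_of_real mult_ac)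
qed

definition dg' :: "real^'n \<Rightarrow> real^'n \<Rightarrow> complex^'n^'n" where
  "dg' \<alpha> \<beta> = (\<chi> i j. if i = j then (\<beta> $ i) *\<^sub>R (2 * of_real pi * \<i> * expi (\<alpha> $ i)) else 0)"

lemma has_derivative_dg: "((\<lambda>t. dg (\<alpha> + t)) has_derivative dg' \<alpha>) (at 0)"
  unfolding dg_def dg'_def[abs_def]
proof (intro has_derivative_vec_lambda)
  fix i j
  have "((\<lambda>t. (\<alpha> + t) $ i) has_derivative (\<lambda>t. t $ i)) (at 0)"
    by (auto intro!: derivative_eq_intros bounded_linear.has_derivative[OF bounded_linear_vec_nth])
  from has_derivative_compose[OF this has_derivative_expi]
  show "((\<lambda>t. if i = j then expi ((\<alpha> + t) $ i) else 0) has_derivative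
      (\<lambda>h. if i = j then (h $ i) *\<^sub>R (2 * of_real pi * \<i> * expi (\<alpha> $ i)) else 0)) (at 0)"
    by (cases "i = j") simp_all
qed

text \<open>Conjugation by an arbitrary invertible matrix near the identity, so that the parameter
  \<open>z\<close> varies in an open subset of a linear space rather than in the unitary
  group.\<close>

definition twist :: "('n::finite) cmat \<Rightarrow> ('n, 'l::finite) mats \<Rightarrow> ('n, 'l) mats" where
  "twist z \<sigma> = (\<chi> s. (mat 1 + z) ** \<sigma> $ s ** matrix_inv (mat 1 + z))"

text \<open>Normalizing by the scalar \<open>g $ i $ i\<close> removes the centre of \<open>U(n)\<close>, which acts trivially.\<close>

lemma conj_by_twist:
  fixes \<sigma> :: "('n::finite, 'l::finite) mats"
  assumes g: "unitary g" and c: "cmod c = 1" and \<epsilon>: "dist g (mat c) < \<epsilon>" "\<epsilon> \<le> 1/2"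
  obtains z where "z $ i $ i = 0" "norm z \<le> 2 * (1 + norm (mat 1 :: 'n cmat)) * \<epsilon>" "conj_by g \<sigma> = twist z \<sigma>"
proof -
  define d where "d = g $ i $ i"
  have dc: "cmod (d - c) < \<epsilon>"
  proof -
    have "cmod ((g - mat c) $ i $ i) \<le> norm (g - mat c)"
      by (meson Finite_Cartesian_Product.norm_nth_le order_trans)
    then show ?thesis using \<epsilon> by (simp add: d_def mat_nth dist_norm)
  qed
  have "1 \<le> cmod d + cmod (d - c)" using c norm_triangle_sub[of c d] by (simp add: norm_minus_commute)
  then have d: "cmod d \<ge> 1/2" using dc \<epsilon>(2) by linarith
  then have d0: "d \<noteq> 0" by auto
  \<comment> \<open>Dividing \<open>g\<close> by its own diagonal entry \<open>d\<close>, which is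
    near \<open>c\<close> and so at least 1/2 in modulus.\<close>
  define z where "z = mat (1 / d) ** g - mat 1"
  have gz: "g = mat d ** (mat 1 + z)" using d0 by (simp add: z_def mat_mult_mat_assoc)
  have z1: "mat 1 + z = mat (1 / d) ** g" by (simp add: z_def)
  have inv: "(mat 1 + z) ** (adj g ** mat d) = mat 1" "(adj g ** mat d) ** (mat 1 + z) = mat 1"
  proof -
    show "(mat 1 + z) ** (adj g ** mat d) = mat 1"
      unfolding z1 using g d0 by (simp add: matrix_mul_assoc[symmetric] mat_mult_mat)
    then show "(adj g ** mat d) ** (mat 1 + z) = mat 1" by (simp add: matrix_left_right_inverse)
  qed
  then have "invertible (mat 1 + z)" by (auto simp: invertible_def)
  then have "matrix_inv (mat 1 + z) = adj g ** mat d"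
    by (metis inv(1) matrix_inv_mult(2) matrix_mul_assoc matrix_mul_lid matrix_mul_rid)
  then have tw: "twist z \<sigma> $ s = mat (1 / d) ** (g ** \<sigma> $ s ** adj g) ** mat d" for s
    by (simp add: twist_def z1 matrix_mul_assoc)
  have md: "mat (1 / d) ** mat d = (mat 1 :: 'n cmat)"
    using d0 by (simp add: mat_mult_mat)
  have "twist z \<sigma> $ s = conj_by g \<sigma> $ s" for s
    unfolding tw mat_mult_commute[of "1 / d" "g ** \<sigma> $ s ** adj g"]
    by (simp only: matrix_mul_assoc[symmetric] md matrix_mul_rid) (simp add: conj_by_def matrix_mul_assoc)
  then have "conj_by g \<sigma> = twist z \<sigma>" by (simp add: vec_eq_iff)
  moreover have "z $ i $ i = 0" using d0 by (simp add: z_def mat_mult_nth mat_nth d_def)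
  moreover have "norm z \<le> 2 * (1 + norm (mat 1 :: 'n cmat)) * \<epsilon>"
  proof -
    have "z = mat (1 / d) ** (g - mat d)" using d0 by (simp add: z_def matrix_mult_linear_simps mat_mult_mat)
    then have "norm z = norm (g - mat d) / cmod d" by (simp add: norm_mat_mult norm_divide)
    also have "\<dots> \<le> norm (g - mat d) * 2"
    proof -
      have "1 / cmod d \<le> 2" using d by (simp add: divide_le_eq)
      from mult_left_mono[OF this norm_ge_zero[of "g - mat d"]] show ?thesis by simp
    qed
    also have "norm (g - mat d) \<le> norm (g - mat c) + norm (mat (c - d) ** mat 1 :: 'n cmat)"
    proof -
      have "mat (c - d) = (mat c - mat d :: 'n cmat)" by (simp add: vec_eq_iff mat_nth)
      then have "g - mat d = (g - mat c) + mat (c - d) ** mat 1" by simp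
      then show ?thesis by (metis norm_triangle_ineq)
    qed
    also have "\<dots> \<le> \<epsilon> + \<epsilon> * norm (mat 1 :: 'n cmat)"
      unfolding norm_mat_mult
      using \<epsilon>(1) dc by (intro add_mono mult_right_mono) (auto simp: dist_norm norm_minus_commute)
    finally show ?thesis by (simp add: algebra_simps)
  qed
  ultimately show ?thesis using that by blast
qed

text \<open>What the implicit function theorem and \<open>mismatch_rigid\<close> together provide:
  \<open>Y\<close> solves the equations for \<open>y\<close>, and solutions over the tangent
  directions of the stratum are frames.\<close>

locale frame_chart = irreducible_frame \<rho> p0 a
  for \<rho> :: "('n::{finite,linorder}, 'l::{finite,linorder}) mats" and p0 a +
  fixes \<Omega> \<Omega>' :: "(('n, 'l) mats \<times> ('n, 'l) spectra) set"
    and Y :: "('n, 'l) mats \<times> ('n, 'l) spectra \<Rightarrow> ('n, 'l) mats"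
  assumes open_\<Omega>: "open \<Omega>" "(0, 0) \<in> \<Omega>" and open_\<Omega>': "open \<Omega>'" "(0, 0) \<in> \<Omega>'"
    and smooth_Y: "smooth_on \<Omega>' Y" and Y_0: "Y (0, 0) = 0"
    and eqs_chart: "(y, t) \<in> \<Omega> \<Longrightarrow> eqs (y, t) = 0 \<Longrightarrow>
      (proj fibre_space y, t) \<in> \<Omega>' \<and> Y (proj fibre_space y, t) = y"
    and chart_eqs: "(f, t) \<in> \<Omega>' \<Longrightarrow> f \<in> fibre_space \<Longrightarrow> (Y (f, t), t) \<in> \<Omega> \<and> eqs (Y (f, t), t) = 0"
    and derivative_Y: "f \<in> fibre_space \<Longrightarrow> frechet_derivative Y (at (0, 0)) (f, 0) = f"
    and eqs_frame: "(y, t) \<in> \<Omega> \<Longrightarrow> t \<in> tangent_dirs a \<Longrightarrow> eqs (y, t) = 0 \<Longrightarrow>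
      frame (rep_of (p0 + y) t) (p0 + y) (a + t)"

lemma (in irreducible_frame) ex_frame_chart: "\<exists>\<Omega> \<Omega>' Y. frame_chart \<rho> p0 a \<Omega> \<Omega>' Y"
proof -
  obtain \<epsilon> where \<epsilon>: "\<epsilon> > 0" "\<And>p t s. \<forall>s. unitary (p $ s) \<Longrightarrow> t \<in> tangent_dirs a \<Longrightarrow>
    \<forall>s. norm (mismatch p (a + t) s - mat 1) < \<epsilon> \<Longrightarrow>
    trace_free (\<chi> s. mismatch p (a + t) s - cj (mismatch p (a + t) s)) = 0 \<Longrightarrow> mismatch p (a + t) s = mat 1"
    by (rule mismatch_rigid) (rule that)
  \<comment> \<open>On this neighbourhood all mismatches are close enough to the identity for
    \<open>mismatch_rigid\<close>.\<close>
  define W where "W = {x. \<forall>s. norm (mismatch (p0 + fst x) (a + snd x) s - mat 1) < \<epsilon>}"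
  have "W = (\<Inter>s. {x. norm (mismatch (p0 + fst x) (a + snd x) s - mat 1) < \<epsilon>})" by (auto simp: W_def)
  then have W: "open W"
    unfolding mismatch_def by (simp only:) (intro open_INT ballI open_Collect_less continuous_intros finite)
  have W0: "(0, 0) \<in> W" using \<epsilon>(1) by (simp add: W_def mismatch_base)
  have F: "{y. lin_eqs y = 0} = fibre_space" by (simp add: fibre_space_def)
  have sm: "smooth_on W eqs" by (rule smooth_on_subset[OF smooth_on_eqs]) simp
  have ran: "eqs x \<in> range lin_eqs" for x unfolding range_lin_eqs by (rule eqs_in_eq_space)
  obtain \<Omega> \<Omega>' Y where *: "open \<Omega>" "(0, 0) \<in> \<Omega>" "\<Omega> \<subseteq> W" "open \<Omega>'" "(0, 0) \<in> \<Omega>'" "smooth_on \<Omega>' Y" "Y (0, 0) = 0"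
    "\<And>y t. (y, t) \<in> \<Omega> \<Longrightarrow> eqs (y, t) = 0 \<Longrightarrow> (proj {y. lin_eqs y = 0} y, t) \<in> \<Omega>' \<and> Y (proj {y. lin_eqs y = 0} y, t) = y"
    "\<And>f t. (f, t) \<in> \<Omega>' \<Longrightarrow> lin_eqs f = 0 \<Longrightarrow>
      (Y (f, t), t) \<in> \<Omega> \<and> eqs (Y (f, t), t) = 0 \<and> proj {y. lin_eqs y = 0} (Y (f, t)) = f"
    "\<And>f. lin_eqs f = 0 \<Longrightarrow> frechet_derivative Y (at (0, 0)) (f, 0) = f"
    by (rule implicit_zero_set[OF W W0 sm eqs_0 has_derivative_eqs ran]) (rule that)
  have "frame_chart \<rho> p0 a \<Omega> \<Omega>' Y"
  proof (unfold_locales)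
    fix y t assume y: "(y, t) \<in> \<Omega>" and t: "t \<in> tangent_dirs a" and e: "eqs (y, t) = 0"
    have u: "unitary ((p0 + y) $ s)" for s by (rule unitary_of_eqs[OF e])
    have n: "\<forall>s. norm (mismatch (p0 + y) (a + t) s - mat 1) < \<epsilon>" using y *(3) by (auto simp: W_def)
    have tf: "trace_free (\<chi> s. mismatch (p0 + y) (a + t) s - cj (mismatch (p0 + y) (a + t) s)) = 0"
      using e by (simp add: eqs_def Let_def zero_prod_def)
    have "mismatch (p0 + y) (a + t) s = mat 1" for s
      using u by (intro \<epsilon>(2)[OF _ t n tf] allI)
    then show "frame (rep_of (p0 + y) t) (p0 + y) (a + t)" by (intro mismatch_imp_frame u)
  qed (use * in \<open>auto simp: F fibre_space_def[symmetric]\<close>, (simp add: fibre_space_def)+)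
  then show ?thesis by blast
qed

context frame_chart
begin

definition tau :: "('n, 'l) mats \<times> ('n, 'l) spectra \<Rightarrow> ('n, 'l) mats" where
  "tau x = rep_of (p0 + Y x) (snd x)"

lemma tau_0: "tau (0, 0) = \<rho>"
  by (simp add: tau_def Y_0 rep_of_def rho_frame vec_eq_iff[of _ \<rho>])

lemma smooth_on_tau: "smooth_on \<Omega>' tau"
  unfolding tau_def rep_of_def
  by (intro smooth_intros open_\<Omega>' smooth_Y)

lemma frame_tau:
  "(f, t) \<in> \<Omega>' \<Longrightarrow> f \<in> fibre_space \<Longrightarrow> t \<in> tangent_dirs a \<Longrightarrow> frame (tau (f, t)) (p0 + Y (f, t)) (a + t)"
  unfolding tau_def snd_conv using chart_eqs eqs_frame by blast

text \<open>The consequences of lying in the stratum of \<open>a\<close> that the coordinates rely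
  on, stated through \<open>a\<close> alone.\<close>

definition near_stratum :: "('n, 'l) mats \<Rightarrow> bool" where
  "near_stratum \<rho>' \<longleftrightarrow> lagrangian_rep \<rho>' \<and> pattern_le a (spec_proj \<rho>') \<and> spec_proj \<rho>' - a \<in> tangent_dirs a"

text \<open>Choose a frame near \<open>p0\<close>, then move it to the closest point of its gauge
  orbit, which is no farther from \<open>p0\<close> and satisfies the slice condition; the result
  solves \<open>eqs\<close> and has coordinates (f, t).\<close>

lemma coverage:
  assumes "\<epsilon> > 0"
  obtains e where "e > 0" "\<And>\<rho>'. dist \<rho>' \<rho> < e \<Longrightarrow> near_stratum \<rho>' \<Longrightarrow>
    \<exists>g f. unitary g \<and> f \<in> fibre_space \<and> norm f < \<epsilon> \<and> norm (spec_proj \<rho>' - a) < \<epsilon> \<and>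
      (f, spec_proj \<rho>' - a) \<in> \<Omega>' \<and> \<rho>' = conj_by g (tau (f, spec_proj \<rho>' - a))"
proof -
  obtain r where r: "r > 0" "ball (0, 0) r \<subseteq> \<Omega>" using open_\<Omega> by (meson open_contains_ball)
  define \<delta> where "\<delta> = min \<epsilon> (r / 2)"
  have \<delta>: "\<delta> > 0" using assms r by (simp add: \<delta>_def)
  obtain e where e: "e > 0" "\<And>\<rho>'. dist \<rho>' \<rho> < e \<Longrightarrow> lagrangian_rep \<rho>' \<Longrightarrow> pattern_le a (spec_proj \<rho>') \<Longrightarrow>
    \<exists>p. frame \<rho>' p (spec_proj \<rho>') \<and> dist p p0 < \<delta> \<and> dist (spec_proj \<rho>') a < \<delta>"
    by (rule frames_nearby[OF irr frame0 spec_a \<delta>]) (rule that)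
  show ?thesis
  proof (rule that[OF e(1)])
    fix \<rho>' assume d: "dist \<rho>' \<rho> < e" and ns: "near_stratum \<rho>'"
    define t where "t = spec_proj \<rho>' - a"
    have b: "spec_proj \<rho>' = a + t" by (simp add: t_def)
    have lag: "lagrangian_rep \<rho>'" and pat: "pattern_le a (a + t)" using ns by (auto simp: near_stratum_def b)
    obtain p where p: "frame \<rho>' p (a + t)" "dist p p0 < \<delta>" "dist (a + t) a < \<delta>"
      using e(2)[OF d lag] pat by (auto simp: b)
    have up: "unitary (p $ s)" for s using p(1) by (simp add: frame_def)
    obtain g c where gc: "unitary g" "in_gauge a c" "proj gauge_dirs ((\<chi> s. g ** p $ s ** c s) - p0) = 0"
      "dist (\<chi> s. g ** p $ s ** c s) p0 \<le> dist p p0"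
      by (rule slice[OF up]) (rule that)
    define q where "q = (\<chi> s. g ** p $ s ** c s)"
    define y where "y = q - p0"
    have q: "q = p0 + y" by (simp add: y_def)
    have "in_gauge (a + t) c" by (rule in_gauge_pattern_le[OF gc(2) spec_a pat])
    then have "frame \<rho>' (\<chi> s. p $ s ** c s) (a + t)"
      by (intro frame_gauge p) (auto simp: in_gauge_def)
    from frame_conj_by[OF this gc(1)] have fr: "frame (conj_by g \<rho>') (p0 + y) (a + t)"
      unfolding q[symmetric] by (simp add: q_def matrix_mul_assoc)
    have py: "proj gauge_dirs y = 0" using gc(3) by (simp add: y_def q_def)
    have ny: "norm y < \<delta>" using gc(4) p(2) by (simp add: y_def q_def dist_norm)
    have nt: "norm t < \<delta>" using p(3) by (simp add: dist_norm)
    have "norm (y, t) < r"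
      using norm_Pair_le[of y t] ny nt by (simp add: \<delta>_def)
    then have yt: "(y, t) \<in> \<Omega>" using r(2) by (auto simp: dist_norm zero_prod_def[symmetric])
    define f where "f = proj fibre_space y"
    have E: "eqs (y, t) = 0" and rep: "conj_by g \<rho>' = rep_of (p0 + y) t"
      using frame_imp_eqs[OF fr py] by auto
    have f: "(f, t) \<in> \<Omega>'" "Y (f, t) = y" using eqs_chart[OF yt E] by (auto simp: f_def)
    have "\<rho>' = conj_by (adj g) (conj_by g \<rho>')" using gc(1) by (simp add: conj_by_adj)
    also have "conj_by g \<rho>' = tau (f, t)" by (simp add: tau_def f rep)
    finally have "\<rho>' = conj_by (adj g) (tau (f, t))" .
    moreover have "norm f < \<epsilon>" "norm t < \<epsilon>"
      using norm_proj_le[OF subspace_fibre_space, of y] ny nt by (auto simp: f_def \<delta>_def)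
    moreover have "f \<in> fibre_space" unfolding f_def by (rule proj_in[OF subspace_fibre_space])
    ultimately show "\<exists>g f. unitary g \<and> f \<in> fibre_space \<and> norm f < \<epsilon> \<and> norm (spec_proj \<rho>' - a) < \<epsilon> \<and>
      (f, spec_proj \<rho>' - a) \<in> \<Omega>' \<and> \<rho>' = conj_by g (tau (f, spec_proj \<rho>' - a))"
      unfolding t_def[symmetric] using f(1) gc(1) unitary_adj by blast
  qed
qed

text \<open>The section \<open>tau\<close> enlarged by the directions of conjugation.\<close>

definition Theta :: "'n cmat \<times> ('n, 'l) mats \<times> ('n, 'l) spectra \<Rightarrow> ('n, 'l) mats" where
  "Theta x = twist (fst x) (tau (snd x))"

definition Theta_dom :: "('n cmat \<times> ('n, 'l) mats \<times> ('n, 'l) spectra) set" where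
  "Theta_dom = {x. invertible (mat 1 + fst x) \<and> snd x \<in> \<Omega>'}"

lemma open_Theta_dom: "open Theta_dom" and zero_Theta_dom: "0 \<in> Theta_dom"
proof -
  have "Theta_dom = (\<lambda>x. mat 1 + fst x) -` {A. invertible A} \<inter> snd -` \<Omega>'" by (auto simp: Theta_dom_def)
  moreover have "open ((\<lambda>x. mat 1 + fst x) -` {A. invertible A} :: ('n cmat \<times> ('n, 'l) mats \<times> ('n, 'l) spectra) set)"
    by (intro open_vimage open_invertible continuous_intros)
  moreover have "open (snd -` \<Omega>' :: ('n cmat \<times> ('n, 'l) mats \<times> ('n, 'l) spectra) set)"
    by (intro open_vimage open_\<Omega>' continuous_intros)
  ultimately show "open Theta_dom" by (simp only: open_Int)
  show "0 \<in> Theta_dom"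
    using open_\<Omega>'(2) by (auto simp: Theta_dom_def zero_prod_def invertible_def intro!: exI[of _ "mat 1"])
qed

lemma smooth_on_Theta: "smooth_on Theta_dom Theta"
  unfolding Theta_def twist_def
  by (intro smooth_intros open_Theta_dom smooth_on_compose[OF open_Theta_dom _ smooth_on_tau]
      smooth_on_compose[OF open_Theta_dom _ smooth_on_matrix_inv]) (auto simp: Theta_dom_def)

text \<open>The relation Theta (1 + z) = (1 + z) tau is differentiated, which avoids a derivative of
  the inverse matrix.\<close>

lemma derivative_Theta:
  assumes f: "f \<in> fibre_space" and v: "v = frechet_derivative Y (at (0, 0)) (f, t)"
  shows "frechet_derivative Theta (at 0) (z, f, t) $ s =
    z ** \<rho> $ s - \<rho> $ s ** z + (v $ s ** dg (a $ s) ** adj (p0 $ s) + p0 $ s ** dg' (a $ s) (t $ s) ** adj (p0 $ s)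
      + p0 $ s ** dg (a $ s) ** adj (v $ s))"
proof -
  let ?D = "frechet_derivative Theta (at 0)" and ?DY = "frechet_derivative Y (at (0, 0))"
  have D: "(Theta has_derivative ?D) (at 0)" by (rule smooth_on_has_derivative[OF smooth_on_Theta zero_Theta_dom])
  have DY: "(Y has_derivative ?DY) (at (0, 0))" by (rule smooth_on_has_derivative[OF smooth_Y open_\<Omega>'(2)])
  have DY': "((\<lambda>x. Y (snd x)) has_derivative (\<lambda>x. ?DY (snd x))) (at (0 :: 'n cmat \<times> ('n, 'l) mats \<times> ('n, 'l) spectra))"
    by (rule has_derivative_compose[of snd]) (use DY in \<open>auto simp: zero_prod_def intro!: derivative_eq_intros\<close>)
  have p: "((\<lambda>x. (p0 + Y (snd x)) $ s) has_derivative (\<lambda>x. ?DY (snd x) $ s)) (at (0 :: 'n cmat \<times> ('n, 'l) mats \<times> ('n, 'l) spectra))"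
    using has_derivative_add[OF has_derivative_const[of "p0 $ s"] bounded_linear.has_derivative[OF bounded_linear_vec_nth DY']]
    by simp
  have sn: "((\<lambda>x. snd (snd x) $ s) has_derivative (\<lambda>x. snd (snd x) $ s)) (at (0 :: 'n cmat \<times> ('n, 'l) mats \<times> ('n, 'l) spectra))"
    by (intro bounded_linear.has_derivative[OF bounded_linear_vec_nth] has_derivative_snd has_derivative_ident)
  have d: "((\<lambda>x. dg (a $ s + snd (snd x) $ s)) has_derivative (\<lambda>x. dg' (a $ s) (snd (snd x) $ s)))
      (at (0 :: 'n cmat \<times> ('n, 'l) mats \<times> ('n, 'l) spectra))"
    by (rule has_derivative_compose[OF sn]) (simp add: has_derivative_dg)
  have fs: "((\<lambda>x. mat 1 + fst x) has_derivative fst) (at (0 :: 'n cmat \<times> ('n, 'l) mats \<times> ('n, 'l) spectra))"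
    using has_derivative_add[OF has_derivative_const[of "mat 1"] has_derivative_fst[OF has_derivative_ident]] by simp
  note T = has_derivative_matrix_mult[OF has_derivative_matrix_mult[OF p d] bounded_linear.has_derivative[OF bounded_linear_adj p]]
  note R = has_derivative_matrix_mult[OF fs T]
  note L = has_derivative_matrix_mult[OF bounded_linear.has_derivative[OF bounded_linear_vec_nth[of s] D] fs]
  have eq: "Theta x $ s ** (mat 1 + fst x) =
      (mat 1 + fst x) ** ((p0 + Y (snd x)) $ s ** dg (a $ s + snd (snd x) $ s) ** adj ((p0 + Y (snd x)) $ s))"
    if "x \<in> Theta_dom" for x
    using that matrix_inv_mult(2)[of "mat 1 + fst x"]
    by (simp add: Theta_def twist_def tau_def rep_of_def Theta_dom_def matrix_mul_assoc[symmetric])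
  note R' = has_derivative_transform_within_open[OF R open_Theta_dom zero_Theta_dom eq[symmetric]]
  have T0: "Theta 0 = \<rho>"
    using matrix_inv_mult(1)[of "mat 1 :: 'n cmat"] tau_0
    by (simp add: Theta_def twist_def zero_prod_def vec_eq_iff[of _ \<rho>] invertible_def)
  from fun_cong[OF has_derivative_unique[OF L R'], of "(z, f, t)"]
  have "\<rho> $ s ** z + ?D (z, f, t) $ s = p0 $ s ** dg (a $ s) ** adj (v $ s) +
      (p0 $ s ** dg' (a $ s) (t $ s) + v $ s ** dg (a $ s)) ** adj (p0 $ s) + z ** \<rho> $ s"
    by (simp add: T0[unfolded zero_prod_def] v Y_0 zero_prod_def rho_frame)
  then show ?thesis by (simp add: matrix_mult_linear_simps algebra_simps)
qed

text \<open>Differentiation of the unitarity of \<open>p0 + Y\<close> along the line through (f, t);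
  only the equations enter, so \<open>t\<close> may be any direction.\<close>

lemma tangent_skew:
  assumes f: "f \<in> fibre_space" and v: "v = frechet_derivative Y (at (0, 0)) (f, t)"
  shows "adj (v $ s) ** p0 $ s + adj (p0 $ s) ** v $ s = 0"
proof -
  let ?DY = "frechet_derivative Y (at (0, 0))"
  have DY: "(Y has_derivative ?DY) (at (0, 0))" by (rule smooth_on_has_derivative[OF smooth_Y open_\<Omega>'(2)])
  have line: "((\<lambda>r. (r *\<^sub>R f, r *\<^sub>R t)) has_derivative (\<lambda>r. (r *\<^sub>R f, r *\<^sub>R t))) (at (0::real))"
    by (auto intro!: derivative_eq_intros)
  have "((\<lambda>r. Y (r *\<^sub>R f, r *\<^sub>R t)) has_derivative (\<lambda>r. ?DY (r *\<^sub>R f, r *\<^sub>R t))) (at 0)"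
    by (rule has_derivative_compose[OF line]) (use DY in simp)
  then have p: "((\<lambda>r. (p0 + Y (r *\<^sub>R f, r *\<^sub>R t)) $ s) has_derivative (\<lambda>r. ?DY (r *\<^sub>R f, r *\<^sub>R t) $ s)) (at 0)"
    using has_derivative_add[OF has_derivative_const[of "p0 $ s"] bounded_linear.has_derivative[OF bounded_linear_vec_nth]]
    by fastforce
  note P = has_derivative_matrix_mult[OF bounded_linear.has_derivative[OF bounded_linear_adj p] p]
  have op: "open ((\<lambda>r. (r *\<^sub>R f, r *\<^sub>R t)) -` \<Omega>')" by (intro open_vimage open_\<Omega>' continuous_intros)
  have z: "0 \<in> (\<lambda>r. (r *\<^sub>R f, r *\<^sub>R t)) -` \<Omega>'" using open_\<Omega>' by simp
  have "((\<lambda>r. mat 1 :: 'n cmat) has_derivative (\<lambda>h. adj ((p0 + Y (0 *\<^sub>R f, 0 *\<^sub>R t)) $ s) ** ?DY (h *\<^sub>R f, h *\<^sub>R t) $ s +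
      adj (?DY (h *\<^sub>R f, h *\<^sub>R t) $ s) ** (p0 + Y (0 *\<^sub>R f, 0 *\<^sub>R t)) $ s)) (at 0)"
  proof (rule has_derivative_transform_within_open[OF P op z])
    fix r assume "r \<in> (\<lambda>r. (r *\<^sub>R f, r *\<^sub>R t)) -` \<Omega>'"
    then have "eqs (Y (r *\<^sub>R f, r *\<^sub>R t), r *\<^sub>R t) = 0"
      using chart_eqs f subspace_fibre_space by (auto simp: subspace_scale)
    from unitary_of_eqs[OF this] show "adj ((p0 + Y (r *\<^sub>R f, r *\<^sub>R t)) $ s) ** (p0 + Y (r *\<^sub>R f, r *\<^sub>R t)) $ s = mat 1"
      by (rule unitaryD)
  qed
  from fun_cong[OF has_derivative_unique[OF this has_derivative_const], of 1]
  show ?thesis by (simp add: v Y_0 add.commute)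
qed

text \<open>The motion of the eigenvalues gives t = 0; then the motion of the frame is
  \<open>f\<close> itself, and \<open>fibre_space_immersion\<close> gives f = 0 and a scalar
  \<open>z\<close>, which the normalized diagonal entry makes zero.\<close>

lemma Theta_immersion:
  assumes f: "f \<in> fibre_space" and z: "z $ i $ i = 0" and D: "frechet_derivative Theta (at 0) (z, f, t) = 0"
  shows "(z, f, t) = 0"
proof -
  define v where "v = frechet_derivative Y (at (0, 0)) (f, t)"
  define e where "e = (\<chi> s. v $ s ** adj (p0 $ s))"
  have ve: "v $ s = e $ s ** p0 $ s" for s by (simp add: e_def matrix_mul_assoc[symmetric])
  have sk: "adj (e $ s) = - (e $ s)" for s
  proof -
    have "p0 $ s ** (adj (v $ s) ** p0 $ s + adj (p0 $ s) ** v $ s) ** adj (p0 $ s) = 0"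
      by (simp only: tangent_skew[OF f v_def] matrix_mult_linear_simps)
    then have "adj (e $ s) + e $ s = 0"
      by (simp add: e_def adj_mult matrix_mult_linear_simps matrix_mul_assoc[symmetric])
    then show ?thesis by (simp add: add_eq_0_iff2)
  qed
  have main: "(z + e $ s) ** \<rho> $ s - \<rho> $ s ** (z + e $ s) + p0 $ s ** dg' (a $ s) (t $ s) ** adj (p0 $ s) = 0" for s
  proof -
    have "adj (v $ s) = - (adj (p0 $ s) ** e $ s)" by (simp add: ve adj_mult sk matrix_mult_linear_simps)
    then have 1: "p0 $ s ** dg (a $ s) ** adj (v $ s) = - (\<rho> $ s ** e $ s)"
      by (simp add: rho_frame matrix_mult_linear_simps matrix_mul_assoc)
    have 2: "v $ s ** dg (a $ s) ** adj (p0 $ s) = e $ s ** \<rho> $ s"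
      by (simp add: ve rho_frame matrix_mul_assoc)
    have "0 = frechet_derivative Theta (at 0) (z, f, t) $ s" by (simp add: D)
    then show ?thesis
      unfolding derivative_Theta[OF f v_def] 1 2 by (simp add: matrix_mult_linear_simps algebra_simps)
  qed
  \<comment> \<open>In the eigenbasis a commutator with a diagonal matrix has zero diagonal, so the
    diagonal entries show the derivative of the eigenvalues alone.\<close>
  have t: "t $ s $ j = 0" for s j
  proof -
    define w where "w = z + e $ s"
    define m where "m = adj (p0 $ s) ** w ** p0 $ s"
    have "w ** \<rho> $ s - \<rho> $ s ** w + p0 $ s ** dg' (a $ s) (t $ s) ** adj (p0 $ s) = 0"
      unfolding w_def by (rule main)
    then have "adj (p0 $ s) ** (w ** \<rho> $ s - \<rho> $ s ** w + p0 $ s ** dg' (a $ s) (t $ s) ** adj (p0 $ s)) ** p0 $ s = 0"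
      by simp
    moreover have "adj (p0 $ s) ** (w ** \<rho> $ s) ** p0 $ s = m ** dg (a $ s)"
      "adj (p0 $ s) ** (\<rho> $ s ** w) ** p0 $ s = dg (a $ s) ** m"
      "adj (p0 $ s) ** (p0 $ s ** dg' (a $ s) (t $ s) ** adj (p0 $ s)) ** p0 $ s = dg' (a $ s) (t $ s)"
      by (simp_all add: rho_frame m_def matrix_mul_assoc[symmetric])
    ultimately have "m ** dg (a $ s) - dg (a $ s) ** m + dg' (a $ s) (t $ s) = 0"
      by (simp only: matrix_mult_linear_simps)
    from arg_cong[OF this, of "\<lambda>A. A $ j $ j"]
    have "(t $ s $ j) *\<^sub>R (2 * of_real pi * \<i> * expi (a $ s $ j)) = 0"
      by (simp add: dg_mult_nth mult_dg_nth dg'_def mult.commute)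
    moreover have "expi (a $ s $ j) \<noteq> 0" using norm_expi[of "a $ s $ j"] by (metis norm_zero zero_neq_one)
    ultimately show ?thesis by simp
  qed
  then have t0: "t = 0" by (simp add: vec_eq_iff)
  then have vf: "v = f" using derivative_Y[OF f] by (simp add: v_def)
  have comm: "(z + e $ s) ** \<rho> $ s = \<rho> $ s ** (z + e $ s)" for s
  proof -
    have "dg' (a $ s) (t $ s) = 0" by (simp add: t0 dg'_def vec_eq_iff)
    then show ?thesis using main[of s] by (simp add: matrix_mult_linear_simps)
  qed
  obtain e' where e': "\<And>s. adj (e' $ s) = - (e' $ s)" "\<And>s. f $ s = e' $ s ** p0 $ s" "\<And>s. cj (link e' s) = link e' s"
    using f by (rule fibre_space_obtain) (rule that)
  have "e' $ s = e $ s" for s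
  proof -
    have "e' $ s ** p0 $ s ** adj (p0 $ s) = e $ s ** p0 $ s ** adj (p0 $ s)"
      by (simp only: e'(2)[symmetric] ve[symmetric] vf)
    then show ?thesis by (simp add: matrix_mul_assoc[symmetric])
  qed
  then have "e' = e" by (simp add: vec_eq_iff[of e'])
  then have e3: "cj (link e s) = link e s" for s using e'(3) by simp
  have fe: "f $ s = e $ s ** p0 $ s" for s using ve vf by simp
  from fibre_space_immersion[OF f sk fe e3 comm] have "f = 0" "\<exists>c. z = mat c" by auto
  then have "z = 0" using z by (auto simp: mat_nth)
  then show ?thesis using \<open>f = 0\<close> t0 by (simp add: zero_prod_def)
qed

end

context frame_chart
begin

lemma near_stratum_base: "near_stratum \<rho>"
  using frame_imp_lagrangian_rep[OF frame0] frame_spec_proj[OF frame0] spec_a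
    subspace_0[OF subspace_tangent_dirs, of a]
  by (simp add: near_stratum_def spectral_def pattern_le_def)

lemma Theta_0: "Theta (0, f, t) = tau (f, t)"
  using matrix_inv_mult(1)[of "mat 1 :: 'n cmat"]
  by (simp add: Theta_def twist_def vec_eq_iff[of _ "tau (f, t)"] invertible_def)

text \<open>A nearby representation is \<open>conj_by g\<close> of some \<open>tau (f, t)\<close>
  with \<open>g\<close> nearly scalar, so it is \<open>Theta (z, f, t)\<close> with small
  \<open>z\<close>. The left inverse of \<open>Theta\<close> returns the triple, and forgetting
  \<open>z\<close> gives a function constant on nearby conjugates.\<close>

lemma local_chart:
  obtains O' \<Lambda> e r where "open O'" "smooth_on O' \<Lambda>" "e > 0" "r > 0"
    "\<And>\<sigma>. dist \<sigma> \<rho> < e \<Longrightarrow> near_stratum \<sigma> \<Longrightarrow> \<sigma> \<in> O' \<and> snd (\<Lambda> \<sigma>) = spec_proj \<sigma> - a \<and>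
      fst (\<Lambda> \<sigma>) \<in> fibre_space \<and> (\<exists>g. unitary g \<and> \<sigma> = conj_by g (tau (\<Lambda> \<sigma>)))"
    "\<And>\<sigma> \<sigma>' g. dist \<sigma> \<rho> < e \<Longrightarrow> dist \<sigma>' \<rho> < e \<Longrightarrow> near_stratum \<sigma> \<Longrightarrow> near_stratum \<sigma>' \<Longrightarrow> unitary g \<Longrightarrow>
      \<sigma> = conj_by g \<sigma>' \<Longrightarrow> \<Lambda> \<sigma> = \<Lambda> \<sigma>'"
    "\<And>f t. f \<in> fibre_space \<Longrightarrow> t \<in> tangent_dirs a \<Longrightarrow> norm f < r \<Longrightarrow> norm t < r \<Longrightarrow> \<Lambda> (tau (f, t)) = (f, t)"
proof -
  \<comment> \<open>One normalized diagonal entry removes the scalars, the only matrices whose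
    conjugation is infinitesimally trivial.\<close>
  define X :: "('n cmat \<times> ('n, 'l) mats \<times> ('n, 'l) spectra) set"
    where "X = {z. z $ undefined $ undefined = 0} \<times> fibre_space \<times> tangent_dirs a"
  have "subspace {z :: 'n cmat. z $ undefined $ undefined = 0}"
    by (auto simp: subspace_def)
  then have X: "subspace X"
    unfolding X_def by (intro subspace_Times subspace_fibre_space subspace_tangent_dirs)
  have inj: "x = 0" if "x \<in> X" "frechet_derivative Theta (at 0) x = 0" for x
    using that Theta_immersion by (cases x) (auto simp: X_def)
  obtain U' O' \<Lambda>0 where L: "open U'" "0 \<in> U'" "U' \<subseteq> Theta_dom" "open O'" "smooth_on O' \<Lambda>0"
    "\<And>x. x \<in> U' \<Longrightarrow> x \<in> X \<Longrightarrow> Theta x \<in> O' \<and> \<Lambda>0 (Theta x) = x"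
    by (rule smooth_left_inverse[OF open_Theta_dom zero_Theta_dom smooth_on_Theta X inj]) (assumption+, rule that)
  obtain r0 where r0: "r0 > 0" "ball 0 r0 \<subseteq> U'" using L(1,2) open_contains_ball by blast
  define r where "r = r0 / 3"
  have r: "r > 0" using r0 by (simp add: r_def)
  have U': "(z, f, t) \<in> U'" if "norm z < r" "norm f < r" "norm t < r" for z f t
  proof -
    have "norm (z, f, t) \<le> norm z + (norm f + norm t)"
      using norm_Pair_le[of z "(f, t)"] norm_Pair_le[of f t] by linarith
    then have "norm (z, f, t) < r0" using that by (simp add: r_def)
    then show ?thesis using r0(2) by auto
  qed
  have rep: "conj_by g (tau (f, t)) \<in> O' \<and> snd (\<Lambda>0 (conj_by g (tau (f, t)))) = (f, t)"
    if "norm z < r" "norm f < r" "norm t < r" "z $ undefined $ undefined = 0" "f \<in> fibre_space" "t \<in> tangent_dirs a"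
      "conj_by g (tau (f, t)) = twist z (tau (f, t))" for z f t g
    using L(6)[OF U'[OF that(1-3)]] that(4-) by (auto simp: X_def Theta_def)
  define M where "M = 2 * (1 + norm (mat 1 :: 'n cmat))"
  have M: "M > 0" unfolding M_def by (intro mult_pos_pos add_pos_nonneg) simp_all
  \<comment> \<open>Chosen so that the bound on \<open>z\<close> in \<open>conj_by_twist\<close>,
    which is \<open>M\<close> times \<epsilon>, stays below \<open>r\<close>.\<close>
  define \<epsilon> where "\<epsilon> = min (1/2) (r / (2 * M))"
  have \<epsilon>: "\<epsilon> > 0" "\<epsilon> \<le> 1/2" "M * \<epsilon> < r"
  proof -
    show "\<epsilon> > 0" "\<epsilon> \<le> 1/2" using r M by (auto simp: \<epsilon>_def)
    have "M * \<epsilon> \<le> M * (r / (2 * M))" using M by (intro mult_left_mono) (auto simp: \<epsilon>_def)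
    also have "\<dots> < r" using M r by simp
    finally show "M * \<epsilon> < r" .
  qed
  obtain e0 where e0: "e0 > 0" "\<And>\<sigma> \<sigma>' g. dist \<sigma> \<rho> < e0 \<Longrightarrow> dist \<sigma>' \<rho> < e0 \<Longrightarrow> unitary g \<Longrightarrow> \<sigma> = conj_by g \<sigma>' \<Longrightarrow>
    \<exists>c. cmod c = 1 \<and> dist g (mat c) < \<epsilon>"
    by (rule conjugators_near_scalar[OF irr \<epsilon>(1)]) (rule that)
  have key: "\<sigma> \<in> O' \<and> snd (\<Lambda>0 \<sigma>) = (f, t)"
    if k: "dist \<sigma> \<rho> < e0" "dist (tau (f, t)) \<rho> < e0" "norm f < r" "norm t < r" "f \<in> fibre_space" "t \<in> tangent_dirs a"
      and g: "unitary g" and \<sigma>: "\<sigma> = conj_by g (tau (f, t))" for \<sigma> f t g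
  proof -
    obtain c where c: "cmod c = 1" "dist g (mat c) < \<epsilon>" using e0(2)[OF k(1,2) g \<sigma>] by blast
    obtain z where z: "z $ undefined $ undefined = 0" "norm z \<le> 2 * (1 + norm (mat 1 :: 'n cmat)) * \<epsilon>" "conj_by g (tau (f, t)) = twist z (tau (f, t))"
      by (rule conj_by_twist[OF g c \<epsilon>(2)]) (rule that)
    show ?thesis unfolding \<sigma>
      using z(1,3) z(2)[folded M_def] \<epsilon>(3) k by (intro rep[of z]) auto
  qed
  have "continuous_on \<Omega>' tau" by (rule smooth_on_imp_continuous_on[OF smooth_on_tau])
  then have "\<exists>d>0. \<forall>x\<in>\<Omega>'. dist x (0, 0) < d \<longrightarrow> dist (tau x) (tau (0, 0)) < e0"
    using open_\<Omega>'(2) e0(1) unfolding continuous_on_iff by blast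
  then obtain d where d: "d > 0" "\<And>x. x \<in> \<Omega>' \<Longrightarrow> dist x (0, 0) < d \<Longrightarrow> dist (tau x) \<rho> < e0"
    by (auto simp: tau_0)
  define q where "q = min r (d / 2)"
  have q: "q > 0" using r d by (simp add: q_def)
  obtain e1 where e1: "e1 > 0" "\<And>\<rho>'. dist \<rho>' \<rho> < e1 \<Longrightarrow> near_stratum \<rho>' \<Longrightarrow>
    \<exists>g f. unitary g \<and> f \<in> fibre_space \<and> norm f < q \<and> norm (spec_proj \<rho>' - a) < q \<and>
      (f, spec_proj \<rho>' - a) \<in> \<Omega>' \<and> \<rho>' = conj_by g (tau (f, spec_proj \<rho>' - a))"
    by (rule coverage[OF q]) (rule that)
  define \<Lambda> where "\<Lambda> \<sigma> = snd (\<Lambda>0 \<sigma>)" for \<sigma>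
  have cov: "\<exists>g f. unitary g \<and> f \<in> fibre_space \<and> norm f < r \<and> norm (spec_proj \<sigma> - a) < r \<and>
      spec_proj \<sigma> - a \<in> tangent_dirs a \<and>
      dist (tau (f, spec_proj \<sigma> - a)) \<rho> < e0 \<and> \<sigma> = conj_by g (tau (f, spec_proj \<sigma> - a))"
    if "dist \<sigma> \<rho> < min e0 e1" "near_stratum \<sigma>" for \<sigma>
  proof -
    have "dist \<sigma> \<rho> < e1" using that(1) by simp
    from e1(2)[OF this that(2)]
    obtain g f where gf: "unitary g" "f \<in> fibre_space" "norm f < q" "norm (spec_proj \<sigma> - a) < q"
      "(f, spec_proj \<sigma> - a) \<in> \<Omega>'" "\<sigma> = conj_by g (tau (f, spec_proj \<sigma> - a))"
      by blast
    have "norm (f, spec_proj \<sigma> - a) < d"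
      using norm_Pair_le[of f "spec_proj \<sigma> - a"] gf(3,4) by (simp add: q_def)
    then have "dist (tau (f, spec_proj \<sigma> - a)) \<rho> < e0"
      using d(2)[OF gf(5)] by (simp add: dist_norm zero_prod_def[symmetric])
    then show ?thesis using gf that(2) by (auto simp: q_def near_stratum_def)
  qed
  show ?thesis
  proof (rule that)
    show "open O'" "0 < min e0 e1" "r > 0" by (simp_all add: L e0 e1 r)
    show "smooth_on O' \<Lambda>" unfolding \<Lambda>_def by (intro smooth_on_snd L)
  next
    fix \<sigma> assume \<sigma>: "dist \<sigma> \<rho> < min e0 e1" "near_stratum \<sigma>"
    obtain g f where gf: "unitary g" "f \<in> fibre_space" "norm f < r" "norm (spec_proj \<sigma> - a) < r"
      "spec_proj \<sigma> - a \<in> tangent_dirs a"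
      "dist (tau (f, spec_proj \<sigma> - a)) \<rho> < e0" "\<sigma> = conj_by g (tau (f, spec_proj \<sigma> - a))"
      using cov[OF \<sigma>] by blast
    have "\<sigma> \<in> O'" "\<Lambda> \<sigma> = (f, spec_proj \<sigma> - a)"
      unfolding \<Lambda>_def using key[OF _ gf(6,3,4,2,5,1,7)] \<sigma> by auto
    then show "\<sigma> \<in> O' \<and> snd (\<Lambda> \<sigma>) = spec_proj \<sigma> - a \<and> fst (\<Lambda> \<sigma>) \<in> fibre_space \<and>
        (\<exists>g. unitary g \<and> \<sigma> = conj_by g (tau (\<Lambda> \<sigma>)))"
      using gf(1,2,7) by auto
  next
    fix \<sigma> \<sigma>' g
    assume d\<sigma>: "dist \<sigma> \<rho> < min e0 e1" and \<sigma>': "dist \<sigma>' \<rho> < min e0 e1" "near_stratum \<sigma>'" and g: "unitary g"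
      and eq: "\<sigma> = conj_by g \<sigma>'"
    obtain g' f where gf: "unitary g'" "f \<in> fibre_space" "norm f < r" "norm (spec_proj \<sigma>' - a) < r"
      "spec_proj \<sigma>' - a \<in> tangent_dirs a"
      "dist (tau (f, spec_proj \<sigma>' - a)) \<rho> < e0" "\<sigma>' = conj_by g' (tau (f, spec_proj \<sigma>' - a))"
      using cov[OF \<sigma>'] by blast
    have "\<sigma> = conj_by (g ** g') (tau (f, spec_proj \<sigma>' - a))"
      unfolding eq conj_by_conj_by[symmetric] using gf(7) by simp
    then have "\<Lambda> \<sigma> = (f, spec_proj \<sigma>' - a)"
      unfolding \<Lambda>_def using key[OF _ gf(6,3,4,2,5) unitary_mult[OF g gf(1)]] d\<sigma> by auto
    moreover have "\<Lambda> \<sigma>' = (f, spec_proj \<sigma>' - a)"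
      unfolding \<Lambda>_def using key[OF _ gf(6,3,4,2,5,1,7)] \<sigma>' by auto
    ultimately show "\<Lambda> \<sigma> = \<Lambda> \<sigma>'" by simp
  next
    fix f t assume ft: "f \<in> fibre_space" "t \<in> tangent_dirs a" "norm f < r" "norm t < r"
    have "(0, f, t) \<in> U'" by (rule U') (use ft r in auto)
    moreover have "(0, f, t) \<in> X" using ft by (simp add: X_def)
    ultimately show "\<Lambda> (tau (f, t)) = (f, t)" using L(6) by (auto simp: \<Lambda>_def Theta_0[symmetric])
  qed
qed

end

section \<open>Passage to conjugacy classes: the fibration over the stratum and its
  consequences\<close>

definition stratum_reps ::
    "int \<Rightarrow> ('l::{finite,linorder} \<Rightarrow> nat) \<Rightarrow> ('l \<Rightarrow> nat \<Rightarrow> nat) \<Rightarrow> 'l set \<Rightarrow> ('n::{finite,linorder}, 'l) mats set" where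
  "stratum_reps I l m z = {\<sigma>. lagrangian_rep \<sigma> \<and> irreducible_rep \<sigma> \<and> spec_proj \<sigma> \<in> P_stratum I l m z}"

text \<open>The frames are forgotten at this point: what remains are a smooth map \<Lambda> reading
  off the spectrum and a fibre coordinate, and a smooth section \<tau> inverting it up to
  conjugation. The spectrum itself replaces the displacement \<open>t\<close>, and it is placed
  first.\<close>

lemma stratum_reps_local_structure:
  fixes \<rho> :: "('n::{finite,linorder}, 'l::{finite,linorder}) mats"
  assumes part: "\<And>s. is_partition CARD('n) (l s) (m s)" and \<rho>: "\<rho> \<in> stratum_reps I l m z"
  obtains S :: "('n, 'l) mats set" and O' \<Lambda> V \<tau> e r
  where "subspace S"
    "real (dim S) = (real CARD('l) - 2) / 2 * (real CARD('n))\<^sup>2 + 1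
       - 1/2 * (\<Sum>s\<in>UNIV. \<Sum>j=1..l s. (real (multiplicity_of (m s) j))\<^sup>2)"
    "open O'" "smooth_on O' \<Lambda>" "open V" "smooth_on V \<tau>" "e > 0" "r > 0"
    "\<And>\<sigma>. \<sigma> \<in> stratum_reps I l m z \<Longrightarrow> dist \<sigma> \<rho> < e \<Longrightarrow> \<sigma> \<in> O' \<and> fst (\<Lambda> \<sigma>) = spec_proj \<sigma> \<and>
      snd (\<Lambda> \<sigma>) \<in> S \<and> (\<exists>g. unitary g \<and> \<sigma> = conj_by g (\<tau> (\<Lambda> \<sigma>)))"
    "\<And>\<sigma> \<sigma>' g. \<sigma> \<in> stratum_reps I l m z \<Longrightarrow> \<sigma>' \<in> stratum_reps I l m z \<Longrightarrow> dist \<sigma> \<rho> < e \<Longrightarrow> dist \<sigma>' \<rho> < e \<Longrightarrow>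
      unitary g \<Longrightarrow> \<sigma> = conj_by g \<sigma>' \<Longrightarrow> \<Lambda> \<sigma> = \<Lambda> \<sigma>'"
    "\<And>b f. b \<in> P_stratum I l m z \<Longrightarrow> f \<in> S \<Longrightarrow> dist b (spec_proj \<rho>) < r \<Longrightarrow> norm f < r \<Longrightarrow>
      (b, f) \<in> V \<and> \<tau> (b, f) \<in> stratum_reps I l m z \<and> dist (\<tau> (b, f)) \<rho> < e \<and> \<Lambda> (\<tau> (b, f)) = (b, f)"
    "\<Lambda> \<rho> = (spec_proj \<rho>, 0)"
proof -
  define a where "a = spec_proj \<rho>"
  have lag: "lagrangian_rep \<rho>" and irr: "irreducible_rep \<rho>" and a: "a \<in> P_stratum I l m z"
    using \<rho> by (auto simp: stratum_reps_def a_def)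
  obtain p0 where p0: "frame \<rho> p0 a" using lagrangian_rep_imp_frame[OF lag] unfolding a_def by metis
  note spec_a = P_stratum_spectral[where l = l and m = m, OF part a]
  interpret irreducible_frame \<rho> p0 a by unfold_locales (fact irr p0 spec_a)+
  obtain \<Omega> \<Omega>' Y where "frame_chart \<rho> p0 a \<Omega> \<Omega>' Y" using ex_frame_chart by blast
  then interpret frame_chart \<rho> p0 a \<Omega> \<Omega>' Y .
  have near: "near_stratum \<sigma>" if "\<sigma> \<in> stratum_reps I l m z" for \<sigma>
    using that P_stratum_pattern_le[where l = l and m = m, OF part a] P_stratum_diff[where l = l and m = m, OF part a]
    by (auto simp: near_stratum_def stratum_reps_def)
  obtain O' \<Lambda>0 e1 r1 where L: "open O'" "smooth_on O' \<Lambda>0" "e1 > 0" "r1 > 0"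
    "\<And>\<sigma>. dist \<sigma> \<rho> < e1 \<Longrightarrow> near_stratum \<sigma> \<Longrightarrow> \<sigma> \<in> O' \<and> snd (\<Lambda>0 \<sigma>) = spec_proj \<sigma> - a \<and>
      fst (\<Lambda>0 \<sigma>) \<in> fibre_space \<and> (\<exists>g. unitary g \<and> \<sigma> = conj_by g (tau (\<Lambda>0 \<sigma>)))"
    "\<And>\<sigma> \<sigma>' g. dist \<sigma> \<rho> < e1 \<Longrightarrow> dist \<sigma>' \<rho> < e1 \<Longrightarrow> near_stratum \<sigma> \<Longrightarrow> near_stratum \<sigma>' \<Longrightarrow> unitary g \<Longrightarrow>
      \<sigma> = conj_by g \<sigma>' \<Longrightarrow> \<Lambda>0 \<sigma> = \<Lambda>0 \<sigma>'"
    "\<And>f t. f \<in> fibre_space \<Longrightarrow> t \<in> tangent_dirs a \<Longrightarrow> norm f < r1 \<Longrightarrow> norm t < r1 \<Longrightarrow> \<Lambda>0 (tau (f, t)) = (f, t)"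
    by (rule local_chart) (rule that)
  obtain e2 where e2: "e2 > 0" "\<And>\<rho>'. dist \<rho>' \<rho> < e2 \<Longrightarrow> is_rep \<rho>' \<Longrightarrow> irreducible_rep \<rho>'"
    by (rule irreducible_rep_nearby[OF irr]) (rule that)
  define e where "e = min e1 e2"
  have e: "e > 0" "e \<le> e1" "e \<le> e2" using L(3) e2(1) by (auto simp: e_def)
  \<comment> \<open>Parameters whose representation is close enough to \<rho> to be irreducible and
    to lie where \<Lambda> is controlled.\<close>
  define A where "A = {x \<in> \<Omega>'. tau x \<in> ball \<rho> e}"
  have "open A"
    unfolding A_def using continuous_open_preimage[OF smooth_on_imp_continuous_on[OF smooth_on_tau] open_\<Omega>'(1) open_ball]
    by (simp add: vimage_def Int_def)
  moreover have "(0, 0) \<in> A" using open_\<Omega>' e by (simp add: A_def tau_0)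
  ultimately obtain r2 where r2: "r2 > 0" "ball (0, 0) r2 \<subseteq> A" by (meson open_contains_ball)
  define r where "r = min r1 (r2 / 2)"
  have r: "r > 0" "r \<le> r1" using L(4) r2 by (auto simp: r_def)
  have A: "(f, t) \<in> A" if "norm f < r" "norm t < r" for f t
  proof -
    have "norm (f, t) < r2" using norm_Pair_le[of f t] that by (simp add: r_def)
    then show ?thesis using r2(2) by (auto simp: dist_norm zero_prod_def[symmetric])
  qed
  define \<Lambda> where "\<Lambda> \<sigma> = (a + snd (\<Lambda>0 \<sigma>), fst (\<Lambda>0 \<sigma>))" for \<sigma>
  define \<tau> where "\<tau> x = tau (snd x, fst x - a)" for x
  define V where "V = (\<lambda>x. (snd x, fst x - a)) -` \<Omega>'"
  have V: "open V" unfolding V_def by (intro open_vimage open_\<Omega>' continuous_intros)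
  have inS: "\<tau> (b, f) \<in> stratum_reps I l m z \<and> dist (\<tau> (b, f)) \<rho> < e \<and> (b, f) \<in> V \<and> \<Lambda> (\<tau> (b, f)) = (b, f)"
    if b: "b \<in> P_stratum I l m z" and f: "f \<in> fibre_space" and small: "dist b a < r" "norm f < r" for b f
  proof -
    have t: "b - a \<in> tangent_dirs a" by (rule P_stratum_diff[where l = l and m = m, OF part a b])
    have n: "norm (b - a) < r" using small by (simp add: dist_norm)
    have fA: "(f, b - a) \<in> A" by (rule A[OF small(2) n])
    then have \<Omega>: "(f, b - a) \<in> \<Omega>'" and near: "dist (tau (f, b - a)) \<rho> < e"
      by (auto simp: A_def dist_commute)
    have fr: "frame (tau (f, b - a)) (p0 + Y (f, b - a)) b"
      using frame_tau[OF \<Omega> f t] by simp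
    have lagr: "lagrangian_rep (tau (f, b - a))" by (rule frame_imp_lagrangian_rep[OF fr])
    have "spectral b" by (rule P_stratum_spectral[where l = l and m = m, OF part b])
    then have sp: "spec_proj (tau (f, b - a)) = b" using frame_spec_proj[OF fr] by (simp add: spectral_def)
    have "irreducible_rep (tau (f, b - a))"
      using e2(2) near e(3) lagr by (simp add: lagrangian_rep_def)
    moreover have "\<Lambda>0 (tau (f, b - a)) = (f, b - a)"
      using L(7)[OF f t] small(2) n r(2) by simp
    ultimately show ?thesis using lagr sp near \<Omega> b by (simp add: stratum_reps_def \<tau>_def \<Lambda>_def V_def)
  qed
  show ?thesis
  proof (rule that[where S = fibre_space and O' = O' and \<Lambda> = \<Lambda> and V = V and \<tau> = \<tau> and e = e and r = r])
    show "subspace fibre_space" by (rule subspace_fibre_space)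
    show "real (dim fibre_space) = (real CARD('l) - 2) / 2 * (real CARD('n))\<^sup>2 + 1
       - 1/2 * (\<Sum>s\<in>UNIV. \<Sum>j=1..l s. (real (multiplicity_of (m s) j))\<^sup>2)"
      unfolding dim_fibre_space P_stratum_card[where l = l and m = m, OF part a] by simp
    show "open O'" "open V" "e > 0" "r > 0" by (fact L V e r)+
    show "smooth_on O' \<Lambda>" unfolding \<Lambda>_def by (intro smooth_intros L)
    show "smooth_on V \<tau>" unfolding \<tau>_def
      by (rule smooth_on_compose[OF V _ smooth_on_tau]) (intro smooth_intros V, simp add: V_def)
  next
    fix \<sigma> assume \<sigma>: "\<sigma> \<in> stratum_reps I l m z" "dist \<sigma> \<rho> < e"
    show "\<sigma> \<in> O' \<and> fst (\<Lambda> \<sigma>) = spec_proj \<sigma> \<and> snd (\<Lambda> \<sigma>) \<in> fibre_space \<and>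
        (\<exists>g. unitary g \<and> \<sigma> = conj_by g (\<tau> (\<Lambda> \<sigma>)))"
    proof -
      have *: "\<sigma> \<in> O'" "snd (\<Lambda>0 \<sigma>) = spec_proj \<sigma> - a" "fst (\<Lambda>0 \<sigma>) \<in> fibre_space"
        "\<exists>g. unitary g \<and> \<sigma> = conj_by g (tau (\<Lambda>0 \<sigma>))"
        using L(5)[OF _ near[OF \<sigma>(1)]] \<sigma>(2) e(2) by auto
      have "\<tau> (\<Lambda> \<sigma>) = tau (\<Lambda>0 \<sigma>)" by (simp add: \<tau>_def \<Lambda>_def)
      then show ?thesis using * by (simp add: \<Lambda>_def)
    qed
  next
    fix \<sigma> \<sigma>' g
    assume *: "\<sigma> \<in> stratum_reps I l m z" "\<sigma>' \<in> stratum_reps I l m z" "dist \<sigma> \<rho> < e" "dist \<sigma>' \<rho> < e"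
      "unitary g" "\<sigma> = conj_by g \<sigma>'"
    have "\<Lambda>0 \<sigma> = \<Lambda>0 \<sigma>'"
      by (rule L(6)[OF _ _ near near]) (use * e(2) in auto)
    then show "\<Lambda> \<sigma> = \<Lambda> \<sigma>'" by (simp add: \<Lambda>_def)
  next
    fix b f assume "b \<in> P_stratum I l m z" "f \<in> fibre_space" "dist b (spec_proj \<rho>) < r" "norm f < r"
    then show "(b, f) \<in> V \<and> \<tau> (b, f) \<in> stratum_reps I l m z \<and> dist (\<tau> (b, f)) \<rho> < e \<and> \<Lambda> (\<tau> (b, f)) = (b, f)"
      using inS by (simp add: a_def)
  next
    have "\<tau> (a, 0) = \<rho>" by (simp add: \<tau>_def tau_0)
    then show "\<Lambda> \<rho> = (spec_proj \<rho>, 0)"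
      using inS[OF a subspace_0[OF subspace_fibre_space]] r(1) by (simp add: a_def)
  qed
qed

lemma stratum_reps_conj_by: "\<sigma> \<in> stratum_reps I l m z \<Longrightarrow> unitary g \<Longrightarrow> conj_by g \<sigma> \<in> stratum_reps I l m z"
  by (simp add: stratum_reps_def lagrangian_rep_conj_by irreducible_rep_conj_by spec_proj_conj_by)

lemma LRep_irr_over_eq: "LRep_irr_over I l m z = conj_class ` stratum_reps I l m z"
  by (auto simp: LRep_irr_over_def LRep_irr_def L_stratum_def stratum_reps_def spec_proj_class_conj_class)

lemma conj_class_LRep_irr_over: "conj_class -` LRep_irr_over I l m z = stratum_reps I l m z"
proof (intro equalityI subsetI)
  fix \<sigma> assume "\<sigma> \<in> conj_class -` LRep_irr_over I l m z"
  then obtain \<sigma>' where \<sigma>': "\<sigma>' \<in> stratum_reps I l m z" "conj_class \<sigma>' = conj_class \<sigma>"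
    unfolding LRep_irr_over_eq by auto
  then obtain g where "unitary g" "\<sigma> = conj_by g \<sigma>'" unfolding conj_class_eq_iff by blast
  then show "\<sigma> \<in> stratum_reps I l m z" using stratum_reps_conj_by[OF \<sigma>'(1)] by simp
qed (simp add: LRep_irr_over_eq)

lemma linear_conj_by: "linear (conj_by g)"
  by (rule linearI) (simp_all add: vec_eq_iff[of "conj_by _ _"] matrix_mult_linear_simps)

lemma smooth_map_onI:
  "(\<And>x. x \<in> A \<Longrightarrow> \<exists>U g. open U \<and> x \<in> U \<and> smooth_on U g \<and> (\<forall>y\<in>A \<inter> U. g y = f y)) \<Longrightarrow> smooth_map_on A f"
  unfolding smooth_map_on_def smooth_on_def by blast

lemma smooth_map_onD:
  "smooth_map_on A f \<Longrightarrow> x \<in> A \<Longrightarrow> \<exists>U g. open U \<and> x \<in> U \<and> smooth_on U g \<and> (\<forall>y\<in>A \<inter> U. g y = f y)"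
  unfolding smooth_map_on_def smooth_on_def by blast

lemma smooth_map_on_subset:
  assumes f: "smooth_map_on A f" and BA: "B \<subseteq> A"
  shows "smooth_map_on B f"
proof (rule smooth_map_onI)
  fix x assume "x \<in> B"
  then obtain U g where "open U" "x \<in> U" "smooth_on U g" "\<forall>y\<in>A \<inter> U. g y = f y"
    using smooth_map_onD[OF f] BA by blast
  then show "\<exists>U g. open U \<and> x \<in> U \<and> smooth_on U g \<and> (\<forall>y\<in>B \<inter> U. g y = f y)"
    using BA by (intro exI[of _ U] exI[of _ g]) auto
qed

lemma smooth_map_on_imp_continuous_on:
  assumes "smooth_map_on A f"
  shows "continuous_on A f"
proof (subst continuous_on_eq_continuous_within, intro ballI)
  fix x assume x: "x \<in> A"
  obtain U g where U: "open U" "x \<in> U" "smooth_on U g" "\<forall>y\<in>A \<inter> U. g y = f y"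
    using smooth_map_onD[OF assms x] by blast
  have "continuous_on (A \<inter> U) g"
    using smooth_on_imp_continuous_on[OF U(3)] by (rule continuous_on_subset) simp
  then have "continuous_on (A \<inter> U) f" using U(4) by (subst continuous_on_cong[OF refl, of _ _ g]) auto
  then have "continuous (at x within A \<inter> U) f" using x U(2) by (simp add: continuous_on_eq_continuous_within)
  then show "continuous (at x within A) f"
    using at_within_nhd[OF U(2,1), of "A \<inter> U" A] by simp
qed

lemma smooth_map_on_compose:
  assumes f: "smooth_map_on A f" and g: "smooth_map_on B g" and AB: "\<And>x. x \<in> A \<Longrightarrow> f x \<in> B"
  shows "smooth_map_on A (\<lambda>x. g (f x))"
proof (rule smooth_map_onI)
  fix x assume x: "x \<in> A"
  obtain U f' where U: "open U" "x \<in> U" "smooth_on U f'" "\<forall>y\<in>A \<inter> U. f' y = f y"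
    using smooth_map_onD[OF f x] by blast
  obtain V g' where V: "open V" "f x \<in> V" "smooth_on V g'" "\<forall>y\<in>B \<inter> V. g' y = g y"
    using smooth_map_onD[OF g AB[OF x]] by blast
  have o: "open (U \<inter> f' -` V)"
    by (rule continuous_open_preimage[OF smooth_on_imp_continuous_on[OF U(3)] U(1) V(1)])
  have "smooth_on (U \<inter> f' -` V) (\<lambda>x. g' (f' x))"
    by (rule smooth_on_compose[OF o smooth_on_subset[OF U(3)] V(3)]) auto
  then show "\<exists>U h. open U \<and> x \<in> U \<and> smooth_on U h \<and> (\<forall>y\<in>A \<inter> U. h y = g (f y))"
    using o x U V AB by (intro exI[of _ "U \<inter> f' -` V"] exI[of _ "\<lambda>x. g' (f' x)"]) auto
qed

lemma smooth_on_imp_smooth_map_on: "open U \<Longrightarrow> A \<subseteq> U \<Longrightarrow> smooth_on U f \<Longrightarrow> smooth_map_on A f"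
  by (rule smooth_map_onI) blast

text \<open>Constancy on nearby conjugates lets \<Lambda> descend to classes, while \<tau> lifts its
  inverse. Since the first component of \<Lambda> is the spectrum, the chart is a product over a
  ball in the stratum.\<close>

lemma smooth_fibration_near_stratum:
  fixes \<rho> :: "('n::{finite,linorder}, 'l::{finite,linorder}) mats"
  assumes part: "\<And>s. is_partition CARD('n) (l s) (m s)" and \<rho>: "\<rho> \<in> stratum_reps I l m z"
  shows "\<exists>d. real d = (real CARD('l) - 2) / 2 * (real CARD('n))\<^sup>2 + 1
       - 1/2 * (\<Sum>s\<in>UNIV. \<Sum>j=1..l s. (real (multiplicity_of (m s) j))\<^sup>2) \<and>
     smooth_fibration_near (LRep_irr_over I l m z) (P_stratum I l m z) spec_proj_class (conj_class \<rho>) d"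
proof -
  let ?X = "stratum_reps I l m z :: ('n, 'l) mats set" and ?P = "P_stratum I l m z :: ('n, 'l) spectra set"
  obtain S :: "('n, 'l) mats set" and O' \<Lambda> V \<tau> e r where S: "subspace S"
    and dimS: "real (dim S) = (real CARD('l) - 2) / 2 * (real CARD('n))\<^sup>2 + 1
       - 1/2 * (\<Sum>s\<in>UNIV. \<Sum>j=1..l s. (real (multiplicity_of (m s) j))\<^sup>2)"
    and smooth: "open O'" "smooth_on O' \<Lambda>" "open V" "smooth_on V \<tau>" and pos: "e > 0" "r > 0"
    and chart: "\<And>\<sigma>. \<sigma> \<in> ?X \<Longrightarrow> dist \<sigma> \<rho> < e \<Longrightarrow> \<sigma> \<in> O' \<and> fst (\<Lambda> \<sigma>) = spec_proj \<sigma> \<and>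
      snd (\<Lambda> \<sigma>) \<in> S \<and> (\<exists>g. unitary g \<and> \<sigma> = conj_by g (\<tau> (\<Lambda> \<sigma>)))"
    and inv: "\<And>\<sigma> \<sigma>' g. \<sigma> \<in> ?X \<Longrightarrow> \<sigma>' \<in> ?X \<Longrightarrow> dist \<sigma> \<rho> < e \<Longrightarrow> dist \<sigma>' \<rho> < e \<Longrightarrow>
      unitary g \<Longrightarrow> \<sigma> = conj_by g \<sigma>' \<Longrightarrow> \<Lambda> \<sigma> = \<Lambda> \<sigma>'"
    and sec: "\<And>b f. b \<in> ?P \<Longrightarrow> f \<in> S \<Longrightarrow> dist b (spec_proj \<rho>) < r \<Longrightarrow> norm f < r \<Longrightarrow>
      (b, f) \<in> V \<and> \<tau> (b, f) \<in> ?X \<and> dist (\<tau> (b, f)) \<rho> < e \<and> \<Lambda> (\<tau> (b, f)) = (b, f)"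
    and base: "\<Lambda> \<rho> = (spec_proj \<rho>, 0)"
    by (rule stratum_reps_local_structure[OF part \<rho>]) (rule that; assumption)
  define U where "U = ?P \<inter> ball (spec_proj \<rho>) r"
  define F where "F = S \<inter> ball 0 r"
  \<comment> \<open>An open set of tuples, not saturated under conjugation; saturation is supplied
    afterwards by taking all conjugates.\<close>
  define B where "B = (O' \<inter> \<Lambda> -` (ball (spec_proj \<rho>) r \<times> ball 0 r)) \<inter> ball \<rho> e"
  have oB: "open B"
    unfolding B_def
    by (intro open_Int open_ball continuous_open_preimage[OF smooth_on_imp_continuous_on[OF smooth(2)] smooth(1)] open_Times)
  have XB: "\<sigma> \<in> O'" "\<Lambda> \<sigma> \<in> U \<times> F" "fst (\<Lambda> \<sigma>) = spec_proj \<sigma>" "dist \<sigma> \<rho> < e" "\<exists>g. unitary g \<and> \<sigma> = conj_by g (\<tau> (\<Lambda> \<sigma>))"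
    if "\<sigma> \<in> ?X" "\<sigma> \<in> B" for \<sigma>
  proof -
    have d: "dist \<sigma> \<rho> < e" using that(2) by (simp add: B_def dist_commute)
    from chart[OF that(1) d] that show "\<sigma> \<in> O'" "\<Lambda> \<sigma> \<in> U \<times> F" "fst (\<Lambda> \<sigma>) = spec_proj \<sigma>" "dist \<sigma> \<rho> < e"
      "\<exists>g. unitary g \<and> \<sigma> = conj_by g (\<tau> (\<Lambda> \<sigma>))"
      using d by (auto simp: B_def U_def F_def stratum_reps_def mem_Times_iff)
  qed
  have UF: "x \<in> V" "\<tau> x \<in> ?X" "\<tau> x \<in> B" "\<Lambda> (\<tau> x) = x" if "x \<in> U \<times> F" for x
  proof -
    obtain b f where x: "x = (b, f)" by (cases x)
    have *: "(b, f) \<in> V \<and> \<tau> (b, f) \<in> ?X \<and> dist (\<tau> (b, f)) \<rho> < e \<and> \<Lambda> (\<tau> (b, f)) = (b, f)"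
      by (rule sec) (use that in \<open>auto simp: x U_def F_def dist_commute\<close>)
    then show "x \<in> V" "\<tau> x \<in> ?X" "\<Lambda> (\<tau> x) = x" by (simp_all add: x)
    have "\<tau> x \<in> O'" using chart[of "\<tau> x"] * by (simp add: x)
    then show "\<tau> x \<in> B" using * that by (auto simp: x B_def dist_commute U_def F_def)
  qed
  define N where "N = conj_class ` (?X \<inter> B)"
  define \<phi> where "\<phi> C = \<Lambda> (SOME \<sigma>. \<sigma> \<in> ?X \<inter> B \<and> conj_class \<sigma> = C)" for C
  have \<phi>: "\<phi> (conj_class \<sigma>) = \<Lambda> \<sigma>" if "\<sigma> \<in> ?X" "\<sigma> \<in> B" for \<sigma>
  proof -
    define \<sigma>' where "\<sigma>' = (SOME \<sigma>'. \<sigma>' \<in> ?X \<inter> B \<and> conj_class \<sigma>' = conj_class \<sigma>)"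
    have "\<sigma>' \<in> ?X \<inter> B \<and> conj_class \<sigma>' = conj_class \<sigma>"
      unfolding \<sigma>'_def by (rule someI[of _ \<sigma>]) (use that in simp)
    then have \<sigma>': "\<sigma>' \<in> ?X" "\<sigma>' \<in> B" and "conj_class \<sigma> = conj_class \<sigma>'" by auto
    then obtain g where "unitary g" "\<sigma>' = conj_by g \<sigma>" unfolding conj_class_eq_iff by blast
    then have "\<Lambda> \<sigma>' = \<Lambda> \<sigma>" by (rule inv[OF \<sigma>'(1) that(1) XB(4)[OF \<sigma>'] XB(4)[OF that]])
    then show ?thesis by (simp add: \<phi>_def \<sigma>'_def)
  qed
  have N: "conj_class \<sigma> \<in> N \<longleftrightarrow> (\<exists>g. unitary g \<and> conj_by g \<sigma> \<in> ?X \<inter> B)" for \<sigma>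
    using conj_class_eq_iff[of \<sigma>] by (auto simp: N_def image_iff)
  \<comment> \<open>The saturation is a union of preimages of \<open>B\<close> under linear maps,
    which makes \<open>N\<close> open in the quotient topology.\<close>
  have "conj_class -` N = ?X \<inter> (\<Union>g\<in>{g. unitary g}. conj_by g -` B)"
  proof (intro equalityI subsetI)
    fix \<sigma> assume "\<sigma> \<in> conj_class -` N"
    then obtain g where g: "unitary g" "conj_by g \<sigma> \<in> ?X" "conj_by g \<sigma> \<in> B" by (auto simp: N)
    then have "\<sigma> \<in> ?X" using stratum_reps_conj_by[OF g(2) unitary_adj[OF g(1)]] by (simp add: conj_by_adj)
    then show "\<sigma> \<in> ?X \<inter> (\<Union>g\<in>{g. unitary g}. conj_by g -` B)" using g by auto
  qed (auto simp: N intro: stratum_reps_conj_by)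
  moreover have "open (\<Union>g\<in>{g. unitary g}. conj_by g -` B)"
    by (intro open_UN ballI open_vimage oB linear_continuous_on linear_conj_by[unfolded linear_conv_bounded_linear])
  ultimately have oN: "openin (class_topology (LRep_irr_over I l m z)) N"
    unfolding openin_class_topology conj_class_LRep_irr_over
    by (auto simp: N_def LRep_irr_over_eq intro: openin_open_Int)
  have diffeo: "class_diffeo N (U \<times> F) \<phi>"
    unfolding class_diffeo_def
  proof (intro conjI ballI)
    have "inj_on \<phi> N"
    proof (rule inj_onI)
      fix C D assume "C \<in> N" "D \<in> N" and eq: "\<phi> C = \<phi> D"
      then obtain \<sigma> \<sigma>' where \<sigma>: "\<sigma> \<in> ?X" "\<sigma> \<in> B" "C = conj_class \<sigma>" and \<sigma>': "\<sigma>' \<in> ?X" "\<sigma>' \<in> B" "D = conj_class \<sigma>'"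
        by (auto simp: N_def)
      have "\<Lambda> \<sigma> = \<Lambda> \<sigma>'" using eq \<sigma> \<sigma>' by (simp add: \<phi>)
      then show "C = D"
        using XB(5)[OF \<sigma>(1,2)] XB(5)[OF \<sigma>'(1,2)] by (metis \<sigma>(3) \<sigma>'(3) conj_class_conj_by)
    qed
    moreover have "\<phi> ` N = U \<times> F"
    proof (intro equalityI subsetI)
      fix x assume x: "x \<in> U \<times> F"
      have "x = \<phi> (conj_class (\<tau> x))" using UF[OF x] by (simp add: \<phi>)
      moreover have "conj_class (\<tau> x) \<in> N" using UF[OF x] by (simp add: N_def)
      ultimately show "x \<in> \<phi> ` N" by blast
    next
      fix x assume "x \<in> \<phi> ` N"
      then obtain \<sigma> where \<sigma>: "\<sigma> \<in> ?X" "\<sigma> \<in> B" "x = \<Lambda> \<sigma>" by (auto simp: N_def \<phi>)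
      show "x \<in> U \<times> F" unfolding \<sigma>(3) by (rule XB(2)[OF \<sigma>(1,2)])
    qed
    ultimately show "bij_betw \<phi> N (U \<times> F)" by (simp add: bij_betw_def)
  next
    show "smooth_map_on (conj_class -` N) (\<phi> \<circ> conj_class)"
    proof (rule smooth_map_onI)
      fix \<sigma> assume "\<sigma> \<in> conj_class -` N"
      then obtain g where g: "unitary g" "conj_by g \<sigma> \<in> ?X" "conj_by g \<sigma> \<in> B" by (auto simp: N)
      have o: "open (conj_by g -` B)"
        by (intro open_vimage oB linear_continuous_on linear_conj_by[unfolded linear_conv_bounded_linear])
      have "smooth_on (conj_by g -` B) (\<lambda>\<sigma>. \<Lambda> (conj_by g \<sigma>))"
        by (rule smooth_on_compose[OF o smooth_on_linear[OF linear_conj_by o smooth_on_id[OF o]] smooth(2)]) (simp add: B_def)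
      moreover have "\<Lambda> (conj_by g \<sigma>') = (\<phi> \<circ> conj_class) \<sigma>'" if "\<sigma>' \<in> conj_class -` N \<inter> conj_by g -` B" for \<sigma>'
      proof -
        have "\<sigma>' \<in> ?X"
          using that unfolding conj_class_LRep_irr_over[symmetric] by (auto simp: N_def LRep_irr_over_eq)
        then have "conj_by g \<sigma>' \<in> ?X" by (rule stratum_reps_conj_by[OF _ g(1)])
        then show ?thesis using that \<phi>[of "conj_by g \<sigma>'"] by (simp add: conj_class_conj_by[OF g(1)])
      qed
      ultimately show "\<exists>U h. open U \<and> \<sigma> \<in> U \<and> smooth_on U h \<and> (\<forall>y\<in>conj_class -` N \<inter> U. h y = (\<phi> \<circ> conj_class) y)"
        using o g(3) by (intro exI[of _ "conj_by g -` B"] exI[of _ "\<lambda>\<sigma>. \<Lambda> (conj_by g \<sigma>)"]) simp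
    qed
  next
    fix y assume y: "y \<in> U \<times> F"
    have "smooth_map_on (U \<times> F) \<tau>"
      by (rule smooth_on_imp_smooth_map_on[OF smooth(3) _ smooth(4)]) (use UF in blast)
    then show "\<exists>V \<tau>. openin (top_of_set (U \<times> F)) V \<and> y \<in> V \<and> smooth_map_on V \<tau> \<and>
        (\<forall>u\<in>V. conj_class (\<tau> u) \<in> N \<and> \<phi> (conj_class (\<tau> u)) = u)"
      using y UF by (intro exI[of _ "U \<times> F"] exI[of _ \<tau>]) (auto simp: N_def \<phi>)
  qed
  have "\<rho> \<in> B"
    using chart[OF \<rho>] pos base by (simp add: B_def)
  then have "conj_class \<rho> \<in> N" using \<rho> by (simp add: N_def)
  moreover have "openin (top_of_set ?P) U" "openin (top_of_set S) F"
    by (simp_all add: U_def F_def openin_open_Int)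
  moreover have "\<forall>D\<in>N. fst (\<phi> D) = spec_proj_class D"
    by (auto simp: N_def \<phi> XB(3) spec_proj_class_conj_class)
  ultimately have "smooth_fibration_near (LRep_irr_over I l m z) ?P spec_proj_class (conj_class \<rho>) (dim S)"
    unfolding smooth_fibration_near_def using oN S diffeo by blast
  then show ?thesis using dimS by blast
qed

text \<open>In the local product \<open>U \<times> F\<close> the fibre through \<open>C\<close> is
  \<open>{p C} \<times> F\<close>; its chart is the second component and its lifts are restrictions
  of the lifts of the product chart.\<close>

lemma smooth_fibration_near_imp_smooth_manifold_near:
  fixes C :: "('n::finite, 'l::finite) mats set" and B :: "'b::euclidean_space set"
  assumes fib: "smooth_fibration_near Q B p C d"
  shows "smooth_manifold_near {D \<in> Q. p D = p C} C d"
proof -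
  obtain N U and S :: "('n, 'l) mats set" and F \<phi> where N: "openin (class_topology Q) N" "C \<in> N"
    and S: "subspace S" "dim S = d" "openin (top_of_set S) F"
    and \<phi>: "class_diffeo N (U \<times> F) \<phi>" and fst: "\<And>D. D \<in> N \<Longrightarrow> fst (\<phi> D) = p D"
    using fib unfolding smooth_fibration_near_def by blast
  have bij: "bij_betw \<phi> N (U \<times> F)" and sm: "smooth_map_on (conj_class -` N) (\<phi> \<circ> conj_class)"
    and sec: "\<And>y. y \<in> U \<times> F \<Longrightarrow> \<exists>V \<tau>. openin (top_of_set (U \<times> F)) V \<and> y \<in> V \<and> smooth_map_on V \<tau> \<and>
        (\<forall>u\<in>V. conj_class (\<tau> u) \<in> N \<and> \<phi> (conj_class (\<tau> u)) = u)"
    using \<phi> unfolding class_diffeo_def by blast+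
  let ?R = "{D \<in> Q. p D = p C}"
  define W where "W = N \<inter> ?R"
  have NQ: "N \<subseteq> Q" and oN: "openin (top_of_set (conj_class -` Q)) (conj_class -` N)"
    using N(1) by (auto simp: openin_class_topology)
  have W: "D \<in> W \<longleftrightarrow> D \<in> N \<and> fst (\<phi> D) = p C" for D using NQ fst by (auto simp: W_def)
  have aU: "p C \<in> U" using bij_betwE[OF bij] N(2) fst by (metis mem_Times_iff)
  obtain G where G: "open G" "conj_class -` N = (conj_class -` Q) \<inter> G" using oN by (meson openin_open)
  have "conj_class -` W = (conj_class -` ?R) \<inter> G" using G(2) by (auto simp: W_def)
  then have oW: "openin (class_topology ?R) W"
    unfolding openin_class_topology using G(1) by (auto simp: W_def intro: openin_open_Int)
  have "class_diffeo W F (\<lambda>D. snd (\<phi> D))"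
    unfolding class_diffeo_def
  proof (intro conjI ballI)
    have "\<phi> ` W = {p C} \<times> F"
    proof (intro equalityI subsetI)
      fix x assume "x \<in> {p C} \<times> F"
      then have "x \<in> \<phi> ` N" "fst x = p C" using bij aU by (auto simp: bij_betw_def)
      then show "x \<in> \<phi> ` W" by (auto simp: W)
    next
      fix x assume "x \<in> \<phi> ` W"
      then obtain D where "D \<in> N" "fst (\<phi> D) = p C" "x = \<phi> D" using W by blast
      moreover from this have "\<phi> D \<in> U \<times> F" using bij_betwE[OF bij] by blast
      ultimately show "x \<in> {p C} \<times> F" by (simp add: mem_Times_iff)
    qed
    moreover have "inj_on \<phi> W" using bij by (auto simp: bij_betw_def W_def intro: inj_on_subset)
    ultimately have "bij_betw \<phi> W ({p C} \<times> F)" by (simp add: bij_betw_def)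
    moreover have "bij_betw snd ({p C} \<times> F) F" by (force simp: bij_betw_def inj_on_def)
    ultimately show "bij_betw (\<lambda>D. snd (\<phi> D)) W F" using bij_betw_trans[of \<phi> W _ snd F] by (simp add: o_def)
  next
    have "smooth_map_on (conj_class -` W) (\<phi> \<circ> conj_class)"
      by (rule smooth_map_on_subset[OF sm]) (auto simp: W_def)
    moreover have "smooth_map_on UNIV (snd :: 'b \<times> ('n, 'l) mats \<Rightarrow> _)"
      by (rule smooth_on_imp_smooth_map_on[OF open_UNIV subset_UNIV]) (intro smooth_intros open_UNIV)
    ultimately have "smooth_map_on (conj_class -` W) (\<lambda>x. snd ((\<phi> \<circ> conj_class) x))"
      by (rule smooth_map_on_compose) simp
    then show "smooth_map_on (conj_class -` W) ((\<lambda>D. snd (\<phi> D)) \<circ> conj_class)" by (simp add: o_def)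
  next
    fix y assume y: "y \<in> F"
    obtain V \<tau> where V: "openin (top_of_set (U \<times> F)) V" "(p C, y) \<in> V" "smooth_map_on V \<tau>"
      "\<And>u. u \<in> V \<Longrightarrow> conj_class (\<tau> u) \<in> N \<and> \<phi> (conj_class (\<tau> u)) = u"
      using sec[of "(p C, y)"] y aU by auto
    obtain H where H: "open H" "V = (U \<times> F) \<inter> H" using V(1) by (meson openin_open)
    define V' where "V' = F \<inter> (\<lambda>f. (p C, f)) -` H"
    have V': "(p C, f) \<in> V" if "f \<in> V'" for f using that aU by (auto simp: V'_def H)
    have "openin (top_of_set F) V'"
      unfolding V'_def by (intro openin_open_Int open_vimage H continuous_intros)
    moreover have "y \<in> V'" using V(2) by (auto simp: V'_def H)
    moreover have "smooth_map_on V' (\<lambda>f. (p C, f))"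
      by (rule smooth_on_imp_smooth_map_on[OF open_UNIV subset_UNIV]) (intro smooth_intros open_UNIV)
    then have "smooth_map_on V' (\<lambda>f. \<tau> (p C, f))" by (rule smooth_map_on_compose[OF _ V(3) V'])
    moreover have "\<forall>f\<in>V'. conj_class (\<tau> (p C, f)) \<in> W \<and> snd (\<phi> (conj_class (\<tau> (p C, f)))) = f"
      using V(4)[OF V'] by (simp add: W)
    ultimately show "\<exists>V \<tau>. openin (top_of_set F) V \<and> y \<in> V \<and> smooth_map_on V \<tau> \<and>
        (\<forall>u\<in>V. conj_class (\<tau> u) \<in> W \<and> snd (\<phi> (conj_class (\<tau> u))) = u)"
      by blast
  qed
  moreover have "C \<in> W" using N(2) fst by (simp add: W)
  ultimately show ?thesis unfolding smooth_manifold_near_def using oW S by blast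
qed

text \<open>The horizontal slice b -> (b, f) through the point of \<open>C\<close> lifts
  continuously to representations, and nearby \<open>b\<close> are carried into the open set
  \<open>M\<close>.\<close>

lemma smooth_fibration_near_imp_open_image:
  fixes C :: "('n::finite, 'l::finite) mats set" and B :: "'b::euclidean_space set"
  assumes fib: "smooth_fibration_near Q B p C d" and M: "openin (class_topology Q) M" "C \<in> M"
  shows "\<exists>V. openin (top_of_set B) V \<and> p C \<in> V \<and> V \<subseteq> p ` M"
proof -
  obtain N U and S :: "('n, 'l) mats set" and F \<phi> where N: "openin (class_topology Q) N" "C \<in> N"
    and S: "subspace S" "dim S = d" "openin (top_of_set S) F" and U: "openin (top_of_set B) U"
    and \<phi>: "class_diffeo N (U \<times> F) \<phi>" and fst: "\<And>D. D \<in> N \<Longrightarrow> fst (\<phi> D) = p D"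
    using fib unfolding smooth_fibration_near_def by blast
  have bij: "bij_betw \<phi> N (U \<times> F)" using \<phi> by (simp add: class_diffeo_def)
  define f where "f = snd (\<phi> C)"
  have C: "\<phi> C = (p C, f)" using fst[OF N(2)] by (metis f_def prod.collapse)
  have "\<phi> C \<in> U \<times> F" using bij_betwE[OF bij] N(2) by blast
  then obtain V \<tau> where V: "openin (top_of_set (U \<times> F)) V" "\<phi> C \<in> V" "smooth_map_on V \<tau>"
    and \<tau>: "\<And>u. u \<in> V \<Longrightarrow> conj_class (\<tau> u) \<in> N \<and> \<phi> (conj_class (\<tau> u)) = u"
    using \<phi> unfolding class_diffeo_def by metis
  obtain H where H: "open H" "V = (U \<times> F) \<inter> H" using V(1) by (meson openin_open)
  have NQ: "N \<subseteq> Q" using N(1) by (simp add: openin_class_topology)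
  obtain G where G: "open G" "conj_class -` M = (conj_class -` Q) \<inter> G"
    using M(1) by (auto simp: openin_class_topology openin_open)
  \<comment> \<open>\<open>G\<close> is open and its trace on the representations over
    \<open>Q\<close> is the preimage of \<open>M\<close>, so continuity of the lift \<tau> keeps
    nearby points in \<open>M\<close>.\<close>
  have "openin (top_of_set V) (V \<inter> \<tau> -` G)"
    by (rule continuous_openin_preimage_gen[OF smooth_map_on_imp_continuous_on[OF V(3)] G(1)])
  then obtain K where K: "open K" "V \<inter> \<tau> -` G = V \<inter> K" by (meson openin_open)
  define V' where "V' = U \<inter> (\<lambda>b. (b, f)) -` (H \<inter> K)"
  have fF: "f \<in> F" using \<open>\<phi> C \<in> U \<times> F\<close> by (simp add: C)
  have "openin (top_of_set U) V'"
    unfolding V'_def by (intro openin_open_Int open_vimage open_Int H K continuous_intros)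
  then have oV': "openin (top_of_set B) V'" using U by (rule openin_trans)
  \<comment> \<open>Injectivity of the chart: both classes have the same coordinates.\<close>
  have "conj_class (\<tau> (\<phi> C)) = C"
    using \<tau>[OF V(2)] bij N(2) by (auto simp: bij_betw_def inj_on_def)
  then have "\<tau> (\<phi> C) \<in> G" using M(2) G(2) by auto
  then have "\<phi> C \<in> K" using V(2) K(2) by auto
  then have "p C \<in> V'" using V(2) by (auto simp: V'_def C H)
  moreover have "V' \<subseteq> p ` M"
  proof
    fix b assume b: "b \<in> V'"
    then have bf: "(b, f) \<in> V" using fF by (auto simp: V'_def H)
    then have "\<tau> (b, f) \<in> G" using b K(2) by (auto simp: V'_def)
    moreover have inN: "conj_class (\<tau> (b, f)) \<in> N" and "\<phi> (conj_class (\<tau> (b, f))) = (b, f)" using \<tau>[OF bf] by auto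
    ultimately have "conj_class (\<tau> (b, f)) \<in> M" "p (conj_class (\<tau> (b, f))) = b"
      using G(2) NQ fst[OF inN] by auto
    then show "b \<in> p ` M" by (metis imageI)
  qed
  ultimately show ?thesis using oV' by blast
qed

lemma topspace_class_topology: "topspace (class_topology Q) = Q"
proof -
  have "openin (class_topology Q) Q" by (simp add: openin_class_topology)
  then have "Q \<subseteq> topspace (class_topology Q)" by (rule openin_subset)
  moreover have "topspace (class_topology Q) \<subseteq> Q"
    using openin_topspace[of "class_topology Q"] unfolding openin_class_topology by blast
  ultimately show ?thesis by blast
qed

theorem proposition4p3:
  fixes \<rho> :: "('n::{finite,linorder}, 'l::{finite,linorder}) mats"
    and a :: "('n, 'l) spectra"
    and I :: int and l :: "'l \<Rightarrow> nat" and m :: "'l \<Rightarrow> nat \<Rightarrow> nat" and z :: "'l set"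
  assumes "CARD('n) \<ge> 1" and "CARD('l) \<ge> 3"
    and "\<And>s. is_partition CARD('n) (l s) (m s)"
    and "lagrangian_rep \<rho>" and "irreducible_rep \<rho>"
    and "spec_proj \<rho> = a" and "a \<in> L_stratum I l m z"
  shows "\<exists>d::nat.
      real d = (real CARD('l) - 2) / 2 * (real CARD('n))\<^sup>2 + 1
                 - 1/2 * (\<Sum>s\<in>UNIV. \<Sum>j=1..l s. (real (multiplicity_of (m s) j))\<^sup>2) \<and>
      smooth_manifold_near (LRep_irr_at a) (conj_class \<rho>) d \<and>
      locally_surjective
        (class_topology (LRep_irr_over I l m z :: ('n, 'l) mats set set))
        (top_of_set (P_stratum I l m z :: ('n, 'l) spectra set)) spec_proj_class \<and>
      smooth_fibration_near (LRep_irr_over I l m z) (P_stratum I l m z) spec_proj_class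
        (conj_class \<rho>) d"
proof -
  let ?Q = "LRep_irr_over I l m z :: ('n, 'l) mats set set"
    and ?P = "P_stratum I l m z :: ('n, 'l) spectra set"
  note fibration = smooth_fibration_near_stratum[where l = l and m = m, OF assms(3)]
  have "\<rho> \<in> stratum_reps I l m z"
    using assms by (simp add: stratum_reps_def L_stratum_def)
  from fibration[OF this] obtain d where d: "real d = (real CARD('l) - 2) / 2 * (real CARD('n))\<^sup>2 + 1
       - 1/2 * (\<Sum>s\<in>UNIV. \<Sum>j=1..l s. (real (multiplicity_of (m s) j))\<^sup>2)"
    and fib: "smooth_fibration_near ?Q ?P spec_proj_class (conj_class \<rho>) d"
    by blast
  \<comment> \<open>As \<open>a\<close> lies in the stratum, the classes with spectrum
    \<open>a\<close> form the fibre of the total space over \<open>a\<close>.\<close>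
  have "LRep_irr_at a = {D \<in> ?Q. spec_proj_class D = spec_proj_class (conj_class \<rho>)}"
    using assms(6,7) by (auto simp: LRep_irr_at_def LRep_irr_over_def spec_proj_class_conj_class)
  then have "smooth_manifold_near (LRep_irr_at a) (conj_class \<rho>) d"
    using smooth_fibration_near_imp_smooth_manifold_near[OF fib] by simp
  moreover have "locally_surjective (class_topology ?Q) (top_of_set ?P) spec_proj_class"
    unfolding locally_surjective_def
  proof (intro conjI allI impI)
    show "spec_proj_class \<in> topspace (class_topology ?Q) \<rightarrow> topspace (top_of_set ?P)"
      by (auto simp: topspace_class_topology LRep_irr_over_def L_stratum_def)
  next
    fix C M assume M: "openin (class_topology ?Q) M \<and> C \<in> M"
    then have "C \<in> ?Q" by (auto simp: openin_class_topology)
    then obtain \<sigma> where \<sigma>: "C = conj_class \<sigma>" "\<sigma> \<in> stratum_reps I l m z" by (auto simp: LRep_irr_over_eq)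
    \<comment> \<open>Local surjectivity concerns every class over the stratum, so the fibration is
      invoked at each one.\<close>
    from fibration[OF \<sigma>(2)] obtain d' where "smooth_fibration_near ?Q ?P spec_proj_class C d'"
      unfolding \<sigma>(1) by (elim exE conjE)
    then show "\<exists>V. openin (top_of_set ?P) V \<and> spec_proj_class C \<in> V \<and> V \<subseteq> spec_proj_class ` M"
      by (rule smooth_fibration_near_imp_open_image) (use M in simp_all)
  qed
  ultimately show ?thesis using d fib by blast
qed

end
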